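(* Let $\kappa>0$ be a limit ordinal, let $\mathcal E$ be a category with a $\kappa$-backdrop $\mathcal M$, and let $u:\mathcal J\to\mathcal E^\to$ be a diagram compatible with $\mathcal M$ such that $\mathrm{dom}(u_i)$ is $(\kappa,\mathcal M)$-small for every $i\in\mathcal J$. Write $(\mathsf L,\mathsf R)$ for the AWFS cofibrantly generated by $u$. Let $P:\mathcal F\to\mathcal E$ be a Grothendieck fibration such that (a) colimits of $(1+\alpha)$-chains in $\mathcal M$ are Van Kampen for $P$ for $\alpha\preceq\kappa$; (b) cobase changes of maps in $\mathcal M$ are Van Kampen for $P$. Then any lift of $\mathrm D_u:\mathcal E^\to\to\mathcal E^\to$ through $U_P:\mathrm{Ext}_P\to\mathcal E^\to$ induces a functor $\mathsf L_{\mathrm p}\text{-}\mathrm{Coalg}\to\mathrm{Ext}_P$ over $\mathcal E^\to$ (assigning an extension operation to every left map of the AWFS).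
   Context: **Ordinals.** An ordinal is a transitive set of transitive sets; $\alpha<\beta$ means $\alpha\in\beta$ and $\alpha\preceq\beta$ means $\alpha<\beta$ or $\alpha=\beta$. $\alpha$ is a limit ordinal if for every family $(\beta_i<\alpha)_{i\in I}$ with $I$ finite inhabited there is $\beta<\alpha$ with all $\beta_i<\beta$. An $\alpha$-chain is a diagram indexed by the poset $(\alpha,\preceq)$. **Backdrops.** $\mathcal E^{\to}$ is the arrow category. A wide subcategory $\mathcal M\hookrightarrow\mathcal E$ *has $\mathcal K$-indexed colimits in $\mathcal E$* if the category $\mathcal M$ has them and the inclusion preserves them; it is *closed under cobase change in $\mathcal E$* if for all $A\to B$ in $\mathcal M$ and $A\to X$ in $\mathcal E$ there is a pushout square in $\mathcal E$ whose map $X\to Y$ opposite $A\to B$ is in $\mathcal M$. $\mathcal M$ is a *$\kappa$-backdrop* if (a) $\mathcal M$ has colimits of $(1+\alpha)$-chains in $\mathcal E$ for $\alpha<\kappa$; (b) $\kappa$-chains in $\mathcal M$ have colimits in $\mathcal E$; (c) $\mathcal M$ is closed under cobase change in $\mathcal E$. $A\in\mathcal E$ is *$(\kappa,\mathcal M)$-small* if $\mathcal E(A,-)$ preserves colimits of $\kappa$-chains in $\mathcal M$. **Density comonad, compatibility.** $\mathrm D_u:\mathcal E^\to\to\mathcal E^\to$ is (when it exists) the pointwise left Kan extension of $u$ along itself, $\mathrm D_u(f)=\mathrm{colim}(u\downarrow f\to\mathcal J\xrightarrow{u}\mathcal E^\to)$. $u$ is *compatible with $\mathcal M$* if (a) $\mathrm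 D_u$ exists and every $\mathrm D_u(f)$ lies in $\mathcal M$; (b) for every square $(h,k):f\to g$ with $h,k\in\mathcal M$, the pushout gap map $\mathrm{cod}\,\mathrm D_uf\sqcup_{\mathrm{dom}\,\mathrm D_uf}\mathrm{dom}\,\mathrm D_ug\to\mathrm{cod}\,\mathrm D_ug$ is in $\mathcal M$. **AWFS.** An AWFS on $\mathcal E$ consists of functors $L,R:\mathcal E^\to\to\mathcal E^\to$ with $\mathrm{dom}L=\mathrm{dom}$, $\mathrm{cod}L=\mathrm{dom}R=:E$, $\mathrm{cod}R=\mathrm{cod}$, $Rf\circ Lf=f$, a comonad $\mathsf L=(L,\Phi,\Sigma)$ with counit $\Phi_f=(\mathrm{id},Rf):Lf\to f$ and a monad $\mathsf R=(R,\Lambda,\Pi)$ with unit $\Lambda_f=(Lf,\mathrm{id}):f\to Rf$; then $\Sigma_f=(\mathrm{id},\delta_f)$, $\Pi_f=(\mu_f,\mathrm{id})$ with $\delta_f:Ef\to ELf$, $\mu_f:ERf\to Ef$, and the squares $(\delta_f,\mu_f):LRf\to RLf$ are required to form a distributive law of $\mathsf L$ over $\mathsf R$. $\mathsf L_{\mathrm p}=(L,\Phi)$ is the underlying copointed endofunctor; an object of $\mathsf L_{\mathrm p}\text{-}\mathrm{Coalg}$ (a left map) is a map $f:A\to B$ with $s:B\to Ef$ such that $sf=Lf$ and $Rf\circ s=\mathrm{id}_B$; a morphism $(f,s)\to(g,t)$ is a square $(h,k):f\to g$ with $tk=E(h,k)s$. **Cofibrant generation.** $\mathbb S\mathrm q(\mathcal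 E)$ is the double category whose objects are those of $\mathcal E$, whose horizontal and vertical morphisms are both the morphisms of $\mathcal E$, and whose squares are commutative squares. $\mathsf R\text{-}\mathbb A\mathrm{lg}$ is the double category whose objects and horizontal morphisms are those of $\mathcal E$, whose vertical morphisms $A\to B$ are $\mathsf R$-algebras, i.e. maps $f:A\to B$ with $p:Ef\to A$ such that $(p,\mathrm{id}):Rf\to f$ is an algebra structure, whose squares are algebra morphisms, with identities $(\mathrm{id}_A,R(\mathrm{id}_A))$, and with composite of $(f,p):A\to B$ and $(g,q):B\to C$ the map $gf$ with structure $p\circ E(\mathrm{id}_A,q)\circ E(\mathrm{id}_A,E(f,\mathrm{id}_C))\circ\delta_{gf}$. $\mathcal J^{\pitchfork\pitchfork}$ is the double category with the same objects and horizontal morphisms, whose vertical morphisms are maps $f$ with a choice of filler $\psi(i,\alpha)$ for each lifting problem $\alpha:u_i\to f$ such that $\psi(j,\alpha u_t)=\psi(i,\alpha)\circ\mathrm{cod}(u_t)$ for all $t:j\to i$ in $\mathcal J$, whose squares are commutative squares $\beta=(x,y):f\to f'$ with $\psi'(i,\beta\alpha)=x\,\psi(i,\alpha)$, with the usual identity and composition of lifting structures. $(\mathsf L,\mathsf R)$ is *cofibrantly generated by $u$* if there is an isomorphism of double categories $\mathsf R\text{-}\mathbb A\mathrm{lg}\cong\mathcal J^{\pitchfork\pitchfork}$ over $\mathbb S\mathrm q(\mathcal E)$. (Under the hypotheses here it exists and is unique up to isomorphism.) **Fibrations, Van Kampen colimits.** Grothendieck fibrations come with a choice of cartesian lifts $h^*X\to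 X$. $\mathcal F_A$ is the fiber of $P$ over $A$, and $\mathcal F_{\mathrm{cart}}\hookrightarrow\mathcal F$ is the wide subcategory of $P$-cartesian morphisms. A colimit cocone $\beta:b\to\Delta b_0$ under $b:\mathcal K\to\mathcal E$ is *Van Kampen for $P$* if (a) every $e:\mathcal K\to\mathcal F_{\mathrm{cart}}$ over $b$ admits a colimit cocone in $\mathcal F_{\mathrm{cart}}$ over $\beta$; (b) given $e:\mathcal K\to\mathcal F_{\mathrm{cart}}$ over $b$, every cocone $e\to\Delta e_0$ in $\mathcal F_{\mathrm{cart}}$ over $\beta$ is a colimit cocone in $\mathcal F$. (A cobase change of a map in $\mathcal M$ is regarded as the colimit cocone under a span.) **Extension operations.** $U_P:\mathrm{Ext}_P\to\mathcal E^\to$ is defined as the cartesian pushforward of $\langle P,\mathrm{dom}\rangle:\mathcal F^{\dashrightarrow}\to\mathcal E^\to\times_{\mathcal E}\mathcal F$ along the projection $\mathcal E^\to\times_{\mathcal E}\mathcal F\to\mathcal E^\to$ (pullback of $\mathrm{dom}$ and $P$), where $\mathcal F^{\dashrightarrow}\hookrightarrow\mathcal F^\to$ is the full subcategory on the $P$-cartesian morphisms. Explicitly: an object of $\mathrm{Ext}_P$ over $m:A\to B$ is a section $\xi$ of the domain projection from the category of $P$-cartesian morphisms over $m$ (with morphisms the commutative squares over $\mathrm{id}_m$) to $\mathcal F_A$; that is, a functorial assignment to each $X\in\mathcal F_A$ of an object $\xi X\in\mathcal F_B$ and a $P$-cartesian morphism $X\to\xi X$ over $m$. A morphism $\xi\to\xi'$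 over a square $(h,k):m\to m'$ (with $m':A'\to B'$) is a family, natural in $X'\in\mathcal F_{A'}$, of $P$-cartesian morphisms $\xi(h^*X')\to\xi'(X')$ over $k$ such that the square formed with $h^*X'\to\xi(h^*X')$, $X'\to\xi'X'$ and the chosen cartesian lift $h^*X'\to X'$ commutes; composition uses the canonical isomorphisms $(h'h)^*\cong h^*h'^*$. $U_P$ sends $\xi$ to $m$. *)

theory Defs
  imports Main "HOL-Library.FuncSet"
begin

unbundle cardinal_syntax

record ('o, 'a) cat =
  Obj :: "'o set"
  Arr :: "'a set"
  Dom :: "'a \<Rightarrow> 'o"
  Cod :: "'a \<Rightarrow> 'o"
  Idt :: "'o \<Rightarrow> 'a"
  Cmp :: "'a \<Rightarrow> 'a \<Rightarrow> 'a" (infixr \<open>\<cdot>\<index>\<close> 70)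

definition hom :: "('o, 'a) cat \<Rightarrow> 'o \<Rightarrow> 'o \<Rightarrow> 'a set" where
  "hom C x y = {a \<in> Arr C. Dom C a = x \<and> Cod C a = y}"

locale category =
  fixes C :: "('o, 'a) cat" (structure)
  assumes dom_obj: "a \<in> Arr C \<Longrightarrow> Dom C a \<in> Obj C"
    and cod_obj: "a \<in> Arr C \<Longrightarrow> Cod C a \<in> Obj C"
    and idt_hom: "x \<in> Obj C \<Longrightarrow> Idt C x \<in> hom C x x"
    and cmp_hom: "\<lbrakk>a \<in> hom C x y; b \<in> hom C y z\<rbrakk> \<Longrightarrow> b \<cdot> a \<in> hom C x z"
    and idt_left: "a \<in> hom C x y \<Longrightarrow> Idt C y \<cdot> a = a"
    and idt_right: "a \<in> hom C x y \<Longrightarrow> a \<cdot> Idt C x = a"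
    and assoc: "\<lbrakk>a \<in> hom C w x; b \<in> hom C x y; c \<in> hom C y z\<rbrakk> \<Longrightarrow> (c \<cdot> b) \<cdot> a = c \<cdot> (b \<cdot> a)"

record ('o, 'a, 'p, 'b) funct =
  Ob :: "'o \<Rightarrow> 'p"
  Ar :: "'a \<Rightarrow> 'b"

definition is_functor ::
  "('o, 'a) cat \<Rightarrow> ('p, 'b) cat \<Rightarrow> ('o, 'a, 'p, 'b) funct \<Rightarrow> bool" where
  "is_functor C D T \<longleftrightarrow>
     (\<forall>x \<in> Obj C. Ob T x \<in> Obj D) \<and>
     (\<forall>a \<in> Arr C. Ar T a \<in> hom D (Ob T (Dom C a)) (Ob T (Cod C a))) \<and>
     (\<forall>x \<in> Obj C. Ar T (Idt C x) = Idt D (Ob T x)) \<and>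
     (\<forall>a \<in> Arr C. \<forall>b \<in> Arr C. Cod C a = Dom C b \<longrightarrow>
        Ar T (b \<cdot>\<^bsub>C\<^esub> a) = Ar T b \<cdot>\<^bsub>D\<^esub> Ar T a)"

definition id_functor :: "('o, 'a, 'o, 'a) funct" where
  "id_functor = \<lparr>Ob = id, Ar = id\<rparr>"

definition comp_functor ::
  "('p, 'b, 'q, 'c) funct \<Rightarrow> ('o, 'a, 'p, 'b) funct \<Rightarrow> ('o, 'a, 'q, 'c) funct"
  (infixr \<open>\<circ>\<^sub>F\<close> 75) where
  "S \<circ>\<^sub>F T = \<lparr>Ob = Ob S \<circ> Ob T, Ar = Ar S \<circ> Ar T\<rparr>"

text \<open>Values of a functor outside its source category are irrelevant, so strict equality of
  functors out of a category is agreement on that category.\<close>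

definition functor_eq ::
  "('o, 'a) cat \<Rightarrow> ('o, 'a, 'p, 'b) funct \<Rightarrow> ('o, 'a, 'p, 'b) funct \<Rightarrow> bool" where
  "functor_eq C S T \<longleftrightarrow> (\<forall>x \<in> Obj C. Ob S x = Ob T x) \<and> (\<forall>a \<in> Arr C. Ar S a = Ar T a)"

definition nat_trans ::
  "('o, 'a) cat \<Rightarrow> ('p, 'b) cat \<Rightarrow> ('o, 'a, 'p, 'b) funct \<Rightarrow> ('o, 'a, 'p, 'b) funct
    \<Rightarrow> ('o \<Rightarrow> 'b) \<Rightarrow> bool" where
  "nat_trans C D S T \<tau> \<longleftrightarrow>
     (\<forall>x \<in> Obj C. \<tau> x \<in> hom D (Ob S x) (Ob T x)) \<and>
     (\<forall>a \<in> Arr C. \<tau> (Cod C a) \<cdot>\<^bsub>D\<^esub> Ar S a = Ar T a \<cdot>\<^bsub>D\<^esub> \<tau> (Dom C a))"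

definition is_cocone ::
  "('k, 't) cat \<Rightarrow> ('o, 'a) cat \<Rightarrow> ('k, 't, 'o, 'a) funct \<Rightarrow> 'o \<Rightarrow> ('k \<Rightarrow> 'a) \<Rightarrow> bool" where
  "is_cocone K C b c \<iota> \<longleftrightarrow>
     c \<in> Obj C \<and>
     (\<forall>k \<in> Obj K. \<iota> k \<in> hom C (Ob b k) c) \<and>
     (\<forall>t \<in> Arr K. \<iota> (Cod K t) \<cdot>\<^bsub>C\<^esub> Ar b t = \<iota> (Dom K t))"

definition is_colimit ::
  "('k, 't) cat \<Rightarrow> ('o, 'a) cat \<Rightarrow> ('k, 't, 'o, 'a) funct \<Rightarrow> 'o \<Rightarrow> ('k \<Rightarrow> 'a) \<Rightarrow> bool" where
  "is_colimit K C b c \<iota> \<longleftrightarrow>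
     is_cocone K C b c \<iota> \<and>
     (\<forall>d \<nu>. is_cocone K C b d \<nu> \<longrightarrow>
        (\<exists>!a. a \<in> hom C c d \<and> (\<forall>k \<in> Obj K. a \<cdot>\<^bsub>C\<^esub> \<iota> k = \<nu> k)))"

definition wide_subcategory :: "('o, 'a) cat \<Rightarrow> 'a set \<Rightarrow> bool" where
  "wide_subcategory C M \<longleftrightarrow>
     M \<subseteq> Arr C \<and>
     (\<forall>x \<in> Obj C. Idt C x \<in> M) \<and>
     (\<forall>a \<in> M. \<forall>b \<in> M. Cod C a = Dom C b \<longrightarrow> b \<cdot>\<^bsub>C\<^esub> a \<in> M)"

definition wide :: "('o, 'a) cat \<Rightarrow> 'a set \<Rightarrow> ('o, 'a) cat" where
  "wide C M = C\<lparr>Arr := M\<rparr>"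

text \<open>Objects of \<open>B\<close> equipped with structure: \<open>\<pi> x\<close> is the object underlying \<open>x \<in> X\<close>, and
  a morphism \<open>x \<rightarrow> y\<close> is a morphism \<open>\<pi> x \<rightarrow> \<pi> y\<close> that respects the structure.\<close>

definition struct_cat ::
  "('o, 'a) cat \<Rightarrow> 'x set \<Rightarrow> ('x \<Rightarrow> 'o) \<Rightarrow> ('x \<Rightarrow> 'a \<Rightarrow> 'x \<Rightarrow> bool) \<Rightarrow> ('x, 'x \<times> 'a \<times> 'x) cat" where
  "struct_cat B X \<pi> resp =
     \<lparr>Obj = X,
      Arr = {(x, a, y). x \<in> X \<and> y \<in> X \<and> a \<in> hom B (\<pi> x) (\<pi> y) \<and> resp x a y},
      Dom = (\<lambda>(x, a, y). x),
      Cod = (\<lambda>(x, a, y). y),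
      Idt = (\<lambda>x. (x, Idt B (\<pi> x), x)),
      Cmp = (\<lambda>(_, b, z) (x, a, _). (x, b \<cdot>\<^bsub>B\<^esub> a, z))\<rparr>"

definition struct_forget :: "('x \<Rightarrow> 'o) \<Rightarrow> ('x, 'x \<times> 'a \<times> 'x, 'o, 'a) funct" where
  "struct_forget \<pi> = \<lparr>Ob = \<pi>, Ar = (\<lambda>(x, a, y). a)\<rparr>"

definition comma ::
  "('i, 't) cat \<Rightarrow> ('o, 'a) cat \<Rightarrow> ('i, 't, 'o, 'a) funct \<Rightarrow> 'o
    \<Rightarrow> ('i \<times> 'a, ('i \<times> 'a) \<times> 't \<times> ('i \<times> 'a)) cat" where
  "comma J C u c =
     struct_cat J {(i, a). i \<in> Obj J \<and> a \<in> hom C (Ob u i) c} fst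
       (\<lambda>(i, a) t (j, b). b \<cdot>\<^bsub>C\<^esub> Ar u t = a)"

text \<open>Ordinals are well-orders \<open>\<alpha> :: 'k rel\<close>.  The ordinals below \<open>\<alpha>\<close> correspond to the elements
  of \<open>Field \<alpha>\<close>, and every ordinal below \<open>\<alpha>\<close> is the order type of some \<open>\<beta> :: 'k rel\<close> with
  \<open>\<beta> <o \<alpha>\<close>.\<close>

definition limit_ordinal :: "'k rel \<Rightarrow> bool" where
  "limit_ordinal \<alpha> \<longleftrightarrow>
     Well_order \<alpha> \<and>
     (\<forall>B. B \<subseteq> Field \<alpha> \<and> finite B \<and> B \<noteq> {} \<longrightarrow>
        (\<exists>c \<in> Field \<alpha>. \<forall>b \<in> B. (b, c) \<in> \<alpha> \<and> b \<noteq> c))"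

definition one_plus :: "'k rel \<Rightarrow> 'k option rel" where
  "one_plus \<alpha> =
     {(None, None)} \<union> {(None, Some b) | b. b \<in> Field \<alpha>} \<union> {(Some a, Some b) | a b. (a, b) \<in> \<alpha>}"

definition poset_cat :: "'k rel \<Rightarrow> ('k, 'k \<times> 'k) cat" where
  "poset_cat r =
     \<lparr>Obj = Field r, Arr = r, Dom = fst, Cod = snd, Idt = (\<lambda>a. (a, a)),
      Cmp = (\<lambda>(_, c) (a, _). (a, c))\<rparr>"

datatype span = Apex | Lft | Rgt

definition span_cat :: "(span, span \<times> span) cat" where
  "span_cat = poset_cat {(Apex, Apex), (Lft, Lft), (Rgt, Rgt), (Apex, Lft), (Apex, Rgt)}"

definition span_diagram :: "('o, 'a) cat \<Rightarrow> 'a \<Rightarrow> 'a \<Rightarrow> (span, span \<times> span, 'o, 'a) funct" where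
  "span_diagram C m f =
     (let ob = (\<lambda>k. case k of Apex \<Rightarrow> Dom C m | Lft \<Rightarrow> Cod C m | Rgt \<Rightarrow> Cod C f)
      in \<lparr>Ob = ob,
          Ar = (\<lambda>t. if t = (Apex, Lft) then m
                    else if t = (Apex, Rgt) then f
                    else Idt C (ob (fst t)))\<rparr>)"

definition pushout_cocone :: "('o, 'a) cat \<Rightarrow> 'a \<Rightarrow> 'a \<Rightarrow> 'a \<Rightarrow> span \<Rightarrow> 'a" where
  "pushout_cocone C m p q k = (case k of Apex \<Rightarrow> p \<cdot>\<^bsub>C\<^esub> m | Lft \<Rightarrow> p | Rgt \<Rightarrow> q)"

text \<open>\<open>m : A \<rightarrow> B\<close>, \<open>f : A \<rightarrow> X\<close>, \<open>p : B \<rightarrow> Y\<close>, and \<open>q : X \<rightarrow> Y\<close> is opposite \<open>m\<close>.\<close>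

definition is_pushout :: "('o, 'a) cat \<Rightarrow> 'a \<Rightarrow> 'a \<Rightarrow> 'a \<Rightarrow> 'a \<Rightarrow> bool" where
  "is_pushout C m f p q \<longleftrightarrow>
     m \<in> Arr C \<and> f \<in> Arr C \<and> Dom C m = Dom C f \<and>
     is_colimit span_cat C (span_diagram C m f) (Cod C p) (pushout_cocone C m p q)"

definition has_colimits_in :: "('k, 't) cat \<Rightarrow> ('o, 'a) cat \<Rightarrow> 'a set \<Rightarrow> bool" where
  "has_colimits_in K C M \<longleftrightarrow>
     (\<forall>b. is_functor K (wide C M) b \<longrightarrow>
        (\<exists>c \<iota>. is_colimit K (wide C M) b c \<iota>) \<and>
        (\<forall>c \<iota>. is_colimit K (wide C M) b c \<iota> \<longrightarrow> is_colimit K C b c \<iota>))"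

definition closed_under_cobase_change :: "('o, 'a) cat \<Rightarrow> 'a set \<Rightarrow> bool" where
  "closed_under_cobase_change C M \<longleftrightarrow>
     (\<forall>m \<in> M. \<forall>f \<in> Arr C. Dom C f = Dom C m \<longrightarrow> (\<exists>p q. is_pushout C m f p q \<and> q \<in> M))"

definition backdrop :: "('o, 'a) cat \<Rightarrow> 'k rel \<Rightarrow> 'a set \<Rightarrow> bool" where
  "backdrop C \<kappa> M \<longleftrightarrow>
     wide_subcategory C M \<and>
     (\<forall>\<alpha> :: 'k rel. \<alpha> <o \<kappa> \<longrightarrow> has_colimits_in (poset_cat (one_plus \<alpha>)) C M) \<and>
     (\<forall>b. is_functor (poset_cat \<kappa>) (wide C M) b \<longrightarrow> (\<exists>c \<iota>. is_colimit (poset_cat \<kappa>) C b c \<iota>)) \<and>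
     closed_under_cobase_change C M"

definition set_cat :: "('x set, 'x set \<times> ('x \<Rightarrow> 'x) \<times> 'x set) cat" where
  "set_cat =
     \<lparr>Obj = UNIV,
      Arr = {(X, s, Y). s \<in> X \<rightarrow>\<^sub>E Y},
      Dom = (\<lambda>(X, s, Y). X),
      Cod = (\<lambda>(X, s, Y). Y),
      Idt = (\<lambda>X. (X, restrict id X, X)),
      Cmp = (\<lambda>(_, t, Z) (X, s, _). (X, compose X t s, Z))\<rparr>"

text \<open>All values of the covariant hom-functor are subsets of the type of arrows of \<open>C\<close>, so it is a
  functor into the category of subsets of that type.  Testing colimits against these sets only
  is no restriction: if the type has at least two elements, this holds because a map of sets that
  induces a bijection on maps into a two-element set is a bijection; if it has only one, every
  diagram below is constant.\<close>

definition hom_functor ::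
  "('o, 'a) cat \<Rightarrow> 'o \<Rightarrow> ('o, 'a, 'a set, 'a set \<times> ('a \<Rightarrow> 'a) \<times> 'a set) funct" where
  "hom_functor C x =
     \<lparr>Ob = (\<lambda>y. hom C x y),
      Ar = (\<lambda>a. (hom C x (Dom C a), \<lambda>g \<in> hom C x (Dom C a). a \<cdot>\<^bsub>C\<^esub> g, hom C x (Cod C a)))\<rparr>"

definition small_object :: "('o, 'a) cat \<Rightarrow> 'k rel \<Rightarrow> 'a set \<Rightarrow> 'o \<Rightarrow> bool" where
  "small_object C \<kappa> M x \<longleftrightarrow>
     x \<in> Obj C \<and>
     (\<forall>b c \<iota>. is_functor (poset_cat \<kappa>) (wide C M) b \<and> is_colimit (poset_cat \<kappa>) C b c \<iota> \<longrightarrow>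
        is_colimit (poset_cat \<kappa>) set_cat (hom_functor C x \<circ>\<^sub>F b)
          (Ob (hom_functor C x) c) (\<lambda>k. Ar (hom_functor C x) (\<iota> k)))"

text \<open>\<open>Square f h k g\<close> is the square \<open>(h, k) : f \<rightarrow> g\<close>.\<close>

datatype 'a square = Square (sdom: 'a) (upper: 'a) (lower: 'a) (scod: 'a)

definition arrow_cat :: "('o, 'a) cat \<Rightarrow> ('a, 'a square) cat" where
  "arrow_cat C =
     \<lparr>Obj = Arr C,
      Arr = {Square f h k g | f h k g.
               f \<in> Arr C \<and> g \<in> Arr C \<and>
               h \<in> hom C (Dom C f) (Dom C g) \<and> k \<in> hom C (Cod C f) (Cod C g) \<and>
               k \<cdot>\<^bsub>C\<^esub> f = g \<cdot>\<^bsub>C\<^esub> h},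
      Dom = sdom,
      Cod = scod,
      Idt = (\<lambda>f. Square f (Idt C (Dom C f)) (Idt C (Cod C f)) f),
      Cmp = (\<lambda>\<tau> \<sigma>. Square (sdom \<sigma>) (upper \<tau> \<cdot>\<^bsub>C\<^esub> upper \<sigma>) (lower \<tau> \<cdot>\<^bsub>C\<^esub> lower \<sigma>) (scod \<tau>))\<rparr>"

definition dom_functor :: "('o, 'a) cat \<Rightarrow> ('a, 'a square, 'o, 'a) funct" where
  "dom_functor C = \<lparr>Ob = Dom C, Ar = upper\<rparr>"

definition cod_functor :: "('o, 'a) cat \<Rightarrow> ('a, 'a square, 'o, 'a) funct" where
  "cod_functor C = \<lparr>Ob = Cod C, Ar = lower\<rparr>"

text \<open>\<open>D\<close>, with unit \<open>\<eta> : u \<rightarrow> D u\<close>, is the pointwise left Kan extension of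
  \<open>u : J \<rightarrow> arrow_cat C\<close> along itself.\<close>

definition density_comonad ::
  "('o, 'a) cat \<Rightarrow> ('i, 't) cat \<Rightarrow> ('i, 't, 'a, 'a square) funct
    \<Rightarrow> ('a, 'a square, 'a, 'a square) funct \<Rightarrow> ('i \<Rightarrow> 'a square) \<Rightarrow> bool" where
  "density_comonad C J u D \<eta> \<longleftrightarrow>
     is_functor (arrow_cat C) (arrow_cat C) D \<and>
     nat_trans J (arrow_cat C) u (D \<circ>\<^sub>F u) \<eta> \<and>
     (\<forall>f \<in> Arr C.
        is_colimit (comma J (arrow_cat C) u f) (arrow_cat C) (u \<circ>\<^sub>F struct_forget fst)
          (Ob D f) (\<lambda>(i, a). Ar D a \<cdot>\<^bsub>arrow_cat C\<^esub> \<eta> i))"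

text \<open>The pushout gap map is only determined up to isomorphism of the pushout; it is required to be
  in \<open>M\<close> for every choice of pushout.  Existence of the pushout is a consequence of \<open>Ob D f \<in> M\<close>
  when \<open>M\<close> is closed under cobase change.\<close>

definition compatible ::
  "('o, 'a) cat \<Rightarrow> 'a set \<Rightarrow> ('i, 't) cat \<Rightarrow> ('i, 't, 'a, 'a square) funct
    \<Rightarrow> ('a, 'a square, 'a, 'a square) funct \<Rightarrow> ('i \<Rightarrow> 'a square) \<Rightarrow> bool" where
  "compatible C M J u D \<eta> \<longleftrightarrow>
     density_comonad C J u D \<eta> \<and>
     (\<forall>f \<in> Arr C. Ob D f \<in> M) \<and>
     (\<forall>\<sigma> \<in> Arr (arrow_cat C). upper \<sigma> \<in> M \<and> lower \<sigma> \<in> M \<longrightarrow>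
        (\<forall>p q w.
           is_pushout C (Ob D (sdom \<sigma>)) (upper (Ar D \<sigma>)) p q \<and>
           w \<in> hom C (Cod C p) (Cod C (Ob D (scod \<sigma>))) \<and>
           w \<cdot>\<^bsub>C\<^esub> p = lower (Ar D \<sigma>) \<and> w \<cdot>\<^bsub>C\<^esub> q = Ob D (scod \<sigma>) \<longrightarrow> w \<in> M))"

definition comonad ::
  "('o, 'a) cat \<Rightarrow> ('o, 'a, 'o, 'a) funct \<Rightarrow> ('o \<Rightarrow> 'a) \<Rightarrow> ('o \<Rightarrow> 'a) \<Rightarrow> bool" where
  "comonad C T \<epsilon> \<delta> \<longleftrightarrow>
     is_functor C C T \<and> nat_trans C C T id_functor \<epsilon> \<and> nat_trans C C T (T \<circ>\<^sub>F T) \<delta> \<and>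
     (\<forall>x \<in> Obj C.
        \<epsilon> (Ob T x) \<cdot>\<^bsub>C\<^esub> \<delta> x = Idt C (Ob T x) \<and>
        Ar T (\<epsilon> x) \<cdot>\<^bsub>C\<^esub> \<delta> x = Idt C (Ob T x) \<and>
        \<delta> (Ob T x) \<cdot>\<^bsub>C\<^esub> \<delta> x = Ar T (\<delta> x) \<cdot>\<^bsub>C\<^esub> \<delta> x)"

definition monad ::
  "('o, 'a) cat \<Rightarrow> ('o, 'a, 'o, 'a) funct \<Rightarrow> ('o \<Rightarrow> 'a) \<Rightarrow> ('o \<Rightarrow> 'a) \<Rightarrow> bool" where
  "monad C T \<eta> \<mu> \<longleftrightarrow>
     is_functor C C T \<and> nat_trans C C id_functor T \<eta> \<and> nat_trans C C (T \<circ>\<^sub>F T) T \<mu> \<and>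
     (\<forall>x \<in> Obj C.
        \<mu> x \<cdot>\<^bsub>C\<^esub> \<eta> (Ob T x) = Idt C (Ob T x) \<and>
        \<mu> x \<cdot>\<^bsub>C\<^esub> Ar T (\<eta> x) = Idt C (Ob T x) \<and>
        \<mu> x \<cdot>\<^bsub>C\<^esub> \<mu> (Ob T x) = \<mu> x \<cdot>\<^bsub>C\<^esub> Ar T (\<mu> x))"

text \<open>\<open>\<lambda>\<close> is a distributive law \<open>L R \<rightarrow> R L\<close> of the comonad \<open>(L, \<epsilon>, \<delta>)\<close> over the
  monad \<open>(R, \<eta>, \<mu>)\<close>.\<close>

definition distributive_law ::
  "('o, 'a) cat \<Rightarrow>
   ('o, 'a, 'o, 'a) funct \<Rightarrow> ('o \<Rightarrow> 'a) \<Rightarrow> ('o \<Rightarrow> 'a) \<Rightarrow>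
   ('o, 'a, 'o, 'a) funct \<Rightarrow> ('o \<Rightarrow> 'a) \<Rightarrow> ('o \<Rightarrow> 'a) \<Rightarrow> ('o \<Rightarrow> 'a) \<Rightarrow> bool" where
  "distributive_law C L \<epsilon> \<delta> R \<eta> \<mu> dl \<longleftrightarrow>
     nat_trans C C (L \<circ>\<^sub>F R) (R \<circ>\<^sub>F L) dl \<and>
     (\<forall>x \<in> Obj C.
        dl x \<cdot>\<^bsub>C\<^esub> Ar L (\<eta> x) = \<eta> (Ob L x) \<and>
        Ar R (\<epsilon> x) \<cdot>\<^bsub>C\<^esub> dl x = \<epsilon> (Ob R x) \<and>
        dl x \<cdot>\<^bsub>C\<^esub> Ar L (\<mu> x) = \<mu> (Ob L x) \<cdot>\<^bsub>C\<^esub> Ar R (dl x) \<cdot>\<^bsub>C\<^esub> dl (Ob R x) \<and>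
        Ar R (\<delta> x) \<cdot>\<^bsub>C\<^esub> dl x = dl (Ob L x) \<cdot>\<^bsub>C\<^esub> Ar L (dl x) \<cdot>\<^bsub>C\<^esub> \<delta> (Ob R x))"

record 'a awfs =
  left_functor :: "('a, 'a square, 'a, 'a square) funct" (\<open>\<L>\<index>\<close>)
  right_functor :: "('a, 'a square, 'a, 'a square) funct" (\<open>\<R>\<index>\<close>)
  comult :: "'a \<Rightarrow> 'a square"
  mult :: "'a \<Rightarrow> 'a square"

definition counit_square :: "('o, 'a) cat \<Rightarrow> 'a awfs \<Rightarrow> 'a \<Rightarrow> 'a square" where
  "counit_square C W f = Square (Ob \<L>\<^bsub>W\<^esub> f) (Idt C (Dom C f)) (Ob \<R>\<^bsub>W\<^esub> f) f"

definition unit_square :: "('o, 'a) cat \<Rightarrow> 'a awfs \<Rightarrow> 'a \<Rightarrow> 'a square" where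
  "unit_square C W f = Square f (Ob \<L>\<^bsub>W\<^esub> f) (Idt C (Cod C f)) (Ob \<R>\<^bsub>W\<^esub> f)"

definition delta :: "'a awfs \<Rightarrow> 'a \<Rightarrow> 'a" where
  "delta W f = lower (comult W f)"

definition mu :: "'a awfs \<Rightarrow> 'a \<Rightarrow> 'a" where
  "mu W f = upper (mult W f)"

text \<open>The functor \<open>E = cod L = dom R\<close>.\<close>

definition mid :: "('o, 'a) cat \<Rightarrow> 'a awfs \<Rightarrow> ('a, 'a square, 'o, 'a) funct" where
  "mid C W = dom_functor C \<circ>\<^sub>F \<R>\<^bsub>W\<^esub>"

definition is_awfs :: "('o, 'a) cat \<Rightarrow> 'a awfs \<Rightarrow> bool" where
  "is_awfs C W \<longleftrightarrow>
     is_functor (arrow_cat C) (arrow_cat C) \<L>\<^bsub>W\<^esub> \<and>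
     is_functor (arrow_cat C) (arrow_cat C) \<R>\<^bsub>W\<^esub> \<and>
     functor_eq (arrow_cat C) (dom_functor C \<circ>\<^sub>F \<L>\<^bsub>W\<^esub>) (dom_functor C) \<and>
     functor_eq (arrow_cat C) (cod_functor C \<circ>\<^sub>F \<L>\<^bsub>W\<^esub>) (dom_functor C \<circ>\<^sub>F \<R>\<^bsub>W\<^esub>) \<and>
     functor_eq (arrow_cat C) (cod_functor C \<circ>\<^sub>F \<R>\<^bsub>W\<^esub>) (cod_functor C) \<and>
     (\<forall>f \<in> Arr C. Ob \<R>\<^bsub>W\<^esub> f \<cdot>\<^bsub>C\<^esub> Ob \<L>\<^bsub>W\<^esub> f = f) \<and>
     comonad (arrow_cat C) \<L>\<^bsub>W\<^esub> (counit_square C W) (comult W) \<and>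
     monad (arrow_cat C) \<R>\<^bsub>W\<^esub> (unit_square C W) (mult W) \<and>
     distributive_law (arrow_cat C)
       \<L>\<^bsub>W\<^esub> (counit_square C W) (comult W) \<R>\<^bsub>W\<^esub> (unit_square C W) (mult W)
       (\<lambda>f. Square (Ob \<L>\<^bsub>W\<^esub> (Ob \<R>\<^bsub>W\<^esub> f)) (delta W f) (mu W f) (Ob \<R>\<^bsub>W\<^esub> (Ob \<L>\<^bsub>W\<^esub> f)))"

text \<open>Coalgebras for the copointed endofunctor \<open>(L, \<Phi>)\<close>; the object \<open>(f, s)\<close> has \<open>s : cod f \<rightarrow> E f\<close>.\<close>

definition left_maps :: "('o, 'a) cat \<Rightarrow> 'a awfs \<Rightarrow> ('a \<times> 'a) set" where
  "left_maps C W =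
     {(f, s). f \<in> Arr C \<and> s \<in> hom C (Cod C f) (Ob (mid C W) f) \<and>
        s \<cdot>\<^bsub>C\<^esub> f = Ob \<L>\<^bsub>W\<^esub> f \<and> Ob \<R>\<^bsub>W\<^esub> f \<cdot>\<^bsub>C\<^esub> s = Idt C (Cod C f)}"

definition coalg_cat ::
  "('o, 'a) cat \<Rightarrow> 'a awfs \<Rightarrow> ('a \<times> 'a, ('a \<times> 'a) \<times> 'a square \<times> ('a \<times> 'a)) cat" where
  "coalg_cat C W =
     struct_cat (arrow_cat C) (left_maps C W) fst
       (\<lambda>(f, s) \<sigma> (g, t). t \<cdot>\<^bsub>C\<^esub> lower \<sigma> = Ar (mid C W) \<sigma> \<cdot>\<^bsub>C\<^esub> s)"

definition coalg_forget ::
  "('a \<times> 'a, ('a \<times> 'a) \<times> 'a square \<times> ('a \<times> 'a), 'a, 'a square) funct" where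
  "coalg_forget = struct_forget fst"

text \<open>A double category as an internal category in categories: \<open>Hor\<close> consists of the objects and the
  horizontal morphisms, \<open>Ver\<close> of the vertical morphisms and the squares, under horizontal
  composition.\<close>

record ('o, 'h, 'v, 's) dbl =
  Hor :: "('o, 'h) cat"
  Ver :: "('v, 's) cat"
  VDom :: "('v, 's, 'o, 'h) funct"
  VCod :: "('v, 's, 'o, 'h) funct"
  VIdt :: "('o, 'h, 'v, 's) funct"
  VCmp :: "'v \<Rightarrow> 'v \<Rightarrow> 'v"
  SCmp :: "'s \<Rightarrow> 's \<Rightarrow> 's"

definition dbl_functor ::
  "('o, 'h, 'v, 's) dbl \<Rightarrow> ('p, 'i, 'w, 't) dbl \<Rightarrow>
   ('o, 'h, 'p, 'i) funct \<Rightarrow> ('v, 's, 'w, 't) funct \<Rightarrow> bool" where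
  "dbl_functor A B H V \<longleftrightarrow>
     is_functor (Hor A) (Hor B) H \<and>
     is_functor (Ver A) (Ver B) V \<and>
     functor_eq (Ver A) (VDom B \<circ>\<^sub>F V) (H \<circ>\<^sub>F VDom A) \<and>
     functor_eq (Ver A) (VCod B \<circ>\<^sub>F V) (H \<circ>\<^sub>F VCod A) \<and>
     functor_eq (Hor A) (V \<circ>\<^sub>F VIdt A) (VIdt B \<circ>\<^sub>F H) \<and>
     (\<forall>v \<in> Obj (Ver A). \<forall>w \<in> Obj (Ver A). Ob (VCod A) v = Ob (VDom A) w \<longrightarrow>
        Ob V (VCmp A w v) = VCmp B (Ob V w) (Ob V v)) \<and>
     (\<forall>s \<in> Arr (Ver A). \<forall>t \<in> Arr (Ver A). Ar (VCod A) s = Ar (VDom A) t \<longrightarrow>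
        Ar V (SCmp A t s) = SCmp B (Ar V t) (Ar V s))"

text \<open>An isomorphism of double categories \<open>A \<cong> B\<close> that commutes with given double functors
  \<open>(HA, VA)\<close> and \<open>(HB, VB)\<close> from \<open>A\<close> and \<open>B\<close> to a common target.\<close>

definition dbl_iso_over ::
  "('o, 'h, 'v, 's) dbl \<Rightarrow> ('o, 'h, 'x, 'y) funct \<Rightarrow> ('v, 's, 'm, 'n) funct \<Rightarrow>
   ('p, 'i, 'w, 't) dbl \<Rightarrow> ('p, 'i, 'x, 'y) funct \<Rightarrow> ('w, 't, 'm, 'n) funct \<Rightarrow> bool" where
  "dbl_iso_over A HA VA B HB VB \<longleftrightarrow>
     (\<exists>H V H' V'.
        dbl_functor A B H V \<and> dbl_functor B A H' V' \<and>
        functor_eq (Hor A) (H' \<circ>\<^sub>F H) id_functor \<and> functor_eq (Ver A) (V' \<circ>\<^sub>F V) id_functor \<and>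
        functor_eq (Hor B) (H \<circ>\<^sub>F H') id_functor \<and> functor_eq (Ver B) (V \<circ>\<^sub>F V') id_functor \<and>
        functor_eq (Hor A) (HB \<circ>\<^sub>F H) HA \<and> functor_eq (Ver A) (VB \<circ>\<^sub>F V) VA)"

definition vstack :: "('o, 'a) cat \<Rightarrow> 'a square \<Rightarrow> 'a square \<Rightarrow> 'a square" where
  "vstack C \<tau> \<sigma> = Square (sdom \<tau> \<cdot>\<^bsub>C\<^esub> sdom \<sigma>) (upper \<sigma>) (lower \<tau>) (scod \<tau> \<cdot>\<^bsub>C\<^esub> scod \<sigma>)"

definition id_square :: "('o, 'a) cat \<Rightarrow> 'a \<Rightarrow> 'a square" where
  "id_square C h = Square (Idt C (Dom C h)) h h (Idt C (Cod C h))"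

definition Sq :: "('o, 'a) cat \<Rightarrow> ('o, 'a, 'a, 'a square) dbl" where
  "Sq C =
     \<lparr>Hor = C, Ver = arrow_cat C, VDom = dom_functor C, VCod = cod_functor C,
      VIdt = \<lparr>Ob = Idt C, Ar = id_square C\<rparr>,
      VCmp = Cmp C, SCmp = vstack C\<rparr>"

text \<open>Objects and horizontal morphisms are those of \<open>C\<close>, vertical morphisms are arrows of \<open>C\<close>
  with structure, and squares are the commutative squares that respect the structure.  The
  arguments \<open>idv\<close> and \<open>cmpv\<close> are the identities and the composition of vertical morphisms.\<close>

definition struct_dbl ::
  "('o, 'a) cat \<Rightarrow> ('a \<times> 'x) set \<Rightarrow> (('a \<times> 'x) \<Rightarrow> 'a square \<Rightarrow> ('a \<times> 'x) \<Rightarrow> bool) \<Rightarrow>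
   ('o \<Rightarrow> 'a \<times> 'x) \<Rightarrow> ('a \<times> 'x \<Rightarrow> 'a \<times> 'x \<Rightarrow> 'a \<times> 'x) \<Rightarrow>
   ('o, 'a, 'a \<times> 'x, ('a \<times> 'x) \<times> 'a square \<times> ('a \<times> 'x)) dbl" where
  "struct_dbl C X resp idv cmpv =
     \<lparr>Hor = C,
      Ver = struct_cat (arrow_cat C) X fst resp,
      VDom = dom_functor C \<circ>\<^sub>F struct_forget fst,
      VCod = cod_functor C \<circ>\<^sub>F struct_forget fst,
      VIdt = \<lparr>Ob = idv, Ar = (\<lambda>h. (idv (Dom C h), id_square C h, idv (Cod C h)))\<rparr>,
      VCmp = cmpv,
      SCmp = (\<lambda>(x', \<tau>, y') (x, \<sigma>, y). (cmpv x' x, vstack C \<tau> \<sigma>, cmpv y' y))\<rparr>"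

definition monad_algebra ::
  "('o, 'a) cat \<Rightarrow> ('o, 'a, 'o, 'a) funct \<Rightarrow> ('o \<Rightarrow> 'a) \<Rightarrow> ('o \<Rightarrow> 'a) \<Rightarrow> 'o \<Rightarrow> 'a \<Rightarrow> bool" where
  "monad_algebra C T \<eta> \<mu> x a \<longleftrightarrow>
     x \<in> Obj C \<and> a \<in> hom C (Ob T x) x \<and>
     a \<cdot>\<^bsub>C\<^esub> \<eta> x = Idt C x \<and> a \<cdot>\<^bsub>C\<^esub> Ar T a = a \<cdot>\<^bsub>C\<^esub> \<mu> x"

definition alg_square :: "('o, 'a) cat \<Rightarrow> 'a awfs \<Rightarrow> 'a \<Rightarrow> 'a \<Rightarrow> 'a square" where
  "alg_square C W f p = Square (Ob \<R>\<^bsub>W\<^esub> f) p (Idt C (Cod C f)) f"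

definition right_maps :: "('o, 'a) cat \<Rightarrow> 'a awfs \<Rightarrow> ('a \<times> 'a) set" where
  "right_maps C W =
     {(f, p). monad_algebra (arrow_cat C) \<R>\<^bsub>W\<^esub> (unit_square C W) (mult W) f (alg_square C W f p)}"

definition alg_comp :: "('o, 'a) cat \<Rightarrow> 'a awfs \<Rightarrow> ('a \<times> 'a) \<Rightarrow> ('a \<times> 'a) \<Rightarrow> ('a \<times> 'a)" where
  "alg_comp C W = (\<lambda>(g, q) (f, p).
     let gf = g \<cdot>\<^bsub>C\<^esub> f;
         idA = Idt C (Dom C f);
         Ef1 = Ar (mid C W) (Square gf f (Idt C (Cod C g)) g);
         Lgf = Ob \<L>\<^bsub>W\<^esub> g \<cdot>\<^bsub>C\<^esub> f
     in (gf,
         p \<cdot>\<^bsub>C\<^esub> Ar (mid C W) (Square Lgf idA q f)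
           \<cdot>\<^bsub>C\<^esub> Ar (mid C W) (Square (Ob \<L>\<^bsub>W\<^esub> gf) idA Ef1 Lgf)
           \<cdot>\<^bsub>C\<^esub> delta W gf))"

definition Alg_dbl ::
  "('o, 'a) cat \<Rightarrow> 'a awfs \<Rightarrow>
   ('o, 'a, 'a \<times> 'a, ('a \<times> 'a) \<times> 'a square \<times> ('a \<times> 'a)) dbl" where
  "Alg_dbl C W =
     struct_dbl C (right_maps C W)
       (\<lambda>(f, p) \<sigma> (g, q).
          \<sigma> \<cdot>\<^bsub>arrow_cat C\<^esub> alg_square C W f p = alg_square C W g q \<cdot>\<^bsub>arrow_cat C\<^esub> Ar \<R>\<^bsub>W\<^esub> \<sigma>)
       (\<lambda>x. (Idt C x, Ob \<R>\<^bsub>W\<^esub> (Idt C x)))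
       (alg_comp C W)"

definition lifting_problems ::
  "('o, 'a) cat \<Rightarrow> ('i, 't) cat \<Rightarrow> ('i, 't, 'a, 'a square) funct \<Rightarrow> 'a \<Rightarrow> ('i \<times> 'a square) set" where
  "lifting_problems C J u f = {(i, \<alpha>). i \<in> Obj J \<and> \<alpha> \<in> hom (arrow_cat C) (Ob u i) f}"

text \<open>Lifting structures are extensional, so that equality of vertical morphisms of \<open>Lift_dbl\<close> is
  equality of all the chosen fillers.\<close>

definition lift_structs ::
  "('o, 'a) cat \<Rightarrow> ('i, 't) cat \<Rightarrow> ('i, 't, 'a, 'a square) funct
    \<Rightarrow> ('a \<times> ('i \<times> 'a square \<Rightarrow> 'a)) set" where
  "lift_structs C J u =
     {(f, \<psi>). f \<in> Arr C \<and> \<psi> \<in> extensional (lifting_problems C J u f) \<and>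
        (\<forall>(i, \<alpha>) \<in> lifting_problems C J u f.
           \<psi> (i, \<alpha>) \<in> hom C (Cod C (Ob u i)) (Dom C f) \<and>
           \<psi> (i, \<alpha>) \<cdot>\<^bsub>C\<^esub> Ob u i = upper \<alpha> \<and> f \<cdot>\<^bsub>C\<^esub> \<psi> (i, \<alpha>) = lower \<alpha>) \<and>
        (\<forall>t \<in> Arr J. \<forall>\<alpha> \<in> hom (arrow_cat C) (Ob u (Cod J t)) f.
           \<psi> (Dom J t, \<alpha> \<cdot>\<^bsub>arrow_cat C\<^esub> Ar u t) = \<psi> (Cod J t, \<alpha>) \<cdot>\<^bsub>C\<^esub> lower (Ar u t))}"

definition lift_idt ::
  "('o, 'a) cat \<Rightarrow> ('i, 't) cat \<Rightarrow> ('i, 't, 'a, 'a square) funct \<Rightarrow> 'o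
    \<Rightarrow> 'a \<times> ('i \<times> 'a square \<Rightarrow> 'a)" where
  "lift_idt C J u x = (Idt C x, \<lambda>(i, \<alpha>) \<in> lifting_problems C J u (Idt C x). lower \<alpha>)"

text \<open>A lifting problem \<open>(a, c) : u i \<rightarrow> g f\<close> is filled by first filling \<open>(f a, c) : u i \<rightarrow> g\<close>.\<close>

definition lift_comp ::
  "('o, 'a) cat \<Rightarrow> ('i, 't) cat \<Rightarrow> ('i, 't, 'a, 'a square) funct
    \<Rightarrow> 'a \<times> ('i \<times> 'a square \<Rightarrow> 'a) \<Rightarrow> 'a \<times> ('i \<times> 'a square \<Rightarrow> 'a)
    \<Rightarrow> 'a \<times> ('i \<times> 'a square \<Rightarrow> 'a)" where
  "lift_comp C J u = (\<lambda>(g, \<psi>) (f, \<phi>).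
     (g \<cdot>\<^bsub>C\<^esub> f,
      \<lambda>(i, \<alpha>) \<in> lifting_problems C J u (g \<cdot>\<^bsub>C\<^esub> f).
        \<phi> (i, Square (Ob u i) (upper \<alpha>)
                (\<psi> (i, Square (Ob u i) (f \<cdot>\<^bsub>C\<^esub> upper \<alpha>) (lower \<alpha>) g)) f)))"

definition Lift_dbl ::
  "('o, 'a) cat \<Rightarrow> ('i, 't) cat \<Rightarrow> ('i, 't, 'a, 'a square) funct \<Rightarrow>
   ('o, 'a, 'a \<times> ('i \<times> 'a square \<Rightarrow> 'a),
    ('a \<times> ('i \<times> 'a square \<Rightarrow> 'a)) \<times> 'a square \<times> ('a \<times> ('i \<times> 'a square \<Rightarrow> 'a))) dbl" where
  "Lift_dbl C J u =
     struct_dbl C (lift_structs C J u)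
       (\<lambda>(f, \<psi>) \<beta> (f', \<psi>').
          \<forall>(i, \<alpha>) \<in> lifting_problems C J u f.
            \<psi>' (i, \<beta> \<cdot>\<^bsub>arrow_cat C\<^esub> \<alpha>) = upper \<beta> \<cdot>\<^bsub>C\<^esub> \<psi> (i, \<alpha>))
       (lift_idt C J u)
       (lift_comp C J u)"

text \<open>The forgetful double functors of \<open>Alg_dbl\<close> and \<open>Lift_dbl\<close> to \<open>Sq C\<close> are the identity on objects
  and horizontal morphisms and \<open>struct_forget fst\<close> on vertical morphisms and squares.\<close>

definition cofibrantly_generated ::
  "('o, 'a) cat \<Rightarrow> 'a awfs \<Rightarrow> ('i, 't) cat \<Rightarrow> ('i, 't, 'a, 'a square) funct \<Rightarrow> bool" where
  "cofibrantly_generated C W J u \<longleftrightarrow>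
     dbl_iso_over (Alg_dbl C W) id_functor (struct_forget fst)
                  (Lift_dbl C J u) id_functor (struct_forget fst)"

definition cartesian ::
  "('o, 'a) cat \<Rightarrow> ('p, 'b) cat \<Rightarrow> ('p, 'b, 'o, 'a) funct \<Rightarrow> 'b set" where
  "cartesian E F P =
     {e \<in> Arr F. \<forall>e' \<in> Arr F. \<forall>w. Cod F e' = Cod F e \<and>
        w \<in> hom E (Ob P (Dom F e')) (Ob P (Dom F e)) \<and> Ar P e \<cdot>\<^bsub>E\<^esub> w = Ar P e' \<longrightarrow>
        (\<exists>!x. x \<in> hom F (Dom F e') (Dom F e) \<and> Ar P x = w \<and> e \<cdot>\<^bsub>F\<^esub> x = e')}"

text \<open>\<open>cl h X\<close> is the chosen cartesian lift of \<open>h\<close> with codomain \<open>X\<close>, and \<open>Dom F (cl h X)\<close> is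
  the reindexing of \<open>X\<close> along \<open>h\<close>.\<close>

definition fibration ::
  "('o, 'a) cat \<Rightarrow> ('p, 'b) cat \<Rightarrow> ('p, 'b, 'o, 'a) funct \<Rightarrow> ('a \<Rightarrow> 'p \<Rightarrow> 'b) \<Rightarrow> bool" where
  "fibration E F P cl \<longleftrightarrow>
     is_functor F E P \<and>
     (\<forall>X \<in> Obj F. \<forall>h \<in> Arr E. Cod E h = Ob P X \<longrightarrow>
        cl h X \<in> cartesian E F P \<and> Cod F (cl h X) = X \<and> Ar P (cl h X) = h)"

definition van_kampen ::
  "('k, 't) cat \<Rightarrow> ('o, 'a) cat \<Rightarrow> ('p, 'b) cat \<Rightarrow> ('p, 'b, 'o, 'a) funct \<Rightarrow>
   ('k, 't, 'o, 'a) funct \<Rightarrow> 'o \<Rightarrow> ('k \<Rightarrow> 'a) \<Rightarrow> bool" where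
  "van_kampen K E F P b b0 \<beta> \<longleftrightarrow>
     (\<forall>e. is_functor K (wide F (cartesian E F P)) e \<and> functor_eq K (P \<circ>\<^sub>F e) b \<longrightarrow>
        (\<exists>e0 \<epsilon>. is_colimit K (wide F (cartesian E F P)) e e0 \<epsilon> \<and>
                Ob P e0 = b0 \<and> (\<forall>k \<in> Obj K. Ar P (\<epsilon> k) = \<beta> k)) \<and>
        (\<forall>e0 \<epsilon>. is_cocone K (wide F (cartesian E F P)) e e0 \<epsilon> \<and>
                Ob P e0 = b0 \<and> (\<forall>k \<in> Obj K. Ar P (\<epsilon> k) = \<beta> k) \<longrightarrow>
                is_colimit K F e e0 \<epsilon>))"

definition van_kampen_chains ::
  "('o, 'a) cat \<Rightarrow> 'k rel \<Rightarrow> 'a set \<Rightarrow> ('p, 'b) cat \<Rightarrow> ('p, 'b, 'o, 'a) funct \<Rightarrow> bool" where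
  "van_kampen_chains E \<kappa> M F P \<longleftrightarrow>
     (\<forall>(\<alpha> :: 'k rel) b b0 \<beta>.
        \<alpha> \<le>o \<kappa> \<and>
        is_functor (poset_cat (one_plus \<alpha>)) (wide E M) b \<and>
        is_colimit (poset_cat (one_plus \<alpha>)) E b b0 \<beta> \<longrightarrow>
        van_kampen (poset_cat (one_plus \<alpha>)) E F P b b0 \<beta>)"

definition van_kampen_cobase_changes ::
  "('o, 'a) cat \<Rightarrow> 'a set \<Rightarrow> ('p, 'b) cat \<Rightarrow> ('p, 'b, 'o, 'a) funct \<Rightarrow> bool" where
  "van_kampen_cobase_changes E M F P \<longleftrightarrow>
     (\<forall>m f p q. m \<in> M \<and> is_pushout E m f p q \<longrightarrow>
        van_kampen span_cat E F P (span_diagram E m f) (Cod E p) (pushout_cocone E m p q))"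

definition fiber ::
  "('o, 'a) cat \<Rightarrow> ('p, 'b) cat \<Rightarrow> ('p, 'b, 'o, 'a) funct \<Rightarrow> 'o \<Rightarrow> ('p, 'b) cat" where
  "fiber E F P A =
     F\<lparr>Obj := {X \<in> Obj F. Ob P X = A}, Arr := {x \<in> Arr F. Ar P x = Idt E A}\<rparr>"

definition cart_over ::
  "('o, 'a) cat \<Rightarrow> ('p, 'b) cat \<Rightarrow> ('p, 'b, 'o, 'a) funct \<Rightarrow> 'a \<Rightarrow> ('b, 'b square) cat" where
  "cart_over E F P m =
     (let X = {e \<in> cartesian E F P. Ar P e = m}
      in (arrow_cat F)\<lparr>Obj := X,
           Arr := {\<sigma> \<in> Arr (arrow_cat F). sdom \<sigma> \<in> X \<and> scod \<sigma> \<in> X \<and>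
             Ar P (upper \<sigma>) = Idt E (Dom E m) \<and> Ar P (lower \<sigma>) = Idt E (Cod E m)}\<rparr>)"

text \<open>An object \<open>(m, \<xi>)\<close> over \<open>m\<close>: the section \<open>\<xi>\<close> sends \<open>X\<close> to a cartesian morphism
  \<open>Ob \<xi> X : X \<rightarrow> \<xi>X\<close>, and a morphism \<open>x\<close> of the fiber to a square with upper side \<open>x\<close>, whose lower side
  is the value \<open>\<xi>x\<close>.  Sections are extensional, so that equality of objects is equality of
  functors.\<close>

type_synonym ('a, 'p, 'b) ext_obj = "'a \<times> ('p, 'b, 'b, 'b square) funct"

definition ext_objs ::
  "('o, 'a) cat \<Rightarrow> ('p, 'b) cat \<Rightarrow> ('p, 'b, 'o, 'a) funct \<Rightarrow> ('a, 'p, 'b) ext_obj set" where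
  "ext_objs E F P =
     {(m, \<xi>). m \<in> Arr E \<and>
        is_functor (fiber E F P (Dom E m)) (cart_over E F P m) \<xi> \<and>
        functor_eq (fiber E F P (Dom E m)) (dom_functor F \<circ>\<^sub>F \<xi>) id_functor \<and>
        Ob \<xi> \<in> extensional (Obj (fiber E F P (Dom E m))) \<and>
        Ar \<xi> \<in> extensional (Arr (fiber E F P (Dom E m)))}"

definition reindex ::
  "('o, 'a) cat \<Rightarrow> ('p, 'b) cat \<Rightarrow> ('p, 'b, 'o, 'a) funct \<Rightarrow> ('a \<Rightarrow> 'p \<Rightarrow> 'b) \<Rightarrow> 'a \<Rightarrow> 'b \<Rightarrow> 'b" where
  "reindex E F P cl h y =
     (THE z. z \<in> hom (fiber E F P (Dom E h))
                   (Dom F (cl h (Dom F y))) (Dom F (cl h (Cod F y))) \<and>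
             cl h (Cod F y) \<cdot>\<^bsub>F\<^esub> z = y \<cdot>\<^bsub>F\<^esub> cl h (Dom F y))"

text \<open>The component at \<open>X\<close> of the canonical isomorphism from reindexing along \<open>h' h\<close> to reindexing
  along \<open>h'\<close> and then along \<open>h\<close>.\<close>

definition reindex_comp ::
  "('o, 'a) cat \<Rightarrow> ('p, 'b) cat \<Rightarrow> ('p, 'b, 'o, 'a) funct \<Rightarrow> ('a \<Rightarrow> 'p \<Rightarrow> 'b)
    \<Rightarrow> 'a \<Rightarrow> 'a \<Rightarrow> 'p \<Rightarrow> 'b" where
  "reindex_comp E F P cl h' h X =
     (THE z. z \<in> hom (fiber E F P (Dom E h))
                   (Dom F (cl (h' \<cdot>\<^bsub>E\<^esub> h) X)) (Dom F (cl h (Dom F (cl h' X)))) \<and>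
             cl h' X \<cdot>\<^bsub>F\<^esub> cl h (Dom F (cl h' X)) \<cdot>\<^bsub>F\<^esub> z = cl (h' \<cdot>\<^bsub>E\<^esub> h) X)"

text \<open>A morphism \<open>((m, \<xi>), (\<sigma>, \<phi>), (m', \<xi>'))\<close> over \<open>\<sigma> = (h, k)\<close> has components
  \<open>\<phi> X : \<xi>(h\<^sup>*X) \<rightarrow> \<xi>'X\<close> for \<open>X\<close> in the fiber over the domain of \<open>m'\<close>.\<close>

type_synonym ('a, 'p, 'b) ext_arr =
  "('a, 'p, 'b) ext_obj \<times> ('a square \<times> ('p \<Rightarrow> 'b)) \<times> ('a, 'p, 'b) ext_obj"

definition ext_arrs ::
  "('o, 'a) cat \<Rightarrow> ('p, 'b) cat \<Rightarrow> ('p, 'b, 'o, 'a) funct \<Rightarrow> ('a \<Rightarrow> 'p \<Rightarrow> 'b)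
    \<Rightarrow> ('a, 'p, 'b) ext_arr set" where
  "ext_arrs E F P cl =
     {((m, \<xi>), (\<sigma>, \<phi>), (m', \<xi>')).
        (m, \<xi>) \<in> ext_objs E F P \<and> (m', \<xi>') \<in> ext_objs E F P \<and>
        \<sigma> \<in> hom (arrow_cat E) m m' \<and>
        \<phi> \<in> extensional (Obj (fiber E F P (Dom E m'))) \<and>
        (\<forall>X \<in> Obj (fiber E F P (Dom E m')).
           \<phi> X \<in> hom F (Cod F (Ob \<xi> (Dom F (cl (upper \<sigma>) X)))) (Cod F (Ob \<xi>' X)) \<and>
           \<phi> X \<in> cartesian E F P \<and>
           Ar P (\<phi> X) = lower \<sigma> \<and>
           \<phi> X \<cdot>\<^bsub>F\<^esub> Ob \<xi> (Dom F (cl (upper \<sigma>) X)) = Ob \<xi>' X \<cdot>\<^bsub>F\<^esub> cl (upper \<sigma>) X) \<and>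
        (\<forall>y \<in> Arr (fiber E F P (Dom E m')).
           \<phi> (Cod F y) \<cdot>\<^bsub>F\<^esub> lower (Ar \<xi> (reindex E F P cl (upper \<sigma>) y)) =
           lower (Ar \<xi>' y) \<cdot>\<^bsub>F\<^esub> \<phi> (Dom F y))}"

definition ext_idt ::
  "('o, 'a) cat \<Rightarrow> ('p, 'b) cat \<Rightarrow> ('p, 'b, 'o, 'a) funct \<Rightarrow> ('a \<Rightarrow> 'p \<Rightarrow> 'b)
    \<Rightarrow> ('a, 'p, 'b) ext_obj \<Rightarrow> ('a, 'p, 'b) ext_arr" where
  "ext_idt E F P cl = (\<lambda>(m, \<xi>).
     ((m, \<xi>),
      (Idt (arrow_cat E) m,
       \<lambda>X \<in> Obj (fiber E F P (Dom E m)). lower (Ar \<xi> (cl (Idt E (Dom E m)) X))),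
      (m, \<xi>)))"

definition ext_cmp ::
  "('o, 'a) cat \<Rightarrow> ('p, 'b) cat \<Rightarrow> ('p, 'b, 'o, 'a) funct \<Rightarrow> ('a \<Rightarrow> 'p \<Rightarrow> 'b)
    \<Rightarrow> ('a, 'p, 'b) ext_arr \<Rightarrow> ('a, 'p, 'b) ext_arr \<Rightarrow> ('a, 'p, 'b) ext_arr" where
  "ext_cmp E F P cl = (\<lambda>(_, (\<sigma>', \<phi>'), (m'', \<xi>'')) ((m, \<xi>), (\<sigma>, \<phi>), _).
     ((m, \<xi>),
      (\<sigma>' \<cdot>\<^bsub>arrow_cat E\<^esub> \<sigma>,
       \<lambda>X \<in> Obj (fiber E F P (Dom E m'')).
         \<phi>' X \<cdot>\<^bsub>F\<^esub> \<phi> (Dom F (cl (upper \<sigma>') X))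
           \<cdot>\<^bsub>F\<^esub> lower (Ar \<xi> (reindex_comp E F P cl (upper \<sigma>') (upper \<sigma>) X))),
      (m'', \<xi>'')))"

definition Ext ::
  "('o, 'a) cat \<Rightarrow> ('p, 'b) cat \<Rightarrow> ('p, 'b, 'o, 'a) funct \<Rightarrow> ('a \<Rightarrow> 'p \<Rightarrow> 'b)
    \<Rightarrow> (('a, 'p, 'b) ext_obj, ('a, 'p, 'b) ext_arr) cat" where
  "Ext E F P cl =
     \<lparr>Obj = ext_objs E F P,
      Arr = ext_arrs E F P cl,
      Dom = (\<lambda>(x, _, _). x),
      Cod = (\<lambda>(_, _, y). y),
      Idt = ext_idt E F P cl,
      Cmp = ext_cmp E F P cl\<rparr>"

definition ext_forget ::
  "(('a, 'p, 'b) ext_obj, ('a, 'p, 'b) ext_arr, 'a, 'a square) funct" where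
  "ext_forget = \<lparr>Ob = fst, Ar = (\<lambda>(_, (\<sigma>, _), _). \<sigma>)\<rparr>"

end

theory Submission
  imports Defs
begin

text \<open>For \<open>Z\<close> in \<open>F\<close> and \<open>f : P Z \<rightarrow> B\<close>, factor \<open>f\<close> by a small object argument that attaches, at each
  stage, the cells of the density comonad.  The lift \<open>T\<close> extends an object of \<open>F\<close> along every such
  cell, and because chain colimits and cobase changes are Van Kampen, the whole transfinite
  construction can be carried out in the comma category of pairs \<open>(Z, f)\<close>.  It ends in a map
  \<open>p : P Y \<rightarrow> B\<close> and a cartesian morphism \<open>Z \<rightarrow> Y\<close> over some \<open>i : P Z \<rightarrow> P Y\<close> with \<open>p i = f\<close>.  By smallness
  \<open>p\<close> carries a lifting structure against \<open>u\<close>, so by cofibrant generation it is an algebra for the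
  right monad, with structure \<open>q\<close>; then \<open>\<phi> = q \<circ> E(i, id) : E f \<rightarrow> P Y\<close> satisfies \<open>\<phi> \<circ> L f = i\<close> and is
  natural.  (No freeness of \<open>p\<close> is needed, only the unit law of \<open>q\<close>.)  A left map \<open>(f, s)\<close> extends \<open>Z\<close>
  to the reindexing of \<open>Y\<close> along \<open>\<phi> s\<close>.\<close>

section \<open>Categories, pushouts and ordinal chains\<close>

text \<open>The last map is to carry coherent fillers, so a filler found at one stage must agree
  with the one found at any later stage. Attaching a fresh cell for every lifting problem at every
  stage would destroy this: stage \<open>c\<close> may attach only what is new compared with all
  \<open>d < c\<close>. The new part is a map out of a colimit of the old cells, and it has to lie
  in \<open>M\<close>, because only cobase changes of maps in \<open>M\<close> are Van Kampen.
  Condition (b) of compatibility gives this for one earlier stage; passing to all earlier stages at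
  once is the technical core and is done for an abstract cell system. Working in the comma category
  instead of lifting a finished chain from \<open>E\<close> to \<open>F\<close> has a second
  benefit: each universal property yields the maps in \<open>F\<close> and in \<open>E\<close>
  together, and the uniqueness of maps between cellular chains gives functoriality although all
  chains are chosen arbitrarily. Morphisms of \<open>Ext\<close> are stated with chosen cartesian
  lifts and canonical isomorphisms. They are traded for assignments on all maps over the upper side
  of a square, where composition is strict.\<close>

lemma in_hom [simp]: "a \<in> hom C x y \<longleftrightarrow> a \<in> Arr C \<and> Dom C a = x \<and> Cod C a = y"
  by (auto simp: hom_def)

lemma Obj_span_cat [simp]: "Obj span_cat = {Apex, Lft, Rgt}"
  by (auto simp: span_cat_def poset_cat_def Field_def)

lemma span_cat_simps [simp]:
  "Arr span_cat = {(Apex, Apex), (Lft, Lft), (Rgt, Rgt), (Apex, Lft), (Apex, Rgt)}"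
  "Dom span_cat = fst" "Cod span_cat = snd"
  "Idt span_cat k = (k, k)" "Cmp span_cat t s = (fst s, snd t)"
  by (auto simp: span_cat_def poset_cat_def split: prod.splits)

lemma span_diagram_simps [simp]:
  "Ob (span_diagram C m f) Apex = Dom C m" "Ob (span_diagram C m f) Lft = Cod C m"
  "Ob (span_diagram C m f) Rgt = Cod C f"
  "Ar (span_diagram C m f) (Apex, Lft) = m" "Ar (span_diagram C m f) (Apex, Rgt) = f"
  "Ar (span_diagram C m f) (Apex, Apex) = Idt C (Dom C m)"
  "Ar (span_diagram C m f) (Lft, Lft) = Idt C (Cod C m)"
  "Ar (span_diagram C m f) (Rgt, Rgt) = Idt C (Cod C f)"
  by (simp_all add: span_diagram_def Let_def)

section \<open>Pushouts as commuting squares with a universal property\<close>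

context category
begin

lemma idt_simps [simp]:
  assumes "x \<in> Obj C"
  shows "Idt C x \<in> Arr C" "Dom C (Idt C x) = x" "Cod C (Idt C x) = x"
  using idt_hom[OF assms] by auto

lemma cmp_simps [simp]:
  assumes "a \<in> Arr C" "b \<in> Arr C" "Cod C a = Dom C b"
  shows "b \<cdot> a \<in> Arr C" "Dom C (b \<cdot> a) = Dom C a" "Cod C (b \<cdot> a) = Cod C b"
  using cmp_hom[of a "Dom C a" "Dom C b" b "Cod C b"] assms by auto

lemma obj_simps [simp]:
  assumes "a \<in> Arr C"
  shows "Dom C a \<in> Obj C" "Cod C a \<in> Obj C"
  using dom_obj cod_obj assms by auto

lemma idt_cmp [simp]: "a \<in> Arr C \<Longrightarrow> Cod C a = x \<Longrightarrow> Idt C x \<cdot> a = a"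
  using idt_left[of a "Dom C a" x] by simp

lemma cmp_idt [simp]: "a \<in> Arr C \<Longrightarrow> Dom C a = x \<Longrightarrow> a \<cdot> Idt C x = a"
  using idt_right[of a x "Cod C a"] by simp

lemma assoc_simp [simp]:
  "a \<in> Arr C \<Longrightarrow> b \<in> Arr C \<Longrightarrow> c \<in> Arr C \<Longrightarrow> Cod C a = Dom C b \<Longrightarrow> Cod C b = Dom C c \<Longrightarrow>
    (c \<cdot> b) \<cdot> a = c \<cdot> b \<cdot> a"
  using assoc[of a "Dom C a" "Dom C b" b "Dom C c" c "Cod C c"] by simp

lemma cmp_eq_cmp:
  assumes "b \<cdot> a = h" "a \<in> Arr C" "b \<in> Arr C" "z \<in> Arr C" "Cod C a = Dom C b" "Cod C z = Dom C a"
  shows "b \<cdot> a \<cdot> z = h \<cdot> z"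
  unfolding assms(1)[symmetric] using assms(2-) by simp

definition pushout :: "'a \<Rightarrow> 'a \<Rightarrow> 'a \<Rightarrow> 'a \<Rightarrow> bool" where
  "pushout m f p q \<longleftrightarrow>
     m \<in> Arr C \<and> f \<in> Arr C \<and> Dom C m = Dom C f \<and>
     p \<in> Arr C \<and> q \<in> Arr C \<and> Dom C p = Cod C m \<and> Dom C q = Cod C f \<and> Cod C q = Cod C p \<and>
     p \<cdot> m = q \<cdot> f \<and>
     (\<forall>v w. v \<in> Arr C \<and> w \<in> Arr C \<and> Dom C v = Cod C m \<and> Dom C w = Cod C f \<and>
            Cod C w = Cod C v \<and> v \<cdot> m = w \<cdot> f \<longrightarrow>
        (\<exists>!z. z \<in> hom C (Cod C p) (Cod C v) \<and> z \<cdot> p = v \<and> z \<cdot> q = w))"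

lemma span_cocone_iff:
  assumes "m \<in> Arr C" "f \<in> Arr C" "Dom C m = Dom C f"
  shows "is_cocone span_cat C (span_diagram C m f) c \<iota> \<longleftrightarrow>
    c \<in> Obj C \<and> \<iota> Lft \<in> hom C (Cod C m) c \<and> \<iota> Rgt \<in> hom C (Cod C f) c \<and>
    \<iota> Lft \<cdot> m = \<iota> Apex \<and> \<iota> Rgt \<cdot> f = \<iota> Apex" (is "?L \<longleftrightarrow> ?R")
proof
  assume ?L
  then show ?R
    by (simp add: is_cocone_def)
next
  assume R: ?R
  then have "\<iota> Lft \<in> hom C (Cod C m) c" by blast
  then have "\<iota> Lft \<cdot> m \<in> hom C (Dom C m) c"
    using assms by simp
  with R have "\<iota> Apex \<in> hom C (Dom C m) c"
    by simp
  with R assms show ?L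
    by (simp add: is_cocone_def)
qed

lemma pushout_ex1:
  assumes "pushout m f p q" "v \<in> hom C (Cod C m) V" "w \<in> hom C (Cod C f) V" "v \<cdot> m = w \<cdot> f"
  shows "\<exists>!z. z \<in> hom C (Cod C p) V \<and> z \<cdot> p = v \<and> z \<cdot> q = w"
proof -
  have V: "V = Cod C v" using assms by simp
  show ?thesis using assms unfolding pushout_def V by simp
qed

text \<open>The component at \<open>Apex\<close> is forced by either leg, so a cocone on a span is a
  commuting pair of maps, and the mediating condition at \<open>Apex\<close> follows from the one at
  \<open>Lft\<close>.\<close>

lemma is_pushout_iff: "is_pushout C m f p q \<longleftrightarrow> pushout m f p q"
proof (cases "m \<in> Arr C \<and> f \<in> Arr C \<and> Dom C m = Dom C f")
  case True
  then have mf: "m \<in> Arr C" "f \<in> Arr C" "Dom C m = Dom C f" by auto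
  note co = span_cocone_iff[OF mf]
  show ?thesis
  proof
    assume *: "is_pushout C m f p q"
    then have col: "is_colimit span_cat C (span_diagram C m f) (Cod C p) (pushout_cocone C m p q)"
      by (simp add: is_pushout_def)
    then have 1: "Cod C p \<in> Obj C \<and> p \<in> hom C (Cod C m) (Cod C p) \<and> q \<in> hom C (Cod C f) (Cod C p)
        \<and> p \<cdot> m = q \<cdot> f"
      by (simp add: is_colimit_def co pushout_cocone_def)
    have "\<exists>!z. z \<in> hom C (Cod C p) (Cod C v) \<and> z \<cdot> p = v \<and> z \<cdot> q = w"
      if "v \<in> Arr C" "w \<in> Arr C" "Dom C v = Cod C m" "Dom C w = Cod C f" "Cod C w = Cod C v"
        "v \<cdot> m = w \<cdot> f" for v w
    proof -
      have "is_cocone span_cat C (span_diagram C m f) (Cod C v) (pushout_cocone C m v w)"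
        using that mf by (simp add: co pushout_cocone_def)
      then have "\<exists>!z. z \<in> hom C (Cod C p) (Cod C v) \<and>
          (\<forall>k \<in> Obj span_cat. z \<cdot> pushout_cocone C m p q k = pushout_cocone C m v w k)"
        using col unfolding is_colimit_def by blast
      moreover have "(\<forall>k \<in> Obj span_cat. z \<cdot> pushout_cocone C m p q k = pushout_cocone C m v w k)
          \<longleftrightarrow> z \<cdot> p = v \<and> z \<cdot> q = w" if "z \<in> hom C (Cod C p) (Cod C v)" for z
      proof -
        have A: "z \<cdot> p \<cdot> m = (z \<cdot> p) \<cdot> m" using that 1 mf by simp
        show ?thesis by (auto simp: pushout_cocone_def A simp del: assoc_simp)
      qed
      ultimately show ?thesis by (smt (verit, ccfv_threshold))
    qed
    with 1 mf show "pushout m f p q" unfolding pushout_def by auto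
  next
    assume *: "pushout m f p q"
    then have 1: "p \<in> Arr C" "q \<in> Arr C" "Dom C p = Cod C m" "Dom C q = Cod C f"
      "Cod C q = Cod C p" "p \<cdot> m = q \<cdot> f"
      by (auto simp: pushout_def)
    have "\<exists>!z. z \<in> hom C (Cod C p) d \<and> (\<forall>k \<in> Obj span_cat. z \<cdot> pushout_cocone C m p q k = \<nu> k)"
      if "is_cocone span_cat C (span_diagram C m f) d \<nu>" for d \<nu>
    proof -
      from that have n: "\<nu> Lft \<in> hom C (Cod C m) d" "\<nu> Rgt \<in> hom C (Cod C f) d"
        "\<nu> Lft \<cdot> m = \<nu> Apex" "\<nu> Rgt \<cdot> f = \<nu> Apex"
        by (auto simp: co)
      then have "\<exists>!z. z \<in> hom C (Cod C p) d \<and> z \<cdot> p = \<nu> Lft \<and> z \<cdot> q = \<nu> Rgt"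
        by (intro pushout_ex1[OF *]) auto
      moreover have "(\<forall>k \<in> Obj span_cat. z \<cdot> pushout_cocone C m p q k = \<nu> k)
          \<longleftrightarrow> z \<cdot> p = \<nu> Lft \<and> z \<cdot> q = \<nu> Rgt" if "z \<in> hom C (Cod C p) d" for z
      proof -
        have A: "z \<cdot> p \<cdot> m = (z \<cdot> p) \<cdot> m" using that 1 mf by simp
        show ?thesis using n(3) by (auto simp: pushout_cocone_def A simp del: assoc_simp)
      qed
      ultimately show ?thesis by (smt (verit, ccfv_threshold))
    qed
    moreover have "is_cocone span_cat C (span_diagram C m f) (Cod C p) (pushout_cocone C m p q)"
      using 1 by (simp add: co pushout_cocone_def)
    ultimately show "is_pushout C m f p q"
      using mf by (simp add: is_pushout_def is_colimit_def)
  qed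
qed (auto simp: is_pushout_def pushout_def)

lemma pushoutD:
  assumes "pushout m f p q"
  shows "m \<in> Arr C" "f \<in> Arr C" "p \<in> Arr C" "q \<in> Arr C" "Dom C f = Dom C m"
    "Dom C p = Cod C m" "Dom C q = Cod C f" "Cod C q = Cod C p" "p \<cdot> m = q \<cdot> f"
  using assms by (auto simp: pushout_def)

lemma pushout_ex:
  assumes "pushout m f p q" "v \<in> hom C (Cod C m) V" "w \<in> hom C (Cod C f) V" "v \<cdot> m = w \<cdot> f"
  obtains z where "z \<in> hom C (Cod C p) V" "z \<cdot> p = v" "z \<cdot> q = w"
  using pushout_ex1[OF assms] by blast

lemma pushout_eqI:
  assumes po: "pushout m f p q" and z: "z \<in> hom C (Cod C p) V" "z' \<in> hom C (Cod C p) V"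
    and "z \<cdot> p = z' \<cdot> p" "z \<cdot> q = z' \<cdot> q"
  shows "z = z'"
proof -
  note [simp] = pushoutD[OF po]
  have "(z \<cdot> p) \<cdot> m = (z \<cdot> q) \<cdot> f" using z by simp
  then have "\<exists>!y. y \<in> hom C (Cod C p) V \<and> y \<cdot> p = z \<cdot> p \<and> y \<cdot> q = z \<cdot> q"
    using z by (intro pushout_ex1[OF po]) auto
  with assms show ?thesis by metis
qed

end

lemma wide_simps [simp]:
  "Obj (wide C M) = Obj C" "Arr (wide C M) = M" "Dom (wide C M) = Dom C" "Cod (wide C M) = Cod C"
  "Idt (wide C M) = Idt C" "Cmp (wide C M) = Cmp C"
  by (simp_all add: wide_def)

lemma poset_cat_simps [simp]:
  "Obj (poset_cat r) = Field r" "Arr (poset_cat r) = r" "Dom (poset_cat r) = fst"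
  "Cod (poset_cat r) = snd" "Idt (poset_cat r) a = (a, a)" "Cmp (poset_cat r) t s = (fst s, snd t)"
  by (auto simp: poset_cat_def split: prod.splits)

lemma one_plus_iff [simp]:
  "(None, None) \<in> one_plus r" "(None, Some b) \<in> one_plus r \<longleftrightarrow> b \<in> Field r"
  "(Some a, None) \<notin> one_plus r" "(Some a, Some b) \<in> one_plus r \<longleftrightarrow> (a, b) \<in> r"
  by (auto simp: one_plus_def)

lemma Field_one_plus [simp]: "Field (one_plus r) = insert None (Some ` Field r)"
proof -
  have "x \<in> insert None (Some ` Field r)" if "(x, y) \<in> one_plus r \<or> (y, x) \<in> one_plus r" for x y
    using that by (cases x; cases y) (auto simp: Field_def)
  moreover have "(None, x) \<in> one_plus r" if "x \<in> insert None (Some ` Field r)" for x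
    using that by auto
  ultimately show ?thesis unfolding Field_def by (blast intro: Domain.intros Range.intros)
qed

lemma functorD:
  assumes "is_functor C D T"
  shows "x \<in> Obj C \<Longrightarrow> Ob T x \<in> Obj D"
    "f \<in> Arr C \<Longrightarrow> Ar T f \<in> Arr D"
    "f \<in> Arr C \<Longrightarrow> Dom D (Ar T f) = Ob T (Dom C f)"
    "f \<in> Arr C \<Longrightarrow> Cod D (Ar T f) = Ob T (Cod C f)"
    "x \<in> Obj C \<Longrightarrow> Ar T (Idt C x) = Idt D (Ob T x)"
    "f \<in> Arr C \<Longrightarrow> g \<in> Arr C \<Longrightarrow> Cod C f = Dom C g \<Longrightarrow> Ar T (g \<cdot>\<^bsub>C\<^esub> f) = Ar T g \<cdot>\<^bsub>D\<^esub> Ar T f"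
  using assms by (auto simp: is_functor_def)

lemma comp_functor_simps [simp]: "Ob (S \<circ>\<^sub>F T) x = Ob S (Ob T x)" "Ar (S \<circ>\<^sub>F T) a = Ar S (Ar T a)"
  by (simp_all add: comp_functor_def)

section \<open>Chains indexed by 1 + D for a down-closed set D of stages\<close>

abbreviation seg :: "'k rel \<Rightarrow> 'k \<Rightarrow> 'k rel" where
  "seg r c \<equiv> Restr r (underS r c)"

text \<open>A chain is coded by what a recursion over stages produces: at \<open>d\<close> a cocone
  \<open>l d\<close> on everything earlier, with vertex \<open>Dom G (n d)\<close>, and a map
  \<open>n d\<close> from this vertex to the value at \<open>d\<close>. Every transition into stage
  \<open>d\<close> is a leg followed by \<open>n d\<close>, so successor and limit stages look
  alike.\<close>

definition chain_diagram ::
  "('o, 'a) cat \<Rightarrow> 'o \<Rightarrow> ('k \<Rightarrow> 'k option \<Rightarrow> 'a) \<Rightarrow> ('k \<Rightarrow> 'a)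
    \<Rightarrow> ('k option, 'k option \<times> 'k option, 'o, 'a) funct" where
  "chain_diagram G X l n =
     (let ob = (\<lambda>k. case k of None \<Rightarrow> X | Some d \<Rightarrow> Cod G (n d))
      in \<lparr>Ob = ob,
          Ar = (\<lambda>(x, y). if x = y then Idt G (ob x) else n (the y) \<cdot>\<^bsub>G\<^esub> l (the y) x)\<rparr>)"

lemma chain_diagram_simps [simp]:
  "Ob (chain_diagram G X l n) None = X"
  "Ob (chain_diagram G X l n) (Some d) = Cod G (n d)"
  "Ar (chain_diagram G X l n) (None, None) = Idt G X"
  "Ar (chain_diagram G X l n) (None, Some d) = n d \<cdot>\<^bsub>G\<^esub> l d None"
  "Ar (chain_diagram G X l n) (Some c, Some d) =
     (if c = d then Idt G (Cod G (n d)) else n d \<cdot>\<^bsub>G\<^esub> l d (Some c))"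
  by (simp_all add: chain_diagram_def Let_def)

text \<open>The recursions below choose three functions at once, and the property required at
  \<open>d\<close> refers to their earlier values; this is \<open>dependent_wf_choice\<close> for
  triples. Where two functions are wanted, the third takes values in \<open>unit\<close>.\<close>

lemma wf_choice3:
  assumes wf: "wf R"
    and cong: "\<And>l n w l' n' w' d x y z. (\<And>e. (e, d) \<in> R \<Longrightarrow> l e = l' e \<and> n e = n' e \<and> w e = w' e) \<Longrightarrow>
      P l n w d x y z \<Longrightarrow> P l' n' w' d x y z"
    and step: "\<And>l n w d. (\<And>e. (e, d) \<in> R \<Longrightarrow> P l n w e (l e) (n e) (w e)) \<Longrightarrow> \<exists>x y z. P l n w d x y z"
  shows "\<exists>l n w. \<forall>d. P l n w d (l d) (n d) (w d)"
proof -
  let ?P = "\<lambda>f d r. P (\<lambda>e. fst (f e)) (\<lambda>e. fst (snd (f e))) (\<lambda>e. snd (snd (f e))) d (fst r) (fst (snd r)) (snd (snd r))"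
  have "\<exists>f. \<forall>d. ?P f d (f d)"
  proof (rule dependent_wf_choice[OF wf])
    show "?P f x r = ?P g x r" if "\<And>z. (z, x) \<in> R \<Longrightarrow> f z = g z" for f g x r
      using that by (intro iffI; elim cong[rotated]) auto
    show "\<exists>r. ?P f x r" if "\<And>y. (y, x) \<in> R \<Longrightarrow> ?P f y (f y)" for x f
      using step[of x "\<lambda>e. fst (f e)" "\<lambda>e. fst (snd (f e))" "\<lambda>e. snd (snd (f e))"] that by auto
  qed
  then show ?thesis by blast
qed

locale chains = category G for G :: "('o, 'g) cat" (structure) +
  fixes \<kappa> :: "'k rel"
  assumes wo: "Well_order \<kappa>"
begin

lemma lt_iff: "d \<in> underS \<kappa> c \<longleftrightarrow> (d, c) \<in> \<kappa> - Id"
  by (auto simp: underS_def)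

lemma wf_lt: "wf (\<kappa> - Id)"
  using wo by (simp add: well_order_on_def)

lemma lt_trans: "x \<in> underS \<kappa> y \<Longrightarrow> y \<in> underS \<kappa> z \<Longrightarrow> x \<in> underS \<kappa> z"
  using wo unfolding underS_def well_order_on_def linear_order_on_def partial_order_on_def
    preorder_on_def antisym_def trans_def by blast

lemma lt_Field: "x \<in> underS \<kappa> y \<Longrightarrow> x \<in> Field \<kappa>" "x \<in> underS \<kappa> y \<Longrightarrow> y \<in> Field \<kappa>"
  by (auto simp: underS_def Field_def)

lemma lt_irrefl [simp]: "x \<notin> underS \<kappa> x"
  by (simp add: underS_def)

lemma lt_induct [consumes 0, case_names less]:
  assumes "\<And>d. (\<And>e. e \<in> underS \<kappa> d \<Longrightarrow> P e) \<Longrightarrow> P d"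
  shows "P d"
  using wf_lt by (induction d rule: wf_induct_rule) (rule assms, simp add: lt_iff)

lemma Field_Restr: "D \<subseteq> Field \<kappa> \<Longrightarrow> Field (Restr \<kappa> D) = D"
  using wo Refl_Field_Restr2
  unfolding well_order_on_def linear_order_on_def partial_order_on_def preorder_on_def by blast

text \<open>Only arrows between different stages are listed, since the identities of the poset
  impose no condition on a cocone.\<close>

definition chain_cocone where
  "chain_cocone X l n D V v \<longleftrightarrow>
     v None \<in> hom G X V \<and>
     (\<forall>d \<in> D. v (Some d) \<in> hom G (Cod G (n d)) V \<and>
        v (Some d) \<cdot> n d \<cdot> l d None = v None \<and>
        (\<forall>d' \<in> underS \<kappa> d. v (Some d) \<cdot> n d \<cdot> l d (Some d') = v (Some d')))"

definition chain_colimit where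
  "chain_colimit X l n D x lc \<longleftrightarrow>
     chain_cocone X l n D x lc \<and>
     (\<forall>V v. chain_cocone X l n D V v \<longrightarrow>
        (\<exists>!z. z \<in> hom G x V \<and> (\<forall>k \<in> insert None (Some ` D). z \<cdot> lc k = v k)))"

lemma chain_cocone_cong:
  assumes "\<And>d. d \<in> D \<Longrightarrow> l d = l' d \<and> n d = n' d"
  shows "chain_cocone X l n D = chain_cocone X l' n' D"
  using assms by (simp add: chain_cocone_def fun_eq_iff)

lemma chain_colimit_cong:
  assumes "\<And>d. d \<in> D \<Longrightarrow> l d = l' d \<and> n d = n' d"
  shows "chain_colimit X l n D = chain_colimit X l' n' D"
  using chain_cocone_cong[OF assms] by (simp add: chain_colimit_def fun_eq_iff)

definition chain_on where
  "chain_on X l n D \<longleftrightarrow>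
     X \<in> Obj G \<and> D \<subseteq> Field \<kappa> \<and> (\<forall>d \<in> D. underS \<kappa> d \<subseteq> D) \<and>
     (\<forall>d \<in> D. n d \<in> Arr G \<and> chain_cocone X l n (underS \<kappa> d) (Dom G (n d)) (l d))"

lemma chain_onD:
  assumes "chain_on X l n D" "d \<in> D"
  shows "n d \<in> Arr G" "l d None \<in> Arr G" "Dom G (l d None) = X" "Cod G (l d None) = Dom G (n d)"
    "d' \<in> underS \<kappa> d \<Longrightarrow> l d (Some d') \<in> Arr G"
    "d' \<in> underS \<kappa> d \<Longrightarrow> Dom G (l d (Some d')) = Cod G (n d')"
    "d' \<in> underS \<kappa> d \<Longrightarrow> Cod G (l d (Some d')) = Dom G (n d)"
    "d' \<in> underS \<kappa> d \<Longrightarrow> l d (Some d') \<cdot> n d' \<cdot> l d' None = l d None"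
    "d' \<in> underS \<kappa> d \<Longrightarrow> d'' \<in> underS \<kappa> d' \<Longrightarrow> l d (Some d') \<cdot> n d' \<cdot> l d' (Some d'') = l d (Some d'')"
  using assms by (auto simp: chain_on_def chain_cocone_def)

text \<open>Bridge from coded chains to functors on \<open>1 + D\<close>, which are what backdrops
  and Van Kampen colimits speak about.\<close>

lemma is_cocone_chain_iff:
  assumes ch: "chain_on X l n D"
  shows "is_cocone (poset_cat (one_plus (Restr \<kappa> D))) G (chain_diagram G X l n) V v
    \<longleftrightarrow> chain_cocone X l n D V v"
proof -
  note [simp] = chain_onD[OF ch]
  have [simp]: "X \<in> Obj G" "D \<subseteq> Field \<kappa>" using ch by (auto simp: chain_on_def)
  have F: "Field (Restr \<kappa> D) = D" by (simp add: Field_Restr)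
  have dc: "d' \<in> D" if "d \<in> D" "d' \<in> underS \<kappa> d" for d d'
    using ch that by (auto simp: chain_on_def)
  show ?thesis
  proof
    assume L: "is_cocone (poset_cat (one_plus (Restr \<kappa> D))) G (chain_diagram G X l n) V v"
    then have o: "\<And>k. k \<in> insert None (Some ` D) \<Longrightarrow> v k \<in> hom G (Ob (chain_diagram G X l n) k) V"
      and t: "\<And>x y. (x, y) \<in> one_plus (Restr \<kappa> D) \<Longrightarrow> v y \<cdot> Ar (chain_diagram G X l n) (x, y) = v x"
      using F by (force simp: is_cocone_def)+
    show "chain_cocone X l n D V v"
      unfolding chain_cocone_def
    proof (intro conjI ballI)
      show "v None \<in> hom G X V" using o[of None] by simp
      fix d assume d: "d \<in> D"
      show "v (Some d) \<in> hom G (Cod G (n d)) V" using o[of "Some d"] d by simp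
      show "v (Some d) \<cdot> n d \<cdot> l d None = v None" using t[of None "Some d"] d F by simp
      fix d' assume d': "d' \<in> underS \<kappa> d"
      then have "d' \<noteq> d" "d' \<in> D" "(d', d) \<in> \<kappa>" using dc[OF d d'] by (auto simp: underS_def)
      then show "v (Some d) \<cdot> n d \<cdot> l d (Some d') = v (Some d')"
        using t[of "Some d'" "Some d"] d by simp
    qed
  next
    assume R: "chain_cocone X l n D V v"
    then have v: "v None \<in> Arr G" "Dom G (v None) = X" "Cod G (v None) = V"
      "\<And>d. d \<in> D \<Longrightarrow> v (Some d) \<in> Arr G" "\<And>d. d \<in> D \<Longrightarrow> Dom G (v (Some d)) = Cod G (n d)"
      "\<And>d. d \<in> D \<Longrightarrow> Cod G (v (Some d)) = V"
      by (auto simp: chain_cocone_def)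
    have "v y \<cdot> Ar (chain_diagram G X l n) (x, y) = v x" if xy: "(x, y) \<in> one_plus (Restr \<kappa> D)" for x y
    proof (cases y)
      case None
      then show ?thesis using xy v by (cases x) auto
    next
      case (Some d)
      then have d: "d \<in> D" using xy F by (cases x) auto
      show ?thesis
      proof (cases x)
        case None
        then show ?thesis using R Some d by (simp add: chain_cocone_def)
      next
        case (Some d')
        then show ?thesis
          using \<open>y = Some d\<close> xy d R v by (cases "d' = d") (auto simp: chain_cocone_def underS_def)
      qed
    qed
    moreover have "V \<in> Obj G" using v obj_simps(2) by blast
    ultimately show "is_cocone (poset_cat (one_plus (Restr \<kappa> D))) G (chain_diagram G X l n) V v"
      using v F by (auto simp: is_cocone_def)
  qed
qed

lemma is_colimit_chain_iff:
  assumes ch: "chain_on X l n D"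
  shows "is_colimit (poset_cat (one_plus (Restr \<kappa> D))) G (chain_diagram G X l n) x lc
    \<longleftrightarrow> chain_colimit X l n D x lc"
proof -
  have "D \<subseteq> Field \<kappa>" using ch by (simp add: chain_on_def)
  then show ?thesis
    by (simp add: is_colimit_def is_cocone_chain_iff[OF ch] chain_colimit_def Field_Restr)
qed

lemma chain_diagram_functor:
  assumes ch: "chain_on X l n D" and M: "wide_subcategory G M"
    and nM: "\<And>d. d \<in> D \<Longrightarrow> n d \<in> M"
    and lM: "\<And>d k. d \<in> D \<Longrightarrow> k \<in> insert None (Some ` underS \<kappa> d) \<Longrightarrow> l d k \<in> M"
  shows "is_functor (poset_cat (one_plus (Restr \<kappa> D))) (wide G M) (chain_diagram G X l n)"
proof -
  note [simp] = chain_onD[OF ch]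
  have X [simp]: "X \<in> Obj G" "D \<subseteq> Field \<kappa>" using ch by (auto simp: chain_on_def)
  have F: "Field (Restr \<kappa> D) = D" by (simp add: Field_Restr)
  let ?b = "chain_diagram G X l n"
  have Mi: "Idt G x \<in> M" if "x \<in> Obj G" for x using M that by (simp add: wide_subcategory_def)
  have Mc: "g \<cdot> f \<in> M" if "f \<in> M" "g \<in> M" "Cod G f = Dom G g" for f g
    using M that by (simp add: wide_subcategory_def)
  have cases: "(x = y \<and> (y = None \<or> (\<exists>d \<in> D. y = Some d))) \<or>
      (\<exists>d \<in> D. y = Some d \<and> x \<in> insert None (Some ` underS \<kappa> d) \<and> x \<noteq> y)"
    if "(x, y) \<in> one_plus (Restr \<kappa> D)" for x y
    using that F by (cases x; cases y) (auto simp: underS_def)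
  have Ar_lt: "Ar ?b (x, Some d) = n d \<cdot> l d x" if "d \<in> D" "x \<in> insert None (Some ` underS \<kappa> d)" for x d
    using that by auto
  have Ar_id: "Ar ?b (x, x) = Idt G (Ob ?b x)" for x by (cases x) auto
  have ObD: "Ob ?b x \<in> Obj G" if "x = None \<or> (\<exists>d \<in> D. x = Some d)" for x
    using that by auto
  have dc: "d' \<in> D" if "d \<in> D" "d' \<in> underS \<kappa> d" for d d'
    using ch that by (auto simp: chain_on_def)
  have lh: "l d x \<in> Arr G" "Dom G (l d x) = Ob ?b x" "Cod G (l d x) = Dom G (n d)"
    if "d \<in> D" "x \<in> insert None (Some ` underS \<kappa> d)" for d x
    using that by auto
  have arr: "Ar ?b (x, y) \<in> M \<and> Dom G (Ar ?b (x, y)) = Ob ?b x \<and> Cod G (Ar ?b (x, y)) = Ob ?b y"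
    if xy: "(x, y) \<in> one_plus (Restr \<kappa> D)" for x y
    using cases[OF xy]
  proof
    assume "x = y \<and> (y = None \<or> (\<exists>d \<in> D. y = Some d))"
    then show ?thesis using ObD[of x] Mi by (auto simp: Ar_id)
  next
    assume "\<exists>d \<in> D. y = Some d \<and> x \<in> insert None (Some ` underS \<kappa> d) \<and> x \<noteq> y"
    then obtain d where d: "d \<in> D" "y = Some d" "x \<in> insert None (Some ` underS \<kappa> d)" by blast
    have "n d \<cdot> l d x \<in> M" by (rule Mc) (use d nM lM lh in auto)
    then show ?thesis using d lh[OF d(1,3)] by (simp add: Ar_lt[OF d(1,3)] d(2))
  qed
  have cmp: "Ar ?b (x, z) = Ar ?b (y, z) \<cdot> Ar ?b (x, y)"
    if xy: "(x, y) \<in> one_plus (Restr \<kappa> D)" and yz: "(y, z) \<in> one_plus (Restr \<kappa> D)" for x y z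
  proof -
    have MA: "M \<subseteq> Arr G" using M by (simp add: wide_subcategory_def)
    consider "x = y" | "y = z" | d e where "d \<in> D" "e \<in> D" "y = Some d" "z = Some e"
      "x \<in> insert None (Some ` underS \<kappa> d)" "d \<in> underS \<kappa> e"
      using cases[OF xy] cases[OF yz] by auto
    then show ?thesis
    proof cases
      case 1
      with arr[OF yz] MA show ?thesis by (auto simp: Ar_id)
    next
      case 2
      with arr[OF xy] MA show ?thesis by (auto simp: Ar_id)
    next
      case 3
      have x: "x \<in> insert None (Some ` underS \<kappa> e)" using 3 lt_trans by auto
      \<comment> \<open>Functoriality is exactly the cocone law of \<open>l e\<close> at the
        intermediate stage \<open>d\<close>.\<close>
      have "l e (Some d) \<cdot> n d \<cdot> l d x = l e x" using 3 by auto
      moreover have "(n e \<cdot> l e (Some d)) \<cdot> n d \<cdot> l d x = n e \<cdot> l e (Some d) \<cdot> n d \<cdot> l d x"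
        using 3 lh[OF 3(1,5)] by simp
      ultimately show ?thesis unfolding 3(3,4) Ar_lt[OF 3(2) x] Ar_lt[OF 3(1,5)]
        using 3(1,2,6) Ar_lt[of e "Some d"] by simp
    qed
  qed
  show ?thesis
    unfolding is_functor_def
    using arr cmp ObD by (auto simp: F Ar_id)
qed

lemma chain_colimitD:
  assumes "chain_colimit X l n D x lc"
  shows "lc None \<in> Arr G" "Dom G (lc None) = X" "Cod G (lc None) = x"
    "d \<in> D \<Longrightarrow> lc (Some d) \<in> Arr G" "d \<in> D \<Longrightarrow> Dom G (lc (Some d)) = Cod G (n d)"
    "d \<in> D \<Longrightarrow> Cod G (lc (Some d)) = x"
    "d \<in> D \<Longrightarrow> lc (Some d) \<cdot> n d \<cdot> l d None = lc None"
    "d \<in> D \<Longrightarrow> d' \<in> underS \<kappa> d \<Longrightarrow> lc (Some d) \<cdot> n d \<cdot> l d (Some d') = lc (Some d')"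
  using assms by (auto simp: chain_colimit_def chain_cocone_def)

lemma chain_colimit_ex:
  assumes "chain_colimit X l n D x lc" "v \<in> hom G X V"
    and "\<And>d. d \<in> D \<Longrightarrow> u d \<in> hom G (Cod G (n d)) V"
    and "\<And>d. d \<in> D \<Longrightarrow> u d \<cdot> n d \<cdot> l d None = v"
    and "\<And>d d'. d \<in> D \<Longrightarrow> d' \<in> underS \<kappa> d \<Longrightarrow> u d \<cdot> n d \<cdot> l d (Some d') = u d'"
  obtains z where "z \<in> hom G x V" "z \<cdot> lc None = v" "\<And>d. d \<in> D \<Longrightarrow> z \<cdot> lc (Some d) = u d"
proof -
  have "chain_cocone X l n D V (\<lambda>k. case k of None \<Rightarrow> v | Some d \<Rightarrow> u d)"
    using assms by (simp add: chain_cocone_def)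
  then obtain z where "z \<in> hom G x V"
    "\<forall>k \<in> insert None (Some ` D). z \<cdot> lc k = (case k of None \<Rightarrow> v | Some d \<Rightarrow> u d)"
    using assms(1) unfolding chain_colimit_def by blast
  then show ?thesis using that by auto
qed

lemma chain_colimit_eqI:
  assumes ch: "chain_on X l n D" and col: "chain_colimit X l n D x lc"
    and z: "z \<in> hom G x V" "z' \<in> hom G x V" and "z \<cdot> lc None = z' \<cdot> lc None"
    and "\<And>d. d \<in> D \<Longrightarrow> z \<cdot> lc (Some d) = z' \<cdot> lc (Some d)"
  shows "z = z'"
proof -
  note [simp] = chain_onD[OF ch] chain_colimitD[OF col]
  have "z \<cdot> lc (Some d) \<in> hom G (Cod G (n d)) V \<and>
        (z \<cdot> lc (Some d)) \<cdot> n d \<cdot> l d None = z \<cdot> lc None \<and>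
        (\<forall>d' \<in> underS \<kappa> d. (z \<cdot> lc (Some d)) \<cdot> n d \<cdot> l d (Some d') = z \<cdot> lc (Some d'))"
    if "d \<in> D" for d
    using z that by simp
  then have "chain_cocone X l n D V (\<lambda>k. z \<cdot> lc k)"
    unfolding chain_cocone_def using z by simp
  then have "\<exists>!y. y \<in> hom G x V \<and> (\<forall>k \<in> insert None (Some ` D). y \<cdot> lc k = z \<cdot> lc k)"
    using col unfolding chain_colimit_def by blast
  then show ?thesis using assms by (metis imageE insertE)
qed

end

section \<open>The gap of a chain\<close>

context category
begin

text \<open>Of a Van Kampen colimit cocone we only keep that it is a colimit and that its legs detect cartesian
  morphisms.\<close>

definition detects where
  "detects S l K x \<longleftrightarrow> (\<forall>z \<in> Arr C. Dom C z = x \<and> (\<forall>k \<in> K. z \<cdot> l k \<in> S) \<longrightarrow> z \<in> S)"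

lemma detectsD:
  "detects S l K x \<Longrightarrow> z \<in> Arr C \<Longrightarrow> Dom C z = x \<Longrightarrow> (\<And>k. k \<in> K \<Longrightarrow> z \<cdot> l k \<in> S) \<Longrightarrow> z \<in> S"
  by (simp add: detects_def)

lemma cocone_cmp:
  assumes "is_cocone K C b c \<iota>" "z \<in> hom C c d"
    and "\<And>t. t \<in> Arr K \<Longrightarrow> Dom K t \<in> Obj K \<and> Cod K t \<in> Obj K \<and>
      Ar b t \<in> hom C (Ob b (Dom K t)) (Ob b (Cod K t))"
  shows "is_cocone K C b d (\<lambda>k. z \<cdot> \<iota> k)"
  using assms by (auto simp: is_cocone_def)

lemma colimit_eqI:
  assumes col: "is_colimit K C b c \<iota>" and z: "z \<in> hom C c d" "z' \<in> hom C c d"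
    and b: "\<And>t. t \<in> Arr K \<Longrightarrow> Dom K t \<in> Obj K \<and> Cod K t \<in> Obj K \<and>
      Ar b t \<in> hom C (Ob b (Dom K t)) (Ob b (Cod K t))"
    and eq: "\<And>k. k \<in> Obj K \<Longrightarrow> z \<cdot> \<iota> k = z' \<cdot> \<iota> k"
  shows "z = z'"
proof -
  have "is_cocone K C b d (\<lambda>k. z \<cdot> \<iota> k)"
    by (rule cocone_cmp[OF _ z(1) b]) (use col in \<open>simp_all add: is_colimit_def\<close>)
  then have "\<exists>!y. y \<in> hom C c d \<and> (\<forall>k \<in> Obj K. y \<cdot> \<iota> k = z \<cdot> \<iota> k)"
    using col by (simp add: is_colimit_def)
  with z eq show ?thesis by metis
qed

lemma pushoutI_colimit:
  assumes col: "is_colimit span_cat C (span_diagram C m f) c \<iota>"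
    and mf: "m \<in> Arr C" "f \<in> Arr C" "Dom C m = Dom C f"
  shows "pushout m f (\<iota> Lft) (\<iota> Rgt)" "Cod C (\<iota> Lft) = c"
proof -
  have co: "\<iota> Lft \<in> hom C (Cod C m) c" "\<iota> Lft \<cdot> m = \<iota> Apex"
    using col by (simp_all add: is_colimit_def span_cocone_iff[OF mf])
  then show c: "Cod C (\<iota> Lft) = c" by simp
  have "pushout_cocone C m (\<iota> Lft) (\<iota> Rgt) k = \<iota> k" for k
    using co by (cases k) (simp_all add: pushout_cocone_def)
  then have "pushout_cocone C m (\<iota> Lft) (\<iota> Rgt) = \<iota>" by blast
  then show "pushout m f (\<iota> Lft) (\<iota> Rgt)"
    using col mf c by (simp add: is_pushout_iff[symmetric] is_pushout_def)
qed

end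

text \<open>In the application, \<open>N\<close> consists of the cartesian morphisms and \<open>M\<close> of those cartesian morphisms
  over \<open>id\<^sub>B\<close> whose image in \<open>E\<close> is in the backdrop; \<open>a X : A X \<rightarrow> C X\<close> is the cell over the density
  comonad and \<open>e X : A X \<rightarrow> X\<close> the map along which it is attached.\<close>

locale cell_system = chains G \<kappa>
  for G :: "('o, 'g) cat" (structure) and \<kappa> :: "'k rel" +
  fixes N M :: "'g set" and A C :: "('o, 'g, 'o, 'g) funct" and a e :: "'o \<Rightarrow> 'g"
  assumes N: "wide_subcategory G N" and M: "wide_subcategory G M" and MN: "M \<subseteq> N"
    and A: "is_functor G G A" and C: "is_functor G G C"
    and A_N: "f \<in> N \<Longrightarrow> Ar A f \<in> N" and C_N: "f \<in> N \<Longrightarrow> Ar C f \<in> N"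
    and a_M: "x \<in> Obj G \<Longrightarrow> a x \<in> M" and a_nat: "nat_trans G G A C a"
    and e_N: "x \<in> Obj G \<Longrightarrow> e x \<in> N" and e_nat: "nat_trans G G A id_functor e"
    and chain_ex: "\<And>c b. c \<in> Field \<kappa> \<Longrightarrow>
      is_functor (poset_cat (one_plus (seg \<kappa> c))) (wide G M) b \<Longrightarrow>
      \<exists>x \<iota>. is_colimit (poset_cat (one_plus (seg \<kappa> c))) G b x \<iota> \<and>
        (\<forall>k \<in> Field (one_plus (seg \<kappa> c)). \<iota> k \<in> M) \<and>
        detects N \<iota> (Field (one_plus (seg \<kappa> c))) x \<and>
        detects M \<iota> (Field (one_plus (seg \<kappa> c))) x"
    and cobase_ex: "\<And>m f. m \<in> M \<Longrightarrow> f \<in> N \<Longrightarrow> Dom G f = Dom G m \<Longrightarrow>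
      \<exists>p q. pushout m f p q \<and> p \<in> N \<and> q \<in> M \<and>
        (\<forall>z \<in> Arr G. Dom G z = Cod G p \<and> z \<cdot> p \<in> N \<and> z \<cdot> q \<in> N \<longrightarrow> z \<in> N)"
    and gap_M: "\<And>y p q w. y \<in> M \<Longrightarrow> pushout (a (Dom G y)) (Ar A y) p q \<Longrightarrow> q \<in> M \<Longrightarrow> w \<in> N \<Longrightarrow>
      Dom G w = Cod G p \<Longrightarrow> w \<cdot> p = Ar C y \<Longrightarrow> w \<cdot> q = a (Cod G y) \<Longrightarrow> w \<in> M"
begin

lemma N_Arr: "f \<in> N \<Longrightarrow> f \<in> Arr G" and M_Arr: "f \<in> M \<Longrightarrow> f \<in> Arr G" and M_N: "f \<in> M \<Longrightarrow> f \<in> N"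
  using N M MN by (auto simp: wide_subcategory_def)

lemma N_cmp: "f \<in> N \<Longrightarrow> g \<in> N \<Longrightarrow> Cod G f = Dom G g \<Longrightarrow> g \<cdot> f \<in> N"
  using N by (simp add: wide_subcategory_def)

lemma M_cmp: "f \<in> M \<Longrightarrow> g \<in> M \<Longrightarrow> Cod G f = Dom G g \<Longrightarrow> g \<cdot> f \<in> M"
  using M by (simp add: wide_subcategory_def)

lemmas A_simps [simp] = functorD(1-4)[OF A]
lemmas C_simps [simp] = functorD(1-4)[OF C]
lemmas A_cmp = functorD(6)[OF A]
lemmas C_cmp = functorD(6)[OF C]

lemma a_simps [simp]:
  assumes "x \<in> Obj G"
  shows "a x \<in> Arr G" "Dom G (a x) = Ob A x" "Cod G (a x) = Ob C x"
  using a_nat assms by (auto simp: nat_trans_def)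

lemma e_simps [simp]:
  assumes "x \<in> Obj G"
  shows "e x \<in> Arr G" "Dom G (e x) = Ob A x" "Cod G (e x) = x"
  using e_nat assms by (auto simp: nat_trans_def id_functor_def)

lemma a_natural: "f \<in> Arr G \<Longrightarrow> Ar C f \<cdot> a (Dom G f) = a (Cod G f) \<cdot> Ar A f"
  using a_nat by (simp add: nat_trans_def)

lemma e_natural: "f \<in> Arr G \<Longrightarrow> e (Cod G f) \<cdot> Ar A f = f \<cdot> e (Dom G f)"
  using e_nat by (simp add: nat_trans_def id_functor_def)

text \<open>The assumption \<open>chain_ex\<close> for coded chains. The conclusions on the legs are
  what the recursions hand on from stage to stage: legs in \<open>M\<close> keep the chain in
  \<open>M\<close>, and detection is how induced maps are shown to lie in \<open>N\<close> or
  \<open>M\<close>.\<close>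

lemma chain_colimit_exists:
  assumes ch: "chain_on X l n D" and D: "D = underS \<kappa> c" "c \<in> Field \<kappa>"
    and nM: "\<And>d. d \<in> D \<Longrightarrow> n d \<in> M"
    and lM: "\<And>d k. d \<in> D \<Longrightarrow> k \<in> insert None (Some ` underS \<kappa> d) \<Longrightarrow> l d k \<in> M"
  obtains x lc where "chain_colimit X l n D x lc" "\<And>k. k \<in> insert None (Some ` D) \<Longrightarrow> lc k \<in> M"
    "detects N lc (insert None (Some ` D)) x" "detects M lc (insert None (Some ` D)) x"
proof -
  have "D \<subseteq> Field \<kappa>" using ch by (simp add: chain_on_def)
  then have F: "Field (one_plus (seg \<kappa> c)) = insert None (Some ` D)"
    unfolding D(1) by (simp add: Field_Restr)
  obtain x lc where "is_colimit (poset_cat (one_plus (seg \<kappa> c))) G (chain_diagram G X l n) x lc"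
    "\<forall>k \<in> insert None (Some ` D). lc k \<in> M"
    "detects N lc (insert None (Some ` D)) x" "detects M lc (insert None (Some ` D)) x"
    using chain_ex[OF D(2) chain_diagram_functor[OF ch M nM lM, unfolded D(1)]]
    unfolding F D(1) by blast
  then show ?thesis
    using is_colimit_chain_iff[OF ch] that unfolding D(1) by blast
qed

end

text \<open>The objects from which cells are attached: \<open>Y d\<close> stands for the colimit
  reached before stage \<open>d\<close>, up to and including the stage under consideration. They are
  separated from the attaching itself because the gap maps depend on this chain only.\<close>

locale M_chain = cell_system +
  fixes T :: "'c set" and Y :: "'c \<Rightarrow> 'a" and y :: "'c \<Rightarrow> 'c \<Rightarrow> 'b"
  assumes T: "T \<subseteq> Field \<kappa>" and T_down: "d \<in> T \<Longrightarrow> d' \<in> underS \<kappa> d \<Longrightarrow> d' \<in> T"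
    and Y [simp]: "d \<in> T \<Longrightarrow> Y d \<in> Obj G"
    and y_M: "d \<in> T \<Longrightarrow> d' \<in> underS \<kappa> d \<Longrightarrow> y d' d \<in> M"
    and y_dom [simp]: "d \<in> T \<Longrightarrow> d' \<in> underS \<kappa> d \<Longrightarrow> Dom G (y d' d) = Y d'"
    and y_cod [simp]: "d \<in> T \<Longrightarrow> d' \<in> underS \<kappa> d \<Longrightarrow> Cod G (y d' d) = Y d"
    and y_cmp: "d \<in> T \<Longrightarrow> d' \<in> underS \<kappa> d \<Longrightarrow> d'' \<in> underS \<kappa> d' \<Longrightarrow> y d' d \<cdot> y d'' d' = y d'' d"
begin

lemma y_arr [simp]: "d \<in> T \<Longrightarrow> d' \<in> underS \<kappa> d \<Longrightarrow> y d' d \<in> Arr G"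
  using y_M M_Arr by blast

lemma A_y: "d \<in> T \<Longrightarrow> d' \<in> underS \<kappa> d \<Longrightarrow> d'' \<in> underS \<kappa> d' \<Longrightarrow>
    Ar A (y d' d) \<cdot> Ar A (y d'' d') = Ar A (y d'' d)"
  and C_y: "d \<in> T \<Longrightarrow> d' \<in> underS \<kappa> d \<Longrightarrow> d'' \<in> underS \<kappa> d' \<Longrightarrow>
    Ar C (y d' d) \<cdot> Ar C (y d'' d') = Ar C (y d'' d)"
  using A_cmp[of "y d'' d'" "y d' d"] C_cmp[of "y d'' d'" "y d' d"] y_cmp T_down by auto

lemma a_y: "d \<in> T \<Longrightarrow> d' \<in> underS \<kappa> d \<Longrightarrow> Ar C (y d' d) \<cdot> a (Y d') = a (Y d) \<cdot> Ar A (y d' d)"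
  using a_natural[of "y d' d"] by simp

text \<open>A cocone with vertex \<open>V\<close> on the diagram made of \<open>A (Y c)\<close> and
  of all \<open>A (Y d)\<close> and \<open>C (Y d)\<close> with \<open>d < c\<close>; the leg at
  \<open>A (Y d)\<close> is a composite through \<open>A (Y c)\<close> and is therefore not
  recorded. The colimit of this diagram is the source of the gap map.\<close>

definition attach_cocone where
  "attach_cocone c V v w \<longleftrightarrow>
     v \<in> hom G (Ob A (Y c)) V \<and>
     (\<forall>d \<in> underS \<kappa> c. w d \<in> hom G (Ob C (Y d)) V \<and> w d \<cdot> a (Y d) = v \<cdot> Ar A (y d c) \<and>
        (\<forall>d' \<in> underS \<kappa> d. w d \<cdot> Ar C (y d' d) = w d'))"

text \<open>The cells \<open>C (Y d)\<close>, \<open>d < c\<close>, are already attached before stage \<open>c\<close>; the source of \<open>g\<close> glues them to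
  \<open>A (Y c)\<close>, and only \<open>g\<close> remains to be attached.  For one \<open>d\<close> this is the pushout gap map of the
  compatibility condition.\<close>

definition is_gap where
  "is_gap c j J g \<longleftrightarrow>
     attach_cocone c (Dom G g) j J \<and> j \<in> N \<and> (\<forall>d \<in> underS \<kappa> c. J d \<in> N) \<and>
     g \<in> M \<and> Cod G g = Ob C (Y c) \<and> g \<cdot> j = a (Y c) \<and>
     (\<forall>d \<in> underS \<kappa> c. g \<cdot> J d = Ar C (y d c)) \<and>
     (\<forall>V v w. attach_cocone c V v w \<longrightarrow>
        (\<exists>!z. z \<in> hom G (Dom G g) V \<and> z \<cdot> j = v \<and> (\<forall>d \<in> underS \<kappa> c. z \<cdot> J d = w d))) \<and>
     (\<forall>z \<in> Arr G. Dom G z = Dom G g \<and> z \<cdot> j \<in> N \<and> (\<forall>d \<in> underS \<kappa> c. z \<cdot> J d \<in> N) \<longrightarrow> z \<in> N)"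

lemma is_gapD:
  assumes "is_gap c j J g"
  shows "j \<in> Arr G" "Dom G j = Ob A (Y c)" "Cod G j = Dom G g" "j \<in> N" "g \<in> M" "g \<in> Arr G"
    "Cod G g = Ob C (Y c)" "g \<cdot> j = a (Y c)"
    "d \<in> underS \<kappa> c \<Longrightarrow> J d \<in> N" "d \<in> underS \<kappa> c \<Longrightarrow> J d \<in> Arr G"
    "d \<in> underS \<kappa> c \<Longrightarrow> Dom G (J d) = Ob C (Y d)"
    "d \<in> underS \<kappa> c \<Longrightarrow> Cod G (J d) = Dom G g"
    "d \<in> underS \<kappa> c \<Longrightarrow> g \<cdot> J d = Ar C (y d c)"
    "d \<in> underS \<kappa> c \<Longrightarrow> J d \<cdot> a (Y d) = j \<cdot> Ar A (y d c)"
    "d \<in> underS \<kappa> c \<Longrightarrow> d' \<in> underS \<kappa> d \<Longrightarrow> J d \<cdot> Ar C (y d' d) = J d'"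
    "z \<in> Arr G \<Longrightarrow> Dom G z = Dom G g \<Longrightarrow> z \<cdot> j \<in> N \<Longrightarrow> (\<And>d. d \<in> underS \<kappa> c \<Longrightarrow> z \<cdot> J d \<in> N) \<Longrightarrow> z \<in> N"
  using assms M_Arr[of g] by (auto simp: is_gap_def attach_cocone_def)

lemma gap_ex:
  assumes "is_gap c j J g" "v \<in> hom G (Ob A (Y c)) V"
    "\<And>d. d \<in> underS \<kappa> c \<Longrightarrow> w d \<in> hom G (Ob C (Y d)) V"
    "\<And>d. d \<in> underS \<kappa> c \<Longrightarrow> w d \<cdot> a (Y d) = v \<cdot> Ar A (y d c)"
    "\<And>d d'. d \<in> underS \<kappa> c \<Longrightarrow> d' \<in> underS \<kappa> d \<Longrightarrow> w d \<cdot> Ar C (y d' d) = w d'"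
  obtains z where "z \<in> hom G (Dom G g) V" "z \<cdot> j = v" "\<And>d. d \<in> underS \<kappa> c \<Longrightarrow> z \<cdot> J d = w d"
proof -
  have "attach_cocone c V v w" using assms by (simp add: attach_cocone_def)
  then show ?thesis using assms(1) that unfolding is_gap_def by blast
qed

lemma gap_eqI:
  assumes c: "c \<in> T" and gap: "is_gap c j J g"
    and z: "z \<in> hom G (Dom G g) V" "z' \<in> hom G (Dom G g) V"
    and "z \<cdot> j = z' \<cdot> j" "\<And>d. d \<in> underS \<kappa> c \<Longrightarrow> z \<cdot> J d = z' \<cdot> J d"
  shows "z = z'"
proof -
  note [simp] = is_gapD[OF gap]
  have "z \<cdot> J d \<in> hom G (Ob C (Y d)) V \<and> (z \<cdot> J d) \<cdot> a (Y d) = (z \<cdot> j) \<cdot> Ar A (y d c) \<and>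
      (\<forall>d' \<in> underS \<kappa> d. (z \<cdot> J d) \<cdot> Ar C (y d' d) = z \<cdot> J d')" if "d \<in> underS \<kappa> c" for d
    using z that c T_down[OF c that] by simp
  moreover have "z \<cdot> j \<in> hom G (Ob A (Y c)) V" using z by simp
  ultimately have "attach_cocone c V (z \<cdot> j) (\<lambda>d. z \<cdot> J d)"
    unfolding attach_cocone_def by blast
  then have "\<exists>!x. x \<in> hom G (Dom G g) V \<and> x \<cdot> j = z \<cdot> j \<and> (\<forall>d \<in> underS \<kappa> c. x \<cdot> J d = z \<cdot> J d)"
    using gap unfolding is_gap_def by blast
  then show ?thesis using assms by metis
qed

text \<open>The source of the gap map is the colimit of a chain of pushouts of \<open>a (Y d)\<close> along \<open>A (Y d \<rightarrow> Y c)\<close>.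
  Since \<open>M\<close> need not be closed under isomorphisms, that chain has to be chosen recursively, with each
  transition \<open>q\<close> in \<open>M\<close>.\<close>

definition cell where
  "cell c l n w d lc q p \<longleftrightarrow>
     chain_colimit (Ob A (Y c)) l n (underS \<kappa> d) (Dom G q) lc \<and>
     (\<forall>k \<in> insert None (Some ` underS \<kappa> d). lc k \<in> M) \<and> q \<in> M \<and>
     p \<in> N \<and> p \<in> hom G (Ob C (Y d)) (Cod G q) \<and>
     p \<cdot> a (Y d) = q \<cdot> lc None \<cdot> Ar A (y d c) \<and>
     (\<forall>d' \<in> underS \<kappa> d. p \<cdot> Ar C (y d' d) = q \<cdot> lc (Some d') \<cdot> w d') \<and>
     (\<forall>V v u. v \<in> hom G (Ob A (Y c)) V \<and> u \<in> hom G (Ob C (Y d)) V \<and> u \<cdot> a (Y d) = v \<cdot> Ar A (y d c) \<longrightarrow>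
        (\<exists>!z. z \<in> hom G (Cod G q) V \<and> z \<cdot> q \<cdot> lc None = v \<and> z \<cdot> p = u)) \<and>
     (\<forall>z \<in> Arr G. Dom G z = Cod G q \<and> z \<cdot> q \<cdot> lc None \<in> N \<and> z \<cdot> p \<in> N \<longrightarrow> z \<in> N)"

lemma cell_cong:
  assumes "\<And>d'. d' \<in> underS \<kappa> d \<Longrightarrow> l d' = l' d' \<and> n d' = n' d' \<and> w d' = w' d'"
  shows "cell c l n w d = cell c l' n' w' d"
proof -
  have "chain_colimit (Ob A (Y c)) l n (underS \<kappa> d) = chain_colimit (Ob A (Y c)) l' n' (underS \<kappa> d)"
    by (rule chain_colimit_cong) (use assms in auto)
  then show ?thesis using assms by (simp add: cell_def fun_eq_iff)
qed

lemma cellD: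
  assumes "cell c l n w d lc q p"
  shows "chain_colimit (Ob A (Y c)) l n (underS \<kappa> d) (Dom G q) lc"
    "k \<in> insert None (Some ` underS \<kappa> d) \<Longrightarrow> lc k \<in> M"
    "q \<in> M" "q \<in> Arr G" "p \<in> N" "p \<in> Arr G" "Dom G p = Ob C (Y d)" "Cod G p = Cod G q"
    "p \<cdot> a (Y d) = q \<cdot> lc None \<cdot> Ar A (y d c)"
    "d' \<in> underS \<kappa> d \<Longrightarrow> p \<cdot> Ar C (y d' d) = q \<cdot> lc (Some d') \<cdot> w d'"
    "z \<in> Arr G \<Longrightarrow> Dom G z = Cod G q \<Longrightarrow> z \<cdot> q \<cdot> lc None \<in> N \<Longrightarrow> z \<cdot> p \<in> N \<Longrightarrow> z \<in> N"
  using assms M_Arr[of q] by (simp_all add: cell_def) auto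

lemma cell_ex:
  assumes "cell c l n w d lc q p" "v \<in> hom G (Ob A (Y c)) V" "u \<in> hom G (Ob C (Y d)) V"
    "u \<cdot> a (Y d) = v \<cdot> Ar A (y d c)"
  obtains z where "z \<in> hom G (Cod G q) V" "z \<cdot> q \<cdot> lc None = v" "z \<cdot> p = u"
proof -
  have "\<exists>!z. z \<in> hom G (Cod G q) V \<and> z \<cdot> q \<cdot> lc None = v \<and> z \<cdot> p = u"
    using assms unfolding cell_def by blast
  then show ?thesis using that by blast
qed

text \<open>In use, \<open>D\<close> is \<open>underS \<kappa> d\<close> while the cell at
  \<open>d\<close> is being built, and \<open>underS \<kappa> c\<close> once all cells are there and
  the gap map at \<open>c\<close> is formed.\<close>

context
  fixes c l n w D
  assumes c: "c \<in> T" and D: "D \<subseteq> underS \<kappa> c" and D_down: "\<And>d. d \<in> D \<Longrightarrow> underS \<kappa> d \<subseteq> D"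
    and cell: "\<And>d. d \<in> D \<Longrightarrow> cell c l n w d (l d) (n d) (w d)"
begin

lemma cells_T: "d \<in> D \<Longrightarrow> d \<in> T" and cells_lt: "d \<in> D \<Longrightarrow> d \<in> underS \<kappa> c"
  using c D T_down by blast+

lemma cells_chain_on: "chain_on (Ob A (Y c)) l n D"
  unfolding chain_on_def
proof (intro conjI ballI)
  show "Ob A (Y c) \<in> Obj G" using c by simp
  show "D \<subseteq> Field \<kappa>" using cells_T T by blast
  show "underS \<kappa> d \<subseteq> D" if "d \<in> D" for d using D_down that .
  show "n d \<in> Arr G" if "d \<in> D" for d using cellD(4)[OF cell[OF that]] .
  show "chain_cocone (Ob A (Y c)) l n (underS \<kappa> d) (Dom G (n d)) (l d)" if "d \<in> D" for d
    using cellD(1)[OF cell[OF that]] by (simp add: chain_colimit_def)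
qed

lemma cell_eqI:
  assumes d: "d \<in> D" and z: "z \<in> hom G (Cod G (n d)) V" "z' \<in> hom G (Cod G (n d)) V"
    and eq: "z \<cdot> n d \<cdot> l d None = z' \<cdot> n d \<cdot> l d None" "z \<cdot> w d = z' \<cdot> w d"
  shows "z = z'"
proof -
  note [simp] = cellD[OF cell[OF d]] chain_onD[OF cells_chain_on d] cells_T[OF d]
  have "(z \<cdot> w d) \<cdot> a (Y d) = (z \<cdot> n d \<cdot> l d None) \<cdot> Ar A (y d c)"
    using z c cells_lt[OF d] by simp
  moreover have "z \<cdot> n d \<cdot> l d None \<in> hom G (Ob A (Y c)) V" "z \<cdot> w d \<in> hom G (Ob C (Y d)) V"
    using z by auto
  ultimately have "\<exists>!x. x \<in> hom G (Cod G (n d)) V \<and> x \<cdot> n d \<cdot> l d None = z \<cdot> n d \<cdot> l d None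
      \<and> x \<cdot> w d = z \<cdot> w d"
    using cell[OF d] unfolding cell_def by blast
  then show ?thesis using assms by metis
qed

text \<open>The object at \<open>d'\<close> is a pushout of \<open>A (Y c)\<close> and
  \<open>C (Y d')\<close>, so it is decided on these two pieces whether a map out of stage
  \<open>d\<close> restricts to a given map at \<open>d'\<close>.\<close>

lemma cells_factor:
  assumes d: "d \<in> D" and d': "d' \<in> underS \<kappa> d" and z: "z \<in> hom G (Cod G (n d)) V"
    and z': "z' \<in> hom G (Cod G (n d')) V"
    and eq: "z \<cdot> n d \<cdot> l d None = z' \<cdot> n d' \<cdot> l d' None" "z \<cdot> w d \<cdot> Ar C (y d' d) = z' \<cdot> w d'"
  shows "z \<cdot> n d \<cdot> l d (Some d') = z'"
proof -
  have d'D: "d' \<in> D" using D_down d d' by blast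
  note [simp] = cellD[OF cell[OF d]] chain_onD[OF cells_chain_on d]
    cellD(4-8)[OF cell[OF d'D]] chain_onD[OF cells_chain_on d'D]
    cells_T[OF d] cells_lt[OF d] cells_T[OF d'D] cells_lt[OF d'D]
  show ?thesis
  proof (rule cell_eqI[OF d'D])
    show "z \<cdot> n d \<cdot> l d (Some d') \<in> hom G (Cod G (n d')) V" using z d' by simp
    show "z' \<in> hom G (Cod G (n d')) V" by (rule z')
    show "(z \<cdot> n d \<cdot> l d (Some d')) \<cdot> n d' \<cdot> l d' None = z' \<cdot> n d' \<cdot> l d' None"
      using z z' d' eq(1) by simp
    show "(z \<cdot> n d \<cdot> l d (Some d')) \<cdot> w d' = z' \<cdot> w d'"
      using z z' d' eq(2) by simp
  qed
qed

context
  fixes x lc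
  assumes col: "chain_colimit (Ob A (Y c)) l n D x lc"
begin

text \<open>A map out of one cell is a pair of maps on \<open>A (Y c)\<close> and
  \<open>C (Y d)\<close>, and compatible ones glue to the colimit of the chain. So a colimit over a
  diagram that is not a chain is computed by a chain in \<open>M\<close>, the only kind of colimit
  that the backdrop supplies besides cobase change.\<close>

lemma cells_colim_ex:
  assumes v: "v \<in> hom G (Ob A (Y c)) V"
    and u: "\<And>d. d \<in> D \<Longrightarrow> u d \<in> hom G (Ob C (Y d)) V"
    and ua: "\<And>d. d \<in> D \<Longrightarrow> u d \<cdot> a (Y d) = v \<cdot> Ar A (y d c)"
    and uC: "\<And>d d'. d \<in> D \<Longrightarrow> d' \<in> underS \<kappa> d \<Longrightarrow> u d \<cdot> Ar C (y d' d) = u d'"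
  obtains z where "z \<in> hom G x V" "z \<cdot> lc None = v" "\<And>d. d \<in> D \<Longrightarrow> z \<cdot> lc (Some d) \<cdot> w d = u d"
proof -
  have "\<exists>z. z \<in> hom G (Cod G (n d)) V \<and> z \<cdot> n d \<cdot> l d None = v \<and> z \<cdot> w d = u d" if "d \<in> D" for d
    using cell_ex[OF cell[OF that] v u[OF that] ua[OF that]] by blast
  then obtain h where h: "\<And>d. d \<in> D \<Longrightarrow> h d \<in> hom G (Cod G (n d)) V"
    "\<And>d. d \<in> D \<Longrightarrow> h d \<cdot> n d \<cdot> l d None = v" "\<And>d. d \<in> D \<Longrightarrow> h d \<cdot> w d = u d"
    by metis
  have hC: "h d \<cdot> n d \<cdot> l d (Some d') = h d'" if d: "d \<in> D" and d': "d' \<in> underS \<kappa> d" for d d'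
  proof (rule cells_factor[OF d d' h(1)[OF d]])
    have d'D: "d' \<in> D" using D_down d d' by blast
    show "h d' \<in> hom G (Cod G (n d')) V" by (rule h(1)[OF d'D])
    show "h d \<cdot> n d \<cdot> l d None = h d' \<cdot> n d' \<cdot> l d' None" using h(2) d d'D by simp
    have "h d \<cdot> w d \<cdot> Ar C (y d' d) = u d \<cdot> Ar C (y d' d)"
      by (rule cmp_eq_cmp[OF h(3)[OF d]])
        (use h(1)[OF d] cellD[OF cell[OF d]] cells_T[OF d] d' in auto)
    then show "h d \<cdot> w d \<cdot> Ar C (y d' d) = h d' \<cdot> w d'"
      using uC[OF d d'] h(3)[OF d'D] by simp
  qed
  obtain z where z: "z \<in> hom G x V" "z \<cdot> lc None = v" "\<And>d. d \<in> D \<Longrightarrow> z \<cdot> lc (Some d) = h d"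
    by (rule chain_colimit_ex[OF col v h(1) h(2) hC]) blast+
  have "z \<cdot> lc (Some d) \<cdot> w d = u d" if d: "d \<in> D" for d
  proof -
    have "z \<cdot> lc (Some d) \<cdot> w d = h d \<cdot> w d"
      by (rule cmp_eq_cmp[OF z(3)[OF d]])
        (use z(1) cellD[OF cell[OF d]] chain_colimitD[OF col] d in auto)
    then show ?thesis using h(3)[OF d] by simp
  qed
  with z(1,2) show ?thesis by (rule that)
qed

lemma cells_colim_eqI:
  assumes z: "z \<in> hom G x V" "z' \<in> hom G x V" and eq: "z \<cdot> lc None = z' \<cdot> lc None"
    and eqd: "\<And>d. d \<in> D \<Longrightarrow> z \<cdot> lc (Some d) \<cdot> w d = z' \<cdot> lc (Some d) \<cdot> w d"
  shows "z = z'"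
proof (rule chain_colimit_eqI[OF cells_chain_on col z eq])
  fix d assume d: "d \<in> D"
  note [simp] = cellD[OF cell[OF d]] chain_colimitD[OF col] chain_onD[OF cells_chain_on d]
  show "z \<cdot> lc (Some d) = z' \<cdot> lc (Some d)"
    by (rule cell_eqI[OF d]) (use z eq eqd[OF d] d in simp_all)
qed

text \<open>Detection in two stages: the chain colimit reduces the question to its legs, and each
  cell reduces a leg to its values on \<open>A (Y c)\<close> and \<open>C (Y d)\<close>.\<close>

lemma cells_colim_detect:
  assumes det: "detects N lc (insert None (Some ` D)) x"
    and z: "z \<in> Arr G" "Dom G z = x" "z \<cdot> lc None \<in> N" "\<And>d. d \<in> D \<Longrightarrow> z \<cdot> lc (Some d) \<cdot> w d \<in> N"
  shows "z \<in> N"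
proof -
  have "z \<cdot> lc (Some d) \<in> N" if d: "d \<in> D" for d
  proof -
    note [simp] = cellD(4-8)[OF cell[OF d]] chain_colimitD[OF col] chain_onD[OF cells_chain_on d]
    show ?thesis
      by (rule cellD(11)[OF cell[OF d]]) (use z d in simp_all)
  qed
  with det z show ?thesis by (simp add: detects_def)
qed

end

end

text \<open>The wanted pushout of \<open>a (Y d)\<close> along \<open>A (y d c)\<close> is reached
  through the gap map \<open>g\<close> at \<open>d\<close>. The colimit \<open>x\<close> of the
  earlier cells already receives every \<open>C (Y d')\<close> with \<open>d' < d\<close>, and the
  source of \<open>g\<close> glues just these to \<open>A (Y d)\<close>; pushing \<open>g\<close>
  out along the induced map into \<open>x\<close> adds the rest of \<open>C (Y d)\<close>. As
  \<open>g\<close> is in \<open>M\<close>, the new transition \<open>q\<close> can be taken in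
  \<open>M\<close>.\<close>

lemma cell_exists:
  assumes c: "c \<in> T" and d: "d \<in> underS \<kappa> c" and gap: "is_gap d j J g"
    and cell: "\<And>d'. d' \<in> underS \<kappa> d \<Longrightarrow> cell c l n w d' (l d') (n d') (w d')"
  shows "\<exists>lc q p. cell c l n w d lc q p"
proof -
  let ?D = "underS \<kappa> d"
  have D: "?D \<subseteq> underS \<kappa> c" "\<And>d'. d' \<in> ?D \<Longrightarrow> underS \<kappa> d' \<subseteq> ?D"
    using d lt_trans by blast+
  note H = c D cell
  have dT: "d \<in> T" and dF: "d \<in> Field \<kappa>" using T_down[OF c d] T by auto
  note ch = cells_chain_on[OF H]
  obtain x lc where col: "chain_colimit (Ob A (Y c)) l n ?D x lc"
    and lcM: "\<And>k. k \<in> insert None (Some ` ?D) \<Longrightarrow> lc k \<in> M"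
    and det: "detects N lc (insert None (Some ` ?D)) x"
    by (rule chain_colimit_exists[OF ch refl dF cellD(3)[OF cell] cellD(2)[OF cell]]) blast+
  note [simp] = is_gapD(1-3,6-8,10-15)[OF gap] chain_colimitD[OF col] chain_onD[OF ch]
    cellD(4,6-10)[OF cell] dT d c
  have lt [simp]: "d' \<in> underS \<kappa> c" if "d' \<in> ?D" for d' using that D by blast
  have dT' [simp]: "d' \<in> T" if "d' \<in> ?D" for d' using T_down[OF dT that] .
  \<comment> \<open>On \<open>A (Y d)\<close> the map \<open>t\<close> is \<open>A (y d c)\<close>,
    and on \<open>C (Y d')\<close> it is the coprojection \<open>w d'\<close> of the earlier cell,
    both followed by legs into \<open>x\<close>.\<close>
  have "\<exists>t. t \<in> hom G (Dom G g) x \<and> t \<cdot> j = lc None \<cdot> Ar A (y d c) \<and>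
      (\<forall>d' \<in> ?D. t \<cdot> J d' = lc (Some d') \<cdot> w d')"
  proof (rule gap_ex[OF gap, where v = "lc None \<cdot> Ar A (y d c)" and w = "\<lambda>d'. lc (Some d') \<cdot> w d'"])
    show "lc None \<cdot> Ar A (y d c) \<in> hom G (Ob A (Y d)) x" by simp
    fix d' assume d': "d' \<in> ?D"
    then show "lc (Some d') \<cdot> w d' \<in> hom G (Ob C (Y d')) x" by simp
    have "(lc (Some d') \<cdot> n d' \<cdot> l d' None) \<cdot> Ar A (y d' c) = lc None \<cdot> Ar A (y d c) \<cdot> Ar A (y d' d)"
      using d' by (simp add: A_y)
    then show "(lc (Some d') \<cdot> w d') \<cdot> a (Y d') = (lc None \<cdot> Ar A (y d c)) \<cdot> Ar A (y d' d)"
      using d' by (simp del: chain_colimitD(7,8)[OF col])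
    fix d'' assume d'': "d'' \<in> underS \<kappa> d'"
    then have "d'' \<in> ?D" using D d' by blast
    moreover have "(lc (Some d') \<cdot> n d' \<cdot> l d' (Some d'')) \<cdot> w d'' = lc (Some d'') \<cdot> w d''"
      using d' d'' by simp
    ultimately show "(lc (Some d') \<cdot> w d') \<cdot> Ar C (y d'' d') = lc (Some d'') \<cdot> w d''"
      using d' d'' T_down[OF dT d'] by (simp del: chain_colimitD(7,8)[OF col])
  qed auto
  then obtain t where t: "t \<in> hom G (Dom G g) x" and tj: "t \<cdot> j = lc None \<cdot> Ar A (y d c)"
    and tJ: "\<And>d'. d' \<in> ?D \<Longrightarrow> t \<cdot> J d' = lc (Some d') \<cdot> w d'"
    by blast
  \<comment> \<open>Cobase change is available along maps in \<open>N\<close> only, so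
    \<open>t\<close> must be one; this is tested on the pieces of the source of
    \<open>g\<close>.\<close>
  have "t \<in> N"
  proof (rule is_gapD(16)[OF gap])
    show "t \<cdot> j \<in> N" unfolding tj
      by (rule N_cmp) (use A_N[OF M_N[OF y_M[OF c d]]] lcM[of None] M_N in auto)
    show "t \<cdot> J d' \<in> N" if "d' \<in> ?D" for d' unfolding tJ[OF that]
      by (rule N_cmp) (use that cellD(5)[OF cell[OF that]] lcM[of "Some d'"] M_N in auto)
  qed (use t in auto)
  then obtain p q where po: "pushout g t p q" and pq: "p \<in> N" "q \<in> M"
    and pdet: "\<And>z. z \<in> Arr G \<Longrightarrow> Dom G z = Cod G p \<Longrightarrow> z \<cdot> p \<in> N \<Longrightarrow> z \<cdot> q \<in> N \<Longrightarrow> z \<in> N"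
    using cobase_ex[OF is_gapD(5)[OF gap], of t] t by auto
  have tA [simp]: "t \<in> Arr G" "Dom G t = Dom G g" "Cod G t = x" using t by auto
  note P [simp] = pushoutD(3,4,6-8)[OF po]
  have pg: "p \<cdot> g \<cdot> z = q \<cdot> t \<cdot> z" if "z \<in> Arr G" "Cod G z = Dom G g" for z
    using cmp_eq_cmp[OF pushoutD(9)[OF po], of z] that by simp
  have "cell c l n w d lc q p"
    unfolding cell_def
  proof (intro conjI ballI allI impI; (elim conjE)?)
    show "chain_colimit (Ob A (Y c)) l n ?D (Dom G q) lc" using col by simp
    show "lc k \<in> M" if "k \<in> insert None (Some ` ?D)" for k using lcM that .
    show "q \<in> M" "p \<in> N" by (fact pq)+
    show "p \<in> hom G (Ob C (Y d)) (Cod G q)" by simp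
    show "p \<cdot> a (Y d) = q \<cdot> lc None \<cdot> Ar A (y d c)"
      using pg[of j] tj by simp
    show "p \<cdot> Ar C (y d' d) = q \<cdot> lc (Some d') \<cdot> w d'" if "d' \<in> ?D" for d'
      using pg[of "J d'"] tJ[OF that] that by simp
  next
    fix V v u
    assume v: "v \<in> hom G (Ob A (Y c)) V" and u: "u \<in> hom G (Ob C (Y d)) V"
      and ua: "u \<cdot> a (Y d) = v \<cdot> Ar A (y d c)"
    \<comment> \<open>Before the pushout can be used, a map on \<open>x\<close> is needed; on the
      cell at \<open>d'\<close> it is forced to be \<open>u\<close> restricted along
      \<open>C (y d' d)\<close>.\<close>
    obtain r where r: "r \<in> hom G x V" "r \<cdot> lc None = v"
      and rw: "\<And>d'. d' \<in> ?D \<Longrightarrow> r \<cdot> lc (Some d') \<cdot> w d' = u \<cdot> Ar C (y d' d)"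
    proof (rule cells_colim_ex[OF H col v, where u = "\<lambda>d'. u \<cdot> Ar C (y d' d)"])
      fix d' assume d': "d' \<in> ?D"
      then show "u \<cdot> Ar C (y d' d) \<in> hom G (Ob C (Y d')) V" using u by simp
      have "u \<cdot> a (Y d) \<cdot> Ar A (y d' d) = (v \<cdot> Ar A (y d c)) \<cdot> Ar A (y d' d)"
        by (rule cmp_eq_cmp[OF ua]) (use u v d' in auto)
      then show "(u \<cdot> Ar C (y d' d)) \<cdot> a (Y d') = v \<cdot> Ar A (y d' c)"
        using u v d' by (simp add: a_y A_y)
      fix d'' assume d'': "d'' \<in> underS \<kappa> d'"
      then show "(u \<cdot> Ar C (y d' d)) \<cdot> Ar C (y d'' d') = u \<cdot> Ar C (y d'' d)"
        using u d' T_down[OF dT d'] by (simp add: C_y)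
    qed blast+
    have rV: "r \<in> Arr G" "Dom G r = x" "Cod G r = V" and uV: "u \<in> Arr G" "Dom G u = Ob C (Y d)" "Cod G u = V"
      using r u by auto
    have rt: "r \<cdot> t = u \<cdot> g"
    proof (rule gap_eqI[OF dT gap])
      show "r \<cdot> t \<in> hom G (Dom G g) V" "u \<cdot> g \<in> hom G (Dom G g) V" using rV uV by auto
      have "(r \<cdot> lc None) \<cdot> Ar A (y d c) = u \<cdot> a (Y d)" using ua r by simp
      then show "(r \<cdot> t) \<cdot> j = (u \<cdot> g) \<cdot> j" using rV uV by (simp add: tj)
      show "(r \<cdot> t) \<cdot> J d' = (u \<cdot> g) \<cdot> J d'" if "d' \<in> ?D" for d'
        using rV uV rw[OF that] that by (simp add: tJ)
    qed
    obtain z where z: "z \<in> hom G (Cod G p) V" "z \<cdot> p = u" "z \<cdot> q = r"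
      by (rule pushout_ex[OF po, of u V r]) (use rV uV rt in auto)
    show "\<exists>!z. z \<in> hom G (Cod G q) V \<and> z \<cdot> q \<cdot> lc None = v \<and> z \<cdot> p = u"
    proof (rule ex1I[of _ z])
      have "z \<cdot> q \<cdot> lc None = v"
        using cmp_eq_cmp[OF z(3), of "lc None"] z(1) r by simp
      then show "z \<in> hom G (Cod G q) V \<and> z \<cdot> q \<cdot> lc None = v \<and> z \<cdot> p = u"
        using z by simp
      fix z' assume z': "z' \<in> hom G (Cod G q) V \<and> z' \<cdot> q \<cdot> lc None = v \<and> z' \<cdot> p = u"
      then have zA: "z' \<in> Arr G" "Dom G z' = Cod G p" "Cod G z' = V" by auto
      \<comment> \<open>Because \<open>p g = q t\<close>, the values of \<open>z' q\<close> on the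
        earlier cells are determined by \<open>z' p\<close>.\<close>
      have "z' \<cdot> q = r"
      proof (rule cells_colim_eqI[OF H col])
        show "z' \<cdot> q \<in> hom G x V" "r \<in> hom G x V" using zA rV by auto
        show "(z' \<cdot> q) \<cdot> lc None = r \<cdot> lc None" using z' zA r by simp
        fix d' assume d': "d' \<in> ?D"
        have "(z' \<cdot> p) \<cdot> Ar C (y d' d) = (z' \<cdot> q) \<cdot> lc (Some d') \<cdot> w d'"
          using zA d' pg[of "J d'"] by (simp add: tJ)
        then show "(z' \<cdot> q) \<cdot> lc (Some d') \<cdot> w d' = r \<cdot> lc (Some d') \<cdot> w d'"
          using z' rw[OF d'] by simp
      qed
      then have "z' \<cdot> p = z \<cdot> p" "z' \<cdot> q = z \<cdot> q" using z z' by metis+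
      then show "z' = z" using z(1) zA pushout_eqI[OF po, of z' V z] by auto
    qed
  next
    fix z assume z: "z \<in> Arr G" "Dom G z = Cod G q" "z \<cdot> q \<cdot> lc None \<in> N" "z \<cdot> p \<in> N"
    have "z \<cdot> q \<in> N"
    proof (rule cells_colim_detect[OF H col det])
      show "z \<cdot> q \<in> Arr G" "Dom G (z \<cdot> q) = x" "(z \<cdot> q) \<cdot> lc None \<in> N" using z by auto
      fix d' assume d': "d' \<in> ?D"
      have "(z \<cdot> p) \<cdot> Ar C (y d' d) \<in> N"
        by (rule N_cmp) (use z d' C_N[OF M_N[OF y_M[OF dT d']]] in auto)
      then show "(z \<cdot> q) \<cdot> lc (Some d') \<cdot> w d' \<in> N"
        using z d' pg[of "J d'"] by (simp add: tJ)
    qed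
    then show "z \<in> N" using pdet z by simp
  qed
  then show ?thesis by blast
qed

text \<open>Induction on \<open>c\<close>: the gap maps at earlier stages are what
  \<open>cell_exists\<close> consumes, and the colimit of the resulting chain of pushouts is the
  source of the gap map at \<open>c\<close>. At the least stage there are no earlier cells, and the
  source is a copy of \<open>A (Y c)\<close>.\<close>

lemma gap_exists: "c \<in> T \<Longrightarrow> \<exists>j J g. is_gap c j J g"
proof (induction c rule: lt_induct)
  case (less c)
  note c = less.prems
  \<comment> \<open>For fixed \<open>c\<close> the chain of pushouts is itself chosen by recursion
    on \<open>d\<close>, with an empty requirement outside \<open>underS \<kappa> c\<close>.\<close>
  have "\<exists>l n w. \<forall>d. d \<in> underS \<kappa> c \<longrightarrow> cell c l n w d (l d) (n d) (w d)"
  proof (rule wf_choice3[OF wf_lt])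
    fix l n w l' n' w' d x y z
    assume eq: "\<And>e. (e, d) \<in> \<kappa> - Id \<Longrightarrow> l e = l' e \<and> n e = n' e \<and> w e = w' e"
      and *: "d \<in> underS \<kappa> c \<longrightarrow> cell c l n w d x y z"
    then have "cell c l n w d = cell c l' n' w' d"
      by (intro cell_cong) (simp add: lt_iff)
    with * show "d \<in> underS \<kappa> c \<longrightarrow> cell c l' n' w' d x y z" by simp
  next
    fix l n w d
    assume *: "\<And>e. (e, d) \<in> \<kappa> - Id \<Longrightarrow> e \<in> underS \<kappa> c \<longrightarrow> cell c l n w e (l e) (n e) (w e)"
    show "\<exists>x y z. d \<in> underS \<kappa> c \<longrightarrow> cell c l n w d x y z"
    proof (cases "d \<in> underS \<kappa> c")
      case True
      obtain j J g where "is_gap d j J g" using less.IH[OF True T_down[OF c True]] by blast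
      then show ?thesis
        using cell_exists[OF c True, of j J g l n w] * lt_trans[OF _ True] by (auto simp: lt_iff)
    qed auto
  qed
  then obtain l n w where cell: "\<And>d. d \<in> underS \<kappa> c \<Longrightarrow> cell c l n w d (l d) (n d) (w d)"
    by blast
  let ?D = "underS \<kappa> c"
  have "?D \<subseteq> underS \<kappa> c" "\<And>d'. d' \<in> ?D \<Longrightarrow> underS \<kappa> d' \<subseteq> ?D" using lt_trans by blast+
  note H = c this cell
  note ch = cells_chain_on[OF H]
  have cF: "c \<in> Field \<kappa>" using c T by auto
  obtain x lc where col: "chain_colimit (Ob A (Y c)) l n ?D x lc"
    and lcM: "\<And>k. k \<in> insert None (Some ` ?D) \<Longrightarrow> lc k \<in> M"
    and det: "detects N lc (insert None (Some ` ?D)) x"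
    and detM: "detects M lc (insert None (Some ` ?D)) x"
    by (rule chain_colimit_exists[OF ch refl cF cellD(3)[OF cell] cellD(2)[OF cell]]) blast+
  note [simp] = chain_colimitD[OF col] chain_onD[OF ch] cellD(4,6-10)[OF cell] c
  have cT [simp]: "d \<in> T" if "d \<in> ?D" for d using T_down[OF c that] .
  let ?J = "\<lambda>d. lc (Some d) \<cdot> w d"
  have att: "attach_cocone c x (lc None) ?J"
    unfolding attach_cocone_def
  proof (intro conjI ballI)
    show "lc None \<in> hom G (Ob A (Y c)) x" by simp
    fix d assume d: "d \<in> ?D"
    then show "?J d \<in> hom G (Ob C (Y d)) x" by simp
    have "(lc (Some d) \<cdot> n d \<cdot> l d None) \<cdot> Ar A (y d c) = lc None \<cdot> Ar A (y d c)"
      using d by simp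
    then show "(lc (Some d) \<cdot> w d) \<cdot> a (Y d) = lc None \<cdot> Ar A (y d c)"
      using d by (simp del: chain_colimitD(7,8)[OF col])
    fix d' assume d': "d' \<in> underS \<kappa> d"
    then have "d' \<in> ?D" using d lt_trans by blast
    moreover have "(lc (Some d) \<cdot> n d \<cdot> l d (Some d')) \<cdot> w d' = lc (Some d') \<cdot> w d'"
      using d d' by simp
    ultimately show "(lc (Some d) \<cdot> w d) \<cdot> Ar C (y d' d) = lc (Some d') \<cdot> w d'"
      using d d' by (simp del: chain_colimitD(7,8)[OF col])
  qed
  have JN: "?J d \<in> N" if "d \<in> ?D" for d
    by (rule N_cmp) (use that lcM[of "Some d"] M_N cellD(5)[OF cell[OF that]] in auto)
  obtain g where g: "g \<in> hom G x (Ob C (Y c))" "g \<cdot> lc None = a (Y c)"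
    and gJ: "\<And>d. d \<in> ?D \<Longrightarrow> g \<cdot> lc (Some d) \<cdot> w d = Ar C (y d c)"
    by (rule cells_colim_ex[OF H col, where v = "a (Y c)" and V = "Ob C (Y c)" and u = "\<lambda>d. Ar C (y d c)"])
      (auto simp: a_y C_y)
  have gA [simp]: "g \<in> Arr G" "Dom G g = x" "Cod G g = Ob C (Y c)" using g by auto
  \<comment> \<open>Membership in \<open>M\<close> is detected on the legs. Along
    \<open>lc (Some d)\<close> the map \<open>g\<close> becomes the gap map of the single square
    \<open>y d c\<close>, since the cell at \<open>d\<close> is a pushout of \<open>a (Y d)\<close>
    along \<open>A (y d c)\<close>; there \<open>gap_M\<close> applies. Along \<open>lc None\<close>
    it is \<open>a (Y c)\<close>.\<close>
  have gM: "g \<in> M"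
  proof -
    have "g \<cdot> lc (Some d) \<in> M" if d: "d \<in> ?D" for d
    proof (rule gap_M[OF y_M[OF c d], where p = "w d" and q = "n d \<cdot> l d None"])
      have eq: "g \<cdot> lc (Some d) \<cdot> n d \<cdot> l d None = a (Y c)" using d g by simp
      show "pushout (a (Dom G (y d c))) (Ar A (y d c)) (w d) (n d \<cdot> l d None)"
        unfolding pushout_def
      proof (intro conjI allI impI; (elim conjE)?)
        fix v u assume "v \<in> Arr G" "u \<in> Arr G" "Dom G v = Cod G (a (Dom G (y d c)))"
          "Dom G u = Cod G (Ar A (y d c))" "Cod G u = Cod G v" "v \<cdot> a (Dom G (y d c)) = u \<cdot> Ar A (y d c)"
        then have "u \<in> hom G (Ob A (Y c)) (Cod G v)" "v \<in> hom G (Ob C (Y d)) (Cod G v)"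
          "v \<cdot> a (Y d) = u \<cdot> Ar A (y d c)"
          using d by auto
        then have "\<exists>!z. z \<in> hom G (Cod G (n d)) (Cod G v) \<and> z \<cdot> n d \<cdot> l d None = u \<and> z \<cdot> w d = v"
          using cell[OF d] unfolding cell_def by blast
        then show "\<exists>!z. z \<in> hom G (Cod G (w d)) (Cod G v) \<and> z \<cdot> w d = v \<and> z \<cdot> n d \<cdot> l d None = u"
          using d by (simp add: conj_commute)
      qed (use d in auto)
      show "n d \<cdot> l d None \<in> M"
        by (rule M_cmp) (use d cellD(2,3)[OF cell[OF d]] in auto)
      show "g \<cdot> lc (Some d) \<in> N"
        by (rule cellD(11)[OF cell[OF d]])
          (use d eq gJ[OF d] C_N[OF M_N[OF y_M[OF c d]]] a_M M_N in auto)
      show "(g \<cdot> lc (Some d)) \<cdot> w d = Ar C (y d c)" using d gJ[OF d] by simp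
      show "(g \<cdot> lc (Some d)) \<cdot> n d \<cdot> l d None = a (Cod G (y d c))" using d eq by simp
    qed (use d in auto)
    then show ?thesis using detM g a_M[of "Y c"] by (auto simp: detects_def)
  qed
  have "is_gap c (lc None) ?J g"
    unfolding is_gap_def
  proof (intro conjI ballI allI impI; (elim conjE)?)
    show "attach_cocone c (Dom G g) (lc None) ?J" using att by simp
    show "lc None \<in> N" using lcM[of None] M_N by simp
    show "?J d \<in> N" if "d \<in> ?D" for d using JN that .
    show "g \<in> M" by (fact gM)
    show "Cod G g = Ob C (Y c)" "g \<cdot> lc None = a (Y c)" using g by auto
    show "g \<cdot> ?J d = Ar C (y d c)" if "d \<in> ?D" for d using gJ[OF that] .
  next
    fix V v u assume *: "attach_cocone c V v u"
    obtain z where z: "z \<in> hom G x V" "z \<cdot> lc None = v" "\<And>d. d \<in> ?D \<Longrightarrow> z \<cdot> lc (Some d) \<cdot> w d = u d"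
      by (rule cells_colim_ex[OF H col, of v V u]) (use * in \<open>auto simp: attach_cocone_def\<close>)
    show "\<exists>!z. z \<in> hom G (Dom G g) V \<and> z \<cdot> lc None = v \<and> (\<forall>d \<in> ?D. z \<cdot> ?J d = u d)"
    proof (rule ex1I[of _ z])
      show "z \<in> hom G (Dom G g) V \<and> z \<cdot> lc None = v \<and> (\<forall>d \<in> ?D. z \<cdot> ?J d = u d)" using z by simp
      show "z' = z" if "z' \<in> hom G (Dom G g) V \<and> z' \<cdot> lc None = v \<and> (\<forall>d \<in> ?D. z' \<cdot> ?J d = u d)" for z'
        by (rule cells_colim_eqI[OF H col, of _ V]) (use that z in auto)
    qed
  next
    fix z assume z: "z \<in> Arr G" "Dom G z = Dom G g" "z \<cdot> lc None \<in> N" "\<forall>d \<in> ?D. z \<cdot> ?J d \<in> N"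
    show "z \<in> N" by (rule cells_colim_detect[OF H col det]) (use z in simp_all)
  qed
  then show ?case by blast
qed

end

section \<open>Cellular chains and their functoriality\<close>

context cell_system
begin

text \<open>Stage \<open>c\<close> is the colimit \<open>Dom G q\<close> of the chain so far, and \<open>q\<close> is the cobase change of its gap
  map; the universal property is stated without mentioning the gap.\<close>

definition step where
  "step X l n \<alpha> c lc q p \<longleftrightarrow>
     chain_colimit X l n (underS \<kappa> c) (Dom G q) lc \<and>
     (\<forall>k \<in> insert None (Some ` underS \<kappa> c). lc k \<in> M) \<and>
     detects N lc (insert None (Some ` underS \<kappa> c)) (Dom G q) \<and> q \<in> M \<and>
     p \<in> N \<and> p \<in> hom G (Ob C (Dom G q)) (Cod G q) \<and> p \<cdot> a (Dom G q) = q \<cdot> e (Dom G q) \<and>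
     (\<forall>d \<in> underS \<kappa> c. p \<cdot> Ar C (lc (Some d) \<cdot> n d) = q \<cdot> lc (Some d) \<cdot> \<alpha> d) \<and>
     (\<forall>V v w. v \<in> hom G (Dom G q) V \<and> w \<in> hom G (Ob C (Dom G q)) V \<and>
         w \<cdot> a (Dom G q) = v \<cdot> e (Dom G q) \<and>
         (\<forall>d \<in> underS \<kappa> c. w \<cdot> Ar C (lc (Some d) \<cdot> n d) = v \<cdot> lc (Some d) \<cdot> \<alpha> d) \<longrightarrow>
        (\<exists>!z. z \<in> hom G (Cod G q) V \<and> z \<cdot> q = v \<and> z \<cdot> p = w)) \<and>
     (\<forall>z \<in> Arr G. Dom G z = Cod G q \<and> z \<cdot> q \<in> N \<and> z \<cdot> p \<in> N \<longrightarrow> z \<in> N)"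

lemma step_cong:
  assumes "\<And>d. d \<in> underS \<kappa> c \<Longrightarrow> l d = l' d \<and> n d = n' d \<and> \<alpha> d = \<alpha>' d"
  shows "step X l n \<alpha> c = step X l' n' \<alpha>' c"
proof -
  have "chain_colimit X l n (underS \<kappa> c) = chain_colimit X l' n' (underS \<kappa> c)"
    by (rule chain_colimit_cong) (use assms in auto)
  then show ?thesis using assms by (simp add: step_def fun_eq_iff)
qed

lemma stepD:
  assumes "step X l n \<alpha> c lc q p"
  shows "chain_colimit X l n (underS \<kappa> c) (Dom G q) lc"
    "k \<in> insert None (Some ` underS \<kappa> c) \<Longrightarrow> lc k \<in> M"
    "detects N lc (insert None (Some ` underS \<kappa> c)) (Dom G q)"
    "q \<in> M" "q \<in> Arr G" "p \<in> N" "p \<in> Arr G" "Dom G p = Ob C (Dom G q)" "Cod G p = Cod G q"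
    "p \<cdot> a (Dom G q) = q \<cdot> e (Dom G q)"
    "d \<in> underS \<kappa> c \<Longrightarrow> p \<cdot> Ar C (lc (Some d) \<cdot> n d) = q \<cdot> lc (Some d) \<cdot> \<alpha> d"
    "z \<in> Arr G \<Longrightarrow> Dom G z = Cod G q \<Longrightarrow> z \<cdot> q \<in> N \<Longrightarrow> z \<cdot> p \<in> N \<Longrightarrow> z \<in> N"
  using assms M_Arr[of q] by (simp_all add: step_def) auto

lemma step_ex1:
  assumes "step X l n \<alpha> c lc q p" "v \<in> hom G (Dom G q) V" "w \<in> hom G (Ob C (Dom G q)) V"
    "w \<cdot> a (Dom G q) = v \<cdot> e (Dom G q)"
    "\<And>d. d \<in> underS \<kappa> c \<Longrightarrow> w \<cdot> Ar C (lc (Some d) \<cdot> n d) = v \<cdot> lc (Some d) \<cdot> \<alpha> d"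
  shows "\<exists>!z. z \<in> hom G (Cod G q) V \<and> z \<cdot> q = v \<and> z \<cdot> p = w"
  using assms unfolding step_def by blast

lemma steps_chain_on:
  assumes "X \<in> Obj G" "D \<subseteq> Field \<kappa>" "\<And>d. d \<in> D \<Longrightarrow> underS \<kappa> d \<subseteq> D"
    and st: "\<And>d. d \<in> D \<Longrightarrow> step X l n \<alpha> d (l d) (n d) (\<alpha> d)"
  shows "chain_on X l n D"
  unfolding chain_on_def
proof (intro conjI ballI)
  show "n d \<in> Arr G" if "d \<in> D" for d using stepD(5)[OF st[OF that]] .
  show "chain_cocone X l n (underS \<kappa> d) (Dom G (n d)) (l d)" if "d \<in> D" for d
    using stepD(1)[OF st[OF that]] by (simp add: chain_colimit_def)
qed (use assms in auto)

text \<open>What is pushed out is the gap map and not \<open>a\<close> itself: \<open>t\<close>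
  sends the copy of \<open>A x\<close> to \<open>x\<close> by \<open>e x\<close>, and each earlier
  cell to the place where it was attached. Hence the cell attached for \<open>x\<close> restricts to
  all cells attached before, which is the equation with \<open>\<alpha> d\<close> in
  \<open>step\<close>.\<close>

lemma step_exists:
  assumes X: "X \<in> Obj G" and c: "c \<in> Field \<kappa>"
    and st: "\<And>d. d \<in> underS \<kappa> c \<Longrightarrow> step X l n \<alpha> d (l d) (n d) (\<alpha> d)"
  shows "\<exists>lc q p. step X l n \<alpha> c lc q p"
proof -
  let ?D = "underS \<kappa> c"
  have D: "?D \<subseteq> Field \<kappa>" "\<And>d. d \<in> ?D \<Longrightarrow> underS \<kappa> d \<subseteq> ?D"
    using lt_trans lt_Field by blast+
  note ch = steps_chain_on[OF X D st]
  obtain x lc where col: "chain_colimit X l n ?D x lc"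
    and lcM: "\<And>k. k \<in> insert None (Some ` ?D) \<Longrightarrow> lc k \<in> M"
    and det: "detects N lc (insert None (Some ` ?D)) x"
    by (rule chain_colimit_exists[OF ch refl c stepD(4)[OF st] stepD(2)[OF st]]) blast+
  note [simp] = chain_colimitD[OF col] chain_onD[OF ch] stepD(5,7-9)[OF st]
  have xO [simp]: "x \<in> Obj G" using obj_simps(2)[OF chain_colimitD(1)[OF col]] by simp
  \<comment> \<open>The chain of colimits before the stages, prolonged by the colimit
    \<open>x\<close> at \<open>c\<close>; a transition first attaches by \<open>n d'\<close> and
    then passes to the later colimit.\<close>
  define Y where "Y d = (if d = c then x else Dom G (n d))" for d
  define y where "y d' d = (if d = c then lc (Some d') else l d (Some d')) \<cdot> n d'" for d' d
  have Yc [simp]: "Y c = x" and Yd: "\<And>d. d \<in> ?D \<Longrightarrow> Y d = Dom G (n d)"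
    and yc: "\<And>d. y d c = lc (Some d) \<cdot> n d"
    and yd: "\<And>d' d. d \<in> ?D \<Longrightarrow> y d' d = l d (Some d') \<cdot> n d'"
    by (auto simp: Y_def y_def)
  have Dtr: "d' \<in> ?D" if "d \<in> ?D" "d' \<in> underS \<kappa> d" for d d' using D that by blast
  interpret Y: M_chain G \<kappa> N M A C a e "insert c ?D" Y y
  proof unfold_locales
    show "insert c ?D \<subseteq> Field \<kappa>" using c D by blast
    show "d' \<in> insert c ?D" if "d \<in> insert c ?D" "d' \<in> underS \<kappa> d" for d d'
      using that D by blast
    show "Y d \<in> Obj G" if "d \<in> insert c ?D" for d using that by (auto simp: Yd)
    fix d d' assume d: "d \<in> insert c ?D" and d': "d' \<in> underS \<kappa> d"
    have d'D: "d' \<in> ?D" using d d' D by blast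
    note nM = stepD(4)[OF st[OF d'D]]
    show "y d' d \<in> M"
    proof (cases "d = c")
      case True
      have "lc (Some d') \<cdot> n d' \<in> M" by (rule M_cmp[OF nM]) (use lcM[of "Some d'"] d'D in auto)
      then show ?thesis using True yc by simp
    next
      case False
      then have dD: "d \<in> ?D" using d by simp
      have "l d (Some d') \<cdot> n d' \<in> M"
        by (rule M_cmp[OF nM]) (use stepD(2)[OF st[OF dD], of "Some d'"] d' dD d'D in auto)
      then show ?thesis using yd[OF dD] by simp
    qed
    show "Dom G (y d' d) = Y d'" "Cod G (y d' d) = Y d"
      using d d' d'D by (auto simp: yc yd Yd)
    fix d'' assume d'': "d'' \<in> underS \<kappa> d'"
    have d''D: "d'' \<in> ?D" using d'D d'' D by blast
    show "y d' d \<cdot> y d'' d' = y d'' d"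
    proof (cases "d = c")
      case True
      have "(lc (Some d') \<cdot> n d' \<cdot> l d' (Some d'')) \<cdot> n d'' = lc (Some d'') \<cdot> n d''"
        using d'D d'' by simp
      then show ?thesis using True d'D d'' d''D by (simp add: yc yd del: chain_colimitD(7,8)[OF col])
    next
      case False
      then have dD: "d \<in> ?D" using d by simp
      have "(l d (Some d') \<cdot> n d' \<cdot> l d' (Some d'')) \<cdot> n d'' = l d (Some d'') \<cdot> n d''"
        using d'D d'' d' dD by simp
      then show ?thesis using dD d' d'D d'' d''D
        by (simp add: yd del: chain_onD(8,9)[OF ch])
    qed
  qed
  obtain j J g where gap: "Y.is_gap c j J g" using Y.gap_exists by blast
  note [simp] = Y.is_gapD(1-3,6-8,10-15)[OF gap]
  have "\<exists>t. t \<in> hom G (Dom G g) x \<and> t \<cdot> j = e x \<and> (\<forall>d \<in> ?D. t \<cdot> J d = lc (Some d) \<cdot> \<alpha> d)"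
  proof (rule Y.gap_ex[OF gap, where v = "e x" and w = "\<lambda>d. lc (Some d) \<cdot> \<alpha> d"])
    show "e x \<in> hom G (Ob A (Y c)) x" by simp
    fix d assume d: "d \<in> ?D"
    then show "lc (Some d) \<cdot> \<alpha> d \<in> hom G (Ob C (Y d)) x" by (simp add: Yd)
    \<comment> \<open>Naturality of \<open>e\<close> reduces this to the attaching equation at stage
      \<open>d\<close>.\<close>
    show "(lc (Some d) \<cdot> \<alpha> d) \<cdot> a (Y d) = e x \<cdot> Ar A (y d c)"
      using d e_natural[of "lc (Some d) \<cdot> n d"] stepD(10)[OF st[OF d]] by (simp add: Yd yc)
    fix d' assume d': "d' \<in> underS \<kappa> d"
    have d'D: "d' \<in> ?D" using d d' D by blast
    have "(lc (Some d) \<cdot> n d \<cdot> l d (Some d')) \<cdot> \<alpha> d' = lc (Some d') \<cdot> \<alpha> d'"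
      using d d' by simp
    then show "(lc (Some d) \<cdot> \<alpha> d) \<cdot> Ar C (y d' d) = lc (Some d') \<cdot> \<alpha> d'"
      using d d' d'D stepD(11)[OF st[OF d] d'] by (simp add: yd Yd del: chain_colimitD(7,8)[OF col])
  qed auto
  then obtain t where tA [simp]: "t \<in> Arr G" "Dom G t = Dom G g" "Cod G t = x"
    and tj: "t \<cdot> j = e x" and tJ: "\<And>d. d \<in> ?D \<Longrightarrow> t \<cdot> J d = lc (Some d) \<cdot> \<alpha> d"
    by auto
  have "t \<in> N"
  proof (rule Y.is_gapD(16)[OF gap])
    show "t \<cdot> j \<in> N" by (simp add: tj e_N)
    show "t \<cdot> J d \<in> N" if "d \<in> ?D" for d unfolding tJ[OF that]
      by (rule N_cmp) (use that stepD(6)[OF st[OF that]] lcM[of "Some d"] M_N in auto)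
  qed auto
  then obtain p q where po: "pushout g t p q" and pq: "p \<in> N" "q \<in> M"
    and pdet: "\<And>z. z \<in> Arr G \<Longrightarrow> Dom G z = Cod G p \<Longrightarrow> z \<cdot> p \<in> N \<Longrightarrow> z \<cdot> q \<in> N \<Longrightarrow> z \<in> N"
    using cobase_ex[OF Y.is_gapD(5)[OF gap], of t] by auto
  note P [simp] = pushoutD(3,4,6-8)[OF po]
  have pg: "p \<cdot> g \<cdot> z = q \<cdot> t \<cdot> z" if "z \<in> Arr G" "Cod G z = Dom G g" for z
    using cmp_eq_cmp[OF pushoutD(9)[OF po], of z] that by simp
  have "step X l n \<alpha> c lc q p"
    unfolding step_def
  proof (intro conjI ballI allI impI; (elim conjE)?)
    show "chain_colimit X l n ?D (Dom G q) lc" using col by simp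
    show "lc k \<in> M" if "k \<in> insert None (Some ` ?D)" for k using lcM that .
    show "detects N lc (insert None (Some ` ?D)) (Dom G q)" using det by simp
    show "q \<in> M" "p \<in> N" by (fact pq)+
    show "p \<in> hom G (Ob C (Dom G q)) (Cod G q)" by simp
    show "p \<cdot> a (Dom G q) = q \<cdot> e (Dom G q)" using pg[of j] by (simp add: tj)
    show "p \<cdot> Ar C (lc (Some d) \<cdot> n d) = q \<cdot> lc (Some d) \<cdot> \<alpha> d" if "d \<in> ?D" for d
      using pg[of "J d"] that by (simp add: tJ yc)
  next
    fix V v w
    assume v: "v \<in> hom G (Dom G q) V" and w: "w \<in> hom G (Ob C (Dom G q)) V"
      and wa: "w \<cdot> a (Dom G q) = v \<cdot> e (Dom G q)"
      and wC: "\<forall>d \<in> ?D. w \<cdot> Ar C (lc (Some d) \<cdot> n d) = v \<cdot> lc (Some d) \<cdot> \<alpha> d"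
    have vA: "v \<in> Arr G" "Dom G v = x" "Cod G v = V" and wA: "w \<in> Arr G" "Dom G w = Ob C x" "Cod G w = V"
      using v w by auto
    have "w \<cdot> g = v \<cdot> t"
    proof (rule Y.gap_eqI[OF _ gap, where V = V])
      show "(w \<cdot> g) \<cdot> j = (v \<cdot> t) \<cdot> j" using vA wA wa by (simp add: tj)
      show "(w \<cdot> g) \<cdot> J d = (v \<cdot> t) \<cdot> J d" if "d \<in> ?D" for d
        using vA wA wC that by (simp add: tJ yc)
    qed (use vA wA in auto)
    then have "\<exists>!z. z \<in> hom G (Cod G p) V \<and> z \<cdot> p = w \<and> z \<cdot> q = v"
      by (intro pushout_ex1[OF po]) (use vA wA in auto)
    then show "\<exists>!z. z \<in> hom G (Cod G q) V \<and> z \<cdot> q = v \<and> z \<cdot> p = w"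
      by (simp add: conj_commute)
  next
    show "z \<in> N" if "z \<in> Arr G" "Dom G z = Cod G q" "z \<cdot> q \<in> N" "z \<cdot> p \<in> N" for z
      using pdet that by simp
  qed
  then show ?thesis by blast
qed

lemma steps_exist:
  assumes X: "X \<in> Obj G"
  shows "\<exists>l n \<alpha>. \<forall>c \<in> Field \<kappa>. step X l n \<alpha> c (l c) (n c) (\<alpha> c)"
proof -
  have "\<exists>l n \<alpha>. \<forall>c. c \<in> Field \<kappa> \<longrightarrow> step X l n \<alpha> c (l c) (n c) (\<alpha> c)"
  proof (rule wf_choice3[OF wf_lt])
    fix l n \<alpha> l' n' \<alpha>' c x y z
    assume eq: "\<And>d. (d, c) \<in> \<kappa> - Id \<Longrightarrow> l d = l' d \<and> n d = n' d \<and> \<alpha> d = \<alpha>' d"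
      and *: "c \<in> Field \<kappa> \<longrightarrow> step X l n \<alpha> c x y z"
    then have "step X l n \<alpha> c = step X l' n' \<alpha>' c"
      by (intro step_cong) (simp add: lt_iff)
    with * show "c \<in> Field \<kappa> \<longrightarrow> step X l' n' \<alpha>' c x y z" by simp
  next
    fix l n \<alpha> c
    assume *: "\<And>d. (d, c) \<in> \<kappa> - Id \<Longrightarrow> d \<in> Field \<kappa> \<longrightarrow> step X l n \<alpha> d (l d) (n d) (\<alpha> d)"
    show "\<exists>x y z. c \<in> Field \<kappa> \<longrightarrow> step X l n \<alpha> c x y z"
      using step_exists[OF X, of c l n \<alpha>] * lt_Field by (auto simp: lt_iff)
  qed
  then show ?thesis by blast
qed

text \<open>At full length the legs \<open>t\<close> are only asked to be in \<open>N\<close>: for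
  \<open>\<kappa>\<close>-chains a backdrop provides colimits in the ambient category, with no claim
  that the legs are in \<open>M\<close>.\<close>

definition cellular where
  "cellular X l n \<alpha> t \<longleftrightarrow>
     X \<in> Obj G \<and> (\<forall>c \<in> Field \<kappa>. step X l n \<alpha> c (l c) (n c) (\<alpha> c)) \<and>
     chain_colimit X l n (Field \<kappa>) (Cod G (t None)) t \<and>
     (\<forall>k \<in> insert None (Some ` Field \<kappa>). t k \<in> N) \<and>
     detects N t (insert None (Some ` Field \<kappa>)) (Cod G (t None))"

lemma cellularD:
  assumes "cellular X l n \<alpha> t"
  shows "c \<in> Field \<kappa> \<Longrightarrow> step X l n \<alpha> c (l c) (n c) (\<alpha> c)"
    "chain_colimit X l n (Field \<kappa>) (Cod G (t None)) t"
    "chain_on X l n (Field \<kappa>)"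
    "k \<in> insert None (Some ` Field \<kappa>) \<Longrightarrow> t k \<in> N"
    "detects N t (insert None (Some ` Field \<kappa>)) (Cod G (t None))"
proof -
  show "chain_on X l n (Field \<kappa>)"
    by (rule steps_chain_on[where \<alpha> = \<alpha>]) (use assms lt_Field in \<open>auto simp: cellular_def\<close>)
qed (use assms in \<open>unfold cellular_def, blast+\<close>)

section \<open>Maps between cellular chains\<close>

definition cell_map where
  "cell_map l n \<alpha> t l' n' \<alpha>' t' f v z w \<longleftrightarrow>
     (\<forall>c \<in> Field \<kappa>.
        v c \<in> hom G (Dom G (n c)) (Dom G (n' c)) \<and> z c \<in> hom G (Cod G (n c)) (Cod G (n' c)) \<and>
        v c \<cdot> l c None = l' c None \<cdot> f \<and>
        (\<forall>d \<in> underS \<kappa> c. v c \<cdot> l c (Some d) = l' c (Some d) \<cdot> z d) \<and>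
        z c \<cdot> n c = n' c \<cdot> v c \<and> z c \<cdot> \<alpha> c = \<alpha>' c \<cdot> Ar C (v c)) \<and>
     w \<in> hom G (Cod G (t None)) (Cod G (t' None)) \<and>
     w \<cdot> t None = t' None \<cdot> f \<and> (\<forall>c \<in> Field \<kappa>. w \<cdot> t (Some c) = t' (Some c) \<cdot> z c)"

context
  fixes X l n \<alpha> t X' l' n' \<alpha>' t'
  assumes src: "cellular X l n \<alpha> t" and tgt: "cellular X' l' n' \<alpha>' t'"
begin

lemmas src_simps = chain_onD[OF cellularD(3)[OF src]] chain_colimitD[OF cellularD(2)[OF src]]
  stepD(5,7-10)[OF cellularD(1)[OF src]]

lemmas tgt_simps = chain_onD[OF cellularD(3)[OF tgt]] chain_colimitD[OF cellularD(2)[OF tgt]]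
  stepD(5,7-10)[OF cellularD(1)[OF tgt]]

text \<open>Recursion on stages: \<open>v c\<close> acts on the colimit before stage
  \<open>c\<close> and comes from its universal property, \<open>z c\<close> acts on the object
  after attaching and comes from the universal property in \<open>step\<close>, and \<open>w\<close>
  extends all of them to the last colimit.\<close>

lemma cell_map_exists:
  assumes f: "f \<in> hom G X X'"
  shows "\<exists>v z w. cell_map l n \<alpha> t l' n' \<alpha>' t' f v z w"
proof -
  note [simp] = src_simps(1-7,10,11,13-15,18-22) tgt_simps(1-7,10,11,13-15,18-22)
  have fA [simp]: "f \<in> Arr G" "Dom G f = X" "Cod G f = X'" using f by auto
  let ?Q = "\<lambda>v z c vc zc. vc \<in> hom G (Dom G (n c)) (Dom G (n' c)) \<and>
        zc \<in> hom G (Cod G (n c)) (Cod G (n' c)) \<and>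
        vc \<cdot> l c None = l' c None \<cdot> f \<and>
        (\<forall>d \<in> underS \<kappa> c. vc \<cdot> l c (Some d) = l' c (Some d) \<cdot> z d) \<and>
        zc \<cdot> n c = n' c \<cdot> vc \<and> zc \<cdot> \<alpha> c = \<alpha>' c \<cdot> Ar C vc"
  have "\<exists>v z (u :: 'k \<Rightarrow> unit). \<forall>c. c \<in> Field \<kappa> \<longrightarrow> ?Q v z c (v c) (z c)"
  proof (rule wf_choice3[OF wf_lt])
    fix v z v' z' c vc zc and u u' :: "'k \<Rightarrow> unit"
    assume "\<And>d. (d, c) \<in> \<kappa> - Id \<Longrightarrow> v d = v' d \<and> z d = z' d \<and> u d = u' d"
      and "c \<in> Field \<kappa> \<longrightarrow> ?Q v z c vc zc"
    then show "c \<in> Field \<kappa> \<longrightarrow> ?Q v' z' c vc zc" by (simp add: lt_iff)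
  next
    fix v z c and u :: "'k \<Rightarrow> unit"
    assume "\<And>d. (d, c) \<in> \<kappa> - Id \<Longrightarrow> d \<in> Field \<kappa> \<longrightarrow> ?Q v z d (v d) (z d)"
    then have IH: "?Q v z d (v d) (z d)" if "d \<in> underS \<kappa> c" for d
      using that lt_Field(1)[OF that] lt_iff by blast
    have dF: "d \<in> Field \<kappa>" if "d \<in> underS \<kappa> c" for d using lt_Field that by blast
    have vA: "v d \<in> Arr G" "Dom G (v d) = Dom G (n d)" "Cod G (v d) = Dom G (n' d)"
      and zA: "z d \<in> Arr G" "Dom G (z d) = Cod G (n d)" "Cod G (z d) = Cod G (n' d)"
      and vl: "v d \<cdot> l d None = l' d None \<cdot> f"
      and vl': "\<And>d'. d' \<in> underS \<kappa> d \<Longrightarrow> v d \<cdot> l d (Some d') = l' d (Some d') \<cdot> z d'"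
      and zn: "z d \<cdot> n d = n' d \<cdot> v d" and za: "z d \<cdot> \<alpha> d = \<alpha>' d \<cdot> Ar C (v d)"
      if "d \<in> underS \<kappa> c" for d
      using IH[OF that] by auto
    show "\<exists>x y (w :: unit). c \<in> Field \<kappa> \<longrightarrow> ?Q v z c x y"
    proof (cases "c \<in> Field \<kappa>")
      case c: True
      have zn': "z d \<cdot> n d \<cdot> h = n' d \<cdot> v d \<cdot> h" if "d \<in> underS \<kappa> c" "h \<in> Arr G" "Cod G h = Dom G (n d)" for d h
        using cmp_eq_cmp[OF zn[OF that(1)], of h] that dF vA zA by simp
      obtain vc where vc: "vc \<in> hom G (Dom G (n c)) (Dom G (n' c))" "vc \<cdot> l c None = l' c None \<cdot> f"
        and vcd: "\<And>d. d \<in> underS \<kappa> c \<Longrightarrow> vc \<cdot> l c (Some d) = l' c (Some d) \<cdot> z d"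
      proof (rule chain_colimit_ex[OF stepD(1)[OF cellularD(1)[OF src c]],
            where v = "l' c None \<cdot> f" and V = "Dom G (n' c)" and u = "\<lambda>d. l' c (Some d) \<cdot> z d"])
        show "l' c None \<cdot> f \<in> hom G X (Dom G (n' c))" using c by simp
        fix d assume d: "d \<in> underS \<kappa> c"
        note [simp] = vA[OF d] zA[OF d] dF[OF d] d c
        show "l' c (Some d) \<cdot> z d \<in> hom G (Cod G (n d)) (Dom G (n' c))" by simp
        have "(l' c (Some d) \<cdot> n' d \<cdot> l' d None) \<cdot> f = l' c None \<cdot> f"
          by (subst tgt_simps(8)) auto
        then show "(l' c (Some d) \<cdot> z d) \<cdot> n d \<cdot> l d None = l' c None \<cdot> f"
          using zn'[OF d, of "l d None"] by (simp add: vl)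
        fix d' assume d': "d' \<in> underS \<kappa> d"
        then have d'c: "d' \<in> underS \<kappa> c" using d lt_trans by blast
        note [simp] = zA[OF d'c] dF[OF d'c] d' d'c
        have "(l' c (Some d) \<cdot> n' d \<cdot> l' d (Some d')) \<cdot> z d' = l' c (Some d') \<cdot> z d'"
          by (subst tgt_simps(9)) auto
        then show "(l' c (Some d) \<cdot> z d) \<cdot> n d \<cdot> l d (Some d') = l' c (Some d') \<cdot> z d'"
          using zn'[OF d, of "l d (Some d')"] by (simp add: vl'[OF d])
      qed blast+
      have vcA [simp]: "vc \<in> Arr G" "Dom G vc = Dom G (n c)" "Cod G vc = Dom G (n' c)" using vc by auto
      have "\<exists>!zc. zc \<in> hom G (Cod G (n c)) (Cod G (n' c)) \<and> zc \<cdot> n c = n' c \<cdot> vc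
          \<and> zc \<cdot> \<alpha> c = \<alpha>' c \<cdot> Ar C vc"
      proof (rule step_ex1[OF cellularD(1)[OF src c]])
        show "n' c \<cdot> vc \<in> hom G (Dom G (n c)) (Cod G (n' c))"
          "\<alpha>' c \<cdot> Ar C vc \<in> hom G (Ob C (Dom G (n c))) (Cod G (n' c))"
          using c by auto
        have "(\<alpha>' c \<cdot> a (Dom G (n' c))) \<cdot> Ar A vc = (n' c \<cdot> e (Dom G (n' c))) \<cdot> Ar A vc"
          using c by simp
        then show "(\<alpha>' c \<cdot> Ar C vc) \<cdot> a (Dom G (n c)) = (n' c \<cdot> vc) \<cdot> e (Dom G (n c))"
          using c a_natural[of vc] e_natural[of vc] by (simp del: stepD(10)[OF cellularD(1)[OF tgt]])
        \<comment> \<open>The new map must agree with what was done to the cell of stage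
          \<open>d\<close>: \<open>vc\<close> extends \<open>z d\<close>, and \<open>z d\<close> was
          chosen compatible with \<open>\<alpha> d\<close>.\<close>
        fix d assume d: "d \<in> underS \<kappa> c"
        note [simp] = vA[OF d] zA[OF d] dF[OF d] d c
        have "vc \<cdot> l c (Some d) \<cdot> n d = (l' c (Some d) \<cdot> n' d) \<cdot> v d"
          using cmp_eq_cmp[OF vcd[OF d], of "n d"] by (simp add: zn)
        then have "Ar C vc \<cdot> Ar C (l c (Some d) \<cdot> n d) = Ar C (l' c (Some d) \<cdot> n' d) \<cdot> Ar C (v d)"
          using C_cmp[of "l c (Some d) \<cdot> n d" vc] C_cmp[of "v d" "l' c (Some d) \<cdot> n' d"] by simp
        moreover have "(\<alpha>' c \<cdot> Ar C (l' c (Some d) \<cdot> n' d)) \<cdot> Ar C (v d) = (n' c \<cdot> l' c (Some d) \<cdot> \<alpha>' d) \<cdot> Ar C (v d)"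
          using stepD(11)[OF cellularD(1)[OF tgt c] d] by simp
        moreover have "(n' c \<cdot> vc) \<cdot> l c (Some d) \<cdot> \<alpha> d = n' c \<cdot> l' c (Some d) \<cdot> \<alpha>' d \<cdot> Ar C (v d)"
          using cmp_eq_cmp[OF vcd[OF d], of "\<alpha> d"] by (simp add: za)
        ultimately show "(\<alpha>' c \<cdot> Ar C vc) \<cdot> Ar C (l c (Some d) \<cdot> n d) = (n' c \<cdot> vc) \<cdot> l c (Some d) \<cdot> \<alpha> d"
          by simp
      qed
      then obtain zc where "zc \<in> hom G (Cod G (n c)) (Cod G (n' c))" "zc \<cdot> n c = n' c \<cdot> vc"
        "zc \<cdot> \<alpha> c = \<alpha>' c \<cdot> Ar C vc"
        by blast
      then have "?Q v z c vc zc" using vc vcd by simp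
      then show ?thesis by blast
    qed auto
  qed
  then obtain v z where Q: "\<And>c. c \<in> Field \<kappa> \<Longrightarrow> ?Q v z c (v c) (z c)" by blast
  have vA: "v d \<in> Arr G" "Dom G (v d) = Dom G (n d)" "Cod G (v d) = Dom G (n' d)"
    and zA: "z d \<in> Arr G" "Dom G (z d) = Cod G (n d)" "Cod G (z d) = Cod G (n' d)"
    and vl: "v d \<cdot> l d None = l' d None \<cdot> f"
    and vl': "\<And>d'. d' \<in> underS \<kappa> d \<Longrightarrow> v d \<cdot> l d (Some d') = l' d (Some d') \<cdot> z d'"
    and zn: "z d \<cdot> n d = n' d \<cdot> v d"
    if "d \<in> Field \<kappa>" for d
    using Q[OF that] by auto
  have zn': "z d \<cdot> n d \<cdot> h = n' d \<cdot> v d \<cdot> h" if "d \<in> Field \<kappa>" "h \<in> Arr G" "Cod G h = Dom G (n d)" for d h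
    using cmp_eq_cmp[OF zn[OF that(1)], of h] that vA zA by simp
  obtain w where w: "w \<in> hom G (Cod G (t None)) (Cod G (t' None))" "w \<cdot> t None = t' None \<cdot> f"
    and wd: "\<And>d. d \<in> Field \<kappa> \<Longrightarrow> w \<cdot> t (Some d) = t' (Some d) \<cdot> z d"
  proof (rule chain_colimit_ex[OF cellularD(2)[OF src],
        where v = "t' None \<cdot> f" and V = "Cod G (t' None)" and u = "\<lambda>d. t' (Some d) \<cdot> z d"])
    show "t' None \<cdot> f \<in> hom G X (Cod G (t' None))" by simp
    fix d assume d [simp]: "d \<in> Field \<kappa>"
    note [simp] = vA[OF d] zA[OF d]
    show "t' (Some d) \<cdot> z d \<in> hom G (Cod G (n d)) (Cod G (t' None))" by simp
    have "(t' (Some d) \<cdot> n' d \<cdot> l' d None) \<cdot> f = t' None \<cdot> f"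
      by (subst tgt_simps(16)) auto
    then show "(t' (Some d) \<cdot> z d) \<cdot> n d \<cdot> l d None = t' None \<cdot> f"
      using zn'[OF d, of "l d None"] by (simp add: vl)
    fix d' assume d' [simp]: "d' \<in> underS \<kappa> d"
    then have d'F [simp]: "d' \<in> Field \<kappa>" using lt_Field by blast
    note [simp] = zA[OF d'F]
    have "(t' (Some d) \<cdot> n' d \<cdot> l' d (Some d')) \<cdot> z d' = t' (Some d') \<cdot> z d'"
      by (subst tgt_simps(17)) auto
    then show "(t' (Some d) \<cdot> z d) \<cdot> n d \<cdot> l d (Some d') = t' (Some d') \<cdot> z d'"
      using zn'[OF d, of "l d (Some d')"] by (simp add: vl'[OF d])
  qed blast+
  have "cell_map l n \<alpha> t l' n' \<alpha>' t' f v z w"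
    unfolding cell_map_def using Q w wd by blast
  then show ?thesis by blast
qed

lemma cell_mapD:
  assumes "cell_map l n \<alpha> t l' n' \<alpha>' t' f v z w"
  shows "c \<in> Field \<kappa> \<Longrightarrow> v c \<in> Arr G" "c \<in> Field \<kappa> \<Longrightarrow> Dom G (v c) = Dom G (n c)"
    "c \<in> Field \<kappa> \<Longrightarrow> Cod G (v c) = Dom G (n' c)"
    "c \<in> Field \<kappa> \<Longrightarrow> z c \<in> Arr G" "c \<in> Field \<kappa> \<Longrightarrow> Dom G (z c) = Cod G (n c)"
    "c \<in> Field \<kappa> \<Longrightarrow> Cod G (z c) = Cod G (n' c)"
    "c \<in> Field \<kappa> \<Longrightarrow> v c \<cdot> l c None = l' c None \<cdot> f"
    "d \<in> underS \<kappa> c \<Longrightarrow> v c \<cdot> l c (Some d) = l' c (Some d) \<cdot> z d"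
    "c \<in> Field \<kappa> \<Longrightarrow> z c \<cdot> n c = n' c \<cdot> v c"
    "c \<in> Field \<kappa> \<Longrightarrow> z c \<cdot> \<alpha> c = \<alpha>' c \<cdot> Ar C (v c)"
    "w \<in> Arr G" "Dom G w = Cod G (t None)" "Cod G w = Cod G (t' None)"
    "w \<cdot> t None = t' None \<cdot> f" "c \<in> Field \<kappa> \<Longrightarrow> w \<cdot> t (Some c) = t' (Some c) \<cdot> z c"
  using assms lt_Field(2)[of d c] by (simp_all add: cell_map_def)

text \<open>The universal properties that produce the map also determine it, stage by stage. This
  makes \<open>top_map\<close> a functor although every chain and every map of chains is an
  arbitrary choice.\<close>

lemma cell_map_unique:
  assumes m: "cell_map l n \<alpha> t l' n' \<alpha>' t' f v z w" and m': "cell_map l n \<alpha> t l' n' \<alpha>' t' f v' z' w'"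
  shows "w = w'"
proof -
  note [simp] = cell_mapD(1-6,11-13)[OF m] cell_mapD(1-6,11-13)[OF m']
  note [simp] = src_simps(1-7,10,11,13-15,18-22) tgt_simps(1-7,10,11,13-15,18-22)
  have vz: "v c = v' c \<and> z c = z' c" if "c \<in> Field \<kappa>" for c
    using that
  proof (induction c rule: lt_induct)
    case (less c)
    note c [simp] = less.prems
    have eq: "v d = v' d \<and> z d = z' d" "d \<in> Field \<kappa>" if "d \<in> underS \<kappa> c" for d
      using less.IH[OF that] lt_Field(1)[OF that] by auto
    have dc: "underS \<kappa> c \<subseteq> Field \<kappa>" "\<And>d. d \<in> underS \<kappa> c \<Longrightarrow> underS \<kappa> d \<subseteq> underS \<kappa> c"
      using lt_Field lt_trans by blast+
    have "X \<in> Obj G" using src by (simp add: cellular_def)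
    then have ch: "chain_on X l n (underS \<kappa> c)"
      by (rule steps_chain_on[where \<alpha> = \<alpha>]) (use dc cellularD(1)[OF src] in auto)
    have v: "v c = v' c"
    proof (rule chain_colimit_eqI[OF ch stepD(1)[OF cellularD(1)[OF src c]], of _ "Dom G (n' c)"])
      show "v c \<cdot> l c None = v' c \<cdot> l c None" using cell_mapD(7)[OF m c] cell_mapD(7)[OF m' c] by simp
      show "v c \<cdot> l c (Some d) = v' c \<cdot> l c (Some d)" if "d \<in> underS \<kappa> c" for d
        using cell_mapD(8)[OF m that] cell_mapD(8)[OF m' that] eq[OF that] by simp
    qed auto
    have "\<exists>!zc. zc \<in> hom G (Cod G (n c)) (Cod G (n' c)) \<and> zc \<cdot> n c = z c \<cdot> n c \<and> zc \<cdot> \<alpha> c = z c \<cdot> \<alpha> c"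
    proof (rule step_ex1[OF cellularD(1)[OF src c]])
      fix d assume d: "d \<in> underS \<kappa> c"
      have dF: "d \<in> Field \<kappa>" using lt_Field(1)[OF d] .
      show "(z c \<cdot> \<alpha> c) \<cdot> Ar C (l c (Some d) \<cdot> n d) = (z c \<cdot> n c) \<cdot> l c (Some d) \<cdot> \<alpha> d"
        using stepD(11)[OF cellularD(1)[OF src c] d] d dF by simp
    qed auto
    moreover have "z' c \<cdot> n c = z c \<cdot> n c" "z' c \<cdot> \<alpha> c = z c \<cdot> \<alpha> c"
      using cell_mapD(9,10)[OF m c] cell_mapD(9,10)[OF m' c] v by simp_all
    ultimately have "z c = z' c" using c cell_mapD(4-6)[OF m] cell_mapD(4-6)[OF m'] by (metis in_hom)
    with v show ?case by simp
  qed
  show ?thesis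
  proof (rule chain_colimit_eqI[OF cellularD(3)[OF src] cellularD(2)[OF src], of _ "Cod G (t' None)"])
    show "w \<cdot> t None = w' \<cdot> t None" using cell_mapD(14)[OF m] cell_mapD(14)[OF m'] by simp
    show "w \<cdot> t (Some d) = w' \<cdot> t (Some d)" if "d \<in> Field \<kappa>" for d
      using cell_mapD(15)[OF m that] cell_mapD(15)[OF m' that] vz[OF that] by simp
  qed auto
qed

text \<open>Every colimit and pushout of the construction detects \<open>N\<close>, so membership of
  \<open>f\<close> propagates through the stages. In the application, cartesian morphisms are
  thereby sent to cartesian ones, as the components of a morphism in \<open>Ext\<close> have to
  be.\<close>

lemma cell_map_N:
  assumes m: "cell_map l n \<alpha> t l' n' \<alpha>' t' f v z w" and f: "f \<in> N" "f \<in> hom G X X'"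
  shows "w \<in> N"
proof -
  note [simp] = cell_mapD(1-6,11-13)[OF m]
  note [simp] = src_simps(1-7,10,11,13-15,18-22) tgt_simps(1-7,10,11,13-15,18-22)
  have "v c \<in> N \<and> z c \<in> N" if "c \<in> Field \<kappa>" for c
    using that
  proof (induction c rule: lt_induct)
    case (less c)
    note c [simp] = less.prems
    have "v c \<cdot> l c None \<in> N" unfolding cell_mapD(7)[OF m c]
      by (rule N_cmp) (use f stepD(2)[OF cellularD(1)[OF tgt c], of None] M_N in auto)
    moreover have "v c \<cdot> l c (Some d) \<in> N" if d: "d \<in> underS \<kappa> c" for d
      unfolding cell_mapD(8)[OF m d]
      by (rule N_cmp) (use less.IH[OF d] lt_Field(1)[OF d] d
          stepD(2)[OF cellularD(1)[OF tgt c], of "Some d"] M_N in auto)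
    ultimately have v: "v c \<in> N"
      using stepD(3)[OF cellularD(1)[OF src c]] by (simp add: detects_def)
    have "z c \<in> N"
    proof (rule stepD(12)[OF cellularD(1)[OF src c]])
      show "z c \<cdot> n c \<in> N" unfolding cell_mapD(9)[OF m c]
        by (rule N_cmp) (use v stepD(4)[OF cellularD(1)[OF tgt c]] M_N in auto)
      show "z c \<cdot> \<alpha> c \<in> N" unfolding cell_mapD(10)[OF m c]
        by (rule N_cmp) (use C_N[OF v] stepD(6)[OF cellularD(1)[OF tgt c]] in auto)
    qed auto
    with v show ?case by simp
  qed
  then have "w \<cdot> t (Some c) \<in> N" if "c \<in> Field \<kappa>" for c
    unfolding cell_mapD(15)[OF m that]
    by (intro N_cmp) (use that cellularD(4)[OF tgt, of "Some c"] in auto)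
  moreover have "w \<cdot> t None \<in> N" unfolding cell_mapD(14)[OF m]
    by (rule N_cmp) (use f cellularD(4)[OF tgt, of None] in auto)
  ultimately show ?thesis using cellularD(5)[OF src] by (simp add: detects_def)
qed

end

lemma cell_map_comp:
  assumes c: "cellular X l n \<alpha> t" "cellular X' l' n' \<alpha>' t'" "cellular X'' l'' n'' \<alpha>'' t''"
    and m: "cell_map l n \<alpha> t l' n' \<alpha>' t' f v z w" and m': "cell_map l' n' \<alpha>' t' l'' n'' \<alpha>'' t'' f' v' z' w'"
    and f: "f \<in> hom G X X'" "f' \<in> hom G X' X''"
  shows "cell_map l n \<alpha> t l'' n'' \<alpha>'' t'' (f' \<cdot> f) (\<lambda>c. v' c \<cdot> v c) (\<lambda>c. z' c \<cdot> z c) (w' \<cdot> w)"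
proof -
  note [simp] = cell_mapD(1-6,11-13)[OF c(1,2) m] cell_mapD(1-6,11-13)[OF c(2,3) m']
  note [simp] = src_simps(1-7,10,11,13-15,18-21)[OF c(1,2)] tgt_simps(1-7,10,11,13-15,18-21)[OF c(1,2)]
    tgt_simps(1-7,10,11,13-15,18-21)[OF c(2,3)]
  have fA [simp]: "f \<in> Arr G" "Dom G f = X" "Cod G f = X'" "f' \<in> Arr G" "Dom G f' = X'" "Cod G f' = X''"
    using f by auto
  note E = cell_mapD(7-10,14,15)[OF c(1,2) m] and E' = cell_mapD(7-10,14,15)[OF c(2,3) m']
  show ?thesis
    unfolding cell_map_def
  proof (intro conjI ballI)
    show "w' \<cdot> w \<in> hom G (Cod G (t None)) (Cod G (t'' None))" by simp
    show "(w' \<cdot> w) \<cdot> t None = t'' None \<cdot> f' \<cdot> f"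
      using cmp_eq_cmp[OF E'(5), of f] by (simp add: E(5))
    fix c assume c [simp]: "c \<in> Field \<kappa>"
    show "(w' \<cdot> w) \<cdot> t (Some c) = t'' (Some c) \<cdot> z' c \<cdot> z c"
      using cmp_eq_cmp[OF E'(6)[OF c], of "z c"] by (simp add: E(6))
    show "v' c \<cdot> v c \<in> hom G (Dom G (n c)) (Dom G (n'' c))"
      "z' c \<cdot> z c \<in> hom G (Cod G (n c)) (Cod G (n'' c))" by simp_all
    show "(v' c \<cdot> v c) \<cdot> l c None = l'' c None \<cdot> f' \<cdot> f"
      using cmp_eq_cmp[OF E'(1)[OF c], of f] by (simp add: E(1))
    show "(z' c \<cdot> z c) \<cdot> n c = n'' c \<cdot> v' c \<cdot> v c"
      using cmp_eq_cmp[OF E'(3)[OF c], of "v c"] by (simp add: E(3))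
    show "(z' c \<cdot> z c) \<cdot> \<alpha> c = \<alpha>'' c \<cdot> Ar C (v' c \<cdot> v c)"
      using cmp_eq_cmp[OF E'(4)[OF c], of "Ar C (v c)"] C_cmp[of "v c" "v' c"] by (simp add: E(4))
    fix d assume d: "d \<in> underS \<kappa> c"
    have dF [simp]: "d \<in> Field \<kappa>" using lt_Field(1)[OF d] .
    show "(v' c \<cdot> v c) \<cdot> l c (Some d) = l'' c (Some d) \<cdot> z' d \<cdot> z d"
      using cmp_eq_cmp[OF E'(2)[OF d], of "z d"] d by (simp add: E(2))
  qed
qed

lemma cell_map_idt:
  assumes c: "cellular X l n \<alpha> t"
  shows "cell_map l n \<alpha> t l n \<alpha> t (Idt G X) (\<lambda>c. Idt G (Dom G (n c))) (\<lambda>c. Idt G (Cod G (n c)))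
    (Idt G (Cod G (t None)))"
proof -
  note [simp] = src_simps(1-7,10,11,13-15,18-21)[OF c c]
  have X [simp]: "X \<in> Obj G" using c by (simp add: cellular_def)
  have "t None \<in> Arr G" by simp
  then have [simp]: "Cod G (t None) \<in> Obj G" by (rule obj_simps)
  show ?thesis
    unfolding cell_map_def
  proof (intro conjI ballI)
    fix c d assume "c \<in> Field \<kappa>" "d \<in> underS \<kappa> c"
    then show "Idt G (Dom G (n c)) \<cdot> l c (Some d) = l c (Some d) \<cdot> Idt G (Cod G (n d))"
      using lt_Field by simp
  qed (simp_all add: functorD(5)[OF C])
qed

end

text \<open>\<open>Q\<close> carries the information on the last colimit that cannot be expressed inside \<open>G\<close>.\<close>

locale cell_system_top = cell_system G \<kappa> N M A C a e
  for G :: "('o, 'g) cat" (structure) and \<kappa> :: "'k rel" and N M A C a e +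
  fixes Q :: "('k option, 'k option \<times> 'k option, 'o, 'g) funct \<Rightarrow> 'o \<Rightarrow> ('k option \<Rightarrow> 'g) \<Rightarrow> bool"
  assumes chain_top_ex: "\<And>b. is_functor (poset_cat (one_plus \<kappa>)) (wide G M) b \<Longrightarrow>
      \<exists>x \<iota>. is_colimit (poset_cat (one_plus \<kappa>)) G b x \<iota> \<and>
        (\<forall>k \<in> Field (one_plus \<kappa>). \<iota> k \<in> N) \<and>
        detects N \<iota> (Field (one_plus \<kappa>)) x \<and> Q b x \<iota>"
begin

lemma cellular_exists:
  assumes X: "X \<in> Obj G"
  shows "\<exists>l n \<alpha> t. cellular X l n \<alpha> t \<and> Q (chain_diagram G X l n) (Cod G (t None)) t"
proof -
  obtain l n \<alpha> where st: "\<And>c. c \<in> Field \<kappa> \<Longrightarrow> step X l n \<alpha> c (l c) (n c) (\<alpha> c)"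
    using steps_exist[OF X] by blast
  have ch: "chain_on X l n (Field \<kappa>)"
    by (rule steps_chain_on[where \<alpha> = \<alpha>]) (use X st lt_Field in auto)
  have r: "Restr \<kappa> (Field \<kappa>) = \<kappa>" by (auto simp: Field_def)
  obtain x t where t: "is_colimit (poset_cat (one_plus \<kappa>)) G (chain_diagram G X l n) x t"
    "\<forall>k \<in> Field (one_plus \<kappa>). t k \<in> N" "detects N t (Field (one_plus \<kappa>)) x"
    "Q (chain_diagram G X l n) x t"
    using chain_top_ex[OF chain_diagram_functor[OF ch M stepD(4)[OF st] stepD(2)[OF st], unfolded r]]
    by blast
  have col: "chain_colimit X l n (Field \<kappa>) x t"
    using is_colimit_chain_iff[OF ch] t(1) by (simp add: r)
  moreover have "Cod G (t None) = x" using chain_colimitD(3)[OF col] .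
  ultimately have "cellular X l n \<alpha> t \<and> Q (chain_diagram G X l n) (Cod G (t None)) t"
    using X st t by (simp add: cellular_def)
  then show ?thesis by blast
qed

section \<open>A chosen chain for each object and the resulting endofunctor\<close>

definition cells where
  "cells X = (SOME (l, n, \<alpha>, t). cellular X l n \<alpha> t \<and> Q (chain_diagram G X l n) (Cod G (t None)) t)"

definition legs where "legs X = fst (cells X)"
definition nexts where "nexts X = fst (snd (cells X))"
definition attach where "attach X = fst (snd (snd (cells X)))"
definition tops where "tops X = snd (snd (snd (cells X)))"

lemma cellular_cells:
  assumes "X \<in> Obj G"
  shows "cellular X (legs X) (nexts X) (attach X) (tops X)"
    "Q (chain_diagram G X (legs X) (nexts X)) (Cod G (tops X None)) (tops X)"
proof -
  have "\<exists>r. case r of (l, n, \<alpha>, t) \<Rightarrow> cellular X l n \<alpha> t \<and> Q (chain_diagram G X l n) (Cod G (t None)) t"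
    using cellular_exists[OF assms] by auto
  from someI_ex[OF this] show "cellular X (legs X) (nexts X) (attach X) (tops X)"
    "Q (chain_diagram G X (legs X) (nexts X)) (Cod G (tops X None)) (tops X)"
    by (auto simp: cells_def[symmetric] legs_def nexts_def attach_def tops_def)
qed

abbreviation top_obj where "top_obj X \<equiv> Cod G (tops X None)"

abbreviation cells_map where
  "cells_map X X' \<equiv> cell_map (legs X) (nexts X) (attach X) (tops X) (legs X') (nexts X') (attach X') (tops X')"

definition top_map where
  "top_map f = (SOME w. \<exists>v z. cells_map (Dom G f) (Cod G f) f v z w)"

lemma top_map:
  assumes "f \<in> Arr G"
  shows "\<exists>v z. cells_map (Dom G f) (Cod G f) f v z (top_map f)"
proof -
  have "\<exists>v z w. cells_map (Dom G f) (Cod G f) f v z w"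
    by (rule cell_map_exists[OF cellular_cells(1) cellular_cells(1)]) (use assms in auto)
  then have "\<exists>w v z. cells_map (Dom G f) (Cod G f) f v z w" by blast
  from someI_ex[OF this] show ?thesis by (simp add: top_map_def)
qed

lemma unit_simps [simp]:
  assumes "X \<in> Obj G"
  shows "tops X None \<in> Arr G" "Dom G (tops X None) = X" "top_obj X \<in> Obj G" "tops X None \<in> N"
proof -
  note c = cellular_cells(1)[OF assms]
  show "tops X None \<in> Arr G" "Dom G (tops X None) = X"
    using chain_colimitD[OF cellularD(2)[OF c]] by auto
  then show "top_obj X \<in> Obj G" by simp
  show "tops X None \<in> N" using cellularD(4)[OF c, of None] by simp
qed

lemma top_map_simps [simp]:
  assumes "f \<in> Arr G"
  shows "top_map f \<in> Arr G" "Dom G (top_map f) = top_obj (Dom G f)"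
    "Cod G (top_map f) = top_obj (Cod G f)"
    "top_map f \<cdot> tops (Dom G f) None = tops (Cod G f) None \<cdot> f"
proof -
  obtain v z where "cells_map (Dom G f) (Cod G f) f v z (top_map f)" using top_map[OF assms] by blast
  from cell_mapD(11-14)[OF cellular_cells(1) cellular_cells(1) this]
  show "top_map f \<in> Arr G" "Dom G (top_map f) = top_obj (Dom G f)"
    "Cod G (top_map f) = top_obj (Cod G f)"
    "top_map f \<cdot> tops (Dom G f) None = tops (Cod G f) None \<cdot> f"
    using assms by auto
qed

lemma top_map_eqI:
  assumes "f \<in> Arr G" "cells_map (Dom G f) (Cod G f) f v z w"
  shows "top_map f = w"
proof -
  obtain v' z' where "cells_map (Dom G f) (Cod G f) f v' z' (top_map f)" using top_map[OF assms(1)] by blast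
  from cell_map_unique[OF cellular_cells(1) cellular_cells(1) this assms(2)] show ?thesis
    using assms by simp
qed

lemma top_map_idt: "X \<in> Obj G \<Longrightarrow> top_map (Idt G X) = Idt G (top_obj X)"
  by (rule top_map_eqI) (use cell_map_idt[OF cellular_cells(1)] in auto)

lemma top_map_cmp:
  assumes "f \<in> Arr G" "g \<in> Arr G" "Cod G f = Dom G g"
  shows "top_map (g \<cdot> f) = top_map g \<cdot> top_map f"
proof -
  obtain v z where m: "cells_map (Dom G f) (Cod G f) f v z (top_map f)" using top_map[OF assms(1)] by blast
  obtain v' z' where m': "cells_map (Dom G g) (Cod G g) g v' z' (top_map g)" using top_map[OF assms(2)] by blast
  have o: "Dom G f \<in> Obj G" "Cod G f \<in> Obj G" "Cod G g \<in> Obj G" using assms by auto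
  show ?thesis
    by (rule top_map_eqI)
      (use assms cell_map_comp[OF cellular_cells(1)[OF o(1)] cellular_cells(1)[OF o(2)]
        cellular_cells(1)[OF o(3)] m m'[folded assms(3)]] in auto)
qed

lemma top_map_N:
  assumes "f \<in> N"
  shows "top_map f \<in> N"
proof -
  have f: "f \<in> Arr G" using assms N_Arr by blast
  obtain v z where m: "cells_map (Dom G f) (Cod G f) f v z (top_map f)" using top_map[OF f] by blast
  show ?thesis
    by (rule cell_map_N[OF cellular_cells(1) cellular_cells(1) m assms]) (use f in auto)
qed

end

section \<open>Fibrations and Van Kampen colimits\<close>

locale fibred = E: category E + F: category F
  for E :: "('o, 'a) cat" and F :: "('p, 'b) cat" +
  fixes P :: "('p, 'b, 'o, 'a) funct" and cl :: "'a \<Rightarrow> 'p \<Rightarrow> 'b"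
  assumes fib: "fibration E F P cl"
begin

abbreviation cart where "cart \<equiv> cartesian E F P"

lemma P_functor: "is_functor F E P"
  using fib by (simp add: fibration_def)

lemmas P_simps [simp] = functorD[OF P_functor]

lemma cart_Arr: "c \<in> cart \<Longrightarrow> c \<in> Arr F"
  by (simp add: cartesian_def)

lemma cart_ex:
  assumes "c \<in> cart" "x \<in> Arr F" "Cod F x = Cod F c"
    "w \<in> hom E (Ob P (Dom F x)) (Ob P (Dom F c))" "Ar P c \<cdot>\<^bsub>E\<^esub> w = Ar P x"
  obtains z where "z \<in> hom F (Dom F x) (Dom F c)" "Ar P z = w" "c \<cdot>\<^bsub>F\<^esub> z = x"
  using assms unfolding cartesian_def by blast

lemma cart_eqI:
  assumes c: "c \<in> cart" and z: "z \<in> hom F Z (Dom F c)" "z' \<in> hom F Z (Dom F c)"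
    and eq: "Ar P z = Ar P z'" "c \<cdot>\<^bsub>F\<^esub> z = c \<cdot>\<^bsub>F\<^esub> z'"
  shows "z = z'"
proof -
  have [simp]: "c \<in> Arr F" using cart_Arr[OF c] .
  have "c \<cdot>\<^bsub>F\<^esub> z \<in> Arr F \<and> Cod F (c \<cdot>\<^bsub>F\<^esub> z) = Cod F c \<and>
      Ar P z \<in> hom E (Ob P (Dom F (c \<cdot>\<^bsub>F\<^esub> z))) (Ob P (Dom F c)) \<and>
      Ar P c \<cdot>\<^bsub>E\<^esub> Ar P z = Ar P (c \<cdot>\<^bsub>F\<^esub> z)"
    using z by simp
  then have "\<exists>!x. x \<in> hom F (Dom F (c \<cdot>\<^bsub>F\<^esub> z)) (Dom F c) \<and> Ar P x = Ar P z \<and> c \<cdot>\<^bsub>F\<^esub> x = c \<cdot>\<^bsub>F\<^esub> z"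
    using c unfolding cartesian_def by blast
  moreover have "Dom F (c \<cdot>\<^bsub>F\<^esub> z) = Z" using z by simp
  ultimately show ?thesis using z eq by metis
qed

lemma cartI:
  assumes "c \<in> Arr F"
    and "\<And>x w. x \<in> Arr F \<Longrightarrow> Cod F x = Cod F c \<Longrightarrow> w \<in> hom E (Ob P (Dom F x)) (Ob P (Dom F c)) \<Longrightarrow>
      Ar P c \<cdot>\<^bsub>E\<^esub> w = Ar P x \<Longrightarrow>
      \<exists>z. z \<in> hom F (Dom F x) (Dom F c) \<and> Ar P z = w \<and> c \<cdot>\<^bsub>F\<^esub> z = x"
    and "\<And>z z'. z \<in> Arr F \<Longrightarrow> z' \<in> Arr F \<Longrightarrow> Dom F z' = Dom F z \<Longrightarrow> Cod F z = Dom F c \<Longrightarrow>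
      Cod F z' = Dom F c \<Longrightarrow> Ar P z = Ar P z' \<Longrightarrow> c \<cdot>\<^bsub>F\<^esub> z = c \<cdot>\<^bsub>F\<^esub> z' \<Longrightarrow> z = z'"
  shows "c \<in> cart"
  unfolding cartesian_def
proof (intro CollectI conjI ballI allI impI; (elim conjE)?)
  fix x w assume *: "x \<in> Arr F" "Cod F x = Cod F c" "w \<in> hom E (Ob P (Dom F x)) (Ob P (Dom F c))"
    "Ar P c \<cdot>\<^bsub>E\<^esub> w = Ar P x"
  obtain z where z: "z \<in> hom F (Dom F x) (Dom F c)" "Ar P z = w" "c \<cdot>\<^bsub>F\<^esub> z = x"
    using assms(2)[OF *] by blast
  show "\<exists>!z. z \<in> hom F (Dom F x) (Dom F c) \<and> Ar P z = w \<and> c \<cdot>\<^bsub>F\<^esub> z = x"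
    by (rule ex1I[of _ z]) (use z assms(3) in auto)
qed (use assms in auto)

lemma cart_idt: "X \<in> Obj F \<Longrightarrow> Idt F X \<in> cart"
  by (rule cartI) auto

lemma cart_cmp:
  assumes b: "b \<in> cart" and c: "c \<in> cart" and bc: "Cod F b = Dom F c"
  shows "c \<cdot>\<^bsub>F\<^esub> b \<in> cart"
proof (rule cartI)
  have [simp]: "b \<in> Arr F" "c \<in> Arr F" using cart_Arr b c by auto
  note [simp] = bc
  show "c \<cdot>\<^bsub>F\<^esub> b \<in> Arr F" by simp
  fix x w assume x: "x \<in> Arr F" "Cod F x = Cod F (c \<cdot>\<^bsub>F\<^esub> b)"
    "w \<in> hom E (Ob P (Dom F x)) (Ob P (Dom F (c \<cdot>\<^bsub>F\<^esub> b)))" "Ar P (c \<cdot>\<^bsub>F\<^esub> b) \<cdot>\<^bsub>E\<^esub> w = Ar P x"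
  obtain y where y: "y \<in> hom F (Dom F x) (Dom F c)" "Ar P y = Ar P b \<cdot>\<^bsub>E\<^esub> w" "c \<cdot>\<^bsub>F\<^esub> y = x"
    by (rule cart_ex[OF c, of x "Ar P b \<cdot>\<^bsub>E\<^esub> w"]) (use x in auto)
  obtain z where z: "z \<in> hom F (Dom F y) (Dom F b)" "Ar P z = w" "b \<cdot>\<^bsub>F\<^esub> z = y"
    by (rule cart_ex[OF b, of y w]) (use x y in auto)
  show "\<exists>z. z \<in> hom F (Dom F x) (Dom F (c \<cdot>\<^bsub>F\<^esub> b)) \<and> Ar P z = w \<and> (c \<cdot>\<^bsub>F\<^esub> b) \<cdot>\<^bsub>F\<^esub> z = x"
    by (rule exI[of _ z]) (use y z in auto)
next
  have [simp]: "b \<in> Arr F" "c \<in> Arr F" using cart_Arr b c by auto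
  note [simp] = bc
  fix z z' assume *: "z \<in> Arr F" "z' \<in> Arr F" "Dom F z' = Dom F z" "Cod F z = Dom F (c \<cdot>\<^bsub>F\<^esub> b)"
    "Cod F z' = Dom F (c \<cdot>\<^bsub>F\<^esub> b)" "Ar P z = Ar P z'" "(c \<cdot>\<^bsub>F\<^esub> b) \<cdot>\<^bsub>F\<^esub> z = (c \<cdot>\<^bsub>F\<^esub> b) \<cdot>\<^bsub>F\<^esub> z'"
  have "b \<cdot>\<^bsub>F\<^esub> z = b \<cdot>\<^bsub>F\<^esub> z'"
    by (rule cart_eqI[OF c, where Z = "Dom F z"]) (use * in simp_all)
  then show "z = z'"
    using cart_eqI[OF b, of z "Dom F z" z'] * by simp
qed

lemma cart_cancel:
  assumes c: "c \<in> cart" and cb: "c \<cdot>\<^bsub>F\<^esub> b \<in> cart" and b [simp]: "b \<in> Arr F" "Cod F b = Dom F c"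
  shows "b \<in> cart"
proof (rule cartI[OF b(1)])
  have [simp]: "c \<in> Arr F" using cart_Arr c by auto
  fix x w assume x: "x \<in> Arr F" "Cod F x = Cod F b"
    "w \<in> hom E (Ob P (Dom F x)) (Ob P (Dom F b))" "Ar P b \<cdot>\<^bsub>E\<^esub> w = Ar P x"
  obtain z where z: "z \<in> hom F (Dom F (c \<cdot>\<^bsub>F\<^esub> x)) (Dom F (c \<cdot>\<^bsub>F\<^esub> b))" "Ar P z = w"
    "(c \<cdot>\<^bsub>F\<^esub> b) \<cdot>\<^bsub>F\<^esub> z = c \<cdot>\<^bsub>F\<^esub> x"
    by (rule cart_ex[OF cb, of "c \<cdot>\<^bsub>F\<^esub> x" w]) (use x in auto)
  have "b \<cdot>\<^bsub>F\<^esub> z = x"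
    by (rule cart_eqI[OF c, where Z = "Dom F x"]) (use x z in auto)
  then show "\<exists>z. z \<in> hom F (Dom F x) (Dom F b) \<and> Ar P z = w \<and> b \<cdot>\<^bsub>F\<^esub> z = x"
    using x z by (intro exI[of _ z]) simp
next
  have [simp]: "c \<in> Arr F" using cart_Arr c by auto
  fix z z' assume *: "z \<in> Arr F" "z' \<in> Arr F" "Dom F z' = Dom F z" "Cod F z = Dom F b"
    "Cod F z' = Dom F b" "Ar P z = Ar P z'" "b \<cdot>\<^bsub>F\<^esub> z = b \<cdot>\<^bsub>F\<^esub> z'"
  then have "c \<cdot>\<^bsub>F\<^esub> b \<cdot>\<^bsub>F\<^esub> z = c \<cdot>\<^bsub>F\<^esub> b \<cdot>\<^bsub>F\<^esub> z'" by simp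
  with * show "z = z'"
    using cart_eqI[OF cb, of z "Dom F z" z'] by simp
qed

lemma iso_cart:
  assumes b [simp]: "b \<in> Arr F" "c \<in> Arr F" "Dom F c = Cod F b" "Cod F c = Dom F b"
    and bc: "b \<cdot>\<^bsub>F\<^esub> c = Idt F (Cod F b)" and cb: "c \<cdot>\<^bsub>F\<^esub> b = Idt F (Dom F b)"
  shows "b \<in> cart"
proof (rule cartI[OF b(1)])
  have PbPc: "Ar P c \<cdot>\<^bsub>E\<^esub> Ar P b = Idt E (Ob P (Dom F b))"
    using P_simps(6)[of b c] cb by simp
  fix x w assume x: "x \<in> Arr F" "Cod F x = Cod F b"
    "w \<in> hom E (Ob P (Dom F x)) (Ob P (Dom F b))" "Ar P b \<cdot>\<^bsub>E\<^esub> w = Ar P x"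
  have "(Ar P c \<cdot>\<^bsub>E\<^esub> Ar P b) \<cdot>\<^bsub>E\<^esub> w = Ar P c \<cdot>\<^bsub>E\<^esub> Ar P x" using x by simp
  then have "Ar P (c \<cdot>\<^bsub>F\<^esub> x) = w" using x unfolding PbPc by simp
  moreover have "(b \<cdot>\<^bsub>F\<^esub> c) \<cdot>\<^bsub>F\<^esub> x = x" using x unfolding bc by simp
  ultimately show "\<exists>z. z \<in> hom F (Dom F x) (Dom F b) \<and> Ar P z = w \<and> b \<cdot>\<^bsub>F\<^esub> z = x"
    using x by (intro exI[of _ "c \<cdot>\<^bsub>F\<^esub> x"]) simp
next
  fix z z' assume *: "z \<in> Arr F" "z' \<in> Arr F" "Cod F z = Dom F b" "Cod F z' = Dom F b"
    "b \<cdot>\<^bsub>F\<^esub> z = b \<cdot>\<^bsub>F\<^esub> z'"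
  then have "(c \<cdot>\<^bsub>F\<^esub> b) \<cdot>\<^bsub>F\<^esub> z = (c \<cdot>\<^bsub>F\<^esub> b) \<cdot>\<^bsub>F\<^esub> z'" by simp
  then show "z = z'" using * unfolding cb by simp
qed

lemma cl_simps [simp]:
  assumes "X \<in> Obj F" "h \<in> Arr E" "Cod E h = Ob P X"
  shows "cl h X \<in> cart" "cl h X \<in> Arr F" "Cod F (cl h X) = X" "Ar P (cl h X) = h"
    "Ob P (Dom F (cl h X)) = Dom E h"
proof -
  show 1: "cl h X \<in> cart" "Cod F (cl h X) = X" "Ar P (cl h X) = h"
    using fib assms by (auto simp: fibration_def)
  then show 2: "cl h X \<in> Arr F" using cart_Arr by blast
  from P_simps(3)[OF 2] 1(3) show "Ob P (Dom F (cl h X)) = Dom E h" by simp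
qed

text \<open>The comma category of \<open>P\<close> over the identity of \<open>E\<close>.\<close>

definition gcat :: "('p \<times> 'a, ('p \<times> 'a) \<times> ('b \<times> 'a) \<times> ('p \<times> 'a)) cat" where
  "gcat =
     \<lparr>Obj = {(Z, p). Z \<in> Obj F \<and> p \<in> Arr E \<and> Dom E p = Ob P Z},
      Arr = {((Z, p), (z, k), (Z', p')). Z \<in> Obj F \<and> p \<in> Arr E \<and> Dom E p = Ob P Z \<and>
        Z' \<in> Obj F \<and> p' \<in> Arr E \<and> Dom E p' = Ob P Z' \<and>
        z \<in> hom F Z Z' \<and> k \<in> hom E (Cod E p) (Cod E p') \<and> k \<cdot>\<^bsub>E\<^esub> p = p' \<cdot>\<^bsub>E\<^esub> Ar P z},
      Dom = fst,
      Cod = snd \<circ> snd,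
      Idt = (\<lambda>(Z, p). ((Z, p), (Idt F Z, Idt E (Cod E p)), (Z, p))),
      Cmp = (\<lambda>(_, (z', k'), y) (x, (z, k), _). (x, (z' \<cdot>\<^bsub>F\<^esub> z, k' \<cdot>\<^bsub>E\<^esub> k), y))\<rparr>"

definition fpart :: "('p \<times> 'a) \<times> ('b \<times> 'a) \<times> ('p \<times> 'a) \<Rightarrow> 'b" where
  "fpart t = fst (fst (snd t))"

definition epart :: "('p \<times> 'a) \<times> ('b \<times> 'a) \<times> ('p \<times> 'a) \<Rightarrow> 'a" where
  "epart t = snd (fst (snd t))"

lemma parts_simps [simp]: "fpart (x, (z, k), y) = z" "epart (x, (z, k), y) = k"
  by (simp_all add: fpart_def epart_def)

lemma Obj_gcat [simp]: "(Z, p) \<in> Obj gcat \<longleftrightarrow> Z \<in> Obj F \<and> p \<in> Arr E \<and> Dom E p = Ob P Z"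
  by (simp add: gcat_def)

lemma Obj_gcatD:
  assumes "X \<in> Obj gcat"
  shows "fst X \<in> Obj F" "snd X \<in> Arr E" "Dom E (snd X) = Ob P (fst X)"
  using assms by (auto simp: gcat_def)

lemma Arr_gcat: "((Z, p), (z, k), (Z', p')) \<in> Arr gcat \<longleftrightarrow>
    Z \<in> Obj F \<and> p \<in> Arr E \<and> Dom E p = Ob P Z \<and>
    Z' \<in> Obj F \<and> p' \<in> Arr E \<and> Dom E p' = Ob P Z' \<and>
    z \<in> hom F Z Z' \<and> k \<in> hom E (Cod E p) (Cod E p') \<and> k \<cdot>\<^bsub>E\<^esub> p = p' \<cdot>\<^bsub>E\<^esub> Ar P z"
  by (simp add: gcat_def)

lemma Dom_gcat [simp]: "Dom gcat (x, t, y) = x" and Cod_gcat [simp]: "Cod gcat (x, t, y) = y"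
  by (simp_all add: gcat_def)

lemma Idt_gcat [simp]: "Idt gcat (Z, p) = ((Z, p), (Idt F Z, Idt E (Cod E p)), (Z, p))"
  by (simp add: gcat_def)

lemma parts_idt [simp]:
  "fpart (Idt gcat x) = Idt F (fst x)" "epart (Idt gcat x) = Idt E (Cod E (snd x))"
  "Dom gcat (Idt gcat x) = x" "Cod gcat (Idt gcat x) = x"
  by (cases x, simp)+

lemma Cmp_gcat [simp]:
  "(x', (z', k'), y) \<cdot>\<^bsub>gcat\<^esub> (x, (z, k), y') = (x, (z' \<cdot>\<^bsub>F\<^esub> z, k' \<cdot>\<^bsub>E\<^esub> k), y)"
  by (simp add: gcat_def)

lemma Arr_gcatD:
  assumes "t \<in> Arr gcat"
  shows "fpart t \<in> Arr F" "Dom F (fpart t) = fst (Dom gcat t)" "Cod F (fpart t) = fst (Cod gcat t)"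
    "epart t \<in> Arr E" "Dom E (epart t) = Cod E (snd (Dom gcat t))"
    "Cod E (epart t) = Cod E (snd (Cod gcat t))"
    "epart t \<cdot>\<^bsub>E\<^esub> snd (Dom gcat t) = snd (Cod gcat t) \<cdot>\<^bsub>E\<^esub> Ar P (fpart t)"
    "t = (Dom gcat t, (fpart t, epart t), Cod gcat t)"
    "Dom gcat t \<in> Obj gcat" "Cod gcat t \<in> Obj gcat"
  using assms by (auto simp: gcat_def)

lemma parts_cmp [simp]: "fpart (t \<cdot>\<^bsub>gcat\<^esub> s) = fpart t \<cdot>\<^bsub>F\<^esub> fpart s"
    "epart (t \<cdot>\<^bsub>gcat\<^esub> s) = epart t \<cdot>\<^bsub>E\<^esub> epart s"
    "Dom gcat (t \<cdot>\<^bsub>gcat\<^esub> s) = Dom gcat s" "Cod gcat (t \<cdot>\<^bsub>gcat\<^esub> s) = Cod gcat t"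
  by (auto simp: gcat_def fpart_def epart_def split: prod.splits)

lemma gcat_eqI:
  assumes "t \<in> Arr gcat" "s \<in> Arr gcat" "Dom gcat t = Dom gcat s" "Cod gcat t = Cod gcat s"
    "fpart t = fpart s" "epart t = epart s"
  shows "t = s"
  using Arr_gcatD(8)[OF assms(1)] Arr_gcatD(8)[OF assms(2)] assms(3-) by simp

lemma ArrI_gcat:
  assumes "X \<in> Obj gcat" "Y \<in> Obj gcat" "z \<in> hom F (fst X) (fst Y)"
    "k \<in> hom E (Cod E (snd X)) (Cod E (snd Y))" "k \<cdot>\<^bsub>E\<^esub> snd X = snd Y \<cdot>\<^bsub>E\<^esub> Ar P z"
  shows "(X, (z, k), Y) \<in> Arr gcat"
  using assms by (cases X; cases Y) (auto simp: Arr_gcat)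

lemma category_gcat: "category gcat"
proof
  fix a b c x y z w
  show "Dom gcat a \<in> Obj gcat" "Cod gcat a \<in> Obj gcat" if "a \<in> Arr gcat"
    using Arr_gcatD[OF that] by auto
  show "Idt gcat x \<in> hom gcat x x" if "x \<in> Obj gcat"
    using that by (cases x) (simp add: Arr_gcat)
  show cmp: "b \<cdot>\<^bsub>gcat\<^esub> a \<in> hom gcat x z" if "a \<in> hom gcat x y" "b \<in> hom gcat y z" for a b x y z
  proof -
    have ab: "a \<in> Arr gcat" "b \<in> Arr gcat" "Cod gcat a = y" "Dom gcat b = y" "Dom gcat a = x" "Cod gcat b = z"
      using that by auto
    note [simp] = Arr_gcatD(1-6)[OF ab(1)] Arr_gcatD(1-6)[OF ab(2)] ab
    note o [simp] = Arr_gcatD(9,10)[OF ab(1)] Arr_gcatD(9,10)[OF ab(2)]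
    note [simp] = Obj_gcatD[of x] Obj_gcatD[of y] Obj_gcatD[of z]
    have xyz [simp]: "x \<in> Obj gcat" "y \<in> Obj gcat" "z \<in> Obj gcat" using o by auto
    have "(epart b \<cdot>\<^bsub>E\<^esub> snd y) \<cdot>\<^bsub>E\<^esub> Ar P (fpart a) = (snd z \<cdot>\<^bsub>E\<^esub> Ar P (fpart b)) \<cdot>\<^bsub>E\<^esub> Ar P (fpart a)"
      using Arr_gcatD(7)[OF ab(2)] by simp
    moreover have "epart b \<cdot>\<^bsub>E\<^esub> (epart a \<cdot>\<^bsub>E\<^esub> snd x) = epart b \<cdot>\<^bsub>E\<^esub> (snd y \<cdot>\<^bsub>E\<^esub> Ar P (fpart a))"
      using Arr_gcatD(7)[OF ab(1)] by simp
    ultimately have "(x, (fpart b \<cdot>\<^bsub>F\<^esub> fpart a, epart b \<cdot>\<^bsub>E\<^esub> epart a), z) \<in> Arr gcat"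
      by (intro ArrI_gcat) simp_all
    moreover have "b \<cdot>\<^bsub>gcat\<^esub> a = (x, (fpart b \<cdot>\<^bsub>F\<^esub> fpart a, epart b \<cdot>\<^bsub>E\<^esub> epart a), z)"
      by (subst Arr_gcatD(8)[OF ab(1)], subst Arr_gcatD(8)[OF ab(2)]) simp
    ultimately show ?thesis by simp
  qed
  show "Idt gcat y \<cdot>\<^bsub>gcat\<^esub> a = a" if "a \<in> hom gcat x y"
  proof (rule gcat_eqI)
    show "Idt gcat y \<cdot>\<^bsub>gcat\<^esub> a \<in> Arr gcat"
      using cmp[OF that, of "Idt gcat y" y] that Arr_gcatD(10)[of a] by (cases y) (auto simp: Arr_gcat simp del: parts_idt)
  qed (use that Arr_gcatD(1-6)[of a] in auto)
  show "a \<cdot>\<^bsub>gcat\<^esub> Idt gcat x = a" if "a \<in> hom gcat x y"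
  proof (rule gcat_eqI)
    show "a \<cdot>\<^bsub>gcat\<^esub> Idt gcat x \<in> Arr gcat"
      using cmp[of "Idt gcat x" x x a y] that Arr_gcatD(9)[of a] by (cases x) (auto simp: Arr_gcat)
  qed (use that Arr_gcatD(1-6)[of a] in auto)
  show "(c \<cdot>\<^bsub>gcat\<^esub> b) \<cdot>\<^bsub>gcat\<^esub> a = c \<cdot>\<^bsub>gcat\<^esub> b \<cdot>\<^bsub>gcat\<^esub> a"
    if "a \<in> hom gcat w x" "b \<in> hom gcat x y" "c \<in> hom gcat y z"
  proof (rule gcat_eqI)
    show "(c \<cdot>\<^bsub>gcat\<^esub> b) \<cdot>\<^bsub>gcat\<^esub> a \<in> Arr gcat" "c \<cdot>\<^bsub>gcat\<^esub> b \<cdot>\<^bsub>gcat\<^esub> a \<in> Arr gcat"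
      using cmp[OF that(1) cmp[OF that(2,3)]] cmp[OF cmp[OF that(1,2)] that(3)] by auto
  qed (use that Arr_gcatD(1-6)[of a] Arr_gcatD(1-6)[of b] Arr_gcatD(1-6)[of c] in auto)
qed

sublocale G: category gcat
  by (rule category_gcat)

section \<open>Cartesian morphisms and colimits in the comma category\<close>

definition GN where "GN = {t \<in> Arr gcat. fpart t \<in> cart}"

definition GM where
  "GM M = {t \<in> Arr gcat. fpart t \<in> cart \<and> Ar P (fpart t) \<in> M \<and>
     epart t = Idt E (Cod E (snd (Dom gcat t)))}"

definition FP :: "('p \<times> 'a, ('p \<times> 'a) \<times> ('b \<times> 'a) \<times> ('p \<times> 'a), 'p, 'b) funct" where
  "FP = \<lparr>Ob = fst, Ar = fpart\<rparr>"

definition PE :: "('p \<times> 'a, ('p \<times> 'a) \<times> ('b \<times> 'a) \<times> ('p \<times> 'a), 'o, 'a) funct" where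
  "PE = \<lparr>Ob = \<lambda>X. Ob P (fst X), Ar = \<lambda>t. Ar P (fpart t)\<rparr>"

lemma FP_simps [simp]: "Ob FP X = fst X" "Ar FP t = fpart t"
  by (simp_all add: FP_def)

lemma PE_simps [simp]: "Ob PE X = Ob P (fst X)" "Ar PE t = Ar P (fpart t)"
  by (simp_all add: PE_def)

lemma wide_GN: "wide_subcategory gcat GN"
  using Arr_gcatD by (auto simp: wide_subcategory_def GN_def cart_idt Obj_gcatD intro!: cart_cmp)

lemma GMD:
  assumes "t \<in> GM M"
  shows "t \<in> Arr gcat" "fpart t \<in> cart" "Ar P (fpart t) \<in> M"
    "epart t = Idt E (Cod E (snd (Dom gcat t)))"
    "Cod E (snd (Cod gcat t)) = Cod E (snd (Dom gcat t))"
    "snd (Cod gcat t) \<cdot>\<^bsub>E\<^esub> Ar P (fpart t) = snd (Dom gcat t)"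
proof -
  show t: "t \<in> Arr gcat" "fpart t \<in> cart" "Ar P (fpart t) \<in> M"
    and e: "epart t = Idt E (Cod E (snd (Dom gcat t)))"
    using assms by (auto simp: GM_def)
  note T = Arr_gcatD(1-7,9,10)[OF t(1)] Obj_gcatD[OF Arr_gcatD(9)[OF t(1)]]
  show "Cod E (snd (Cod gcat t)) = Cod E (snd (Dom gcat t))"
    using T e by (metis E.idt_simps(3) E.obj_simps(2))
  show "snd (Cod gcat t) \<cdot>\<^bsub>E\<^esub> Ar P (fpart t) = snd (Dom gcat t)"
    using T e by (metis E.idt_cmp)
qed

lemma wide_GM:
  assumes M: "wide_subcategory E M"
  shows "wide_subcategory gcat (GM M)"
  unfolding wide_subcategory_def
proof (intro conjI ballI impI)
  show "GM M \<subseteq> Arr gcat" by (auto simp: GM_def)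
  show "Idt gcat x \<in> GM M" if x: "x \<in> Obj gcat" for x
    using M G.idt_simps[OF x] Obj_gcatD[OF x] by (simp add: GM_def cart_idt wide_subcategory_def)
  fix t s assume t: "t \<in> GM M" and s: "s \<in> GM M" and ts: "Cod gcat t = Dom gcat s"
  note T = GMD[OF t] GMD[OF s]
  note A = Arr_gcatD(1-6,9,10)[OF T(1)] Arr_gcatD(1-6,9,10)[OF T(7)] Obj_gcatD[OF Arr_gcatD(9)[OF T(1)]]
  have "Ar P (fpart s) \<cdot>\<^bsub>E\<^esub> Ar P (fpart t) \<in> M"
    using M T A ts by (simp add: wide_subcategory_def)
  moreover have "fpart s \<cdot>\<^bsub>F\<^esub> fpart t \<in> cart" using T A ts by (intro cart_cmp) auto
  moreover have "s \<cdot>\<^bsub>gcat\<^esub> t \<in> Arr gcat" using T ts by simp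
  moreover have "epart s \<cdot>\<^bsub>E\<^esub> epart t = Idt E (Cod E (snd (Dom gcat t)))"
    using T A ts by simp
  ultimately show "s \<cdot>\<^bsub>gcat\<^esub> t \<in> GM M"
    using T A ts by (simp add: GM_def)
qed

lemma GM_GN: "GM M \<subseteq> GN"
  by (auto simp: GM_def GN_def)

text \<open>The composites with the legs form a cocone of cartesian maps. The colimit among
  cartesian maps factors it by a cartesian map, and uniqueness in \<open>F\<close> identifies that
  map with \<open>z\<close>. Detection of \<open>GN\<close> rests on this.\<close>

lemma mediator_cart:
  assumes c: "is_colimit K (wide F cart) e e0 \<epsilon>" and f: "is_colimit K F e e0 \<epsilon>"
    and e: "is_functor K (wide F cart) e" and K: "\<And>t. t \<in> Arr K \<Longrightarrow> Dom K t \<in> Obj K \<and> Cod K t \<in> Obj K"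
    and z: "z \<in> Arr F" "Dom F z = e0" "\<And>k. k \<in> Obj K \<Longrightarrow> z \<cdot>\<^bsub>F\<^esub> \<epsilon> k \<in> cart"
  shows "z \<in> cart"
proof -
  have eF: "Dom K t \<in> Obj K \<and> Cod K t \<in> Obj K \<and> Ar e t \<in> hom F (Ob e (Dom K t)) (Ob e (Cod K t))"
    if "t \<in> Arr K" for t
    using functorD(2-4)[OF e that] K[OF that] cart_Arr by simp
  have "is_cocone K F e (Cod F z) (\<lambda>k. z \<cdot>\<^bsub>F\<^esub> \<epsilon> k)"
    by (rule F.cocone_cmp[OF _ _ eF]) (use f z in \<open>simp_all add: is_colimit_def\<close>)
  then have "is_cocone K (wide F cart) e (Cod F z) (\<lambda>k. z \<cdot>\<^bsub>F\<^esub> \<epsilon> k)"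
    using z(3) by (simp add: is_cocone_def)
  then obtain y where y: "y \<in> cart" "Dom F y = e0" "Cod F y = Cod F z"
    "\<And>k. k \<in> Obj K \<Longrightarrow> y \<cdot>\<^bsub>F\<^esub> \<epsilon> k = z \<cdot>\<^bsub>F\<^esub> \<epsilon> k"
    using c unfolding is_colimit_def by (metis in_hom wide_simps(2,3,4,6))
  have "z = y"
    by (rule F.colimit_eqI[OF f _ _ eF, of _ "Cod F z"]) (use z y cart_Arr in auto)
  with y show ?thesis by simp
qed

text \<open>The first half of the Van Kampen property provides a colimit among cartesian maps, and
  the second half makes the same cocone a colimit in \<open>F\<close>; both universal properties are
  used afterwards.\<close>

lemma van_kampen_colimit:
  assumes vk: "van_kampen K E F P b b0 \<beta>" and e: "is_functor K (wide F cart) e" "functor_eq K (P \<circ>\<^sub>F e) b"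
  obtains e0 \<epsilon> where "is_colimit K (wide F cart) e e0 \<epsilon>" "Ob P e0 = b0"
    "\<And>k. k \<in> Obj K \<Longrightarrow> Ar P (\<epsilon> k) = \<beta> k" "is_colimit K F e e0 \<epsilon>"
proof -
  obtain e0 \<epsilon> where c: "is_colimit K (wide F cart) e e0 \<epsilon>" "Ob P e0 = b0" "\<forall>k \<in> Obj K. Ar P (\<epsilon> k) = \<beta> k"
    using vk e unfolding van_kampen_def by blast
  then have "is_cocone K (wide F cart) e e0 \<epsilon>" by (simp add: is_colimit_def)
  then have "is_colimit K F e e0 \<epsilon>"
    using vk e c unfolding van_kampen_def by blast
  with c that show ?thesis by blast
qed

text \<open>A colimit in the comma category is a colimit in \<open>F\<close> over one in
  \<open>E\<close>, together with a map from the latter to the base. The maps of the chain are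
  identities on the base, so the structure maps form a cocone on the chain in \<open>E\<close> and
  induce this last map.\<close>

lemma vk_chain_colimit:
  assumes b: "is_functor (poset_cat (one_plus r)) (wide gcat (GM M)) b"
    and col: "is_colimit (poset_cat (one_plus r)) E (PE \<circ>\<^sub>F b) c \<beta>"
    and vk: "van_kampen (poset_cat (one_plus r)) E F P (PE \<circ>\<^sub>F b) c \<beta>"
  obtains x \<iota> where "is_colimit (poset_cat (one_plus r)) gcat b x \<iota>" "Ob PE x = c"
    "\<And>k. k \<in> Field (one_plus r) \<Longrightarrow> \<iota> k \<in> GN"
    "\<And>k. k \<in> Field (one_plus r) \<Longrightarrow> epart (\<iota> k) = Idt E (Cod E (snd (Ob b k)))"
    "\<And>k. k \<in> Field (one_plus r) \<Longrightarrow> Ar PE (\<iota> k) = \<beta> k"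
    "G.detects GN \<iota> (Field (one_plus r)) x"
proof -
  let ?K = "poset_cat (one_plus r)"
  have Kt: "fst t \<in> Field (one_plus r) \<and> snd t \<in> Field (one_plus r)" if "t \<in> one_plus r" for t
    using that by (cases t) (metis FieldI1 FieldI2 fst_conv snd_conv)
  have K0: "(None, k) \<in> one_plus r" if "k \<in> Field (one_plus r)" for k
    using that by auto
  have KN: "None \<in> Field (one_plus r)" by simp
  have bO: "Ob b k \<in> Obj gcat" if "k \<in> Field (one_plus r)" for k
    using functorD(1)[OF b, of k] that by simp
  have bA: "Ar b t \<in> GM M" "Dom gcat (Ar b t) = Ob b (fst t)" "Cod gcat (Ar b t) = Ob b (snd t)"
    if "t \<in> one_plus r" for t
    using functorD(2-4)[OF b, of t] that by simp_all
  note bA' = GMD[OF bA(1)]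
  note bA'' = Arr_gcatD(1-6)[OF bA'(1)]
  note bO' = Obj_gcatD[OF bO]
  have e: "is_functor ?K (wide F cart) (FP \<circ>\<^sub>F b)"
    unfolding is_functor_def
  proof (intro conjI ballI impI)
    show "Ob (FP \<circ>\<^sub>F b) k \<in> Obj (wide F cart)" if "k \<in> Obj ?K" for k
      using bO' that by simp
    show "Ar (FP \<circ>\<^sub>F b) t \<in> hom (wide F cart) (Ob (FP \<circ>\<^sub>F b) (Dom ?K t)) (Ob (FP \<circ>\<^sub>F b) (Cod ?K t))"
      if "t \<in> Arr ?K" for t
      using that bA bA' bA'' by simp
    show "Ar (FP \<circ>\<^sub>F b) (Idt ?K k) = Idt (wide F cart) (Ob (FP \<circ>\<^sub>F b) k)" if "k \<in> Obj ?K" for k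
      using that functorD(5)[OF b, of k] by simp
    show "Ar (FP \<circ>\<^sub>F b) (s \<cdot>\<^bsub>?K\<^esub> t) = Ar (FP \<circ>\<^sub>F b) s \<cdot>\<^bsub>wide F cart\<^esub> Ar (FP \<circ>\<^sub>F b) t"
      if "t \<in> Arr ?K" "s \<in> Arr ?K" "Cod ?K t = Dom ?K s" for t s
      using that functorD(6)[OF b, of t s] by simp
  qed
  have eF: "Dom ?K t \<in> Obj ?K \<and> Cod ?K t \<in> Obj ?K \<and>
      Ar (FP \<circ>\<^sub>F b) t \<in> hom F (Ob (FP \<circ>\<^sub>F b) (Dom ?K t)) (Ob (FP \<circ>\<^sub>F b) (Cod ?K t))"
    if "t \<in> Arr ?K" for t
    using that bA bA' bA'' Kt by simp
  have eE: "Dom ?K t \<in> Obj ?K \<and> Cod ?K t \<in> Obj ?K \<and>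
      Ar (PE \<circ>\<^sub>F b) t \<in> hom E (Ob (PE \<circ>\<^sub>F b) (Dom ?K t)) (Ob (PE \<circ>\<^sub>F b) (Cod ?K t))"
    if "t \<in> Arr ?K" for t
    using that bA bA' bA'' Kt by simp
  have "functor_eq ?K (P \<circ>\<^sub>F (FP \<circ>\<^sub>F b)) (PE \<circ>\<^sub>F b)"
    by (simp add: functor_eq_def)
  then obtain e0 \<epsilon> where cc: "is_colimit ?K (wide F cart) (FP \<circ>\<^sub>F b) e0 \<epsilon>"
    and over: "Ob P e0 = c" "\<And>k. k \<in> Field (one_plus r) \<Longrightarrow> Ar P (\<epsilon> k) = \<beta> k"
    and cF: "is_colimit ?K F (FP \<circ>\<^sub>F b) e0 \<epsilon>"
    using van_kampen_colimit[OF vk e] unfolding poset_cat_simps(1) by blast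
  have eps: "e0 \<in> Obj F" "\<And>k. k \<in> Field (one_plus r) \<Longrightarrow> \<epsilon> k \<in> cart"
    "\<And>k. k \<in> Field (one_plus r) \<Longrightarrow> Dom F (\<epsilon> k) = fst (Ob b k)"
    "\<And>k. k \<in> Field (one_plus r) \<Longrightarrow> Cod F (\<epsilon> k) = e0"
    "\<And>t. t \<in> one_plus r \<Longrightarrow> \<epsilon> (snd t) \<cdot>\<^bsub>F\<^esub> fpart (Ar b t) = \<epsilon> (fst t)"
    using cc by (auto simp: is_colimit_def is_cocone_def)
  have epsA: "\<epsilon> k \<in> Arr F" if "k \<in> Field (one_plus r)" for k using eps(2)[OF that] cart_Arr by blast
  \<comment> \<open>All objects of the chain lie over the same base, read off at
    \<open>None\<close>, the least element of \<open>1 + r\<close>.\<close>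
  define B where "B = Cod E (snd (Ob b None))"
  have B: "Cod E (snd (Ob b k)) = B" if "k \<in> Field (one_plus r)" for k
    using bA'(5)[OF K0[OF that]] bA(2,3)[OF K0[OF that]] by (simp add: B_def)
  have B' [simp]: "B \<in> Obj E" using bO'(2)[OF KN] by (simp add: B_def)
  have "is_cocone ?K E (PE \<circ>\<^sub>F b) B (\<lambda>k. snd (Ob b k))"
    unfolding is_cocone_def using B bO' B' bA'(6) bA by simp
  then have "\<exists>!a. a \<in> hom E c B \<and> (\<forall>k \<in> Obj ?K. a \<cdot>\<^bsub>E\<^esub> \<beta> k = snd (Ob b k))"
    using col unfolding is_colimit_def by blast
  then obtain pc where pc: "pc \<in> hom E c B"
    and pcb: "\<And>k. k \<in> Field (one_plus r) \<Longrightarrow> pc \<cdot>\<^bsub>E\<^esub> \<beta> k = snd (Ob b k)"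
    unfolding poset_cat_simps(1) by blast
  define x where "x = (e0, pc)"
  have x: "x \<in> Obj gcat" using eps(1) pc over by (simp add: x_def)
  define \<iota> where "\<iota> k = (Ob b k, (\<epsilon> k, Idt E B), x)" for k
  have \<iota>: "\<iota> k \<in> Arr gcat" if "k \<in> Field (one_plus r)" for k
    unfolding \<iota>_def
  proof (rule ArrI_gcat[OF bO[OF that] x])
    show "\<epsilon> k \<in> hom F (fst (Ob b k)) (fst x)" using eps that epsA by (simp add: x_def)
    show "Idt E B \<in> hom E (Cod E (snd (Ob b k))) (Cod E (snd x))"
      using B[OF that] pc by (simp add: x_def)
    show "Idt E B \<cdot>\<^bsub>E\<^esub> snd (Ob b k) = snd x \<cdot>\<^bsub>E\<^esub> Ar P (\<epsilon> k)"
      using bO'(2)[OF that] B[OF that] over(2)[OF that] pcb[OF that] by (simp add: x_def)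
  qed
  have \<iota>' [simp]: "fpart (\<iota> k) = \<epsilon> k" "epart (\<iota> k) = Idt E B" "Dom gcat (\<iota> k) = Ob b k" "Cod gcat (\<iota> k) = x" for k
    by (simp_all add: \<iota>_def)
  have co: "is_cocone ?K gcat b x \<iota>"
    unfolding is_cocone_def
  proof (intro conjI ballI)
    show "x \<in> Obj gcat" by (fact x)
    show "\<iota> k \<in> hom gcat (Ob b k) x" if "k \<in> Obj ?K" for k using \<iota> that by simp
    fix t assume "t \<in> Arr ?K"
    then have t: "t \<in> one_plus r" by simp
    note A = Kt[OF t] bA[OF t] bA'(1)[OF t]
    show "\<iota> (Cod ?K t) \<cdot>\<^bsub>gcat\<^esub> Ar b t = \<iota> (Dom ?K t)"
      by (rule gcat_eqI)
        (use A \<iota> eps(5)[OF t] bA'(4)[OF t] B in simp_all)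
  qed
  have "is_colimit ?K gcat b x \<iota>"
    unfolding is_colimit_def
  proof (intro conjI allI impI)
    fix d \<nu> assume nu: "is_cocone ?K gcat b d \<nu>"
    have nuA: "\<nu> k \<in> Arr gcat" "Dom gcat (\<nu> k) = Ob b k" "Cod gcat (\<nu> k) = d"
      if "k \<in> Field (one_plus r)" for k
      using nu that by (auto simp: is_cocone_def)
    note nuA' = Arr_gcatD(1-7)[OF nuA(1)]
    have nut: "\<nu> (snd t) \<cdot>\<^bsub>gcat\<^esub> Ar b t = \<nu> (fst t)" if "t \<in> one_plus r" for t
      using nu that by (simp add: is_cocone_def)
    have d: "d \<in> Obj gcat" using nu by (simp add: is_cocone_def)
    note d' = Obj_gcatD[OF d]
    let ?h = "epart (\<nu> None)"
    \<comment> \<open>The transitions are identities on the base, so all legs of a cocone have the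
      same base component.\<close>
    have h: "epart (\<nu> k) = ?h" if k: "k \<in> Field (one_plus r)" for k
    proof -
      have "epart (\<nu> k) \<cdot>\<^bsub>E\<^esub> epart (Ar b (None, k)) = ?h"
        using arg_cong[OF nut[OF K0[OF k]], of epart] by simp
      moreover have "epart (Ar b (None, k)) = Idt E (Cod E (snd (Ob b k)))"
        using bA'(4)[OF K0[OF k]] bA(2)[OF K0[OF k]] B[OF k] by (simp add: B_def)
      ultimately show ?thesis using nuA' nuA k by simp
    qed
    have hA: "?h \<in> hom E B (Cod E (snd d))"
      using nuA'(4-6)[OF KN] nuA[OF KN] by (simp add: B_def)
    have "is_cocone ?K F (FP \<circ>\<^sub>F b) (fst d) (\<lambda>k. fpart (\<nu> k))"
      unfolding is_cocone_def
    proof (intro conjI ballI)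
      show "fst d \<in> Obj F" by (fact d'(1))
      show "fpart (\<nu> k) \<in> hom F (Ob (FP \<circ>\<^sub>F b) k) (fst d)" if "k \<in> Obj ?K" for k
        using that nuA nuA' by simp
      show "fpart (\<nu> (Cod ?K t)) \<cdot>\<^bsub>F\<^esub> Ar (FP \<circ>\<^sub>F b) t = fpart (\<nu> (Dom ?K t))" if "t \<in> Arr ?K" for t
        using arg_cong[OF nut, of t fpart] that by simp
    qed
    then have "\<exists>!z. z \<in> hom F e0 (fst d) \<and> (\<forall>k \<in> Obj ?K. z \<cdot>\<^bsub>F\<^esub> \<epsilon> k = fpart (\<nu> k))"
      using cF unfolding is_colimit_def by blast
    then have ex1: "\<exists>!z. z \<in> hom F e0 (fst d) \<and> (\<forall>k \<in> Field (one_plus r). z \<cdot>\<^bsub>F\<^esub> \<epsilon> k = fpart (\<nu> k))"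
      unfolding poset_cat_simps(1) .
    then obtain z where "z \<in> hom F e0 (fst d)"
      and zk: "\<And>k. k \<in> Field (one_plus r) \<Longrightarrow> z \<cdot>\<^bsub>F\<^esub> \<epsilon> k = fpart (\<nu> k)"
      by blast
    then have z: "z \<in> Arr F" "Dom F z = e0" "Cod F z = fst d" by auto
    \<comment> \<open>Both sides are maps out of the colimit in \<open>E\<close> and are compared on
      its legs.\<close>
    have sq: "?h \<cdot>\<^bsub>E\<^esub> pc = snd d \<cdot>\<^bsub>E\<^esub> Ar P z"
    proof (rule E.colimit_eqI[OF col _ _ eE, of _ "Cod E (snd d)"])
      show "?h \<cdot>\<^bsub>E\<^esub> pc \<in> hom E c (Cod E (snd d))" "snd d \<cdot>\<^bsub>E\<^esub> Ar P z \<in> hom E c (Cod E (snd d))"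
        using hA pc z d' over by simp_all
      fix k assume "k \<in> Obj ?K"
      then have k: "k \<in> Field (one_plus r)" by simp
      have bk: "\<beta> k \<in> hom E (Ob P (fst (Ob b k))) c"
        using over(2)[OF k] epsA[OF k] eps(3,4)[OF k] over(1) P_simps(2-4)[OF epsA[OF k]] by simp
      have "(?h \<cdot>\<^bsub>E\<^esub> pc) \<cdot>\<^bsub>E\<^esub> \<beta> k = ?h \<cdot>\<^bsub>E\<^esub> snd (Ob b k)"
        using hA pc bk pcb[OF k] by simp
      also have "\<dots> = snd d \<cdot>\<^bsub>E\<^esub> Ar P (z \<cdot>\<^bsub>F\<^esub> \<epsilon> k)"
        using nuA'(7)[OF k] nuA[OF k] h[OF k] zk[OF k] by simp
      also have "\<dots> = (snd d \<cdot>\<^bsub>E\<^esub> Ar P z) \<cdot>\<^bsub>E\<^esub> \<beta> k"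
        using z epsA[OF k] eps(4)[OF k] over(2)[OF k] d' bk over(1) by simp
      finally show "(?h \<cdot>\<^bsub>E\<^esub> pc) \<cdot>\<^bsub>E\<^esub> \<beta> k = (snd d \<cdot>\<^bsub>E\<^esub> Ar P z) \<cdot>\<^bsub>E\<^esub> \<beta> k" .
    qed simp_all
    define y where "y = (x, (z, ?h), d)"
    have y: "y \<in> Arr gcat" unfolding y_def
      by (rule ArrI_gcat[OF x d]) (use z hA pc sq in \<open>simp_all add: x_def\<close>)
    have y' [simp]: "fpart y = z" "epart y = ?h" "Dom gcat y = x" "Cod gcat y = d"
      by (simp_all add: y_def)
    show "\<exists>!a. a \<in> hom gcat x d \<and> (\<forall>k \<in> Obj ?K. a \<cdot>\<^bsub>gcat\<^esub> \<iota> k = \<nu> k)"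
    proof (rule ex1I[of _ y])
      have "y \<cdot>\<^bsub>gcat\<^esub> \<iota> k = \<nu> k" if k: "k \<in> Field (one_plus r)" for k
        by (rule gcat_eqI) (use \<iota>[OF k] y nuA[OF k] zk[OF k] h[OF k] hA in simp_all)
      then show "y \<in> hom gcat x d \<and> (\<forall>k \<in> Obj ?K. y \<cdot>\<^bsub>gcat\<^esub> \<iota> k = \<nu> k)"
        using y by simp
      fix a assume a: "a \<in> hom gcat x d \<and> (\<forall>k \<in> Obj ?K. a \<cdot>\<^bsub>gcat\<^esub> \<iota> k = \<nu> k)"
      then have aA: "a \<in> Arr gcat" "Dom gcat a = x" "Cod gcat a = d" by auto
      note aA' = Arr_gcatD(1-6)[OF aA(1)]
      have ak: "a \<cdot>\<^bsub>gcat\<^esub> \<iota> k = \<nu> k" if "k \<in> Field (one_plus r)" for k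
        using a that unfolding poset_cat_simps(1) by blast
      show "a = y"
      proof (rule gcat_eqI)
        have "fpart a \<cdot>\<^bsub>F\<^esub> \<epsilon> k = fpart (\<nu> k)" if "k \<in> Field (one_plus r)" for k
          using arg_cong[OF ak[OF that], of fpart] by simp
        then have ak': "fpart a \<cdot>\<^bsub>F\<^esub> \<epsilon> k = z \<cdot>\<^bsub>F\<^esub> \<epsilon> k" if "k \<in> Obj ?K" for k
          using zk that unfolding poset_cat_simps(1) by metis
        have "fpart a = z"
          by (rule F.colimit_eqI[OF cF _ _ eF ak', of "fst d"]) (use z aA' aA in \<open>simp_all add: x_def\<close>)
        then show "fpart a = fpart y" by simp
        have "epart a \<cdot>\<^bsub>E\<^esub> Idt E B = ?h"
          using arg_cong[OF ak[OF KN], of epart] by simp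
        then show "epart a = epart y" using aA' aA pc by (simp add: x_def)
      qed (use aA y in simp_all)
    qed
  qed (rule co)
  moreover have "Ob PE x = c" using over by (simp add: x_def)
  moreover have "\<iota> k \<in> GN" "epart (\<iota> k) = Idt E (Cod E (snd (Ob b k)))" "Ar PE (\<iota> k) = \<beta> k"
    if "k \<in> Field (one_plus r)" for k
    using that \<iota> eps(2) B over by (simp_all add: GN_def)
  moreover have "G.detects GN \<iota> (Field (one_plus r)) x"
    unfolding G.detects_def
  proof (intro ballI impI; elim conjE)
    fix z assume z: "z \<in> Arr gcat" "Dom gcat z = x" "\<forall>k \<in> Field (one_plus r). z \<cdot>\<^bsub>gcat\<^esub> \<iota> k \<in> GN"
    have "fpart z \<in> cart"
    proof (rule mediator_cart[OF cc cF e])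
      show "fpart z \<cdot>\<^bsub>F\<^esub> \<epsilon> k \<in> cart" if "k \<in> Obj ?K" for k
        using z(3) that by (auto simp: GN_def)
    qed (use z Arr_gcatD[OF z(1)] Kt in \<open>simp_all add: x_def\<close>)
    then show "z \<in> GN" using z by (simp add: GN_def)
  qed
  ultimately show ?thesis by (rule that)
qed

text \<open>Here \<open>f\<close> may move the base and only \<open>m\<close> is over an identity.
  The pushout therefore lies over the base of \<open>Cod gcat f\<close>, with \<open>q'\<close> over
  an identity and \<open>p'\<close> over \<open>epart f\<close>.\<close>

lemma vk_pushout:
  assumes m: "m \<in> GM M" and f: "f \<in> GN" and mf: "Dom gcat f = Dom gcat m"
    and po: "is_pushout E (Ar P (fpart m)) (Ar P (fpart f)) p q"
    and vk: "van_kampen span_cat E F P (span_diagram E (Ar P (fpart m)) (Ar P (fpart f))) (Cod E p)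
      (pushout_cocone E (Ar P (fpart m)) p q)"
  obtains p' q' where "G.pushout m f p' q'" "p' \<in> GN" "q' \<in> GN"
    "epart q' = Idt E (Cod E (snd (Cod gcat f)))"
    "Ar P (fpart p') = p" "Ar P (fpart q') = q"
    "\<And>z. z \<in> Arr gcat \<Longrightarrow> Dom gcat z = Cod gcat p' \<Longrightarrow> z \<cdot>\<^bsub>gcat\<^esub> p' \<in> GN \<Longrightarrow> z \<cdot>\<^bsub>gcat\<^esub> q' \<in> GN \<Longrightarrow> z \<in> GN"
proof -
  have fA: "f \<in> Arr gcat" "fpart f \<in> cart" using f by (auto simp: GN_def)
  note M = GMD[OF m]
  note M' = Arr_gcatD(1-6,9,10)[OF M(1)] and F' = Arr_gcatD(1-6,9,10)[OF fA(1)]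
  note Mo = Obj_gcatD[OF M'(7)] Obj_gcatD[OF M'(8)] and Fo = Obj_gcatD[OF F'(8)]
  let ?m = "fpart m" and ?f = "fpart f"
  have pmf: "?m \<in> Arr F" "?f \<in> Arr F" "Dom F ?m = Dom F ?f" using M' F' mf by auto
  note poE = po[unfolded E.is_pushout_iff]
  note po' = E.pushoutD[OF poE]
  let ?e = "span_diagram F ?m ?f"
  have e: "is_functor span_cat (wide F cart) ?e"
    using pmf M(2) fA(2) by (auto simp: is_functor_def intro!: cart_idt)
  have "functor_eq span_cat (P \<circ>\<^sub>F ?e) (span_diagram E (Ar P ?m) (Ar P ?f))"
    using pmf by (simp add: functor_eq_def)
  then obtain e0 \<epsilon> where cc: "is_colimit span_cat (wide F cart) ?e e0 \<epsilon>"
    and over: "Ob P e0 = Cod E p" "\<And>k. k \<in> Obj span_cat \<Longrightarrow> Ar P (\<epsilon> k) = pushout_cocone E (Ar P ?m) p q k"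
    and cF: "is_colimit span_cat F ?e e0 \<epsilon>"
    using van_kampen_colimit[OF vk e] by blast
  note poF = F.pushoutI_colimit[OF cF pmf]
  let ?p = "\<epsilon> Lft" and ?q = "\<epsilon> Rgt"
  have eps: "?p \<in> cart" "?q \<in> cart" using cc by (auto simp: is_colimit_def is_cocone_def)
  note poF' = F.pushoutD[OF poF(1)]
  have Ppq: "Ar P ?p = p" "Ar P ?q = q"
    using over(2)[of Lft] over(2)[of Rgt] by (auto simp: pushout_cocone_def)
  let ?A = "Dom gcat m" and ?B = "Cod gcat m" and ?X = "Cod gcat f"
  have comm: "(epart f \<cdot>\<^bsub>E\<^esub> snd ?B) \<cdot>\<^bsub>E\<^esub> Ar P ?m = snd ?X \<cdot>\<^bsub>E\<^esub> Ar P ?f"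
    using M M' F' Mo Fo mf Arr_gcatD(7)[OF fA(1)] by simp
  \<comment> \<open>The structure map of the pushout: the given one on \<open>Cod gcat f\<close>,
    and on \<open>Cod gcat m\<close> the given one followed by \<open>epart f\<close>.\<close>
  obtain pp where pp: "pp \<in> hom E (Cod E p) (Cod E (snd ?X))" "pp \<cdot>\<^bsub>E\<^esub> p = epart f \<cdot>\<^bsub>E\<^esub> snd ?B"
    "pp \<cdot>\<^bsub>E\<^esub> q = snd ?X"
    by (rule E.pushout_ex[OF poE _ _ comm, of "Cod E (snd ?X)"]) (use M M' F' Mo Fo mf pmf in simp_all)
  define Y where "Y = (e0, pp)"
  have e0: "e0 \<in> Obj F" "Cod F ?p = e0" using cF poF(2) by (auto simp: is_colimit_def is_cocone_def)
  have Y: "Y \<in> Obj gcat" using e0 pp over(1) by (simp add: Y_def)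
  define p' where "p' = (?B, (?p, epart f), Y)"
  define q' where "q' = (?X, (?q, Idt E (Cod E (snd ?X))), Y)"
  have p'A: "p' \<in> Arr gcat" unfolding p'_def
    by (rule ArrI_gcat[OF M'(8) Y]) (use poF' M M' F' Mo Fo mf pp Ppq e0 in \<open>simp_all add: Y_def\<close>)
  have q'A: "q' \<in> Arr gcat" unfolding q'_def
    by (rule ArrI_gcat[OF F'(8) Y]) (use poF' M M' F' Mo Fo mf pp Ppq e0 in \<open>simp_all add: Y_def\<close>)
  have pq' [simp]: "fpart p' = ?p" "epart p' = epart f" "Dom gcat p' = ?B" "Cod gcat p' = Y"
    "fpart q' = ?q" "epart q' = Idt E (Cod E (snd ?X))" "Dom gcat q' = ?X" "Cod gcat q' = Y"
    by (simp_all add: p'_def q'_def)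
  have "G.pushout m f p' q'"
    unfolding G.pushout_def
  proof (intro conjI allI impI; (elim conjE)?)
    show "p' \<cdot>\<^bsub>gcat\<^esub> m = q' \<cdot>\<^bsub>gcat\<^esub> f"
      by (rule gcat_eqI) (use p'A q'A M fA F' mf poF' in simp_all)
    fix v w assume v: "v \<in> Arr gcat" "Dom gcat v = Cod gcat m" and w: "w \<in> Arr gcat" "Dom gcat w = Cod gcat f"
      and vw: "Cod gcat w = Cod gcat v" "v \<cdot>\<^bsub>gcat\<^esub> m = w \<cdot>\<^bsub>gcat\<^esub> f"
    let ?V = "Cod gcat v"
    note v' = Arr_gcatD(1-7,9,10)[OF v(1)] and w' = Arr_gcatD(1-7,9,10)[OF w(1)]
    note Vo = Obj_gcatD[OF v'(9)]
    have eq: "fpart v \<cdot>\<^bsub>F\<^esub> ?m = fpart w \<cdot>\<^bsub>F\<^esub> ?f" "epart v = epart w \<cdot>\<^bsub>E\<^esub> epart f"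
      using arg_cong[OF vw(2), of fpart] arg_cong[OF vw(2), of epart] v v' M by simp_all
    have ex1: "\<exists>!z. z \<in> hom F (Cod F ?p) (fst ?V) \<and> z \<cdot>\<^bsub>F\<^esub> ?p = fpart v \<and> z \<cdot>\<^bsub>F\<^esub> ?q = fpart w"
      by (rule F.pushout_ex1[OF poF(1)]) (use v v' w w' vw eq M' F' in simp_all)
    then obtain z where z: "z \<in> hom F e0 (fst ?V)" "z \<cdot>\<^bsub>F\<^esub> ?p = fpart v" "z \<cdot>\<^bsub>F\<^esub> ?q = fpart w"
      using e0 by auto
    have zp: "Ar P z \<cdot>\<^bsub>E\<^esub> p = Ar P (fpart v)" "Ar P z \<cdot>\<^bsub>E\<^esub> q = Ar P (fpart w)"
      using z(1) P_simps(6)[of ?p z] P_simps(6)[of ?q z] z(2,3) poF' e0 by (simp_all add: Ppq)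
    have sq: "epart w \<cdot>\<^bsub>E\<^esub> pp = snd ?V \<cdot>\<^bsub>E\<^esub> Ar P z"
    proof (rule E.pushout_eqI[OF poE, of _ "Cod E (snd ?V)"])
      show "epart w \<cdot>\<^bsub>E\<^esub> pp \<in> hom E (Cod E p) (Cod E (snd ?V))"
        "snd ?V \<cdot>\<^bsub>E\<^esub> Ar P z \<in> hom E (Cod E p) (Cod E (snd ?V))"
        using w w' vw pp z(1) Vo over(1) by simp_all
      have "(epart w \<cdot>\<^bsub>E\<^esub> pp) \<cdot>\<^bsub>E\<^esub> p = epart w \<cdot>\<^bsub>E\<^esub> epart f \<cdot>\<^bsub>E\<^esub> snd ?B"
        using w w' pp po' by simp
      also have "\<dots> = epart v \<cdot>\<^bsub>E\<^esub> snd ?B"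
        unfolding eq(2) using w w' F' Mo M M' mf by simp
      also have "\<dots> = (snd ?V \<cdot>\<^bsub>E\<^esub> Ar P z) \<cdot>\<^bsub>E\<^esub> p"
        using v'(7) v zp(1) z(1) Vo over(1) po' by simp
      finally show "(epart w \<cdot>\<^bsub>E\<^esub> pp) \<cdot>\<^bsub>E\<^esub> p = (snd ?V \<cdot>\<^bsub>E\<^esub> Ar P z) \<cdot>\<^bsub>E\<^esub> p" .
      have "(epart w \<cdot>\<^bsub>E\<^esub> pp) \<cdot>\<^bsub>E\<^esub> q = epart w \<cdot>\<^bsub>E\<^esub> snd ?X"
        using w w' pp po' by simp
      also have "\<dots> = (snd ?V \<cdot>\<^bsub>E\<^esub> Ar P z) \<cdot>\<^bsub>E\<^esub> q"
        using w'(7) w vw zp(2) z(1) Vo over(1) po' by simp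
      finally show "(epart w \<cdot>\<^bsub>E\<^esub> pp) \<cdot>\<^bsub>E\<^esub> q = (snd ?V \<cdot>\<^bsub>E\<^esub> Ar P z) \<cdot>\<^bsub>E\<^esub> q" .
    qed
    define y where "y = (Y, (z, epart w), ?V)"
    have y: "y \<in> Arr gcat" unfolding y_def
      by (rule ArrI_gcat[OF Y v'(9)]) (use z w w' vw pp sq in \<open>simp_all add: Y_def\<close>)
    have y' [simp]: "fpart y = z" "epart y = epart w" "Dom gcat y = Y" "Cod gcat y = ?V"
      by (simp_all add: y_def)
    show "\<exists>!z. z \<in> hom gcat (Cod gcat p') ?V \<and> z \<cdot>\<^bsub>gcat\<^esub> p' = v \<and> z \<cdot>\<^bsub>gcat\<^esub> q' = w"
    proof (rule ex1I[of _ y])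
      have "y \<cdot>\<^bsub>gcat\<^esub> p' = v"
        by (rule gcat_eqI) (use y p'A v z eq in simp_all)
      moreover have "y \<cdot>\<^bsub>gcat\<^esub> q' = w"
        by (rule gcat_eqI) (use y q'A w w' vw z in simp_all)
      ultimately show "y \<in> hom gcat (Cod gcat p') ?V \<and> y \<cdot>\<^bsub>gcat\<^esub> p' = v \<and> y \<cdot>\<^bsub>gcat\<^esub> q' = w"
        using y by simp
      fix a assume a: "a \<in> hom gcat (Cod gcat p') ?V \<and> a \<cdot>\<^bsub>gcat\<^esub> p' = v \<and> a \<cdot>\<^bsub>gcat\<^esub> q' = w"
      then have aA: "a \<in> Arr gcat" "Dom gcat a = Y" "Cod gcat a = ?V" and ap: "a \<cdot>\<^bsub>gcat\<^esub> p' = v" "a \<cdot>\<^bsub>gcat\<^esub> q' = w" by auto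
      note aA' = Arr_gcatD(1-6)[OF aA(1)]
      show "a = y"
      proof (rule gcat_eqI)
        have "fpart a \<cdot>\<^bsub>F\<^esub> ?p = fpart v" "fpart a \<cdot>\<^bsub>F\<^esub> ?q = fpart w"
          using arg_cong[OF ap(1), of fpart] arg_cong[OF ap(2), of fpart] by simp_all
        moreover have "fpart a \<in> hom F (Cod F ?p) (fst ?V)" using aA aA' e0 by (simp add: Y_def)
        ultimately have "fpart a = z"
          using F.pushout_eqI[OF poF(1), of "fpart a" "fst ?V" z] z e0 by simp
        then show "fpart a = fpart y" by simp
        have "epart a \<cdot>\<^bsub>E\<^esub> Idt E (Cod E (snd ?X)) = epart w"
          using arg_cong[OF ap(2), of epart] by simp
        then show "epart a = epart y" using aA aA' pp by (simp add: Y_def)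
      qed (use aA y in simp_all)
    qed
  qed (use M fA mf p'A q'A in simp_all)
  moreover have "p' \<in> GN" "q' \<in> GN" using p'A q'A eps by (simp_all add: GN_def)
  moreover have "z \<in> GN" if z: "z \<in> Arr gcat" "Dom gcat z = Cod gcat p'" "z \<cdot>\<^bsub>gcat\<^esub> p' \<in> GN" "z \<cdot>\<^bsub>gcat\<^esub> q' \<in> GN" for z
  proof -
    have zF: "fpart z \<in> Arr F" "Dom F (fpart z) = e0" "fpart z \<cdot>\<^bsub>F\<^esub> ?p \<in> cart" "fpart z \<cdot>\<^bsub>F\<^esub> ?q \<in> cart"
      using Arr_gcatD[OF z(1)] z by (auto simp: Y_def GN_def)
    \<comment> \<open>Cartesianness is known on two legs; the leg at \<open>Apex\<close> is a
      composite through the cartesian map \<open>?m\<close>.\<close>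
    have "(fpart z \<cdot>\<^bsub>F\<^esub> ?p) \<cdot>\<^bsub>F\<^esub> ?m \<in> cart"
      by (rule cart_cmp[OF M(2) zF(3)]) (use zF poF' e0 in simp)
    moreover have "?p \<cdot>\<^bsub>F\<^esub> ?m = \<epsilon> Apex"
      using cF by (simp add: is_colimit_def F.span_cocone_iff[OF pmf])
    ultimately have "fpart z \<cdot>\<^bsub>F\<^esub> \<epsilon> Apex \<in> cart" using zF poF' pmf e0 by simp
    then have "fpart z \<cdot>\<^bsub>F\<^esub> \<epsilon> k \<in> cart" if "k \<in> Obj span_cat" for k
      using that zF by (cases k) simp_all
    moreover have "Dom span_cat t \<in> Obj span_cat \<and> Cod span_cat t \<in> Obj span_cat"
      if "t \<in> Arr span_cat" for t
      using that by auto
    ultimately have "fpart z \<in> cart"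
      using mediator_cart[OF cc cF e _ zF(1,2)] by blast
    then show ?thesis using z by (simp add: GN_def)
  qed
  ultimately show ?thesis using Ppq that pq' by metis
qed

end

section \<open>Extension operations\<close>

lemma arrow_cat_simps [simp]:
  "Obj (arrow_cat C) = Arr C" "Dom (arrow_cat C) = sdom" "Cod (arrow_cat C) = scod"
  "Idt (arrow_cat C) f = Square f (Idt C (Dom C f)) (Idt C (Cod C f)) f"
  "\<tau> \<cdot>\<^bsub>arrow_cat C\<^esub> \<sigma> =
     Square (sdom \<sigma>) (upper \<tau> \<cdot>\<^bsub>C\<^esub> upper \<sigma>) (lower \<tau> \<cdot>\<^bsub>C\<^esub> lower \<sigma>) (scod \<tau>)"
  by (simp_all add: arrow_cat_def)

lemma Arr_arrow_cat: "\<sigma> \<in> Arr (arrow_cat C) \<longleftrightarrow>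
    sdom \<sigma> \<in> Arr C \<and> scod \<sigma> \<in> Arr C \<and> upper \<sigma> \<in> hom C (Dom C (sdom \<sigma>)) (Dom C (scod \<sigma>)) \<and>
    lower \<sigma> \<in> hom C (Cod C (sdom \<sigma>)) (Cod C (scod \<sigma>)) \<and>
    lower \<sigma> \<cdot>\<^bsub>C\<^esub> sdom \<sigma> = scod \<sigma> \<cdot>\<^bsub>C\<^esub> upper \<sigma>"
  by (cases \<sigma>) (auto simp: arrow_cat_def)

lemma (in category) category_arrow_cat: "category (arrow_cat C)"
proof
  fix a b c x y z w
  show "Dom (arrow_cat C) a \<in> Obj (arrow_cat C)" "Cod (arrow_cat C) a \<in> Obj (arrow_cat C)"
    if "a \<in> Arr (arrow_cat C)"
    using that by (simp_all add: Arr_arrow_cat)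
  show "Idt (arrow_cat C) x \<in> hom (arrow_cat C) x x" if "x \<in> Obj (arrow_cat C)"
    using that by (simp add: Arr_arrow_cat)
  show "b \<cdot>\<^bsub>arrow_cat C\<^esub> a \<in> hom (arrow_cat C) x z"
    if "a \<in> hom (arrow_cat C) x y" "b \<in> hom (arrow_cat C) y z"
  proof -
    have A: "a \<in> Arr (arrow_cat C)" "sdom a = x" "scod a = y" and B: "b \<in> Arr (arrow_cat C)" "sdom b = y" "scod b = z"
      using that by auto
    note A' = A[unfolded Arr_arrow_cat] and B' = B[unfolded Arr_arrow_cat]
    have H: "upper a \<in> hom C (Dom C x) (Dom C y)" "lower a \<in> hom C (Cod C x) (Cod C y)"
      "upper b \<in> hom C (Dom C y) (Dom C z)" "lower b \<in> hom C (Cod C y) (Cod C z)"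
      "x \<in> Arr C" "y \<in> Arr C" "z \<in> Arr C"
      and ea: "lower a \<cdot> x = y \<cdot> upper a" and eb: "lower b \<cdot> y = z \<cdot> upper b"
      using A' B' by auto
    have "(lower b \<cdot> lower a) \<cdot> x = lower b \<cdot> (lower a \<cdot> x)" using H by simp
    also have "\<dots> = (lower b \<cdot> y) \<cdot> upper a" unfolding ea using H by simp
    also have "\<dots> = z \<cdot> upper b \<cdot> upper a" unfolding eb using H by simp
    finally have "(lower b \<cdot> lower a) \<cdot> x = z \<cdot> upper b \<cdot> upper a" .
    with H show ?thesis by (simp add: Arr_arrow_cat A(2) B(3))
  qed
  show "Idt (arrow_cat C) y \<cdot>\<^bsub>arrow_cat C\<^esub> a = a" if "a \<in> hom (arrow_cat C) x y"
    using that by (cases a) (auto simp: Arr_arrow_cat)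
  show "a \<cdot>\<^bsub>arrow_cat C\<^esub> Idt (arrow_cat C) x = a" if "a \<in> hom (arrow_cat C) x y"
    using that by (cases a) (auto simp: Arr_arrow_cat)
  show "(c \<cdot>\<^bsub>arrow_cat C\<^esub> b) \<cdot>\<^bsub>arrow_cat C\<^esub> a = c \<cdot>\<^bsub>arrow_cat C\<^esub> b \<cdot>\<^bsub>arrow_cat C\<^esub> a"
    if "a \<in> hom (arrow_cat C) w x" "b \<in> hom (arrow_cat C) x y" "c \<in> hom (arrow_cat C) y z"
    using that by (auto simp: Arr_arrow_cat)
qed

lemma fiber_simps [simp]:
  "Obj (fiber E F P A) = {X \<in> Obj F. Ob P X = A}" "Arr (fiber E F P A) = {x \<in> Arr F. Ar P x = Idt E A}"
  "Dom (fiber E F P A) = Dom F" "Cod (fiber E F P A) = Cod F" "Idt (fiber E F P A) = Idt F"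
  "Cmp (fiber E F P A) = Cmp F"
  by (simp_all add: fiber_def)

lemma cart_over_simps [simp]:
  "Obj (cart_over E F P m) = {e \<in> cartesian E F P. Ar P e = m}"
  "Arr (cart_over E F P m) = {\<sigma> \<in> Arr (arrow_cat F).
     sdom \<sigma> \<in> cartesian E F P \<and> Ar P (sdom \<sigma>) = m \<and> scod \<sigma> \<in> cartesian E F P \<and> Ar P (scod \<sigma>) = m \<and>
     Ar P (upper \<sigma>) = Idt E (Dom E m) \<and> Ar P (lower \<sigma>) = Idt E (Cod E m)}"
  "Dom (cart_over E F P m) = sdom" "Cod (cart_over E F P m) = scod"
  "Idt (cart_over E F P m) = Idt (arrow_cat F)" "Cmp (cart_over E F P m) = Cmp (arrow_cat F)"
  by (auto simp: cart_over_def Let_def)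

lemma Ext_simps [simp]:
  "Obj (Ext E F P cl) = ext_objs E F P" "Arr (Ext E F P cl) = ext_arrs E F P cl"
  "Dom (Ext E F P cl) (x, s, y) = x" "Cod (Ext E F P cl) (x, s, y) = y"
  "Idt (Ext E F P cl) = ext_idt E F P cl" "Cmp (Ext E F P cl) = ext_cmp E F P cl"
  by (simp_all add: Ext_def)

context fibred
begin

text \<open>The description by \<open>THE\<close> is proper because the chosen lift with codomain
  \<open>Cod F y\<close> is cartesian.\<close>

lemma reindex_props:
  assumes h: "h \<in> Arr E" and y: "y \<in> Arr F" "Ar P y = Idt E (Cod E h)"
  shows "reindex E F P cl h y \<in> Arr F" "Dom F (reindex E F P cl h y) = Dom F (cl h (Dom F y))"
    "Cod F (reindex E F P cl h y) = Dom F (cl h (Cod F y))"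
    "Ar P (reindex E F P cl h y) = Idt E (Dom E h)"
    "cl h (Cod F y) \<cdot>\<^bsub>F\<^esub> reindex E F P cl h y = y \<cdot>\<^bsub>F\<^esub> cl h (Dom F y)"
proof -
  have P: "Ob P (Dom F y) = Cod E h" "Ob P (Cod F y) = Cod E h"
    using P_simps(3,4)[OF y(1)] y h by simp_all
  have d: "Dom F y \<in> Obj F" "Cod F y \<in> Obj F" using y by auto
  note c = cl_simps[OF d(1) h] cl_simps[OF d(2) h]
  let ?R = "\<lambda>z. z \<in> hom F (Dom F (cl h (Dom F y))) (Dom F (cl h (Cod F y))) \<and> Ar P z = Idt E (Dom E h) \<and>
     cl h (Cod F y) \<cdot>\<^bsub>F\<^esub> z = y \<cdot>\<^bsub>F\<^esub> cl h (Dom F y)"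
  have R: "?R = (\<lambda>z. z \<in> hom (fiber E F P (Dom E h)) (Dom F (cl h (Dom F y))) (Dom F (cl h (Cod F y))) \<and>
     cl h (Cod F y) \<cdot>\<^bsub>F\<^esub> z = y \<cdot>\<^bsub>F\<^esub> cl h (Dom F y))"
    by auto
  obtain z where z: "z \<in> hom F (Dom F (y \<cdot>\<^bsub>F\<^esub> cl h (Dom F y))) (Dom F (cl h (Cod F y)))"
    "Ar P z = Idt E (Dom E h)" "cl h (Cod F y) \<cdot>\<^bsub>F\<^esub> z = y \<cdot>\<^bsub>F\<^esub> cl h (Dom F y)"
    by (rule cart_ex[OF c(6), of "y \<cdot>\<^bsub>F\<^esub> cl h (Dom F y)" "Idt E (Dom E h)"])
      (use c P y h in simp_all)
  have "\<exists>!z. ?R z"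
  proof (rule ex1I[of _ z])
    show "?R z" using z c P y by simp
    show "z' = z" if "?R z'" for z'
      by (rule cart_eqI[OF c(6), of _ "Dom F (cl h (Dom F y))"]) (use that z c P y in simp_all)
  qed
  from theI'[OF this] have "?R (THE z. ?R z)" .
  moreover have "reindex E F P cl h y = (THE z. ?R z)"
    unfolding reindex_def by (rule arg_cong[where f = The]) (use R in simp)
  ultimately have "?R (reindex E F P cl h y)" by simp
  then show "reindex E F P cl h y \<in> Arr F" "Dom F (reindex E F P cl h y) = Dom F (cl h (Dom F y))"
    "Cod F (reindex E F P cl h y) = Dom F (cl h (Cod F y))"
    "Ar P (reindex E F P cl h y) = Idt E (Dom E h)"
    "cl h (Cod F y) \<cdot>\<^bsub>F\<^esub> reindex E F P cl h y = y \<cdot>\<^bsub>F\<^esub> cl h (Dom F y)"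
    by auto
qed

lemma reindex_comp_props:
  assumes h: "h \<in> Arr E" "h' \<in> Arr E" "Cod E h = Dom E h'" and X: "X \<in> Obj F" "Ob P X = Cod E h'"
  defines "c' \<equiv> cl h' X"
  defines "c \<equiv> cl h (Dom F c')"
  shows "reindex_comp E F P cl h' h X \<in> Arr F"
    "Dom F (reindex_comp E F P cl h' h X) = Dom F (cl (h' \<cdot>\<^bsub>E\<^esub> h) X)"
    "Cod F (reindex_comp E F P cl h' h X) = Dom F c"
    "Ar P (reindex_comp E F P cl h' h X) = Idt E (Dom E h)"
    "c' \<cdot>\<^bsub>F\<^esub> c \<cdot>\<^bsub>F\<^esub> reindex_comp E F P cl h' h X = cl (h' \<cdot>\<^bsub>E\<^esub> h) X"
proof -
  let ?c'' = "cl (h' \<cdot>\<^bsub>E\<^esub> h) X"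
  have c': "c' \<in> cart" "c' \<in> Arr F" "Cod F c' = X" "Ar P c' = h'" "Ob P (Dom F c') = Dom E h'"
    using cl_simps[OF X(1) h(2)] X h by (simp_all add: c'_def)
  then have d: "Dom F c' \<in> Obj F" by simp
  have c: "c \<in> cart" "c \<in> Arr F" "Cod F c = Dom F c'" "Ar P c = h" "Ob P (Dom F c) = Dom E h"
    using cl_simps[OF d h(1)] c' h by (simp_all add: c_def)
  have c'': "?c'' \<in> cart" "?c'' \<in> Arr F" "Cod F ?c'' = X" "Ar P ?c'' = h' \<cdot>\<^bsub>E\<^esub> h" "Ob P (Dom F ?c'') = Dom E h"
    using cl_simps[OF X(1), of "h' \<cdot>\<^bsub>E\<^esub> h"] X h by simp_all
  have cc: "c' \<cdot>\<^bsub>F\<^esub> c \<in> cart" by (rule cart_cmp) (use c c' in auto)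
  let ?R = "\<lambda>z. z \<in> hom F (Dom F ?c'') (Dom F c) \<and> Ar P z = Idt E (Dom E h) \<and>
     c' \<cdot>\<^bsub>F\<^esub> c \<cdot>\<^bsub>F\<^esub> z = ?c''"
  have R: "?R = (\<lambda>z. z \<in> hom (fiber E F P (Dom E h)) (Dom F ?c'') (Dom F c) \<and>
     c' \<cdot>\<^bsub>F\<^esub> c \<cdot>\<^bsub>F\<^esub> z = ?c'')"
    by auto
  obtain z where z: "z \<in> hom F (Dom F ?c'') (Dom F (c' \<cdot>\<^bsub>F\<^esub> c))"
    "Ar P z = Idt E (Dom E h)" "(c' \<cdot>\<^bsub>F\<^esub> c) \<cdot>\<^bsub>F\<^esub> z = ?c''"
    by (rule cart_ex[OF cc, of ?c'' "Idt E (Dom E h)"]) (use c c' c'' h in simp_all)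
  have "\<exists>!z. ?R z"
  proof (rule ex1I[of _ z])
    show "?R z" using z c c' by simp
    show "z' = z" if "?R z'" for z'
      by (rule cart_eqI[OF cc, of _ "Dom F ?c''"]) (use that z c c' in simp_all)
  qed
  from theI'[OF this] have "?R (THE z. ?R z)" .
  moreover have "reindex_comp E F P cl h' h X = (THE z. ?R z)"
    unfolding reindex_comp_def c'_def[symmetric] c_def[symmetric] by (rule arg_cong[where f = The]) (use R in simp)
  ultimately have "?R (reindex_comp E F P cl h' h X)" by simp
  then show "reindex_comp E F P cl h' h X \<in> Arr F"
    "Dom F (reindex_comp E F P cl h' h X) = Dom F (cl (h' \<cdot>\<^bsub>E\<^esub> h) X)"
    "Cod F (reindex_comp E F P cl h' h X) = Dom F c"
    "Ar P (reindex_comp E F P cl h' h X) = Idt E (Dom E h)"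
    "c' \<cdot>\<^bsub>F\<^esub> c \<cdot>\<^bsub>F\<^esub> reindex_comp E F P cl h' h X = cl (h' \<cdot>\<^bsub>E\<^esub> h) X"
    by auto
qed

text \<open>The vertical part of \<open>x\<close>: every morphism of \<open>F\<close> is its
  vertical part followed by the chosen lift of its image.\<close>

definition vert where
  "vert x = (SOME r. r \<in> hom F (Dom F x) (Dom F (cl (Ar P x) (Cod F x))) \<and>
     Ar P r = Idt E (Ob P (Dom F x)) \<and> cl (Ar P x) (Cod F x) \<cdot>\<^bsub>F\<^esub> r = x)"

lemma vert_simps:
  assumes "x \<in> Arr F"
  shows "vert x \<in> Arr F" "Dom F (vert x) = Dom F x" "Cod F (vert x) = Dom F (cl (Ar P x) (Cod F x))"
    "Ar P (vert x) = Idt E (Ob P (Dom F x))" "cl (Ar P x) (Cod F x) \<cdot>\<^bsub>F\<^esub> vert x = x"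
proof -
  have "\<exists>r. r \<in> hom F (Dom F x) (Dom F (cl (Ar P x) (Cod F x))) \<and>
     Ar P r = Idt E (Ob P (Dom F x)) \<and> cl (Ar P x) (Cod F x) \<cdot>\<^bsub>F\<^esub> r = x"
    by (rule cart_ex[of "cl (Ar P x) (Cod F x)" x "Idt E (Ob P (Dom F x))"]) (use assms in auto)
  from someI_ex[OF this] show "vert x \<in> Arr F" "Dom F (vert x) = Dom F x" "Cod F (vert x) = Dom F (cl (Ar P x) (Cod F x))"
    "Ar P (vert x) = Idt E (Ob P (Dom F x))" "cl (Ar P x) (Cod F x) \<cdot>\<^bsub>F\<^esub> vert x = x"
    unfolding vert_def[symmetric] by auto
qed

lemma vertical_cart_iso:
  assumes r: "r \<in> cart" and Pr: "Ar P r = Idt E (Ob P (Dom F r))"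
  obtains s where "s \<in> Arr F" "Dom F s = Cod F r" "Cod F s = Dom F r" "Ar P s = Idt E (Ob P (Dom F r))"
    "r \<cdot>\<^bsub>F\<^esub> s = Idt F (Cod F r)" "s \<cdot>\<^bsub>F\<^esub> r = Idt F (Dom F r)"
proof -
  have [simp]: "r \<in> Arr F" using r cart_Arr by blast
  have eq: "Ob P (Cod F r) = Ob P (Dom F r)" using P_simps(4)[of r] Pr by simp
  obtain s where s: "s \<in> hom F (Cod F r) (Dom F r)" "Ar P s = Idt E (Ob P (Dom F r))" "r \<cdot>\<^bsub>F\<^esub> s = Idt F (Cod F r)"
    using cart_ex[OF r, of "Idt F (Cod F r)" "Idt E (Ob P (Dom F r))"] eq Pr by auto
  have "r \<cdot>\<^bsub>F\<^esub> s \<cdot>\<^bsub>F\<^esub> r = r"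
    using F.cmp_eq_cmp[OF s(3), of r] s(1) by simp
  then have "s \<cdot>\<^bsub>F\<^esub> r = Idt F (Dom F r)"
    using cart_eqI[OF r, of "s \<cdot>\<^bsub>F\<^esub> r" "Dom F r" "Idt F (Dom F r)"] s(1,2) Pr by simp
  with s show ?thesis by (intro that[of s]) simp_all
qed

lemma ext_objD:
  assumes "(m, \<xi>) \<in> ext_objs E F P"
  shows "m \<in> Arr E"
    "X \<in> Obj F \<Longrightarrow> Ob P X = Dom E m \<Longrightarrow> Ob \<xi> X \<in> cart"
    "X \<in> Obj F \<Longrightarrow> Ob P X = Dom E m \<Longrightarrow> Ob \<xi> X \<in> Arr F"
    "X \<in> Obj F \<Longrightarrow> Ob P X = Dom E m \<Longrightarrow> Ar P (Ob \<xi> X) = m"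
    "X \<in> Obj F \<Longrightarrow> Ob P X = Dom E m \<Longrightarrow> Dom F (Ob \<xi> X) = X"
    "X \<in> Obj F \<Longrightarrow> Ob P X = Dom E m \<Longrightarrow> Ob P (Cod F (Ob \<xi> X)) = Cod E m"
    "X \<in> Obj F \<Longrightarrow> Ob P X = Dom E m \<Longrightarrow> lower (Ar \<xi> (Idt F X)) = Idt F (Cod F (Ob \<xi> X))"
    "y \<in> Arr F \<Longrightarrow> Ar P y = Idt E (Dom E m) \<Longrightarrow> lower (Ar \<xi> y) \<in> Arr F"
    "y \<in> Arr F \<Longrightarrow> Ar P y = Idt E (Dom E m) \<Longrightarrow> Dom F (lower (Ar \<xi> y)) = Cod F (Ob \<xi> (Dom F y))"
    "y \<in> Arr F \<Longrightarrow> Ar P y = Idt E (Dom E m) \<Longrightarrow> Cod F (lower (Ar \<xi> y)) = Cod F (Ob \<xi> (Cod F y))"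
    "y \<in> Arr F \<Longrightarrow> Ar P y = Idt E (Dom E m) \<Longrightarrow> Ar P (lower (Ar \<xi> y)) = Idt E (Cod E m)"
    "y \<in> Arr F \<Longrightarrow> Ar P y = Idt E (Dom E m) \<Longrightarrow>
      lower (Ar \<xi> y) \<cdot>\<^bsub>F\<^esub> Ob \<xi> (Dom F y) = Ob \<xi> (Cod F y) \<cdot>\<^bsub>F\<^esub> y"
    "y \<in> Arr F \<Longrightarrow> Ar P y = Idt E (Dom E m) \<Longrightarrow> y' \<in> Arr F \<Longrightarrow> Ar P y' = Idt E (Dom E m) \<Longrightarrow>
      Cod F y = Dom F y' \<Longrightarrow> lower (Ar \<xi> (y' \<cdot>\<^bsub>F\<^esub> y)) = lower (Ar \<xi> y') \<cdot>\<^bsub>F\<^esub> lower (Ar \<xi> y)"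
proof -
  have x: "is_functor (fiber E F P (Dom E m)) (cart_over E F P m) \<xi>"
    "functor_eq (fiber E F P (Dom E m)) (dom_functor F \<circ>\<^sub>F \<xi>) id_functor" and m: "m \<in> Arr E"
    using assms by (auto simp: ext_objs_def)
  note X = functorD[OF x(1)]
  show "m \<in> Arr E" by (fact m)
  show XX: "Ob \<xi> X \<in> cart" "Ob \<xi> X \<in> Arr F" "Ar P (Ob \<xi> X) = m" "Dom F (Ob \<xi> X) = X"
    "lower (Ar \<xi> (Idt F X)) = Idt F (Cod F (Ob \<xi> X))"
    if "X \<in> Obj F" "Ob P X = Dom E m" for X
    using X(1)[of X] X(5)[of X] that x(2) cart_Arr
    by (auto simp: functor_eq_def dom_functor_def id_functor_def)
  show "Ob P (Cod F (Ob \<xi> X)) = Cod E m" if "X \<in> Obj F" "Ob P X = Dom E m"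
    using P_simps(4)[OF XX(2)[OF that]] XX(3)[OF that] by simp
  have P: "Ob P (Dom F y) = Dom E m" "Ob P (Cod F y) = Dom E m" if "y \<in> Arr F" "Ar P y = Idt E (Dom E m)" for y
    using P_simps(3,4)[OF that(1)] that m by simp_all
  have up: "upper (Ar \<xi> y) = y" if "y \<in> Arr F" "Ar P y = Idt E (Dom E m)" for y
    using x(2) that by (simp add: functor_eq_def dom_functor_def id_functor_def)
  show "lower (Ar \<xi> y) \<in> Arr F" "Dom F (lower (Ar \<xi> y)) = Cod F (Ob \<xi> (Dom F y))"
    "Cod F (lower (Ar \<xi> y)) = Cod F (Ob \<xi> (Cod F y))" "Ar P (lower (Ar \<xi> y)) = Idt E (Cod E m)"
    "lower (Ar \<xi> y) \<cdot>\<^bsub>F\<^esub> Ob \<xi> (Dom F y) = Ob \<xi> (Cod F y) \<cdot>\<^bsub>F\<^esub> y"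
    if "y \<in> Arr F" "Ar P y = Idt E (Dom E m)"
    using X(2-4)[of y] that up[OF that] by (auto simp: Arr_arrow_cat)
  show "lower (Ar \<xi> (y' \<cdot>\<^bsub>F\<^esub> y)) = lower (Ar \<xi> y') \<cdot>\<^bsub>F\<^esub> lower (Ar \<xi> y)"
    if "y \<in> Arr F" "Ar P y = Idt E (Dom E m)" "y' \<in> Arr F" "Ar P y' = Idt E (Dom E m)" "Cod F y = Dom F y'"
    using X(6)[of y y'] that by simp
qed

text \<open>A morphism in \<open>Ext\<close> is only given on the chosen cartesian lifts; \<open>push\<close> extends it to all morphisms
  over the upper side, by factoring them through the chosen lift.\<close>

definition push :: "('a, 'p, 'b) ext_arr \<Rightarrow> 'b \<Rightarrow> 'b" where
  "push = (\<lambda>((m, \<xi>), (\<sigma>, \<phi>), _) x. \<phi> (Cod F x) \<cdot>\<^bsub>F\<^esub> lower (Ar \<xi> (vert x)))"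

lemma ext_arrD:
  assumes "((m, \<xi>), (\<sigma>, \<phi>), (m', \<xi>')) \<in> ext_arrs E F P cl"
  shows "(m, \<xi>) \<in> ext_objs E F P" "(m', \<xi>') \<in> ext_objs E F P"
    "sdom \<sigma> = m" "scod \<sigma> = m'" "upper \<sigma> \<in> Arr E" "Dom E (upper \<sigma>) = Dom E m" "Cod E (upper \<sigma>) = Dom E m'"
    "lower \<sigma> \<in> Arr E" "Dom E (lower \<sigma>) = Cod E m" "Cod E (lower \<sigma>) = Cod E m'"
    "X \<in> Obj F \<Longrightarrow> Ob P X = Dom E m' \<Longrightarrow> \<phi> X \<in> cart"
    "X \<in> Obj F \<Longrightarrow> Ob P X = Dom E m' \<Longrightarrow> \<phi> X \<in> Arr F"
    "X \<in> Obj F \<Longrightarrow> Ob P X = Dom E m' \<Longrightarrow> Dom F (\<phi> X) = Cod F (Ob \<xi> (Dom F (cl (upper \<sigma>) X)))"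
    "X \<in> Obj F \<Longrightarrow> Ob P X = Dom E m' \<Longrightarrow> Cod F (\<phi> X) = Cod F (Ob \<xi>' X)"
    "X \<in> Obj F \<Longrightarrow> Ob P X = Dom E m' \<Longrightarrow> Ar P (\<phi> X) = lower \<sigma>"
    "X \<in> Obj F \<Longrightarrow> Ob P X = Dom E m' \<Longrightarrow>
      \<phi> X \<cdot>\<^bsub>F\<^esub> Ob \<xi> (Dom F (cl (upper \<sigma>) X)) = Ob \<xi>' X \<cdot>\<^bsub>F\<^esub> cl (upper \<sigma>) X"
    "y \<in> Arr F \<Longrightarrow> Ar P y = Idt E (Dom E m') \<Longrightarrow>
      \<phi> (Cod F y) \<cdot>\<^bsub>F\<^esub> lower (Ar \<xi> (reindex E F P cl (upper \<sigma>) y)) =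
      lower (Ar \<xi>' y) \<cdot>\<^bsub>F\<^esub> \<phi> (Dom F y)"
  using assms by (auto simp: ext_arrs_def Arr_arrow_cat)

lemma push_simps:
  assumes t: "((m, \<xi>), (\<sigma>, \<phi>), (m', \<xi>')) \<in> ext_arrs E F P cl" (is "?t \<in> _")
    and x: "x \<in> Arr F" "Ar P x = upper \<sigma>"
  shows "push ?t x \<in> Arr F" "Dom F (push ?t x) = Cod F (Ob \<xi> (Dom F x))"
    "Cod F (push ?t x) = Cod F (Ob \<xi>' (Cod F x))" "Ar P (push ?t x) = lower \<sigma>"
    "push ?t x \<cdot>\<^bsub>F\<^esub> Ob \<xi> (Dom F x) = Ob \<xi>' (Cod F x) \<cdot>\<^bsub>F\<^esub> x"
    "x \<in> cart \<Longrightarrow> push ?t x \<in> cart"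
proof -
  note T = ext_arrD[OF t]
  note V = vert_simps[OF x(1)]
  have PX: "Ob P (Dom F x) = Dom E m" "Ob P (Cod F x) = Dom E m'"
    using P_simps(3,4)[OF x(1)] x T by simp_all
  have X: "Dom F x \<in> Obj F" "Cod F x \<in> Obj F" using x by auto
  have c: "cl (upper \<sigma>) (Cod F x) \<in> cart" "cl (upper \<sigma>) (Cod F x) \<in> Arr F"
    "Cod F (cl (upper \<sigma>) (Cod F x)) = Cod F x" "Ar P (cl (upper \<sigma>) (Cod F x)) = upper \<sigma>"
    "Ob P (Dom F (cl (upper \<sigma>) (Cod F x))) = Dom E m"
    using cl_simps[OF X(2) T(5)] T PX by simp_all
  have c': "Dom F (cl (upper \<sigma>) (Cod F x)) \<in> Obj F" using c by simp
  have V': "Ar P (vert x) = Idt E (Dom E m)" using V PX by simp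
  note O = ext_objD(3-6)[OF T(1) X(1) PX(1)] ext_objD(3-6)[OF T(2) X(2) PX(2)]
    ext_objD(3-6)[OF T(1) c' c(5)] ext_objD(8-12)[OF T(1) V(1) V']
  note ph = T(11-16)[OF X(2) PX(2)]
  have pd: "push ?t x = \<phi> (Cod F x) \<cdot>\<^bsub>F\<^esub> lower (Ar \<xi> (vert x))"
    by (simp add: push_def)
  have m: "m \<in> Arr E" using ext_objD(1)[OF T(1)] .
  show "push ?t x \<in> Arr F" "Dom F (push ?t x) = Cod F (Ob \<xi> (Dom F x))"
    "Cod F (push ?t x) = Cod F (Ob \<xi>' (Cod F x))" "Ar P (push ?t x) = lower \<sigma>"
    unfolding pd using ph O V x T m by simp_all
  have "push ?t x \<cdot>\<^bsub>F\<^esub> Ob \<xi> (Dom F x) = \<phi> (Cod F x) \<cdot>\<^bsub>F\<^esub> (lower (Ar \<xi> (vert x)) \<cdot>\<^bsub>F\<^esub> Ob \<xi> (Dom F x))"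
    unfolding pd using ph O V x by simp
  also have "\<dots> = \<phi> (Cod F x) \<cdot>\<^bsub>F\<^esub> (Ob \<xi> (Dom F (cl (upper \<sigma>) (Cod F x))) \<cdot>\<^bsub>F\<^esub> vert x)"
    using O V x by simp
  also have "\<dots> = (\<phi> (Cod F x) \<cdot>\<^bsub>F\<^esub> Ob \<xi> (Dom F (cl (upper \<sigma>) (Cod F x)))) \<cdot>\<^bsub>F\<^esub> vert x"
    using ph(1-5) O(1-12) V(1-3) x by simp
  also have "\<dots> = Ob \<xi>' (Cod F x) \<cdot>\<^bsub>F\<^esub> (cl (upper \<sigma>) (Cod F x) \<cdot>\<^bsub>F\<^esub> vert x)"
    unfolding ph(6) using O(1-12) V(1-3) x c by simp
  finally show "push ?t x \<cdot>\<^bsub>F\<^esub> Ob \<xi> (Dom F x) = Ob \<xi>' (Cod F x) \<cdot>\<^bsub>F\<^esub> x"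
    using V x by simp
  assume xc: "x \<in> cart"
  \<comment> \<open>A vertical cartesian map is invertible; a section is a functor on the fiber and
    keeps it invertible, and isomorphisms are cartesian.\<close>
  have "vert x \<in> cart"
    by (rule cart_cancel[OF c(1)]) (use V x c xc in simp_all)
  then obtain s where s: "s \<in> Arr F" "Dom F s = Cod F (vert x)" "Cod F s = Dom F (vert x)"
    "Ar P s = Idt E (Dom E m)" "vert x \<cdot>\<^bsub>F\<^esub> s = Idt F (Cod F (vert x))" "s \<cdot>\<^bsub>F\<^esub> vert x = Idt F (Dom F (vert x))"
    by (rule vertical_cart_iso) (use V PX in simp_all)
  note S = ext_objD(8-12)[OF T(1) s(1,4)]
  have "lower (Ar \<xi> (vert x)) \<in> cart"
  proof (rule iso_cart)
    show "lower (Ar \<xi> (vert x)) \<cdot>\<^bsub>F\<^esub> lower (Ar \<xi> s) = Idt F (Cod F (lower (Ar \<xi> (vert x))))"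
      using ext_objD(13)[OF T(1) s(1,4) V(1) V'] s V O ext_objD(7)[OF T(1) c' c(5)] x by simp
    show "lower (Ar \<xi> s) \<cdot>\<^bsub>F\<^esub> lower (Ar \<xi> (vert x)) = Idt F (Dom F (lower (Ar \<xi> (vert x))))"
      using ext_objD(13)[OF T(1) V(1) V' s(1,4)] s V O ext_objD(7)[OF T(1) X(1) PX(1)] x by simp
  qed (use S O s V x in simp_all)
  then show "push ?t x \<in> cart"
    unfolding pd using ph O V x by (intro cart_cmp) simp_all
qed

text \<open>The chosen lift of an identity may differ from the identity, which is why
  \<open>ext_idt\<close> contains it; the vertical part of \<open>Idt F X\<close> cancels
  it.\<close>

lemma push_idt:
  assumes o: "(m, \<xi>) \<in> ext_objs E F P" and X: "X \<in> Obj F" "Ob P X = Dom E m"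
  shows "push (ext_idt E F P cl (m, \<xi>)) (Idt F X) = Idt F (Cod F (Ob \<xi> X))"
proof -
  have m: "m \<in> Arr E" using ext_objD(1)[OF o] .
  let ?c = "cl (Idt E (Dom E m)) X"
  have c: "?c \<in> Arr F" "Cod F ?c = X" "Ar P ?c = Idt E (Dom E m)" "Ob P (Dom F ?c) = Dom E m"
    using cl_simps[of X "Idt E (Dom E m)"] X m by simp_all
  have i: "Idt F X \<in> Arr F" "Dom F (Idt F X) = X" "Cod F (Idt F X) = X" "Ar P (Idt F X) = Idt E (Dom E m)"
    using X by simp_all
  note V = vert_simps[OF i(1), unfolded i X(2)]
  have "push (ext_idt E F P cl (m, \<xi>)) (Idt F X) = lower (Ar \<xi> ?c) \<cdot>\<^bsub>F\<^esub> lower (Ar \<xi> (vert (Idt F X)))"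
    using X i by (simp add: push_def ext_idt_def)
  also have "\<dots> = lower (Ar \<xi> (Idt F X))"
    using ext_objD(13)[OF o V(1,4) c(1,3)] V c by simp
  finally show ?thesis using ext_objD(7)[OF o X] by simp
qed

text \<open>In terms of \<open>push\<close> the composition of \<open>Ext\<close> is strict: the
  canonical isomorphism in \<open>ext_cmp\<close> and the reindexing in the naturality square absorb
  each other, by the equation \<open>eq\<close> between vertical maps.\<close>

lemma push_cmp:
  assumes t: "((m, \<xi>), (\<sigma>, \<phi>), (m', \<xi>')) \<in> ext_arrs E F P cl" (is "?t \<in> _")
    and t': "((m', \<xi>'), (\<sigma>', \<phi>'), (m'', \<xi>'')) \<in> ext_arrs E F P cl" (is "?t' \<in> _")
    and x: "x \<in> Arr F" "Ar P x = upper \<sigma>" and x': "x' \<in> Arr F" "Ar P x' = upper \<sigma>'" "Cod F x = Dom F x'"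
  shows "push (ext_cmp E F P cl ?t' ?t) (x' \<cdot>\<^bsub>F\<^esub> x) = push ?t' x' \<cdot>\<^bsub>F\<^esub> push ?t x"
proof -
  note T = ext_arrD[OF t] and T' = ext_arrD[OF t']
  let ?h = "upper \<sigma>" and ?h' = "upper \<sigma>'" and ?W = "Cod F x'"
  have xx: "x' \<cdot>\<^bsub>F\<^esub> x \<in> Arr F" "Dom F (x' \<cdot>\<^bsub>F\<^esub> x) = Dom F x" "Cod F (x' \<cdot>\<^bsub>F\<^esub> x) = ?W"
    "Ar P (x' \<cdot>\<^bsub>F\<^esub> x) = ?h' \<cdot>\<^bsub>E\<^esub> ?h"
    using x x' by simp_all
  have PX: "Ob P (Dom F x) = Dom E m" "Ob P (Cod F x) = Dom E m'" "Ob P (Dom F x') = Dom E m'" "Ob P ?W = Dom E m''"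
    using P_simps(3,4)[OF x(1)] P_simps(3,4)[OF x'(1)] x x' T T' by simp_all
  have X: "Dom F x \<in> Obj F" "Cod F x \<in> Obj F" "?W \<in> Obj F" using x x' by auto
  note V = vert_simps[OF x(1), unfolded PX x(2)] and V' = vert_simps[OF x'(1), unfolded PX x'(2)]
    and V'' = vert_simps[OF xx(1), unfolded xx PX]
  have c': "cl ?h' ?W \<in> cart" "cl ?h' ?W \<in> Arr F" "Cod F (cl ?h' ?W) = ?W" "Ob P (Dom F (cl ?h' ?W)) = Dom E m'"
    using cl_simps[OF X(3) T'(5)] T' PX by simp_all
  have d': "Dom F (cl ?h' ?W) \<in> Obj F" using c' by simp
  let ?c = "cl ?h (Dom F (cl ?h' ?W))"
  have c: "?c \<in> cart" "?c \<in> Arr F" "Cod F ?c = Dom F (cl ?h' ?W)" "Ob P (Dom F ?c) = Dom E m" "Ar P ?c = ?h"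
    using cl_simps[OF d' T(5)] T c' by simp_all
  have d: "Dom F ?c \<in> Obj F" using c by simp
  have cW: "cl ?h (Cod F x) \<in> cart" "cl ?h (Cod F x) \<in> Arr F" "Cod F (cl ?h (Cod F x)) = Cod F x"
    "Ob P (Dom F (cl ?h (Cod F x))) = Dom E m"
    using cl_simps[OF X(2) T(5)] T PX by simp_all
  note RC = reindex_comp_props[OF T(5) T'(5) _ X(3), unfolded T T' PX, OF refl refl]
  have Ve: "Ar P (vert x') = Idt E (Cod E ?h)" using V' T by simp
  note RI = reindex_props[OF T(5) V'(1) Ve, unfolded T V' V]
  let ?rc = "reindex_comp E F P cl ?h' ?h ?W" and ?ri = "reindex E F P cl ?h (vert x')"
  have m: "m \<in> Arr E" using ext_objD(1)[OF T(1)] .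
  \<comment> \<open>Both sides become \<open>x' x\<close> after the two chosen lifts in succession,
    and this composite of lifts is cartesian.\<close>
  have eq: "?rc \<cdot>\<^bsub>F\<^esub> vert (x' \<cdot>\<^bsub>F\<^esub> x) = ?ri \<cdot>\<^bsub>F\<^esub> vert x"
  proof (rule cart_eqI[OF cart_cmp[OF c(1) c'(1) c(3)], of _ "Dom F x"])
    show "?rc \<cdot>\<^bsub>F\<^esub> vert (x' \<cdot>\<^bsub>F\<^esub> x) \<in> hom F (Dom F x) (Dom F (cl ?h' ?W \<cdot>\<^bsub>F\<^esub> ?c))"
      using RC V'' c c' by simp
    show "?ri \<cdot>\<^bsub>F\<^esub> vert x \<in> hom F (Dom F x) (Dom F (cl ?h' ?W \<cdot>\<^bsub>F\<^esub> ?c))"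
      using RI V c c' x' by simp
    show "Ar P (?rc \<cdot>\<^bsub>F\<^esub> vert (x' \<cdot>\<^bsub>F\<^esub> x)) = Ar P (?ri \<cdot>\<^bsub>F\<^esub> vert x)"
      using RC RI V V'' x' m by simp
    have "(cl ?h' ?W \<cdot>\<^bsub>F\<^esub> ?c) \<cdot>\<^bsub>F\<^esub> ?rc \<cdot>\<^bsub>F\<^esub> vert (x' \<cdot>\<^bsub>F\<^esub> x) = (cl ?h' ?W \<cdot>\<^bsub>F\<^esub> ?c \<cdot>\<^bsub>F\<^esub> ?rc) \<cdot>\<^bsub>F\<^esub> vert (x' \<cdot>\<^bsub>F\<^esub> x)"
      using RC(1-4) V''(1-4) c c' by simp
    also have "\<dots> = x' \<cdot>\<^bsub>F\<^esub> x" by (simp only: RC(5) V''(5))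
    also have "\<dots> = (cl ?h' ?W \<cdot>\<^bsub>F\<^esub> vert x') \<cdot>\<^bsub>F\<^esub> (cl ?h (Cod F x) \<cdot>\<^bsub>F\<^esub> vert x)"
      by (simp only: V(5) V'(5))
    also have "\<dots> = cl ?h' ?W \<cdot>\<^bsub>F\<^esub> (vert x' \<cdot>\<^bsub>F\<^esub> cl ?h (Cod F x)) \<cdot>\<^bsub>F\<^esub> vert x"
      using V(1-4) V'(1-4) c' cW x' by simp
    also have "\<dots> = cl ?h' ?W \<cdot>\<^bsub>F\<^esub> (?c \<cdot>\<^bsub>F\<^esub> ?ri) \<cdot>\<^bsub>F\<^esub> vert x"
      by (simp only: RI(5) x'(3))
    also have "\<dots> = (cl ?h' ?W \<cdot>\<^bsub>F\<^esub> ?c) \<cdot>\<^bsub>F\<^esub> ?ri \<cdot>\<^bsub>F\<^esub> vert x"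
      using V(1-4) RI(1-4) c c' x' by simp
    finally show "(cl ?h' ?W \<cdot>\<^bsub>F\<^esub> ?c) \<cdot>\<^bsub>F\<^esub> ?rc \<cdot>\<^bsub>F\<^esub> vert (x' \<cdot>\<^bsub>F\<^esub> x) = (cl ?h' ?W \<cdot>\<^bsub>F\<^esub> ?c) \<cdot>\<^bsub>F\<^esub> ?ri \<cdot>\<^bsub>F\<^esub> vert x" .
  qed
  note p' = T'(11-15)[OF X(3) PX(4)] and p = T(11-15)[OF d' c'(4)] and pW = T(11-15)[OF X(2) PX(2)]
  let ?l = "\<lambda>y. lower (Ar \<xi> y)" and ?l' = "\<lambda>y. lower (Ar \<xi>' y)"
  note L = ext_objD(8-10)[OF T(1)] and L' = ext_objD(8-10)[OF T(2)]
  have "push (ext_cmp E F P cl ?t' ?t) (x' \<cdot>\<^bsub>F\<^esub> x) = (\<phi>' ?W \<cdot>\<^bsub>F\<^esub> \<phi> (Dom F (cl ?h' ?W)) \<cdot>\<^bsub>F\<^esub> ?l ?rc) \<cdot>\<^bsub>F\<^esub> ?l (vert (x' \<cdot>\<^bsub>F\<^esub> x))"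
    unfolding push_def ext_cmp_def prod.case xx(3) using X(3) PX(4) by simp
  also have "\<dots> = \<phi>' ?W \<cdot>\<^bsub>F\<^esub> \<phi> (Dom F (cl ?h' ?W)) \<cdot>\<^bsub>F\<^esub> (?l ?rc \<cdot>\<^bsub>F\<^esub> ?l (vert (x' \<cdot>\<^bsub>F\<^esub> x)))"
    using p' p L[OF RC(1,4)] L[OF V''(1,4)] RC(1-4) V''(1-4) by simp
  also have "?l ?rc \<cdot>\<^bsub>F\<^esub> ?l (vert (x' \<cdot>\<^bsub>F\<^esub> x)) = ?l ?ri \<cdot>\<^bsub>F\<^esub> ?l (vert x)"
    using ext_objD(13)[OF T(1) V''(1,4) RC(1,4)] ext_objD(13)[OF T(1) V(1,4) RI(1,4)] eq RC(1-4) RI(1-4) V(1-4) V''(1-4) x'(3)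
    by simp
  also have "\<phi>' ?W \<cdot>\<^bsub>F\<^esub> \<phi> (Dom F (cl ?h' ?W)) \<cdot>\<^bsub>F\<^esub> (?l ?ri \<cdot>\<^bsub>F\<^esub> ?l (vert x)) =
      \<phi>' ?W \<cdot>\<^bsub>F\<^esub> (\<phi> (Dom F (cl ?h' ?W)) \<cdot>\<^bsub>F\<^esub> ?l ?ri) \<cdot>\<^bsub>F\<^esub> ?l (vert x)"
    using p' p L[OF RI(1,4)] L[OF V(1,4)] RI(1-4) V(1-4) x'(3) by simp
  also have "\<phi> (Dom F (cl ?h' ?W)) \<cdot>\<^bsub>F\<^esub> ?l ?ri = ?l' (vert x') \<cdot>\<^bsub>F\<^esub> \<phi> (Cod F x)"
    using T(17)[OF V'(1,4)] V'(2,3) x'(3) p(4) c' by simp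
  also have "\<phi>' ?W \<cdot>\<^bsub>F\<^esub> (?l' (vert x') \<cdot>\<^bsub>F\<^esub> \<phi> (Cod F x)) \<cdot>\<^bsub>F\<^esub> ?l (vert x) =
      (\<phi>' ?W \<cdot>\<^bsub>F\<^esub> ?l' (vert x')) \<cdot>\<^bsub>F\<^esub> (\<phi> (Cod F x) \<cdot>\<^bsub>F\<^esub> ?l (vert x))"
    using p' pW L'[OF V'(1,4)] L[OF V(1,4)] V(1-4) V'(1-4) x'(3) by simp
  finally show ?thesis by (simp only: push_def prod.case)
qed

text \<open>Converse of the passage to \<open>push\<close>: a strictly functorial assignment
  \<open>pl\<close> on all maps over upper sides determines a functor into \<open>Ext\<close>. Its
  values at identities of \<open>K\<close> on vertical maps give the action of the sections, its
  values on chosen lifts give the components, and both naturality and composition are instances of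
  \<open>pl_cmp\<close>.\<close>

lemma ext_functorI:
  fixes K :: "('x, 'y) cat" and H :: "('x, 'y, 'a, 'a square) funct"
  assumes K: "category K" and H: "is_functor K (arrow_cat E) H"
    and S: "\<And>c X. c \<in> Obj K \<Longrightarrow> X \<in> Obj F \<Longrightarrow> Ob P X = Dom E (Ob H c) \<Longrightarrow>
      S c X \<in> cart \<and> Ar P (S c X) = Ob H c \<and> Dom F (S c X) = X"
    and pl: "\<And>t x. t \<in> Arr K \<Longrightarrow> x \<in> Arr F \<Longrightarrow> Ar P x = upper (Ar H t) \<Longrightarrow>
      pl t x \<in> hom F (Cod F (S (Dom K t) (Dom F x))) (Cod F (S (Cod K t) (Cod F x))) \<and>
      Ar P (pl t x) = lower (Ar H t) \<and>
      pl t x \<cdot>\<^bsub>F\<^esub> S (Dom K t) (Dom F x) = S (Cod K t) (Cod F x) \<cdot>\<^bsub>F\<^esub> x"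
    and pl_cart: "\<And>t x. t \<in> Arr K \<Longrightarrow> x \<in> cart \<Longrightarrow> Ar P x = upper (Ar H t) \<Longrightarrow> pl t x \<in> cart"
    and pl_idt: "\<And>c X. c \<in> Obj K \<Longrightarrow> X \<in> Obj F \<Longrightarrow> Ob P X = Dom E (Ob H c) \<Longrightarrow>
      pl (Idt K c) (Idt F X) = Idt F (Cod F (S c X))"
    and pl_cmp: "\<And>t t' x x'. t \<in> Arr K \<Longrightarrow> t' \<in> Arr K \<Longrightarrow> Cod K t = Dom K t' \<Longrightarrow>
      x \<in> Arr F \<Longrightarrow> x' \<in> Arr F \<Longrightarrow> Cod F x = Dom F x' \<Longrightarrow>
      Ar P x = upper (Ar H t) \<Longrightarrow> Ar P x' = upper (Ar H t') \<Longrightarrow>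
      pl (t' \<cdot>\<^bsub>K\<^esub> t) (x' \<cdot>\<^bsub>F\<^esub> x) = pl t' x' \<cdot>\<^bsub>F\<^esub> pl t x"
  shows "\<exists>G. is_functor K (Ext E F P cl) G \<and> functor_eq K (ext_forget \<circ>\<^sub>F G) H"
proof -
  interpret K: category K by (rule K)
  note Hs = functorD[OF H, unfolded arrow_cat_simps]
  have HA: "sdom (Ar H t) = Ob H (Dom K t)" "scod (Ar H t) = Ob H (Cod K t)"
    "upper (Ar H t) \<in> Arr E" "Dom E (upper (Ar H t)) = Dom E (Ob H (Dom K t))"
    "Cod E (upper (Ar H t)) = Dom E (Ob H (Cod K t))"
    "lower (Ar H t) \<in> Arr E" "Dom E (lower (Ar H t)) = Cod E (Ob H (Dom K t))"
    "Cod E (lower (Ar H t)) = Cod E (Ob H (Cod K t))" if "t \<in> Arr K" for t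
    using Hs(2-4)[OF that] by (auto simp: Arr_arrow_cat)
  have HI: "upper (Ar H (Idt K c)) = Idt E (Dom E (Ob H c))" "lower (Ar H (Idt K c)) = Idt E (Cod E (Ob H c))"
    if "c \<in> Obj K" for c using Hs(5)[OF that] by auto
  have SA: "S c X \<in> Arr F" if "c \<in> Obj K" "X \<in> Obj F" "Ob P X = Dom E (Ob H c)" for c X
    using S[OF that] cart_Arr by blast
  define sec where "sec c =
    \<lparr>Ob = (\<lambda>X \<in> Obj (fiber E F P (Dom E (Ob H c))). S c X),
     Ar = (\<lambda>y \<in> Arr (fiber E F P (Dom E (Ob H c))).
       Square (S c (Dom F y)) y (pl (Idt K c) y) (S c (Cod F y)))\<rparr>" for c
  have sec_Ob: "Ob (sec c) X = S c X" if "X \<in> Obj F" "Ob P X = Dom E (Ob H c)" for c X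
    using that by (simp add: sec_def)
  have sec_Ar: "Ar (sec c) y = Square (S c (Dom F y)) y (pl (Idt K c) y) (S c (Cod F y))"
    if "y \<in> Arr F" "Ar P y = Idt E (Dom E (Ob H c))" for c y
    using that by (simp add: sec_def)
  have fib: "Ob P (Dom F y) = A" "Ob P (Cod F y) = A" if "y \<in> Arr F" "Ar P y = Idt E A" "A \<in> Obj E" for y A
    using P_simps(3,4)[OF that(1)] that(2,3) by simp_all
  define G :: "('x, 'y, ('a, 'p, 'b) ext_obj, ('a, 'p, 'b) ext_arr) funct" where
    "G = \<lparr>Ob = (\<lambda>c. (Ob H c, sec c)),
      Ar = (\<lambda>t. ((Ob H (Dom K t), sec (Dom K t)),
        (Ar H t, \<lambda>X \<in> Obj (fiber E F P (Dom E (Ob H (Cod K t)))). pl t (cl (upper (Ar H t)) X)),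
        (Ob H (Cod K t), sec (Cod K t))))\<rparr>"
  have objs: "(Ob H c, sec c) \<in> ext_objs E F P" if c: "c \<in> Obj K" for c
  proof -
    let ?m = "Ob H c"
    let ?Fi = "fiber E F P (Dom E ?m)" and ?Co = "cart_over E F P ?m"
    have m: "?m \<in> Arr E" using Hs(1)[OF c] .
    have I: "Idt K c \<in> Arr K" "Dom K (Idt K c) = c" "Cod K (Idt K c) = c" using c by auto
    have fibm: "Ob P (Dom F y) = Dom E ?m" "Ob P (Cod F y) = Dom E ?m" if "y \<in> Arr F" "Ar P y = Idt E (Dom E ?m)" for y
      using fib[OF that] m by auto
    have plI: "pl (Idt K c) y \<in> hom F (Cod F (S c (Dom F y))) (Cod F (S c (Cod F y)))"
      "Ar P (pl (Idt K c) y) = Idt E (Cod E ?m)" "pl (Idt K c) y \<cdot>\<^bsub>F\<^esub> S c (Dom F y) = S c (Cod F y) \<cdot>\<^bsub>F\<^esub> y"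
      if "y \<in> Arr F" "Ar P y = Idt E (Dom E ?m)" for y
      using pl[OF I(1), of y] that HI[OF c] I by simp_all
    have "is_functor ?Fi ?Co (sec c)"
      unfolding is_functor_def
    proof (intro conjI ballI impI)
      show "Ob (sec c) X \<in> Obj ?Co" if "X \<in> Obj ?Fi" for X
        using that S[OF c, of X] sec_Ob[of X c] by simp
      show "Ar (sec c) y \<in> hom ?Co (Ob (sec c) (Dom ?Fi y)) (Ob (sec c) (Cod ?Fi y))" if "y \<in> Arr ?Fi" for y
      proof -
        have y: "y \<in> Arr F" "Ar P y = Idt E (Dom E ?m)" using that by auto
        have o: "Dom F y \<in> Obj F" "Cod F y \<in> Obj F" using y by auto
        show ?thesis
          using S[OF c o(1) fibm(1)[OF y]] S[OF c o(2) fibm(2)[OF y]] SA[OF c o(1) fibm(1)[OF y]]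
            SA[OF c o(2) fibm(2)[OF y]] plI[OF y] y fibm[OF y] o
          by (simp add: sec_Ob sec_Ar Arr_arrow_cat)
      qed
      show "Ar (sec c) (Idt ?Fi X) = Idt ?Co (Ob (sec c) X)" if "X \<in> Obj ?Fi" for X
        using that S[OF c, of X] sec_Ob[of X c] sec_Ar[of "Idt F X" c] pl_idt[OF c, of X] by simp
      show "Ar (sec c) (y' \<cdot>\<^bsub>?Fi\<^esub> y) = Ar (sec c) y' \<cdot>\<^bsub>?Co\<^esub> Ar (sec c) y"
        if "y \<in> Arr ?Fi" "y' \<in> Arr ?Fi" "Cod ?Fi y = Dom ?Fi y'" for y y'
        using that sec_Ar[of "y' \<cdot>\<^bsub>F\<^esub> y" c] sec_Ar[of y c] sec_Ar[of y' c] m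
          pl_cmp[OF I(1) I(1), of y y'] I HI[OF c] by simp
    qed
    moreover have "functor_eq ?Fi (dom_functor F \<circ>\<^sub>F sec c) id_functor"
      using S[OF c] by (auto simp: functor_eq_def dom_functor_def id_functor_def sec_Ob sec_Ar)
    ultimately show ?thesis
      using m by (simp add: ext_objs_def sec_def)
  qed
  have arrs: "Ar G t \<in> ext_arrs E F P cl" if t: "t \<in> Arr K" for t
  proof -
    let ?c = "Dom K t" and ?c' = "Cod K t"
    have c: "?c \<in> Obj K" "?c' \<in> Obj K" using t by auto
    note m = Hs(1)[OF c(1)] Hs(1)[OF c(2)]
    let ?h = "upper (Ar H t)"
    note h = HA[OF t]
    have clX: "cl ?h X \<in> cart" "cl ?h X \<in> Arr F" "Cod F (cl ?h X) = X" "Ar P (cl ?h X) = ?h"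
      "Ob P (Dom F (cl ?h X)) = Dom E (Ob H ?c)" "Dom F (cl ?h X) \<in> Obj F"
      if "X \<in> Obj F" "Ob P X = Dom E (Ob H ?c')" for X
      using cl_simps[OF that(1) h(3)] that h by simp_all
    have nat: "pl t (cl ?h (Cod F y)) \<cdot>\<^bsub>F\<^esub> lower (Ar (sec ?c) (reindex E F P cl ?h y)) =
        lower (Ar (sec ?c') y) \<cdot>\<^bsub>F\<^esub> pl t (cl ?h (Dom F y))"
      if y: "y \<in> Arr F" "Ar P y = Idt E (Dom E (Ob H ?c'))" for y
    proof -
      have "Ar P y = Idt E (Cod E ?h)" using y h by simp
      note R = reindex_props[OF h(3) y(1) this, unfolded h(4)]
      note f = fib[OF y E.obj_simps(1)[OF m(2)]]
      have o: "Dom F y \<in> Obj F" "Cod F y \<in> Obj F" using y by auto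
      \<comment> \<open>Naturality: one map of \<open>F\<close> is factored as a lift after a
        vertical map and as a vertical map after a lift, with \<open>t\<close> composed with an
        identity on the matching side.\<close>
      have "pl (t \<cdot>\<^bsub>K\<^esub> Idt K ?c) (cl ?h (Cod F y) \<cdot>\<^bsub>F\<^esub> reindex E F P cl ?h y) =
          pl t (cl ?h (Cod F y)) \<cdot>\<^bsub>F\<^esub> pl (Idt K ?c) (reindex E F P cl ?h y)"
        by (rule pl_cmp) (use t c R(1-4) clX[OF o(2) f(2)] HI in simp_all)
      moreover have "pl (Idt K ?c' \<cdot>\<^bsub>K\<^esub> t) (y \<cdot>\<^bsub>F\<^esub> cl ?h (Dom F y)) =
          pl (Idt K ?c') y \<cdot>\<^bsub>F\<^esub> pl t (cl ?h (Dom F y))"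
        by (rule pl_cmp) (use t c y clX[OF o(1) f(1)] HI in simp_all)
      ultimately show ?thesis
        using R t sec_Ar[OF R(1,4)] sec_Ar[OF y] by simp
    qed
    have "pl t (cl ?h X) \<in> hom F (Cod F (Ob (sec ?c) (Dom F (cl ?h X)))) (Cod F (Ob (sec ?c') X)) \<and>
        pl t (cl ?h X) \<in> cart \<and> Ar P (pl t (cl ?h X)) = lower (Ar H t) \<and>
        pl t (cl ?h X) \<cdot>\<^bsub>F\<^esub> Ob (sec ?c) (Dom F (cl ?h X)) = Ob (sec ?c') X \<cdot>\<^bsub>F\<^esub> cl ?h X"
      if X: "X \<in> Obj F" "Ob P X = Dom E (Ob H ?c')" for X
    proof -
      note C = clX[OF X]
      show ?thesis
        using pl[OF t C(2,4)] pl_cart[OF t C(1,4)] sec_Ob[OF X] sec_Ob[OF C(6,5)] C(3) by simp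
    qed
    then show ?thesis
      using objs[OF c(1)] objs[OF c(2)] Hs(2-4)[OF t] nat fib[OF _ _ E.obj_simps(1)[OF m(2)]]
      unfolding G_def ext_arrs_def by simp
  qed
  have "is_functor K (Ext E F P cl) G"
    unfolding is_functor_def
  proof (intro conjI ballI impI)
    show "Ob G c \<in> Obj (Ext E F P cl)" if "c \<in> Obj K" for c using objs[OF that] by (simp add: G_def)
    show "Ar G t \<in> hom (Ext E F P cl) (Ob G (Dom K t)) (Ob G (Cod K t))" if "t \<in> Arr K" for t
      using arrs[OF that] by (simp add: G_def)
    show "Ar G (Idt K c) = Idt (Ext E F P cl) (Ob G c)" if c: "c \<in> Obj K" for c
    proof -
      have m: "Ob H c \<in> Arr E" using Hs(1)[OF c] .
      have "lower (Ar (sec c) (cl (Idt E (Dom E (Ob H c))) X)) = pl (Idt K c) (cl (Idt E (Dom E (Ob H c))) X)"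
        if "X \<in> Obj F" "Ob P X = Dom E (Ob H c)" for X
        using cl_simps[OF that(1), of "Idt E (Dom E (Ob H c))"] that m
          sec_Ar[of "cl (Idt E (Dom E (Ob H c))) X" c] by simp
      then show ?thesis
        using c HI[OF c] Hs(5)[OF c] by (simp add: G_def ext_idt_def restrict_def fun_eq_iff)
    qed
    show "Ar G (t' \<cdot>\<^bsub>K\<^esub> t) = Ar G t' \<cdot>\<^bsub>Ext E F P cl\<^esub> Ar G t"
      if t: "t \<in> Arr K" "t' \<in> Arr K" "Cod K t = Dom K t'" for t t'
    proof -
      let ?h = "upper (Ar H t)" and ?h' = "upper (Ar H t')" and ?c = "Dom K t" and ?c'' = "Cod K t'"
      note h = HA[OF t(1)] and h' = HA[OF t(2)]
      have c: "?c \<in> Obj K" "?c'' \<in> Obj K" using t by auto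
      have Hc: "Ar H (t' \<cdot>\<^bsub>K\<^esub> t) = Ar H t' \<cdot>\<^bsub>arrow_cat E\<^esub> Ar H t"
        using functorD(6)[OF H t] .
      have "pl (t' \<cdot>\<^bsub>K\<^esub> t) (cl (?h' \<cdot>\<^bsub>E\<^esub> ?h) X) =
          pl t' (cl ?h' X) \<cdot>\<^bsub>F\<^esub> pl t (cl ?h (Dom F (cl ?h' X))) \<cdot>\<^bsub>F\<^esub>
            lower (Ar (sec ?c) (reindex_comp E F P cl ?h' ?h X))"
        if X: "X \<in> Obj F" "Ob P X = Dom E (Ob H ?c'')" for X
      proof -
        have X': "Ob P X = Cod E ?h'" using X h' by simp
        have hh: "Cod E ?h = Dom E ?h'" using h h' t by simp
        note C' = cl_simps[OF X(1) h'(3) X'[symmetric]]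
        have d: "Dom F (cl ?h' X) \<in> Obj F" using C' by simp
        have e: "Cod E ?h = Ob P (Dom F (cl ?h' X))" using C' hh by simp
        note C = cl_simps[OF d h(3) e]
        note R = reindex_comp_props[OF h(3) h'(3) hh X(1) X']
        let ?r = "reindex_comp E F P cl ?h' ?h X"
        have r: "Ar P ?r = Idt E (Dom E (Ob H ?c))" using R(4) h by simp
        \<comment> \<open>The chosen lift of the composite is split into two chosen lifts and the
          canonical isomorphism, which is treated as a map over the identity of
          \<open>Dom K t\<close>.\<close>
        have "pl (t \<cdot>\<^bsub>K\<^esub> Idt K ?c) (cl ?h (Dom F (cl ?h' X)) \<cdot>\<^bsub>F\<^esub> ?r) =
            pl t (cl ?h (Dom F (cl ?h' X))) \<cdot>\<^bsub>F\<^esub> pl (Idt K ?c) ?r"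
          by (rule pl_cmp) (use t c R(1-3) r C HI in simp_all)
        moreover have "pl (t' \<cdot>\<^bsub>K\<^esub> t) (cl ?h' X \<cdot>\<^bsub>F\<^esub> (cl ?h (Dom F (cl ?h' X)) \<cdot>\<^bsub>F\<^esub> ?r)) =
            pl t' (cl ?h' X) \<cdot>\<^bsub>F\<^esub> pl t (cl ?h (Dom F (cl ?h' X)) \<cdot>\<^bsub>F\<^esub> ?r)"
          by (rule pl_cmp) (use t c R(1-3) r C C' h in simp_all)
        ultimately show ?thesis
          using R(5) sec_Ar[OF R(1) r] t by simp
      qed
      then have "(\<lambda>X \<in> Obj (fiber E F P (Dom E (Ob H ?c''))). pl (t' \<cdot>\<^bsub>K\<^esub> t) (cl (?h' \<cdot>\<^bsub>E\<^esub> ?h) X)) =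
        (\<lambda>X \<in> Obj (fiber E F P (Dom E (Ob H ?c''))).
          (\<lambda>X \<in> Obj (fiber E F P (Dom E (Ob H ?c''))). pl t' (cl ?h' X)) X \<cdot>\<^bsub>F\<^esub>
          (\<lambda>X \<in> Obj (fiber E F P (Dom E (Ob H (Dom K t')))). pl t (cl ?h X)) (Dom F (cl ?h' X)) \<cdot>\<^bsub>F\<^esub>
            lower (Ar (sec ?c) (reindex_comp E F P cl ?h' ?h X)))"
        using cl_simps[OF _ h'(3)] h' by (intro restrict_ext) simp
      then show ?thesis
        using t Hc by (simp add: G_def ext_cmp_def)
    qed
  qed
  moreover have "functor_eq K (ext_forget \<circ>\<^sub>F G) H"
    by (simp add: functor_eq_def ext_forget_def G_def)
  ultimately show ?thesis by blast
qed

definition fill where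
  "fill c x w = (THE z. z \<in> hom F (Dom F x) (Dom F c) \<and> Ar P z = w \<and> c \<cdot>\<^bsub>F\<^esub> z = x)"

lemma fill_simps:
  assumes "c \<in> cart" "x \<in> Arr F" "Cod F x = Cod F c"
    "w \<in> hom E (Ob P (Dom F x)) (Ob P (Dom F c))" "Ar P c \<cdot>\<^bsub>E\<^esub> w = Ar P x"
  shows "fill c x w \<in> Arr F" "Dom F (fill c x w) = Dom F x" "Cod F (fill c x w) = Dom F c"
    "Ar P (fill c x w) = w" "c \<cdot>\<^bsub>F\<^esub> fill c x w = x"
    "x \<in> cart \<Longrightarrow> fill c x w \<in> cart"
proof -
  have "\<exists>!z. z \<in> hom F (Dom F x) (Dom F c) \<and> Ar P z = w \<and> c \<cdot>\<^bsub>F\<^esub> z = x"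
    using assms unfolding cartesian_def by blast
  from theI'[OF this] show F: "fill c x w \<in> Arr F" "Dom F (fill c x w) = Dom F x" "Cod F (fill c x w) = Dom F c"
    "Ar P (fill c x w) = w" "c \<cdot>\<^bsub>F\<^esub> fill c x w = x"
    unfolding fill_def[symmetric] by auto
  show "fill c x w \<in> cart" if "x \<in> cart"
    by (rule cart_cancel[OF assms(1)]) (use that F in auto)
qed

lemma fill_eqI:
  assumes c: "c \<in> cart" and z: "z \<in> Arr F" "Cod F z = Dom F c" "c \<cdot>\<^bsub>F\<^esub> z = x" "Ar P z = w"
  shows "fill c x w = z"
proof -
  have cA [simp]: "c \<in> Arr F" using c cart_Arr by blast
  have x: "x \<in> Arr F" "Cod F x = Cod F c" "Dom F x = Dom F z" using z by auto
  have P: "w \<in> hom E (Ob P (Dom F x)) (Ob P (Dom F c))" "Ar P c \<cdot>\<^bsub>E\<^esub> w = Ar P x"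
    using z by auto
  note f = fill_simps[OF c x(1,2) P]
  show ?thesis
    by (rule cart_eqI[OF c, of _ "Dom F z"]) (use f z x in simp_all)
qed

end

section \<open>Density comonads and the cell functors\<close>

text \<open>Serves to compare pushouts: compatibility speaks of pushouts in \<open>E\<close>, and a
  pushout of the comma category is recognized as one in \<open>E\<close> through an isomorphism with
  one whose image is known.\<close>

lemma (in category) pushout_iso:
  assumes po: "pushout m f p q" and h: "h \<in> Arr C" "Dom C h = Cod C p"
    and k: "k \<in> Arr C" "Dom C k = Cod C h" "Cod C k = Dom C h"
    and hk: "h \<cdot> k = Idt C (Cod C h)" "k \<cdot> h = Idt C (Dom C h)"
  shows "pushout m f (h \<cdot> p) (h \<cdot> q)"
  unfolding pushout_def
proof (intro conjI allI impI; (elim conjE)?)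
  note [simp] = pushoutD(1-8)[OF po] h k
  show "(h \<cdot> p) \<cdot> m = (h \<cdot> q) \<cdot> f" using pushoutD(9)[OF po] by simp
  fix v w assume v: "v \<in> Arr C" "w \<in> Arr C" "Dom C v = Cod C m" "Dom C w = Cod C f" "Cod C w = Cod C v"
    "v \<cdot> m = w \<cdot> f"
  obtain z where z: "z \<in> hom C (Cod C p) (Cod C v)" "z \<cdot> p = v" "z \<cdot> q = w"
    by (rule pushout_ex[OF po, of v "Cod C v" w]) (use v in auto)
  have kh: "k \<cdot> h \<cdot> x = x" if "x \<in> Arr C" "Cod C x = Cod C p" for x
    using cmp_eq_cmp[OF hk(2), of x] that by simp
  show "\<exists>!z. z \<in> hom C (Cod C (h \<cdot> p)) (Cod C v) \<and> z \<cdot> h \<cdot> p = v \<and> z \<cdot> h \<cdot> q = w"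
  proof (rule ex1I[of _ "z \<cdot> k"])
    show "z \<cdot> k \<in> hom C (Cod C (h \<cdot> p)) (Cod C v) \<and> (z \<cdot> k) \<cdot> h \<cdot> p = v \<and> (z \<cdot> k) \<cdot> h \<cdot> q = w"
      using z by (simp add: kh)
    fix z' assume z': "z' \<in> hom C (Cod C (h \<cdot> p)) (Cod C v) \<and> z' \<cdot> h \<cdot> p = v \<and> z' \<cdot> h \<cdot> q = w"
    have "z' \<cdot> h = z"
      by (rule pushout_eqI[OF po, of _ "Cod C v"]) (use z' z in simp_all)
    then have "(z' \<cdot> h) \<cdot> k = z \<cdot> k" by simp
    then show "z' = z \<cdot> k" using z' hk(1) by simp
  qed
qed (use po h in \<open>auto simp: pushoutD\<close>)

lemma (in category) pushout_unique:
  assumes po: "pushout m f p q" and po': "pushout m f p' q'"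
  obtains h k where "h \<in> hom C (Cod C p) (Cod C p')" "k \<in> hom C (Cod C p') (Cod C p)"
    "h \<cdot> p = p'" "h \<cdot> q = q'" "h \<cdot> k = Idt C (Cod C p')" "k \<cdot> h = Idt C (Cod C p)"
proof -
  note P = pushoutD[OF po] and P' = pushoutD[OF po']
  obtain h where h: "h \<in> hom C (Cod C p) (Cod C p')" "h \<cdot> p = p'" "h \<cdot> q = q'"
    by (rule pushout_ex[OF po, of p' "Cod C p'" q']) (use P' in auto)
  obtain k where k: "k \<in> hom C (Cod C p') (Cod C p)" "k \<cdot> p' = p" "k \<cdot> q' = q"
    by (rule pushout_ex[OF po', of p "Cod C p" q]) (use P in auto)
  have "(h \<cdot> k) \<cdot> p' = p'" "(h \<cdot> k) \<cdot> q' = q'" "(k \<cdot> h) \<cdot> p = p" "(k \<cdot> h) \<cdot> q = q"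
    using h k P P' by simp_all
  then have "h \<cdot> k = Idt C (Cod C p')" "k \<cdot> h = Idt C (Cod C p)"
    using pushout_eqI[OF po', of "h \<cdot> k" "Cod C p'" "Idt C (Cod C p')"]
      pushout_eqI[OF po, of "k \<cdot> h" "Cod C p" "Idt C (Cod C p)"] h(1) k(1) P P' by simp_all
  with h k that show ?thesis by blast
qed

text \<open>The AWFS enters only later: the cellular chains are built from the density comonad and
  its lift \<open>T\<close>.\<close>

locale ext_setting = fibred E F P cl + J: category J
  for E :: "('o, 'a) cat" and F :: "('p, 'b) cat" and P :: "('p, 'b, 'o, 'a) funct"
    and cl :: "'a \<Rightarrow> 'p \<Rightarrow> 'b" and J :: "('i, 't) cat" +
  fixes \<kappa> :: "'k rel" and M :: "'a set" and u :: "('i, 't, 'a, 'a square) funct"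
    and D :: "('a, 'a square, 'a, 'a square) funct" and \<eta> :: "'i \<Rightarrow> 'a square"
    and T :: "('a, 'a square, ('a, 'p, 'b) ext_obj, ('a, 'p, 'b) ext_arr) funct"
  assumes limit: "limit_ordinal \<kappa>" and nonempty: "Field \<kappa> \<noteq> {}" and backdrop: "backdrop E \<kappa> M"
    and u: "is_functor J (arrow_cat E) u" and compatible: "compatible E M J u D \<eta>"
    and small: "i \<in> Obj J \<Longrightarrow> small_object E \<kappa> M (Dom E (Ob u i))"
    and vk_chains: "van_kampen_chains E \<kappa> M F P" and vk_cobase: "van_kampen_cobase_changes E M F P"
    and T: "is_functor (arrow_cat E) (Ext E F P cl) T"
    and T_over: "functor_eq (arrow_cat E) (ext_forget \<circ>\<^sub>F T) D"
begin

sublocale AE: category "arrow_cat E"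
  by (rule E.category_arrow_cat)

section \<open>The density comonad: coprojections and counit\<close>

lemma D: "is_functor (arrow_cat E) (arrow_cat E) D"
  using compatible by (simp add: compatible_def density_comonad_def)

lemma D_simps [simp]:
  "f \<in> Arr E \<Longrightarrow> Ob D f \<in> Arr E"
  "\<sigma> \<in> Arr (arrow_cat E) \<Longrightarrow> Ar D \<sigma> \<in> Arr (arrow_cat E)"
  "\<sigma> \<in> Arr (arrow_cat E) \<Longrightarrow> sdom (Ar D \<sigma>) = Ob D (sdom \<sigma>)"
  "\<sigma> \<in> Arr (arrow_cat E) \<Longrightarrow> scod (Ar D \<sigma>) = Ob D (scod \<sigma>)"
  using functorD(1-4)[OF D] by auto

lemmas D_cmp = functorD(6)[OF D]

lemma arrow_simps:
  assumes "\<sigma> \<in> Arr (arrow_cat E)"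
  shows "sdom \<sigma> \<in> Arr E" "scod \<sigma> \<in> Arr E"
    "upper \<sigma> \<in> Arr E" "Dom E (upper \<sigma>) = Dom E (sdom \<sigma>)" "Cod E (upper \<sigma>) = Dom E (scod \<sigma>)"
    "lower \<sigma> \<in> Arr E" "Dom E (lower \<sigma>) = Cod E (sdom \<sigma>)" "Cod E (lower \<sigma>) = Cod E (scod \<sigma>)"
    "lower \<sigma> \<cdot>\<^bsub>E\<^esub> sdom \<sigma> = scod \<sigma> \<cdot>\<^bsub>E\<^esub> upper \<sigma>"
  using assms by (auto simp: Arr_arrow_cat)

lemma u_simps [simp]:
  "i \<in> Obj J \<Longrightarrow> Ob u i \<in> Arr E"
  "t \<in> Arr J \<Longrightarrow> Ar u t \<in> Arr (arrow_cat E)"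
  "t \<in> Arr J \<Longrightarrow> sdom (Ar u t) = Ob u (Dom J t)"
  "t \<in> Arr J \<Longrightarrow> scod (Ar u t) = Ob u (Cod J t)"
  using functorD(1-4)[OF u] by auto

lemma eta_simps [simp]:
  "i \<in> Obj J \<Longrightarrow> \<eta> i \<in> Arr (arrow_cat E)"
  "i \<in> Obj J \<Longrightarrow> sdom (\<eta> i) = Ob u i"
  "i \<in> Obj J \<Longrightarrow> scod (\<eta> i) = Ob D (Ob u i)"
  using compatible by (auto simp: compatible_def density_comonad_def nat_trans_def)

lemma eta_natural: "t \<in> Arr J \<Longrightarrow>
    \<eta> (Cod J t) \<cdot>\<^bsub>arrow_cat E\<^esub> Ar u t = Ar D (Ar u t) \<cdot>\<^bsub>arrow_cat E\<^esub> \<eta> (Dom J t)"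
  using compatible unfolding compatible_def density_comonad_def nat_trans_def by simp

text \<open>The coprojection, belonging to the object \<open>(i, \<alpha>)\<close> of the comma
  category \<open>u \<down> f\<close>, of the colimit that computes \<open>D f\<close>.\<close>

definition coproj where "coproj i \<alpha> = Ar D \<alpha> \<cdot>\<^bsub>arrow_cat E\<^esub> \<eta> i"

lemma coproj_hom:
  assumes "i \<in> Obj J" "\<alpha> \<in> Arr (arrow_cat E)" "sdom \<alpha> = Ob u i"
  shows "coproj i \<alpha> \<in> Arr (arrow_cat E)" "sdom (coproj i \<alpha>) = Ob u i" "scod (coproj i \<alpha>) = Ob D (scod \<alpha>)"
  unfolding coproj_def using assms AE.cmp_simps[of "\<eta> i" "Ar D \<alpha>"] by (simp_all del: arrow_cat_simps(5))

lemma coproj_D: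
  assumes "i \<in> Obj J" "\<alpha> \<in> Arr (arrow_cat E)" "sdom \<alpha> = Ob u i" "\<sigma> \<in> Arr (arrow_cat E)" "sdom \<sigma> = scod \<alpha>"
  shows "Ar D \<sigma> \<cdot>\<^bsub>arrow_cat E\<^esub> coproj i \<alpha> = coproj i (\<sigma> \<cdot>\<^bsub>arrow_cat E\<^esub> \<alpha>)"
proof -
  have "Ar D (\<sigma> \<cdot>\<^bsub>arrow_cat E\<^esub> \<alpha>) = Ar D \<sigma> \<cdot>\<^bsub>arrow_cat E\<^esub> Ar D \<alpha>"
    using assms by (intro D_cmp) auto
  then show ?thesis
    unfolding coproj_def using assms AE.assoc_simp[of "\<eta> i" "Ar D \<alpha>" "Ar D \<sigma>"] by (simp del: arrow_cat_simps(5))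
qed

lemma coproj_u:
  assumes "t \<in> Arr J" "\<alpha> \<in> Arr (arrow_cat E)" "sdom \<alpha> = Ob u (Cod J t)"
  shows "coproj (Dom J t) (\<alpha> \<cdot>\<^bsub>arrow_cat E\<^esub> Ar u t) = coproj (Cod J t) \<alpha> \<cdot>\<^bsub>arrow_cat E\<^esub> Ar u t"
proof -
  have "Ar D (\<alpha> \<cdot>\<^bsub>arrow_cat E\<^esub> Ar u t) = Ar D \<alpha> \<cdot>\<^bsub>arrow_cat E\<^esub> Ar D (Ar u t)"
    using assms by (intro D_cmp) auto
  moreover have "(Ar D \<alpha> \<cdot>\<^bsub>arrow_cat E\<^esub> Ar D (Ar u t)) \<cdot>\<^bsub>arrow_cat E\<^esub> \<eta> (Dom J t) =
      Ar D \<alpha> \<cdot>\<^bsub>arrow_cat E\<^esub> \<eta> (Cod J t) \<cdot>\<^bsub>arrow_cat E\<^esub> Ar u t"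
    unfolding eta_natural[OF assms(1)] using assms
    by (intro AE.assoc_simp) (auto simp del: arrow_cat_simps(5))
  moreover have "(Ar D \<alpha> \<cdot>\<^bsub>arrow_cat E\<^esub> \<eta> (Cod J t)) \<cdot>\<^bsub>arrow_cat E\<^esub> Ar u t =
      Ar D \<alpha> \<cdot>\<^bsub>arrow_cat E\<^esub> \<eta> (Cod J t) \<cdot>\<^bsub>arrow_cat E\<^esub> Ar u t"
    using assms by (intro AE.assoc_simp) auto
  ultimately show ?thesis unfolding coproj_def by simp
qed

abbreviation comma_diagram where "comma_diagram \<equiv> u \<circ>\<^sub>F struct_forget fst"

lemma comma_simps [simp]:
  "Obj (comma J (arrow_cat E) u f) = {(i, \<alpha>). i \<in> Obj J \<and> \<alpha> \<in> hom (arrow_cat E) (Ob u i) f}"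
  "Arr (comma J (arrow_cat E) u f) = {(x, t, y). x \<in> Obj (comma J (arrow_cat E) u f) \<and>
     y \<in> Obj (comma J (arrow_cat E) u f) \<and> t \<in> hom J (fst x) (fst y) \<and> snd y \<cdot>\<^bsub>arrow_cat E\<^esub> Ar u t = snd x}"
  "Dom (comma J (arrow_cat E) u f) = fst" "Cod (comma J (arrow_cat E) u f) = snd \<circ> snd"
  by (auto simp: comma_def struct_cat_def fun_eq_iff split: prod.splits)

lemma density: "f \<in> Arr E \<Longrightarrow> is_colimit (comma J (arrow_cat E) u f) (arrow_cat E) comma_diagram (Ob D f)
    (\<lambda>(i, \<alpha>). coproj i \<alpha>)"
  using compatible by (simp add: compatible_def density_comonad_def coproj_def del: arrow_cat_simps)

lemma D_eqI:
  assumes f: "f \<in> Arr E" and z: "z \<in> Arr (arrow_cat E)" "sdom z = Ob D f" "z' \<in> Arr (arrow_cat E)"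
    "sdom z' = Ob D f" "scod z' = scod z"
    and eq: "\<And>i \<alpha>. i \<in> Obj J \<Longrightarrow> \<alpha> \<in> Arr (arrow_cat E) \<Longrightarrow> sdom \<alpha> = Ob u i \<Longrightarrow> scod \<alpha> = f \<Longrightarrow>
      z \<cdot>\<^bsub>arrow_cat E\<^esub> coproj i \<alpha> = z' \<cdot>\<^bsub>arrow_cat E\<^esub> coproj i \<alpha>"
  shows "z = z'"
proof (rule AE.colimit_eqI[OF density[OF f], where d = "scod z"])
  show "z \<in> hom (arrow_cat E) (Ob D f) (scod z)" "z' \<in> hom (arrow_cat E) (Ob D f) (scod z)"
    using z by auto
  show "Dom (comma J (arrow_cat E) u f) t \<in> Obj (comma J (arrow_cat E) u f) \<and>
      Cod (comma J (arrow_cat E) u f) t \<in> Obj (comma J (arrow_cat E) u f) \<and>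
      Ar comma_diagram t \<in> hom (arrow_cat E) (Ob comma_diagram (Dom (comma J (arrow_cat E) u f) t))
        (Ob comma_diagram (Cod (comma J (arrow_cat E) u f) t))"
    if "t \<in> Arr (comma J (arrow_cat E) u f)" for t
    using that by (auto simp: struct_forget_def simp del: arrow_cat_simps(5))
  show "z \<cdot>\<^bsub>arrow_cat E\<^esub> (case k of (i, \<alpha>) \<Rightarrow> coproj i \<alpha>) = z' \<cdot>\<^bsub>arrow_cat E\<^esub> (case k of (i, \<alpha>) \<Rightarrow> coproj i \<alpha>)"
    if "k \<in> Obj (comma J (arrow_cat E) u f)" for k
    using that eq by (cases k) auto
qed

text \<open>The counit of the density comonad, induced by the cocone whose leg at
  \<open>(i, \<alpha>)\<close> is \<open>\<alpha>\<close> itself. The data contain \<open>D\<close>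
  and the unit \<open>\<eta>\<close> of the Kan extension, from which it has to be derived.\<close>

definition eps where
  "eps f = (THE z. z \<in> hom (arrow_cat E) (Ob D f) f \<and>
     (\<forall>k \<in> Obj (comma J (arrow_cat E) u f). z \<cdot>\<^bsub>arrow_cat E\<^esub> (case k of (i, \<alpha>) \<Rightarrow> coproj i \<alpha>) = snd k))"

lemma eps_simps [simp]:
  assumes f: "f \<in> Arr E"
  shows "eps f \<in> Arr (arrow_cat E)" "sdom (eps f) = Ob D f" "scod (eps f) = f"
  and eps_coproj: "i \<in> Obj J \<Longrightarrow> \<alpha> \<in> Arr (arrow_cat E) \<Longrightarrow> sdom \<alpha> = Ob u i \<Longrightarrow> scod \<alpha> = f \<Longrightarrow>
      eps f \<cdot>\<^bsub>arrow_cat E\<^esub> coproj i \<alpha> = \<alpha>"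
proof -
  have "is_cocone (comma J (arrow_cat E) u f) (arrow_cat E) comma_diagram f snd"
    unfolding is_cocone_def
  proof (intro conjI ballI)
    show "f \<in> Obj (arrow_cat E)" using f by simp
    show "snd k \<in> hom (arrow_cat E) (Ob comma_diagram k) f" if "k \<in> Obj (comma J (arrow_cat E) u f)" for k
      using that by (auto simp: struct_forget_def)
    show "snd (Cod (comma J (arrow_cat E) u f) t) \<cdot>\<^bsub>arrow_cat E\<^esub> Ar comma_diagram t =
        snd (Dom (comma J (arrow_cat E) u f) t)" if "t \<in> Arr (comma J (arrow_cat E) u f)" for t
      using that by (auto simp: struct_forget_def simp del: arrow_cat_simps(5))
  qed
  then have "\<exists>!z. z \<in> hom (arrow_cat E) (Ob D f) f \<and>
     (\<forall>k \<in> Obj (comma J (arrow_cat E) u f). z \<cdot>\<^bsub>arrow_cat E\<^esub> (case k of (i, \<alpha>) \<Rightarrow> coproj i \<alpha>) = snd k)"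
    using density[OF f] unfolding is_colimit_def by blast
  from theI'[OF this] have z: "eps f \<in> hom (arrow_cat E) (Ob D f) f"
    "\<forall>k \<in> Obj (comma J (arrow_cat E) u f). eps f \<cdot>\<^bsub>arrow_cat E\<^esub> (case k of (i, \<alpha>) \<Rightarrow> coproj i \<alpha>) = snd k"
    unfolding eps_def[symmetric] by auto
  then show "eps f \<in> Arr (arrow_cat E)" "sdom (eps f) = Ob D f" "scod (eps f) = f" by auto
  show "eps f \<cdot>\<^bsub>arrow_cat E\<^esub> coproj i \<alpha> = \<alpha>"
    if "i \<in> Obj J" "\<alpha> \<in> Arr (arrow_cat E)" "sdom \<alpha> = Ob u i" "scod \<alpha> = f"
    using z(2) that by (force simp del: arrow_cat_simps(5))
qed

text \<open>Tested on coprojections, where \<open>D\<close> acts by composition on the index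
  \<open>\<alpha>\<close> and the counit returns the index.\<close>

lemma eps_natural:
  assumes s: "\<sigma> \<in> Arr (arrow_cat E)"
  shows "eps (scod \<sigma>) \<cdot>\<^bsub>arrow_cat E\<^esub> Ar D \<sigma> = \<sigma> \<cdot>\<^bsub>arrow_cat E\<^esub> eps (sdom \<sigma>)"
proof (rule D_eqI[of "sdom \<sigma>"])
  note f = arrow_simps(1,2)[OF s]
  note c = AE.cmp_simps[of "Ar D \<sigma>" "eps (scod \<sigma>)"] AE.cmp_simps[of "eps (sdom \<sigma>)" \<sigma>]
  show "sdom \<sigma> \<in> Arr E" by (fact f)
  show "eps (scod \<sigma>) \<cdot>\<^bsub>arrow_cat E\<^esub> Ar D \<sigma> \<in> Arr (arrow_cat E)" "\<sigma> \<cdot>\<^bsub>arrow_cat E\<^esub> eps (sdom \<sigma>) \<in> Arr (arrow_cat E)"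
    "sdom (eps (scod \<sigma>) \<cdot>\<^bsub>arrow_cat E\<^esub> Ar D \<sigma>) = Ob D (sdom \<sigma>)" "sdom (\<sigma> \<cdot>\<^bsub>arrow_cat E\<^esub> eps (sdom \<sigma>)) = Ob D (sdom \<sigma>)"
    "scod (\<sigma> \<cdot>\<^bsub>arrow_cat E\<^esub> eps (sdom \<sigma>)) = scod (eps (scod \<sigma>) \<cdot>\<^bsub>arrow_cat E\<^esub> Ar D \<sigma>)"
    using c s f by (simp_all del: arrow_cat_simps(5))
  fix i \<alpha> assume a: "i \<in> Obj J" "\<alpha> \<in> Arr (arrow_cat E)" "sdom \<alpha> = Ob u i" "scod \<alpha> = sdom \<sigma>"
  note h = coproj_hom[OF a(1-3)]
  have sa: "\<sigma> \<cdot>\<^bsub>arrow_cat E\<^esub> \<alpha> \<in> Arr (arrow_cat E)" "sdom (\<sigma> \<cdot>\<^bsub>arrow_cat E\<^esub> \<alpha>) = Ob u i"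
    "scod (\<sigma> \<cdot>\<^bsub>arrow_cat E\<^esub> \<alpha>) = scod \<sigma>"
    using AE.cmp_simps[of \<alpha> \<sigma>] a s by (simp_all del: arrow_cat_simps(5))
  have "(eps (scod \<sigma>) \<cdot>\<^bsub>arrow_cat E\<^esub> Ar D \<sigma>) \<cdot>\<^bsub>arrow_cat E\<^esub> coproj i \<alpha> =
      eps (scod \<sigma>) \<cdot>\<^bsub>arrow_cat E\<^esub> (Ar D \<sigma> \<cdot>\<^bsub>arrow_cat E\<^esub> coproj i \<alpha>)"
    using h a s f by (intro AE.assoc_simp) auto
  also have "\<dots> = \<sigma> \<cdot>\<^bsub>arrow_cat E\<^esub> \<alpha>"
    unfolding coproj_D[OF a(1-3) s a(4)[symmetric]] using eps_coproj[OF f(2) a(1) sa] .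
  also have "\<dots> = \<sigma> \<cdot>\<^bsub>arrow_cat E\<^esub> (eps (sdom \<sigma>) \<cdot>\<^bsub>arrow_cat E\<^esub> coproj i \<alpha>)"
    using eps_coproj[OF f(1) a] by simp
  also have "\<dots> = (\<sigma> \<cdot>\<^bsub>arrow_cat E\<^esub> eps (sdom \<sigma>)) \<cdot>\<^bsub>arrow_cat E\<^esub> coproj i \<alpha>"
    using h a s f by (intro AE.assoc_simp[symmetric]) auto
  finally show "(eps (scod \<sigma>) \<cdot>\<^bsub>arrow_cat E\<^esub> Ar D \<sigma>) \<cdot>\<^bsub>arrow_cat E\<^esub> coproj i \<alpha> =
      (\<sigma> \<cdot>\<^bsub>arrow_cat E\<^esub> eps (sdom \<sigma>)) \<cdot>\<^bsub>arrow_cat E\<^esub> coproj i \<alpha>" .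
qed

section \<open>The cell functors A and C on the comma category\<close>

definition sec where "sec p = snd (Ob T p)"

lemma T_Ob: "p \<in> Arr E \<Longrightarrow> Ob T p = (Ob D p, sec p)"
  using T_over by (simp add: functor_eq_def ext_forget_def sec_def prod_eq_iff)

lemma sec_obj: "p \<in> Arr E \<Longrightarrow> (Ob D p, sec p) \<in> ext_objs E F P"
  using functorD(1)[OF T, of p] T_Ob by simp

lemma T_Ar:
  assumes s: "\<sigma> \<in> Arr (arrow_cat E)"
  obtains \<phi> where "Ar T \<sigma> = ((Ob D (sdom \<sigma>), sec (sdom \<sigma>)), (Ar D \<sigma>, \<phi>), (Ob D (scod \<sigma>), sec (scod \<sigma>)))"
    "((Ob D (sdom \<sigma>), sec (sdom \<sigma>)), (Ar D \<sigma>, \<phi>), (Ob D (scod \<sigma>), sec (scod \<sigma>))) \<in> ext_arrs E F P cl"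
proof -
  obtain x \<sigma>' \<phi> y where t: "Ar T \<sigma> = (x, (\<sigma>', \<phi>), y)" by (metis prod.collapse)
  have "x = Ob T (sdom \<sigma>)" "y = Ob T (scod \<sigma>)" "\<sigma>' = Ar D \<sigma>"
    using functorD(3,4)[OF T s] T_over s t by (auto simp: functor_eq_def ext_forget_def)
  then have "Ar T \<sigma> = ((Ob D (sdom \<sigma>), sec (sdom \<sigma>)), (Ar D \<sigma>, \<phi>), (Ob D (scod \<sigma>), sec (scod \<sigma>)))"
    using t T_Ob arrow_simps(1,2)[OF s] by simp
  with functorD(2)[OF T s] that show ?thesis by simp
qed

lemma push_T:
  assumes s: "\<sigma> \<in> Arr (arrow_cat E)" and x: "x \<in> Arr F" "Ar P x = upper (Ar D \<sigma>)"
  shows "push (Ar T \<sigma>) x \<in> Arr F" "Dom F (push (Ar T \<sigma>) x) = Cod F (Ob (sec (sdom \<sigma>)) (Dom F x))"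
    "Cod F (push (Ar T \<sigma>) x) = Cod F (Ob (sec (scod \<sigma>)) (Cod F x))" "Ar P (push (Ar T \<sigma>) x) = lower (Ar D \<sigma>)"
    "push (Ar T \<sigma>) x \<cdot>\<^bsub>F\<^esub> Ob (sec (sdom \<sigma>)) (Dom F x) = Ob (sec (scod \<sigma>)) (Cod F x) \<cdot>\<^bsub>F\<^esub> x"
    "x \<in> cart \<Longrightarrow> push (Ar T \<sigma>) x \<in> cart"
proof -
  obtain \<phi> where t: "Ar T \<sigma> = ((Ob D (sdom \<sigma>), sec (sdom \<sigma>)), (Ar D \<sigma>, \<phi>), (Ob D (scod \<sigma>), sec (scod \<sigma>)))"
    "((Ob D (sdom \<sigma>), sec (sdom \<sigma>)), (Ar D \<sigma>, \<phi>), (Ob D (scod \<sigma>), sec (scod \<sigma>))) \<in> ext_arrs E F P cl"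
    by (rule T_Ar[OF s])
  from push_simps[OF t(2) x] t(1)
  show "push (Ar T \<sigma>) x \<in> Arr F" "Dom F (push (Ar T \<sigma>) x) = Cod F (Ob (sec (sdom \<sigma>)) (Dom F x))"
    "Cod F (push (Ar T \<sigma>) x) = Cod F (Ob (sec (scod \<sigma>)) (Cod F x))" "Ar P (push (Ar T \<sigma>) x) = lower (Ar D \<sigma>)"
    "push (Ar T \<sigma>) x \<cdot>\<^bsub>F\<^esub> Ob (sec (sdom \<sigma>)) (Dom F x) = Ob (sec (scod \<sigma>)) (Cod F x) \<cdot>\<^bsub>F\<^esub> x"
    "x \<in> cart \<Longrightarrow> push (Ar T \<sigma>) x \<in> cart"
    by auto
qed

lemma push_T_idt:
  assumes "p \<in> Arr E" "X \<in> Obj F" "Ob P X = Dom E (Ob D p)"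
  shows "push (Ar T (Idt (arrow_cat E) p)) (Idt F X) = Idt F (Cod F (Ob (sec p) X))"
  using push_idt[OF sec_obj[OF assms(1)] assms(2,3)] functorD(5)[OF T, of p] assms(1)
  by (simp add: T_Ob del: arrow_cat_simps(4))

lemma push_T_cmp:
  assumes s: "\<sigma> \<in> Arr (arrow_cat E)" "\<sigma>' \<in> Arr (arrow_cat E)" "scod \<sigma> = sdom \<sigma>'"
    and x: "x \<in> Arr F" "Ar P x = upper (Ar D \<sigma>)" "x' \<in> Arr F" "Ar P x' = upper (Ar D \<sigma>')" "Cod F x = Dom F x'"
  shows "push (Ar T (\<sigma>' \<cdot>\<^bsub>arrow_cat E\<^esub> \<sigma>)) (x' \<cdot>\<^bsub>F\<^esub> x) = push (Ar T \<sigma>') x' \<cdot>\<^bsub>F\<^esub> push (Ar T \<sigma>) x"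
proof -
  obtain \<phi> where t: "Ar T \<sigma> = ((Ob D (sdom \<sigma>), sec (sdom \<sigma>)), (Ar D \<sigma>, \<phi>), (Ob D (scod \<sigma>), sec (scod \<sigma>)))"
    "((Ob D (sdom \<sigma>), sec (sdom \<sigma>)), (Ar D \<sigma>, \<phi>), (Ob D (scod \<sigma>), sec (scod \<sigma>))) \<in> ext_arrs E F P cl"
    by (rule T_Ar[OF s(1)])
  obtain \<phi>' where t': "Ar T \<sigma>' = ((Ob D (sdom \<sigma>'), sec (sdom \<sigma>')), (Ar D \<sigma>', \<phi>'), (Ob D (scod \<sigma>'), sec (scod \<sigma>')))"
    "((Ob D (sdom \<sigma>'), sec (sdom \<sigma>')), (Ar D \<sigma>', \<phi>'), (Ob D (scod \<sigma>'), sec (scod \<sigma>'))) \<in> ext_arrs E F P cl"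
    by (rule T_Ar[OF s(2)])
  have "Ar T (\<sigma>' \<cdot>\<^bsub>arrow_cat E\<^esub> \<sigma>) = ext_cmp E F P cl (Ar T \<sigma>') (Ar T \<sigma>)"
    using functorD(6)[OF T s(1,2)] s(3) by simp
  then show ?thesis
    using push_cmp[OF t(2)[unfolded s(3)] t'(2) x] t(1) t'(1) s(3) by simp
qed

lemma sec_simps:
  assumes "p \<in> Arr E" "X \<in> Obj F" "Ob P X = Dom E (Ob D p)"
  shows "Ob (sec p) X \<in> cart" "Ob (sec p) X \<in> Arr F" "Ar P (Ob (sec p) X) = Ob D p"
    "Dom F (Ob (sec p) X) = X" "Ob P (Cod F (Ob (sec p) X)) = Cod E (Ob D p)"
  using ext_objD(2-6)[OF sec_obj[OF assms(1)] assms(2,3)] by auto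

text \<open>For \<open>X = (Z, p)\<close> the counit gives a map from the domain of
  \<open>D p\<close> to \<open>P Z\<close>. Reindexing \<open>Z\<close> along it and extending the
  result along \<open>D p\<close> by means of \<open>T\<close> produces a cartesian map over the
  cell \<open>D p\<close>; it becomes \<open>a_trans X\<close>, while \<open>e_trans X\<close> is
  the map along which the cell is attached to \<open>X\<close>.\<close>

definition e_lift where "e_lift X = cl (upper (eps (snd X))) (fst X)"

definition A_obj where "A_obj X = (Dom F (e_lift X), snd X \<cdot>\<^bsub>E\<^esub> upper (eps (snd X)))"

definition a_lift where "a_lift X = Ob (sec (snd X)) (Dom F (e_lift X))"

definition C_obj where "C_obj X = (Cod F (a_lift X), lower (eps (snd X)))"

definition sq where "sq t = Square (snd (Dom gcat t)) (Ar P (fpart t)) (epart t) (snd (Cod gcat t))"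

definition A_part where
  "A_part t = fill (e_lift (Cod gcat t)) (fpart t \<cdot>\<^bsub>F\<^esub> e_lift (Dom gcat t)) (upper (Ar D (sq t)))"

definition C_part where "C_part t = push (Ar T (sq t)) (A_part t)"

definition A_functor where
  "A_functor = \<lparr>Ob = A_obj, Ar = \<lambda>t. (A_obj (Dom gcat t), (A_part t, epart t), A_obj (Cod gcat t))\<rparr>"

definition C_functor where
  "C_functor = \<lparr>Ob = C_obj, Ar = \<lambda>t. (C_obj (Dom gcat t), (C_part t, epart t), C_obj (Cod gcat t))\<rparr>"

definition a_trans where "a_trans X = (A_obj X, (a_lift X, Idt E (Cod E (snd X))), C_obj X)"

definition e_trans where "e_trans X = (A_obj X, (e_lift X, Idt E (Cod E (snd X))), X)"

lemma functor_defs [simp]: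
  "Ob A_functor = A_obj" "Ar A_functor t = (A_obj (Dom gcat t), (A_part t, epart t), A_obj (Cod gcat t))"
  "Ob C_functor = C_obj" "Ar C_functor t = (C_obj (Dom gcat t), (C_part t, epart t), C_obj (Cod gcat t))"
  by (simp_all add: A_functor_def C_functor_def)

context
  fixes X assumes X: "X \<in> Obj gcat"
begin

lemma eps_arrow:
  shows "upper (eps (snd X)) \<in> Arr E" "Dom E (upper (eps (snd X))) = Dom E (Ob D (snd X))"
    "Cod E (upper (eps (snd X))) = Dom E (snd X)"
    "lower (eps (snd X)) \<in> Arr E" "Dom E (lower (eps (snd X))) = Cod E (Ob D (snd X))"
    "Cod E (lower (eps (snd X))) = Cod E (snd X)"
    "lower (eps (snd X)) \<cdot>\<^bsub>E\<^esub> Ob D (snd X) = snd X \<cdot>\<^bsub>E\<^esub> upper (eps (snd X))"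
  using arrow_simps[OF eps_simps(1)[OF Obj_gcatD(2)[OF X]]] Obj_gcatD[OF X] by simp_all

lemma e_lift_simps:
  shows "e_lift X \<in> cart" "e_lift X \<in> Arr F" "Cod F (e_lift X) = fst X" "Ar P (e_lift X) = upper (eps (snd X))"
    "Ob P (Dom F (e_lift X)) = Dom E (Ob D (snd X))" "Dom F (e_lift X) \<in> Obj F"
  using cl_simps[OF Obj_gcatD(1)[OF X] eps_arrow(1)] Obj_gcatD[OF X] eps_arrow by (simp_all add: e_lift_def)

lemma a_lift_simps:
  shows "a_lift X \<in> cart" "a_lift X \<in> Arr F" "Ar P (a_lift X) = Ob D (snd X)"
    "Dom F (a_lift X) = Dom F (e_lift X)" "Ob P (Cod F (a_lift X)) = Cod E (Ob D (snd X))"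
  using sec_simps[OF Obj_gcatD(2)[OF X] e_lift_simps(6,5)] by (simp_all add: a_lift_def)

lemma obj_gcat:
  shows "A_obj X \<in> Obj gcat" "C_obj X \<in> Obj gcat" "Cod E (snd (A_obj X)) = Cod E (snd X)"
    "Cod E (snd (C_obj X)) = Cod E (snd X)"
  using Obj_gcatD[OF X] eps_arrow e_lift_simps a_lift_simps by (simp_all add: A_obj_def C_obj_def)

text \<open>The cell is over an identity of the base, and its image in \<open>E\<close> is a value
  of \<open>D\<close>, which compatibility puts into \<open>M\<close>.\<close>

lemma a_trans_GM: "a_trans X \<in> GM M"
proof -
  have "Ob D (snd X) \<in> M" using compatible Obj_gcatD(2)[OF X] by (simp add: compatible_def)
  moreover have "a_trans X \<in> Arr gcat"
    unfolding a_trans_def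
    by (rule ArrI_gcat) (use obj_gcat Obj_gcatD[OF X] eps_arrow e_lift_simps a_lift_simps in
      \<open>simp_all add: A_obj_def C_obj_def\<close>)
  ultimately show ?thesis
    using a_lift_simps obj_gcat by (simp add: GM_def a_trans_def)
qed

lemma e_trans_GN: "e_trans X \<in> GN"
proof -
  have "e_trans X \<in> Arr gcat"
    unfolding e_trans_def
    by (rule ArrI_gcat) (use X obj_gcat Obj_gcatD[OF X] eps_arrow e_lift_simps in
      \<open>simp_all add: A_obj_def C_obj_def\<close>)
  then show ?thesis using e_lift_simps by (simp add: GN_def e_trans_def)
qed

end

lemma sq_arrow:
  assumes "t \<in> Arr gcat"
  shows "sq t \<in> Arr (arrow_cat E)" "sdom (sq t) = snd (Dom gcat t)" "scod (sq t) = snd (Cod gcat t)"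
    "upper (sq t) = Ar P (fpart t)" "lower (sq t) = epart t"
  using Arr_gcatD[OF assms] Obj_gcatD[of "Dom gcat t"] Obj_gcatD[of "Cod gcat t"]
  by (simp_all add: sq_def Arr_arrow_cat)

context
  fixes t assumes t: "t \<in> Arr gcat"
begin

lemma D_sq:
  shows "upper (Ar D (sq t)) \<in> Arr E" "Dom E (upper (Ar D (sq t))) = Dom E (Ob D (snd (Dom gcat t)))"
    "Cod E (upper (Ar D (sq t))) = Dom E (Ob D (snd (Cod gcat t)))"
    "lower (Ar D (sq t)) \<in> Arr E" "Dom E (lower (Ar D (sq t))) = Cod E (Ob D (snd (Dom gcat t)))"
    "Cod E (lower (Ar D (sq t))) = Cod E (Ob D (snd (Cod gcat t)))"
    "lower (Ar D (sq t)) \<cdot>\<^bsub>E\<^esub> Ob D (snd (Dom gcat t)) = Ob D (snd (Cod gcat t)) \<cdot>\<^bsub>E\<^esub> upper (Ar D (sq t))"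
    "upper (eps (snd (Cod gcat t))) \<cdot>\<^bsub>E\<^esub> upper (Ar D (sq t)) = Ar P (fpart t) \<cdot>\<^bsub>E\<^esub> upper (eps (snd (Dom gcat t)))"
    "lower (eps (snd (Cod gcat t))) \<cdot>\<^bsub>E\<^esub> lower (Ar D (sq t)) = epart t \<cdot>\<^bsub>E\<^esub> lower (eps (snd (Dom gcat t)))"
  using arrow_simps[OF D_simps(2)[OF sq_arrow(1)[OF t]]] eps_natural[OF sq_arrow(1)[OF t]] sq_arrow[OF t]
  by simp_all

lemma A_part_simps:
  shows "A_part t \<in> Arr F" "Dom F (A_part t) = Dom F (e_lift (Dom gcat t))"
    "Cod F (A_part t) = Dom F (e_lift (Cod gcat t))" "Ar P (A_part t) = upper (Ar D (sq t))"
    "e_lift (Cod gcat t) \<cdot>\<^bsub>F\<^esub> A_part t = fpart t \<cdot>\<^bsub>F\<^esub> e_lift (Dom gcat t)"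
    "fpart t \<in> cart \<Longrightarrow> A_part t \<in> cart"
proof -
  note G = Arr_gcatD[OF t]
  note d = e_lift_simps[OF G(9)] and c = e_lift_simps[OF G(10)]
  have x: "fpart t \<cdot>\<^bsub>F\<^esub> e_lift (Dom gcat t) \<in> Arr F"
    "Dom F (fpart t \<cdot>\<^bsub>F\<^esub> e_lift (Dom gcat t)) = Dom F (e_lift (Dom gcat t))"
    "Cod F (fpart t \<cdot>\<^bsub>F\<^esub> e_lift (Dom gcat t)) = Cod F (e_lift (Cod gcat t))"
    using G(1-3) d c by simp_all
  have w: "upper (Ar D (sq t)) \<in> hom E (Ob P (Dom F (fpart t \<cdot>\<^bsub>F\<^esub> e_lift (Dom gcat t)))) (Ob P (Dom F (e_lift (Cod gcat t))))"
    using x d c D_sq by simp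
  have q: "Ar P (e_lift (Cod gcat t)) \<cdot>\<^bsub>E\<^esub> upper (Ar D (sq t)) = Ar P (fpart t \<cdot>\<^bsub>F\<^esub> e_lift (Dom gcat t))"
    using G(1-3) d c D_sq by simp
  note f = fill_simps[OF c(1) x(1,3) w q, folded A_part_def]
  show "A_part t \<in> Arr F" "Dom F (A_part t) = Dom F (e_lift (Dom gcat t))"
    "Cod F (A_part t) = Dom F (e_lift (Cod gcat t))" "Ar P (A_part t) = upper (Ar D (sq t))"
    "e_lift (Cod gcat t) \<cdot>\<^bsub>F\<^esub> A_part t = fpart t \<cdot>\<^bsub>F\<^esub> e_lift (Dom gcat t)"
    using f x by simp_all
  assume "fpart t \<in> cart"
  then have "fpart t \<cdot>\<^bsub>F\<^esub> e_lift (Dom gcat t) \<in> cart"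
    by (intro cart_cmp) (use G d in simp_all)
  with f(6) show "A_part t \<in> cart" by simp
qed

lemma C_part_simps:
  shows "C_part t \<in> Arr F" "Dom F (C_part t) = Cod F (a_lift (Dom gcat t))"
    "Cod F (C_part t) = Cod F (a_lift (Cod gcat t))" "Ar P (C_part t) = lower (Ar D (sq t))"
    "C_part t \<cdot>\<^bsub>F\<^esub> a_lift (Dom gcat t) = a_lift (Cod gcat t) \<cdot>\<^bsub>F\<^esub> A_part t"
    "fpart t \<in> cart \<Longrightarrow> C_part t \<in> cart"
  using push_T[OF sq_arrow(1)[OF t] A_part_simps(1,4)] A_part_simps(2,3,6) sq_arrow[OF t]
  by (simp_all add: C_part_def a_lift_def)

lemma A_C_Arr:
  shows "Ar A_functor t \<in> Arr gcat" "Ar C_functor t \<in> Arr gcat"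
proof -
  note G = Arr_gcatD[OF t]
  note d = Obj_gcatD[OF G(9)] and c = Obj_gcatD[OF G(10)]
  note o = obj_gcat[OF G(9)] obj_gcat[OF G(10)]
  note ed = eps_arrow[OF G(9)] and ec = eps_arrow[OF G(10)]
  have e1: "epart t \<cdot>\<^bsub>E\<^esub> snd (Dom gcat t) \<cdot>\<^bsub>E\<^esub> upper (eps (snd (Dom gcat t))) =
      (snd (Cod gcat t) \<cdot>\<^bsub>E\<^esub> Ar P (fpart t)) \<cdot>\<^bsub>E\<^esub> upper (eps (snd (Dom gcat t)))"
    by (rule E.cmp_eq_cmp[OF G(7)]) (use G(1-6) d c ed in simp_all)
  have e2: "(snd (Cod gcat t) \<cdot>\<^bsub>E\<^esub> Ar P (fpart t)) \<cdot>\<^bsub>E\<^esub> upper (eps (snd (Dom gcat t))) =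
      snd (Cod gcat t) \<cdot>\<^bsub>E\<^esub> (Ar P (fpart t) \<cdot>\<^bsub>E\<^esub> upper (eps (snd (Dom gcat t))))"
    using G(1-6) d c ed by simp
  have e3: "snd (Cod gcat t) \<cdot>\<^bsub>E\<^esub> (upper (eps (snd (Cod gcat t))) \<cdot>\<^bsub>E\<^esub> upper (Ar D (sq t))) =
      (snd (Cod gcat t) \<cdot>\<^bsub>E\<^esub> upper (eps (snd (Cod gcat t)))) \<cdot>\<^bsub>E\<^esub> upper (Ar D (sq t))"
    using D_sq(1-3) c ec(1-6) by simp
  show "Ar A_functor t \<in> Arr gcat"
    unfolding functor_defs
  proof (rule ArrI_gcat[OF o(1,5)])
    show "A_part t \<in> hom F (fst (A_obj (Dom gcat t))) (fst (A_obj (Cod gcat t)))"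
      using A_part_simps by (simp add: A_obj_def)
    show "epart t \<in> hom E (Cod E (snd (A_obj (Dom gcat t)))) (Cod E (snd (A_obj (Cod gcat t))))"
      using o G by simp
    show "epart t \<cdot>\<^bsub>E\<^esub> snd (A_obj (Dom gcat t)) = snd (A_obj (Cod gcat t)) \<cdot>\<^bsub>E\<^esub> Ar P (A_part t)"
      unfolding A_part_simps(4) A_obj_def snd_conv e1 e2 e3[symmetric] D_sq(8) ..
  qed
  show "Ar C_functor t \<in> Arr gcat"
    unfolding functor_defs
  proof (rule ArrI_gcat[OF o(2,6)])
    show "C_part t \<in> hom F (fst (C_obj (Dom gcat t))) (fst (C_obj (Cod gcat t)))"
      using C_part_simps by (simp add: C_obj_def)
    show "epart t \<in> hom E (Cod E (snd (C_obj (Dom gcat t)))) (Cod E (snd (C_obj (Cod gcat t))))"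
      using o G by simp
    show "epart t \<cdot>\<^bsub>E\<^esub> snd (C_obj (Dom gcat t)) = snd (C_obj (Cod gcat t)) \<cdot>\<^bsub>E\<^esub> Ar P (C_part t)"
      unfolding C_part_simps(4) C_obj_def snd_conv D_sq(9) ..
  qed
qed

end

lemma sq_cmp:
  assumes "t \<in> Arr gcat" "s \<in> Arr gcat" "Cod gcat t = Dom gcat s"
  shows "sq (s \<cdot>\<^bsub>gcat\<^esub> t) = sq s \<cdot>\<^bsub>arrow_cat E\<^esub> sq t"
  using Arr_gcatD(1-3)[OF assms(1)] Arr_gcatD(1-3)[OF assms(2)] assms(3) by (simp add: sq_def)

lemma sq_idt: "X \<in> Obj gcat \<Longrightarrow> sq (Idt gcat X) = Idt (arrow_cat E) (snd X)"
  using Obj_gcatD[of X] by (simp add: sq_def)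

lemma A_part_idt:
  assumes X: "X \<in> Obj gcat"
  shows "A_part (Idt gcat X) = Idt F (Dom F (e_lift X))" "C_part (Idt gcat X) = Idt F (Cod F (a_lift X))"
proof -
  note e = e_lift_simps[OF X] and o = Obj_gcatD[OF X]
  have D: "Ar D (Idt (arrow_cat E) (snd X)) = Idt (arrow_cat E) (Ob D (snd X))"
    using functorD(5)[OF D, of "snd X"] o by simp
  show A: "A_part (Idt gcat X) = Idt F (Dom F (e_lift X))"
    unfolding A_part_def parts_idt sq_idt[OF X] D
    by (rule fill_eqI) (use e o in simp_all)
  show "C_part (Idt gcat X) = Idt F (Cod F (a_lift X))"
    unfolding C_part_def A sq_idt[OF X] a_lift_def
    by (rule push_T_idt) (use e o in simp_all)
qed

text \<open>Uniqueness of factorizations through a cartesian map settles \<open>A_part\<close>; for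
  \<open>C_part\<close> it is functoriality of \<open>T\<close> in the strict form
  \<open>push_T_cmp\<close>.\<close>

lemma A_part_cmp:
  assumes t: "t \<in> Arr gcat" and s: "s \<in> Arr gcat" and ts: "Cod gcat t = Dom gcat s"
  shows "A_part (s \<cdot>\<^bsub>gcat\<^esub> t) = A_part s \<cdot>\<^bsub>F\<^esub> A_part t" "C_part (s \<cdot>\<^bsub>gcat\<^esub> t) = C_part s \<cdot>\<^bsub>F\<^esub> C_part t"
proof -
  note At = A_part_simps[OF t] and As = A_part_simps[OF s]
  note Gt = Arr_gcatD[OF t] and Gs = Arr_gcatD[OF s]
  note e = e_lift_simps[OF Gt(9)] e_lift_simps[OF Gs(9)] e_lift_simps[OF Gs(10)]
  have D: "Ar D (sq (s \<cdot>\<^bsub>gcat\<^esub> t)) = Ar D (sq s) \<cdot>\<^bsub>arrow_cat E\<^esub> Ar D (sq t)"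
    unfolding sq_cmp[OF t s ts] using sq_arrow[OF t] sq_arrow[OF s] ts by (intro D_cmp) auto
  show A: "A_part (s \<cdot>\<^bsub>gcat\<^esub> t) = A_part s \<cdot>\<^bsub>F\<^esub> A_part t"
    unfolding A_part_def[of "s \<cdot>\<^bsub>gcat\<^esub> t"] parts_cmp D
  proof (rule fill_eqI)
    show "e_lift (Cod gcat s) \<in> cart" by (fact e)
    show "A_part s \<cdot>\<^bsub>F\<^esub> A_part t \<in> Arr F" "Cod F (A_part s \<cdot>\<^bsub>F\<^esub> A_part t) = Dom F (e_lift (Cod gcat s))"
      using At As ts by simp_all
    have "e_lift (Cod gcat s) \<cdot>\<^bsub>F\<^esub> A_part s \<cdot>\<^bsub>F\<^esub> A_part t = (fpart s \<cdot>\<^bsub>F\<^esub> e_lift (Dom gcat s)) \<cdot>\<^bsub>F\<^esub> A_part t"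
      by (rule F.cmp_eq_cmp[OF As(5)]) (use At As ts e in simp_all)
    also have "\<dots> = fpart s \<cdot>\<^bsub>F\<^esub> (e_lift (Dom gcat s) \<cdot>\<^bsub>F\<^esub> A_part t)"
      using At(1-4) As(1-4) ts e Gs(1-3) by simp
    also have "\<dots> = (fpart s \<cdot>\<^bsub>F\<^esub> fpart t) \<cdot>\<^bsub>F\<^esub> e_lift (Dom gcat t)"
      using At(5) ts e Gs(1-3) Gt(1-3) by simp
    finally show "e_lift (Cod gcat s) \<cdot>\<^bsub>F\<^esub> A_part s \<cdot>\<^bsub>F\<^esub> A_part t = (fpart s \<cdot>\<^bsub>F\<^esub> fpart t) \<cdot>\<^bsub>F\<^esub> e_lift (Dom gcat t)" .
    show "Ar P (A_part s \<cdot>\<^bsub>F\<^esub> A_part t) = upper (Ar D (sq s) \<cdot>\<^bsub>arrow_cat E\<^esub> Ar D (sq t))"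
      using At As ts by simp
  qed
  show "C_part (s \<cdot>\<^bsub>gcat\<^esub> t) = C_part s \<cdot>\<^bsub>F\<^esub> C_part t"
    unfolding C_part_def A sq_cmp[OF t s ts]
    by (rule push_T_cmp) (use At As ts sq_arrow[OF t] sq_arrow[OF s] in simp_all)
qed

lemma A_C_functor:
  shows "is_functor gcat gcat A_functor" "is_functor gcat gcat C_functor"
proof -
  have i: "Idt gcat Y = (Y, (Idt F (fst Y), Idt E (Cod E (snd Y))), Y)" for Y
    by (cases Y) simp
  show "is_functor gcat gcat A_functor"
    unfolding is_functor_def
  proof (intro conjI ballI impI)
    show "Ar A_functor (Idt gcat X) = Idt gcat (Ob A_functor X)" if "X \<in> Obj gcat" for X
      using A_part_idt[OF that] obj_gcat[OF that] unfolding i[of "Ob A_functor X"] by (simp add: A_obj_def)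
  qed (use obj_gcat A_C_Arr A_part_cmp in simp_all)
  show "is_functor gcat gcat C_functor"
    unfolding is_functor_def
  proof (intro conjI ballI impI)
    show "Ar C_functor (Idt gcat X) = Idt gcat (Ob C_functor X)" if "X \<in> Obj gcat" for X
      using A_part_idt[OF that] obj_gcat[OF that] unfolding i[of "Ob C_functor X"] by (simp add: C_obj_def)
  qed (use obj_gcat A_C_Arr A_part_cmp in simp_all)
qed

lemma trans_simps [simp]:
  "fpart (a_trans X) = a_lift X" "epart (a_trans X) = Idt E (Cod E (snd X))"
  "Dom gcat (a_trans X) = A_obj X" "Cod gcat (a_trans X) = C_obj X"
  "fpart (e_trans X) = e_lift X" "epart (e_trans X) = Idt E (Cod E (snd X))"
  "Dom gcat (e_trans X) = A_obj X" "Cod gcat (e_trans X) = X"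
  by (simp_all add: a_trans_def e_trans_def)

lemma a_e_natural:
  shows "nat_trans gcat gcat A_functor C_functor a_trans"
    "nat_trans gcat gcat A_functor id_functor e_trans"
proof -
  have ag: "a_trans X \<in> Arr gcat" "e_trans X \<in> Arr gcat" if "X \<in> Obj gcat" for X
    using a_trans_GM[OF that] e_trans_GN[OF that] by (auto simp: GM_def GN_def)
  show "nat_trans gcat gcat A_functor C_functor a_trans"
    unfolding nat_trans_def
  proof (intro conjI ballI)
    show "a_trans X \<in> hom gcat (Ob A_functor X) (Ob C_functor X)" if "X \<in> Obj gcat" for X
      using ag[OF that] by simp
    fix t assume t: "t \<in> Arr gcat"
    note G = Arr_gcatD[OF t]
    note o = G(9,10) obj_gcat[OF G(9)] obj_gcat[OF G(10)]
    note F = A_C_Arr[OF t]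
    show "a_trans (Cod gcat t) \<cdot>\<^bsub>gcat\<^esub> Ar A_functor t = Ar C_functor t \<cdot>\<^bsub>gcat\<^esub> a_trans (Dom gcat t)"
    proof (rule gcat_eqI)
      show "a_trans (Cod gcat t) \<cdot>\<^bsub>gcat\<^esub> Ar A_functor t \<in> Arr gcat"
        by (rule G.cmp_simps) (use ag o F in simp_all)
      show "Ar C_functor t \<cdot>\<^bsub>gcat\<^esub> a_trans (Dom gcat t) \<in> Arr gcat"
        by (rule G.cmp_simps) (use ag o F in simp_all)
    qed (use C_part_simps[OF t] G(4-6) in simp_all)
  qed
  show "nat_trans gcat gcat A_functor id_functor e_trans"
    unfolding nat_trans_def
  proof (intro conjI ballI)
    show "e_trans X \<in> hom gcat (Ob A_functor X) (Ob id_functor X)" if "X \<in> Obj gcat" for X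
      using ag[OF that] by (simp add: id_functor_def)
    fix t assume t: "t \<in> Arr gcat"
    note G = Arr_gcatD[OF t]
    note o = G(9,10) obj_gcat[OF G(9)] obj_gcat[OF G(10)]
    note F = A_C_Arr[OF t]
    show "e_trans (Cod gcat t) \<cdot>\<^bsub>gcat\<^esub> Ar A_functor t = Ar id_functor t \<cdot>\<^bsub>gcat\<^esub> e_trans (Dom gcat t)"
    proof (rule gcat_eqI)
      show "e_trans (Cod gcat t) \<cdot>\<^bsub>gcat\<^esub> Ar A_functor t \<in> Arr gcat"
        by (rule G.cmp_simps) (use ag o F in simp_all)
      show "Ar id_functor t \<cdot>\<^bsub>gcat\<^esub> e_trans (Dom gcat t) \<in> Arr gcat"
        unfolding id_functor_def using t ag o by simp
    qed (use A_part_simps[OF t] G(4-6) in \<open>simp_all add: id_functor_def\<close>)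
  qed
qed

end

section \<open>Chains of sets and small objects\<close>

lemma Well_orderD:
  assumes "Well_order r"
  shows "k \<in> Field r \<Longrightarrow> (k, k) \<in> r" "(k, l) \<in> r \<Longrightarrow> (l, m) \<in> r \<Longrightarrow> (k, m) \<in> r"
    "k \<in> Field r \<Longrightarrow> l \<in> Field r \<Longrightarrow> (k, l) \<in> r \<or> (l, k) \<in> r"
proof -
  have o: "Refl r" "trans r" "Total r" using assms by (auto simp: order_on_defs)
  show r: "(k, k) \<in> r" if "k \<in> Field r" for k using o(1) that by (rule refl_onD)
  show "(k, l) \<in> r \<Longrightarrow> (l, m) \<in> r \<Longrightarrow> (k, m) \<in> r" using o(2) by (rule transD)
  show "k \<in> Field r \<Longrightarrow> l \<in> Field r \<Longrightarrow> (k, l) \<in> r \<or> (l, k) \<in> r"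
    using o(3) r by (cases "k = l") (auto simp: total_on_def)
qed

text \<open>The chains constructed here are indexed by \<open>1 + \<kappa>\<close>, smallness is about \<open>\<kappa>\<close>-chains: dropping the
  first stage does not change the colimit.\<close>

definition some_functor ::
  "('k option, 'k option \<times> 'k option, 'o, 'a) funct \<Rightarrow> ('k, 'k \<times> 'k, 'o, 'a) funct" where
  "some_functor b = \<lparr>Ob = (\<lambda>k. Ob b (Some k)), Ar = (\<lambda>(x, y). Ar b (Some x, Some y))\<rparr>"

lemma some_functor_simps [simp]:
  "Ob (some_functor b) k = Ob b (Some k)" "Ar (some_functor b) (x, y) = Ar b (Some x, Some y)"
  by (simp_all add: some_functor_def)

lemma some_functor_functor:
  assumes b: "is_functor (poset_cat (one_plus r)) C b"
  shows "is_functor (poset_cat r) C (some_functor b)"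
  unfolding is_functor_def
proof (intro conjI ballI impI)
  show "Ob (some_functor b) k \<in> Obj C" if "k \<in> Obj (poset_cat r)" for k
    using functorD(1)[OF b, of "Some k"] that by simp
  show "Ar (some_functor b) (Idt (poset_cat r) k) = Idt C (Ob (some_functor b) k)" if "k \<in> Obj (poset_cat r)" for k
    using functorD(5)[OF b, of "Some k"] that by simp
  show "Ar (some_functor b) t \<in> hom C (Ob (some_functor b) (Dom (poset_cat r) t)) (Ob (some_functor b) (Cod (poset_cat r) t))"
    if "t \<in> Arr (poset_cat r)" for t
    using functorD(2-4)[OF b, of "(Some (fst t), Some (snd t))"] that by (cases t) simp
  show "Ar (some_functor b) (s \<cdot>\<^bsub>poset_cat r\<^esub> t) = Ar (some_functor b) s \<cdot>\<^bsub>C\<^esub> Ar (some_functor b) t"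
    if "t \<in> Arr (poset_cat r)" "s \<in> Arr (poset_cat r)" "Cod (poset_cat r) t = Dom (poset_cat r) s" for t s
    using functorD(6)[OF b, of "(Some (fst t), Some (snd t))" "(Some (fst s), Some (snd s))"] that
    by (cases t; cases s) simp
qed

context category
begin

context
  fixes r :: "'k rel" and k0 and b
  assumes r: "Well_order r" and k0: "k0 \<in> Field r"
    and b: "is_functor (poset_cat (one_plus r)) C b"
begin

lemma some_cocone:
  assumes v: "is_cocone (poset_cat (one_plus r)) C b V v"
  shows "is_cocone (poset_cat r) C (some_functor b) V (\<lambda>k. v (Some k))"
    "v None = v (Some k0) \<cdot> Ar b (None, Some k0)"
proof -
  have t: "v (snd t) \<cdot> Ar b t = v (fst t)" if "t \<in> one_plus r" for t
    using v that by (simp add: is_cocone_def)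
  have o: "v (Some k) \<in> hom C (Ob b (Some k)) V" if "k \<in> Field r" for k
    using v that by (auto simp: is_cocone_def)
  show "is_cocone (poset_cat r) C (some_functor b) V (\<lambda>k. v (Some k))"
    unfolding is_cocone_def
  proof (intro conjI ballI)
    show "V \<in> Obj C" using v by (simp add: is_cocone_def)
    show "v (Some k) \<in> hom C (Ob (some_functor b) k) V" if "k \<in> Obj (poset_cat r)" for k
      using o that by simp
    show "v (Some (Cod (poset_cat r) s)) \<cdot> Ar (some_functor b) s = v (Some (Dom (poset_cat r) s))"
      if "s \<in> Arr (poset_cat r)" for s
      using t[of "(Some (fst s), Some (snd s))"] that by (cases s) simp
  qed
  show "v None = v (Some k0) \<cdot> Ar b (None, Some k0)"
    using t[of "(None, Some k0)"] k0 by simp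
qed

text \<open>The leg at the added first element has to pass through some stage; any two stages are
  comparable, so the choice of \<open>k0\<close> is immaterial.\<close>

lemma option_cocone:
  assumes w: "is_cocone (poset_cat r) C (some_functor b) V w"
  shows "is_cocone (poset_cat (one_plus r)) C b V
    (\<lambda>k. case k of None \<Rightarrow> w k0 \<cdot> Ar b (None, Some k0) | Some k \<Rightarrow> w k)" (is "is_cocone _ C b V ?v")
proof -
  have o: "w k \<in> hom C (Ob b (Some k)) V" if "k \<in> Field r" for k
    using w that by (auto simp: is_cocone_def)
  have t: "w y \<cdot> Ar b (Some x, Some y) = w x" if "(x, y) \<in> r" for x y
    using w that by (force simp: is_cocone_def)
  have bA: "Ar b s \<in> hom C (Ob b (fst s)) (Ob b (snd s))" if "s \<in> one_plus r" for s
    using functorD(2-4)[OF b, of s] that by simp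
  have bN: "Ar b (None, Some y) = Ar b (Some x, Some y) \<cdot> Ar b (None, Some x)" if "(x, y) \<in> r" for x y
    using functorD(6)[OF b, of "(None, Some x)" "(Some x, Some y)"] that FieldI1[OF that] by simp
  have e: "w y \<cdot> Ar b (None, Some y) = w x \<cdot> Ar b (None, Some x)" if "(x, y) \<in> r" for x y
  proof -
    note F = FieldI1[OF that] FieldI2[OF that]
    have "w y \<cdot> Ar b (None, Some y) = (w y \<cdot> Ar b (Some x, Some y)) \<cdot> Ar b (None, Some x)"
      unfolding bN[OF that] using o[OF F(2)] bA[of "(Some x, Some y)"] bA[of "(None, Some x)"] that F by simp
    then show ?thesis using t[OF that] by simp
  qed
  have N: "w k \<cdot> Ar b (None, Some k) = w k0 \<cdot> Ar b (None, Some k0)" if "k \<in> Field r" for k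
  proof -
    have "(k, k0) \<in> r \<or> (k0, k) \<in> r" using Well_orderD(3)[OF r that k0] .
    then show ?thesis using e[of k k0] e[of k0 k] by auto
  qed
  show ?thesis
    unfolding is_cocone_def
  proof (intro conjI ballI)
    show "V \<in> Obj C" using w by (simp add: is_cocone_def)
    show "?v k \<in> hom C (Ob b k) V" if "k \<in> Obj (poset_cat (one_plus r))" for k
      using that o k0 bA[of "(None, Some k0)"] by (cases k) auto
    fix s assume "s \<in> Arr (poset_cat (one_plus r))"
    then have s: "s \<in> one_plus r" by simp
    obtain x y where xy: "s = (x, y)" by (cases s)
    show "?v (Cod (poset_cat (one_plus r)) s) \<cdot> Ar b s = ?v (Dom (poset_cat (one_plus r)) s)"
    proof (cases y)
      case None
      then have "x = None" using s xy by (cases x) auto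
      moreover have "Ar b (None, None) = Idt C (Ob b None)"
        using functorD(5)[OF b, of None] by simp
      ultimately show ?thesis using None xy o[OF k0] bA[of "(None, Some k0)"] k0 by simp
    next
      case (Some k)
      then show ?thesis using s xy N[of k] t by (cases x) auto
    qed
  qed
qed

lemma option_colimit:
  assumes c: "is_colimit (poset_cat r) C (some_functor b) c \<iota>"
  obtains \<iota>' where "is_colimit (poset_cat (one_plus r)) C b c \<iota>'"
proof
  let ?\<iota> = "\<lambda>k. case k of None \<Rightarrow> \<iota> k0 \<cdot> Ar b (None, Some k0) | Some k \<Rightarrow> \<iota> k"
  have co: "is_cocone (poset_cat r) C (some_functor b) c \<iota>" using c by (simp add: is_colimit_def)
  have bA: "Ar b (None, Some k0) \<in> hom C (Ob b None) (Ob b (Some k0))"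
    using functorD(2-4)[OF b, of "(None, Some k0)"] k0 by simp
  have i0: "\<iota> k0 \<in> hom C (Ob b (Some k0)) c" using co k0 by (simp add: is_cocone_def)
  show "is_colimit (poset_cat (one_plus r)) C b c ?\<iota>"
    unfolding is_colimit_def
  proof (intro conjI allI impI)
    show "is_cocone (poset_cat (one_plus r)) C b c ?\<iota>" by (rule option_cocone[OF co])
    fix d \<nu> assume n: "is_cocone (poset_cat (one_plus r)) C b d \<nu>"
    note S = some_cocone[OF n]
    have ex: "\<exists>!z. z \<in> hom C c d \<and> (\<forall>k \<in> Obj (poset_cat r). z \<cdot> \<iota> k = \<nu> (Some k))"
      using c S(1) unfolding is_colimit_def by blast
    have eq: "(\<forall>k \<in> Obj (poset_cat (one_plus r)). z \<cdot> ?\<iota> k = \<nu> k) \<longleftrightarrow>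
        (\<forall>k \<in> Obj (poset_cat r). z \<cdot> \<iota> k = \<nu> (Some k))" if z: "z \<in> hom C c d" for z
    proof
      assume *: "\<forall>k \<in> Obj (poset_cat r). z \<cdot> \<iota> k = \<nu> (Some k)"
      have "z \<cdot> \<iota> k0 \<cdot> Ar b (None, Some k0) = (z \<cdot> \<iota> k0) \<cdot> Ar b (None, Some k0)"
        using z i0 bA by simp
      also have "\<dots> = \<nu> None" using * k0 S(2) by simp
      finally show "\<forall>k \<in> Obj (poset_cat (one_plus r)). z \<cdot> ?\<iota> k = \<nu> k" using * by auto
    qed force
    show "\<exists>!a. a \<in> hom C c d \<and> (\<forall>k \<in> Obj (poset_cat (one_plus r)). a \<cdot> ?\<iota> k = \<nu> k)"
      using ex eq by (smt (verit, ccfv_threshold))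
  qed
qed

lemma some_colimit:
  assumes c: "is_colimit (poset_cat (one_plus r)) C b c \<iota>"
  shows "is_colimit (poset_cat r) C (some_functor b) c (\<lambda>k. \<iota> (Some k))"
  unfolding is_colimit_def
proof (intro conjI allI impI)
  have co: "is_cocone (poset_cat (one_plus r)) C b c \<iota>" using c by (simp add: is_colimit_def)
  note S = some_cocone[OF co]
  show "is_cocone (poset_cat r) C (some_functor b) c (\<lambda>k. \<iota> (Some k))" by (rule S(1))
  have bA: "Ar b (None, Some k0) \<in> hom C (Ob b None) (Ob b (Some k0))"
    using functorD(2-4)[OF b, of "(None, Some k0)"] k0 by simp
  have i0: "\<iota> (Some k0) \<in> hom C (Ob b (Some k0)) c" using co k0 by (simp add: is_cocone_def)
  fix d \<nu> assume n: "is_cocone (poset_cat r) C (some_functor b) d \<nu>"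
  let ?n = "\<lambda>k. case k of None \<Rightarrow> \<nu> k0 \<cdot> Ar b (None, Some k0) | Some k \<Rightarrow> \<nu> k"
  have ex: "\<exists>!z. z \<in> hom C c d \<and> (\<forall>k \<in> Obj (poset_cat (one_plus r)). z \<cdot> \<iota> k = ?n k)"
    using c option_cocone[OF n] unfolding is_colimit_def by blast
  have eq: "(\<forall>k \<in> Obj (poset_cat (one_plus r)). z \<cdot> \<iota> k = ?n k) \<longleftrightarrow>
      (\<forall>k \<in> Obj (poset_cat r). z \<cdot> \<iota> (Some k) = \<nu> k)" if z: "z \<in> hom C c d" for z
  proof
    assume *: "\<forall>k \<in> Obj (poset_cat r). z \<cdot> \<iota> (Some k) = \<nu> k"
    have "z \<cdot> \<iota> None = (z \<cdot> \<iota> (Some k0)) \<cdot> Ar b (None, Some k0)"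
      unfolding S(2) using z i0 bA by simp
    also have "\<dots> = \<nu> k0 \<cdot> Ar b (None, Some k0)" using * k0 by simp
    finally show "\<forall>k \<in> Obj (poset_cat (one_plus r)). z \<cdot> \<iota> k = ?n k" using * by auto
  qed force
  show "\<exists>!a. a \<in> hom C c d \<and> (\<forall>k \<in> Obj (poset_cat r). a \<cdot> \<iota> (Some k) = \<nu> k)"
    using ex eq by (smt (verit, ccfv_threshold))
qed

end

section \<open>Smallness in terms of arrows\<close>

lemma set_cocone:
  assumes b: "\<And>k k'. (k, k') \<in> r \<Longrightarrow> Ar b (k, k') \<in> hom C (Ob b k) (Ob b k')"
    and s: "\<And>k w. k \<in> Field r \<Longrightarrow> w \<in> hom C x (Ob b k) \<Longrightarrow> s k w \<in> d"
    and c: "\<And>k k' w. (k, k') \<in> r \<Longrightarrow> w \<in> hom C x (Ob b k) \<Longrightarrow> s k' (Ar b (k, k') \<cdot> w) = s k w"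
  shows "is_cocone (poset_cat r) set_cat (hom_functor C x \<circ>\<^sub>F b) d
    (\<lambda>k. (hom C x (Ob b k), restrict (s k) (hom C x (Ob b k)), d))"
  unfolding is_cocone_def
proof (intro conjI ballI)
  show "d \<in> Obj set_cat" by (simp add: set_cat_def)
  show "(hom C x (Ob b k), restrict (s k) (hom C x (Ob b k)), d) \<in>
      hom set_cat (Ob (hom_functor C x \<circ>\<^sub>F b) k) d" if "k \<in> Obj (poset_cat r)" for k
    using that s[of k] by (auto simp: set_cat_def hom_functor_def comp_functor_def)
  fix t assume "t \<in> Arr (poset_cat r)"
  then obtain k k' where t: "t = (k, k')" "(k, k') \<in> r" by (cases t) auto
  note B = b[OF t(2)]
  have "compose (hom C x (Ob b k)) (restrict (s k') (hom C x (Ob b k')))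
      (\<lambda>g \<in> hom C x (Ob b k). Ar b (k, k') \<cdot> g) = restrict (s k) (hom C x (Ob b k))"
    unfolding compose_def using B c[OF t(2)] by (intro restrict_ext) simp
  then show "(hom C x (Ob b (Cod (poset_cat r) t)), restrict (s (Cod (poset_cat r) t)) (hom C x (Ob b (Cod (poset_cat r) t))), d)
      \<cdot>\<^bsub>set_cat\<^esub> Ar (hom_functor C x \<circ>\<^sub>F b) t =
    (hom C x (Ob b (Dom (poset_cat r) t)), restrict (s (Dom (poset_cat r) t)) (hom C x (Ob b (Dom (poset_cat r) t))), d)"
    using B t(1) by (simp add: set_cat_def hom_functor_def comp_functor_def)
qed

context
  fixes r :: "'k rel" and b c \<iota> x
  assumes r: "Well_order r"
    and b: "is_functor (poset_cat r) C b" and i: "is_cocone (poset_cat r) C b c \<iota>"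
    and col: "is_colimit (poset_cat r) set_cat (hom_functor C x \<circ>\<^sub>F b) (Ob (hom_functor C x) c)
      (\<lambda>k. Ar (hom_functor C x) (\<iota> k))"
begin

lemma b_hom: "(k, k') \<in> r \<Longrightarrow> Ar b (k, k') \<in> hom C (Ob b k) (Ob b k')"
  using functorD(2-4)[OF b, of "(k, k')"] by simp

lemma b_cmp: "(k, k') \<in> r \<Longrightarrow> (k', k'') \<in> r \<Longrightarrow> Ar b (k', k'') \<cdot> Ar b (k, k') = Ar b (k, k'')"
  using functorD(6)[OF b, of "(k, k')" "(k', k'')"] by simp

lemma i_hom: "k \<in> Field r \<Longrightarrow> \<iota> k \<in> hom C (Ob b k) c"
  using i by (simp add: is_cocone_def)

lemma i_cmp: "(k, k') \<in> r \<Longrightarrow> \<iota> k' \<cdot> Ar b (k, k') = \<iota> k"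
  using i by (force simp: is_cocone_def)

lemma set_mediator_iff:
  fixes d :: "'a set" and s :: "'k \<Rightarrow> 'a \<Rightarrow> 'a"
  assumes "k \<in> Field r"
  shows "(hom C x c, restrict q (hom C x c), d) \<cdot>\<^bsub>set_cat\<^esub> Ar (hom_functor C x) (\<iota> k) =
      (hom C x (Ob b k), restrict (s k) (hom C x (Ob b k)), d) \<longleftrightarrow>
    (\<forall>w \<in> hom C x (Ob b k). q (\<iota> k \<cdot> w) = s k w)"
proof -
  note I = i_hom[OF assms]
  have "compose (hom C x (Ob b k)) (restrict q (hom C x c)) (\<lambda>g \<in> hom C x (Ob b k). \<iota> k \<cdot> g) =
      (\<lambda>w \<in> hom C x (Ob b k). q (\<iota> k \<cdot> w))"
    unfolding compose_def using I by (intro restrict_ext) simp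
  then have "?thesis \<longleftrightarrow> ((\<lambda>w \<in> hom C x (Ob b k). q (\<iota> k \<cdot> w)) = restrict (s k) (hom C x (Ob b k)) \<longleftrightarrow>
      (\<forall>w \<in> hom C x (Ob b k). q (\<iota> k \<cdot> w) = s k w))"
    using I by (simp add: set_cat_def hom_functor_def)
  then show ?thesis by (auto simp: restrict_def fun_eq_iff)
qed

text \<open>The universal property in \<open>set_cat\<close>, freed of the triples and restrictions
  that encode maps of sets. The target may be any set of arrows.\<close>

lemma set_mediator:
  fixes d :: "'a set" and s :: "'k \<Rightarrow> 'a \<Rightarrow> 'a"
  assumes s: "\<And>k w. k \<in> Field r \<Longrightarrow> w \<in> hom C x (Ob b k) \<Longrightarrow> s k w \<in> d"
    and c: "\<And>k k' w. (k, k') \<in> r \<Longrightarrow> w \<in> hom C x (Ob b k) \<Longrightarrow> s k' (Ar b (k, k') \<cdot> w) = s k w"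
  shows "\<exists>q. (\<forall>g \<in> hom C x c. q g \<in> d) \<and> (\<forall>k \<in> Field r. \<forall>w \<in> hom C x (Ob b k). q (\<iota> k \<cdot> w) = s k w)"
    "\<And>q q'. (\<And>g. g \<in> hom C x c \<Longrightarrow> q g \<in> d) \<Longrightarrow> (\<And>g. g \<in> hom C x c \<Longrightarrow> q' g \<in> d) \<Longrightarrow>
      (\<And>k w. k \<in> Field r \<Longrightarrow> w \<in> hom C x (Ob b k) \<Longrightarrow> q (\<iota> k \<cdot> w) = s k w) \<Longrightarrow>
      (\<And>k w. k \<in> Field r \<Longrightarrow> w \<in> hom C x (Ob b k) \<Longrightarrow> q' (\<iota> k \<cdot> w) = s k w) \<Longrightarrow>
      g \<in> hom C x c \<Longrightarrow> q g = q' g"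
proof -
  have hO: "Ob (hom_functor C x) c = hom C x c" by (simp add: hom_functor_def)
  have "is_cocone (poset_cat r) set_cat (hom_functor C x \<circ>\<^sub>F b) d
    (\<lambda>k. (hom C x (Ob b k), restrict (s k) (hom C x (Ob b k)), d))"
    by (rule set_cocone) (use b_hom s c in auto)
  then have ex1: "\<exists>!a. a \<in> hom set_cat (Ob (hom_functor C x) c) d \<and> (\<forall>k \<in> Obj (poset_cat r).
      a \<cdot>\<^bsub>set_cat\<^esub> Ar (hom_functor C x) (\<iota> k) = (hom C x (Ob b k), restrict (s k) (hom C x (Ob b k)), d))"
    using col unfolding is_colimit_def by blast
  then obtain a where a: "a \<in> hom set_cat (hom C x c) d" "\<And>k. k \<in> Field r \<Longrightarrow>
      a \<cdot>\<^bsub>set_cat\<^esub> Ar (hom_functor C x) (\<iota> k) = (hom C x (Ob b k), restrict (s k) (hom C x (Ob b k)), d)"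
    unfolding poset_cat_simps(1) hO by blast
  obtain X q Y where XqY: "a = (X, q, Y)" by (cases a)
  then have "q \<in> X \<rightarrow>\<^sub>E Y" and XY: "X = hom C x c" "Y = d"
    using a(1) unfolding hom_def[of set_cat] by (auto simp add: set_cat_def simp del: in_hom)
  then have q: "a = (hom C x c, q, d)" "q \<in> hom C x c \<rightarrow>\<^sub>E d"
    using XqY by blast+
  have "restrict q (hom C x c) = q" by (rule PiE_restrict[OF q(2)])
  have "(\<forall>g \<in> hom C x c. q g \<in> d) \<and> (\<forall>k \<in> Field r. \<forall>w \<in> hom C x (Ob b k). q (\<iota> k \<cdot> w) = s k w)"
  proof (intro conjI ballI)
    show "q g \<in> d" if "g \<in> hom C x c" for g using q(2) that by (rule PiE_mem)
    show "q (\<iota> k \<cdot> w) = s k w" if "k \<in> Field r" "w \<in> hom C x (Ob b k)" for k w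
      using set_mediator_iff[OF that(1), of q d s] a(2)[OF that(1)] that(2)
      unfolding q(1) \<open>restrict q (hom C x c) = q\<close> by blast
  qed
  then show "\<exists>q. (\<forall>g \<in> hom C x c. q g \<in> d) \<and> (\<forall>k \<in> Field r. \<forall>w \<in> hom C x (Ob b k). q (\<iota> k \<cdot> w) = s k w)"
    by blast
  fix q q' g
  assume q: "\<And>g. g \<in> hom C x c \<Longrightarrow> q g \<in> d" and q': "\<And>g. g \<in> hom C x c \<Longrightarrow> q' g \<in> d"
    and e: "\<And>k w. k \<in> Field r \<Longrightarrow> w \<in> hom C x (Ob b k) \<Longrightarrow> q (\<iota> k \<cdot> w) = s k w"
    and e': "\<And>k w. k \<in> Field r \<Longrightarrow> w \<in> hom C x (Ob b k) \<Longrightarrow> q' (\<iota> k \<cdot> w) = s k w"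
    and g: "g \<in> hom C x c"
  have m: "(hom C x c, restrict q (hom C x c), d) \<in> hom set_cat (Ob (hom_functor C x) c) d \<and>
      (\<forall>k \<in> Obj (poset_cat r). (hom C x c, restrict q (hom C x c), d) \<cdot>\<^bsub>set_cat\<^esub> Ar (hom_functor C x) (\<iota> k) =
        (hom C x (Ob b k), restrict (s k) (hom C x (Ob b k)), d))"
    if "\<And>g. g \<in> hom C x c \<Longrightarrow> q g \<in> d"
      "\<And>k w. k \<in> Field r \<Longrightarrow> w \<in> hom C x (Ob b k) \<Longrightarrow> q (\<iota> k \<cdot> w) = s k w" for q
  proof
    show "(hom C x c, restrict q (hom C x c), d) \<in> hom set_cat (Ob (hom_functor C x) c) d"
      using that(1) by (auto simp: set_cat_def hom_functor_def)
    show "\<forall>k \<in> Obj (poset_cat r). (hom C x c, restrict q (hom C x c), d) \<cdot>\<^bsub>set_cat\<^esub> Ar (hom_functor C x) (\<iota> k) =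
        (hom C x (Ob b k), restrict (s k) (hom C x (Ob b k)), d)"
      using that(2) set_mediator_iff by (simp del: in_hom)
  qed
  have "(hom C x c, restrict q (hom C x c), d) = (hom C x c, restrict q' (hom C x c), d)"
    using ex1 m[of q] m[of q'] q q' e e' by blast
  then have "restrict q (hom C x c) g = restrict q' (hom C x c) g" by simp
  then show "q g = q' g" using g by simp
qed

text \<open>The arrows that factor through a stage form a set \<open>?d\<close> to which the colimit
  maps. Followed by the inclusion into all arrows this is a mediator for the colimit cocone itself,
  hence the identity, so \<open>?d\<close> contains every arrow.\<close>

lemma small_factor:
  assumes g: "g \<in> hom C x c"
  shows "\<exists>k \<in> Field r. \<exists>w \<in> hom C x (Ob b k). \<iota> k \<cdot> w = g"
proof -
  let ?d = "{\<iota> k \<cdot> w | k w. k \<in> Field r \<and> w \<in> hom C x (Ob b k)}"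
  have c: "\<iota> k' \<cdot> Ar b (k, k') \<cdot> w = \<iota> k \<cdot> w" if "(k, k') \<in> r" "w \<in> hom C x (Ob b k)" for k k' w
    using cmp_eq_cmp[OF i_cmp[OF that(1)], of w] that i_hom[OF FieldI2[OF that(1)]] b_hom[OF that(1)] by simp
  have dh: "?d \<subseteq> hom C x c" using i_hom by auto
  obtain q where q: "\<forall>g \<in> hom C x c. q g \<in> ?d" "\<forall>k \<in> Field r. \<forall>w \<in> hom C x (Ob b k). q (\<iota> k \<cdot> w) = \<iota> k \<cdot> w"
    using set_mediator(1)[of "\<lambda>k w. \<iota> k \<cdot> w" ?d] c by blast
  have "q g = id g"
  proof (rule set_mediator(2)[where s = "\<lambda>k w. \<iota> k \<cdot> w" and d = "hom C x c" and q = q and q' = id and g = g])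
    show "q g \<in> hom C x c" if "g \<in> hom C x c" for g using q(1) dh that by blast
    show "q (\<iota> k \<cdot> w) = \<iota> k \<cdot> w" if "k \<in> Field r" "w \<in> hom C x (Ob b k)" for k w
      using q(2) that by blast
  qed (use c g i_hom in auto)
  then have qg: "q g = g" by simp
  have "q g \<in> ?d" using q(1) g by blast
  then obtain k w where "q g = \<iota> k \<cdot> w" "k \<in> Field r" "w \<in> hom C x (Ob b k)" by blast
  then show ?thesis unfolding qg by blast
qed

text \<open>Becoming equal to \<open>g\<close> at a later stage is a property stable under the
  transitions, so it defines a function on the colimit. It holds for \<open>g\<close>, and as
  \<open>g\<close> and \<open>g'\<close> have the same image in the colimit it holds for
  \<open>g'\<close>.\<close>

lemma small_eq:
  assumes k: "k \<in> Field r" and g: "g \<in> hom C x (Ob b k)" "g' \<in> hom C x (Ob b k)" and eq: "\<iota> k \<cdot> g = \<iota> k \<cdot> g'"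
  shows "\<exists>m. (k, m) \<in> r \<and> Ar b (k, m) \<cdot> g = Ar b (k, m) \<cdot> g'"
proof -
  note rr = Well_orderD(1)[OF r] and tr = Well_orderD(2)[OF r] and to = Well_orderD(3)[OF r]
  show ?thesis
  proof (cases "g = g'")
    case True
    then show ?thesis using rr[OF k] by blast
  next
    case False
    \<comment> \<open>The two truth values are represented by \<open>g\<close> and
      \<open>g'\<close>, because the target sets available to \<open>set_mediator\<close> consist of
      arrows; this is where \<open>g \<noteq> g'\<close> matters.\<close>
    define ev where "ev k' w \<longleftrightarrow> (\<exists>m. (k', m) \<in> r \<and> (k, m) \<in> r \<and> Ar b (k', m) \<cdot> w = Ar b (k, m) \<cdot> g)" for k' w
    define s where "s k' w = (if ev k' w then g else g')" for k' w
    have bc: "Ar b (m, n) \<cdot> Ar b (l, m) \<cdot> w = Ar b (l, n) \<cdot> w"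
      if "(l, m) \<in> r" "(m, n) \<in> r" "w \<in> hom C x (Ob b l)" for l m n w
      using cmp_eq_cmp[OF b_cmp[OF that(1,2)], of w] that b_hom[OF that(1)] b_hom[OF that(2)] by simp
    have "ev k'' (Ar b (k', k'') \<cdot> w) \<longleftrightarrow> ev k' w" if kk: "(k', k'') \<in> r" and w: "w \<in> hom C x (Ob b k')" for k' k'' w
    proof
      assume "ev k'' (Ar b (k', k'') \<cdot> w)"
      then obtain m where m: "(k'', m) \<in> r" "(k, m) \<in> r" "Ar b (k'', m) \<cdot> Ar b (k', k'') \<cdot> w = Ar b (k, m) \<cdot> g"
        by (auto simp: ev_def)
      then show "ev k' w" using bc[OF kk m(1) w] tr[OF kk m(1)] by (auto simp: ev_def)
    next
      assume "ev k' w"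
      then obtain m where m: "(k', m) \<in> r" "(k, m) \<in> r" "Ar b (k', m) \<cdot> w = Ar b (k, m) \<cdot> g"
        by (auto simp: ev_def)
      obtain n where n: "(m, n) \<in> r" "(k'', n) \<in> r"
        using to[OF FieldI2[OF m(1)] FieldI2[OF kk]] rr FieldI2[OF m(1)] FieldI2[OF kk] by blast
      have "Ar b (k'', n) \<cdot> Ar b (k', k'') \<cdot> w = Ar b (m, n) \<cdot> Ar b (k', m) \<cdot> w"
        using bc[OF kk n(2) w] bc[OF m(1) n(1) w] by simp
      also have "\<dots> = Ar b (k, n) \<cdot> g" using m(3) bc[OF m(2) n(1) g(1)] by simp
      finally show "ev k'' (Ar b (k', k'') \<cdot> w)" using n tr[OF m(2) n(1)] by (auto simp: ev_def)
    qed
    then have "s k'' (Ar b (k', k'') \<cdot> w) = s k' w" if "(k', k'') \<in> r" "w \<in> hom C x (Ob b k')" for k' k'' w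
      unfolding s_def using that by (simp only:)
    moreover have "s k' w \<in> {g, g'}" for k' w by (simp add: s_def)
    ultimately obtain q where q: "\<forall>k' \<in> Field r. \<forall>w \<in> hom C x (Ob b k'). q (\<iota> k' \<cdot> w) = s k' w"
      using set_mediator(1)[of s "{g, g'}"] by blast
    have "ev k g" using rr[OF k] by (auto simp: ev_def)
    then have "s k g = g" by (simp add: s_def)
    moreover have "q (\<iota> k \<cdot> g) = s k g" "q (\<iota> k \<cdot> g') = s k g'" using q k g by blast+
    ultimately have "s k g' = g" using eq by simp
    then have "ev k g'" using False by (auto simp: s_def split: if_splits)
    then show ?thesis by (auto simp: ev_def)
  qed
qed

end

end

section \<open>Cellular chains in the comma category\<close>

context ext_setting
begin

lemma wo: "Well_order \<kappa>"
  using limit by (simp add: limit_ordinal_def)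

lemma M_wide: "wide_subcategory E M"
  using backdrop by (simp add: backdrop_def)

lemma M_Arr: "f \<in> M \<Longrightarrow> f \<in> Arr E"
  using M_wide by (auto simp: wide_subcategory_def)

lemma PE_functor:
  assumes b: "is_functor K (wide gcat (GM M)) b"
  shows "is_functor K (wide E M) (PE \<circ>\<^sub>F b)"
  unfolding is_functor_def
proof (intro conjI ballI impI)
  note B = functorD[OF b, unfolded wide_simps]
  show "Ob (PE \<circ>\<^sub>F b) x \<in> Obj (wide E M)" if "x \<in> Obj K" for x
    using Obj_gcatD[OF B(1)[OF that]] by simp
  show "Ar (PE \<circ>\<^sub>F b) t \<in> hom (wide E M) (Ob (PE \<circ>\<^sub>F b) (Dom K t)) (Ob (PE \<circ>\<^sub>F b) (Cod K t))"
    if "t \<in> Arr K" for t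
    using GMD(1-3)[OF B(2)[OF that]] Arr_gcatD(1-3)[OF GMD(1)[OF B(2)[OF that]]] B(3,4)[OF that] by simp
  show "Ar (PE \<circ>\<^sub>F b) (Idt K x) = Idt (wide E M) (Ob (PE \<circ>\<^sub>F b) x)" if "x \<in> Obj K" for x
    using B(5)[OF that] Obj_gcatD[OF B(1)[OF that]] by simp
  show "Ar (PE \<circ>\<^sub>F b) (s \<cdot>\<^bsub>K\<^esub> t) = Ar (PE \<circ>\<^sub>F b) s \<cdot>\<^bsub>wide E M\<^esub> Ar (PE \<circ>\<^sub>F b) t"
    if "t \<in> Arr K" "s \<in> Arr K" "Cod K t = Dom K s" for t s
    using B(6)[OF that] Arr_gcatD(1-3)[OF GMD(1)[OF B(2)[OF that(1)]]] Arr_gcatD(1-3)[OF GMD(1)[OF B(2)[OF that(2)]]]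
      B(3,4)[OF that(1)] B(3,4)[OF that(2)] that(3) by simp
qed

lemma wide_functor: "wide_subcategory E M \<Longrightarrow> is_functor K (wide E M) b \<Longrightarrow> is_functor K E b"
  by (auto simp: is_functor_def wide_subcategory_def)

text \<open>Below full length the colimit exists among maps in \<open>M\<close> and is preserved by
  the inclusion into \<open>E\<close>. The first fact puts the legs into \<open>M\<close> and
  detects \<open>M\<close>; the second feeds the Van Kampen property.\<close>

lemma chain_exists:
  assumes c: "c \<in> Field \<kappa>" and b: "is_functor (poset_cat (one_plus (seg \<kappa> c))) (wide gcat (GM M)) b"
  shows "\<exists>x \<iota>. is_colimit (poset_cat (one_plus (seg \<kappa> c))) gcat b x \<iota> \<and>
        (\<forall>k \<in> Field (one_plus (seg \<kappa> c)). \<iota> k \<in> GM M) \<and>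
        G.detects GN \<iota> (Field (one_plus (seg \<kappa> c))) x \<and>
        G.detects (GM M) \<iota> (Field (one_plus (seg \<kappa> c))) x"
proof -
  let ?r = "seg \<kappa> c"
  let ?K = "poset_cat (one_plus ?r)"
  have less: "?r <o \<kappa>" by (rule underS_Restr_ordLess[OF wo nonempty])
  note b' = PE_functor[OF b]
  have "has_colimits_in ?K E M" using backdrop less by (simp add: backdrop_def)
  then obtain c0 \<beta> where cM: "is_colimit ?K (wide E M) (PE \<circ>\<^sub>F b) c0 \<beta>" and cE: "is_colimit ?K E (PE \<circ>\<^sub>F b) c0 \<beta>"
    using b' unfolding has_colimits_in_def by blast
  have vk: "van_kampen ?K E F P (PE \<circ>\<^sub>F b) c0 \<beta>"
    using vk_chains b' cE ordLess_imp_ordLeq[OF less] unfolding van_kampen_chains_def by blast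
  obtain x \<iota> where x: "is_colimit ?K gcat b x \<iota>" "Ob PE x = c0"
    and iN: "\<And>k. k \<in> Field (one_plus ?r) \<Longrightarrow> \<iota> k \<in> GN"
    and ie: "\<And>k. k \<in> Field (one_plus ?r) \<Longrightarrow> epart (\<iota> k) = Idt E (Cod E (snd (Ob b k)))"
    and iP: "\<And>k. k \<in> Field (one_plus ?r) \<Longrightarrow> Ar PE (\<iota> k) = \<beta> k"
    and det: "G.detects GN \<iota> (Field (one_plus ?r)) x"
    using vk_chain_colimit[OF b cE vk] by blast
  have io: "Dom gcat (\<iota> k) = Ob b k" "Cod gcat (\<iota> k) = x" if "k \<in> Field (one_plus ?r)" for k
    using x(1) that unfolding is_colimit_def is_cocone_def poset_cat_simps(1) in_hom by blast+
  have bM: "\<beta> k \<in> M" if "k \<in> Field (one_plus ?r)" for k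
    using cM that unfolding is_colimit_def is_cocone_def poset_cat_simps(1) in_hom wide_simps by blast
  have "\<iota> k \<in> GM M" if "k \<in> Field (one_plus ?r)" for k
    using iN[OF that] ie[OF that] iP[OF that] bM[OF that] io[OF that] by (simp add: GM_def GN_def)
  moreover have "G.detects (GM M) \<iota> (Field (one_plus ?r)) x"
    unfolding G.detects_def
  proof (intro ballI impI; elim conjE)
    fix z assume z: "z \<in> Arr gcat" "Dom gcat z = x" and zi: "\<forall>k \<in> Field (one_plus ?r). z \<cdot>\<^bsub>gcat\<^esub> \<iota> k \<in> GM M"
    have zN: "z \<in> GN" by (rule G.detectsD[OF det z]) (use zi GM_GN in blast)
    note Z = Arr_gcatD[OF z(1)]
    have Pz: "Ar P (fpart z) \<in> hom E c0 (Ob P (fst (Cod gcat z)))" using Z(1-3) z x(2) by simp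
    have zb: "Ar P (fpart z) \<cdot>\<^bsub>E\<^esub> \<beta> k \<in> M" if k: "k \<in> Field (one_plus ?r)" for k
    proof -
      have "fpart (\<iota> k) \<in> Arr F" "Cod F (fpart (\<iota> k)) = fst x"
        using Arr_gcatD(1,3)[of "\<iota> k"] iN[OF k] io[OF k] by (auto simp: GN_def)
      moreover have "Ar P (fpart (z \<cdot>\<^bsub>gcat\<^esub> \<iota> k)) \<in> M" using zi k GMD(3) by blast
      ultimately show ?thesis using Z(1,2) z iP[OF k] by simp
    qed
    have bt: "Dom ?K t \<in> Obj ?K \<and> Cod ?K t \<in> Obj ?K \<and>
        Ar (PE \<circ>\<^sub>F b) t \<in> hom E (Ob (PE \<circ>\<^sub>F b) (Dom ?K t)) (Ob (PE \<circ>\<^sub>F b) (Cod ?K t))" if "t \<in> Arr ?K" for t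
    proof -
      have "fst t \<in> Field (one_plus ?r)" "snd t \<in> Field (one_plus ?r)"
        using that unfolding poset_cat_simps(2) by (metis FieldI1 FieldI2 prod.collapse)+
      then show ?thesis using functorD(2-4)[OF wide_functor[OF M_wide b'] that] unfolding poset_cat_simps by simp
    qed
    \<comment> \<open>The image of \<open>z\<close> is compared with the mediator inside
      \<open>M\<close>: both mediate the same cocone in \<open>E\<close>, so they are equal.\<close>
    have "is_cocone ?K E (PE \<circ>\<^sub>F b) (Ob P (fst (Cod gcat z))) (\<lambda>k. Ar P (fpart z) \<cdot>\<^bsub>E\<^esub> \<beta> k)"
      by (rule E.cocone_cmp[OF _ Pz bt]) (use cE in \<open>simp_all add: is_colimit_def\<close>)
    then have "is_cocone ?K (wide E M) (PE \<circ>\<^sub>F b) (Ob P (fst (Cod gcat z))) (\<lambda>k. Ar P (fpart z) \<cdot>\<^bsub>E\<^esub> \<beta> k)"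
      using zb unfolding is_cocone_def poset_cat_simps(1) in_hom wide_simps by blast
    then have "\<exists>!y. y \<in> hom (wide E M) c0 (Ob P (fst (Cod gcat z))) \<and>
        (\<forall>k \<in> Obj ?K. y \<cdot>\<^bsub>wide E M\<^esub> \<beta> k = Ar P (fpart z) \<cdot>\<^bsub>E\<^esub> \<beta> k)"
      using cM unfolding is_colimit_def by blast
    then obtain y where yM: "y \<in> hom (wide E M) c0 (Ob P (fst (Cod gcat z)))"
      and yb: "\<And>k. k \<in> Obj ?K \<Longrightarrow> y \<cdot>\<^bsub>E\<^esub> \<beta> k = Ar P (fpart z) \<cdot>\<^bsub>E\<^esub> \<beta> k"
      unfolding wide_simps(6) by blast
    have y: "y \<in> M" "y \<in> hom E c0 (Ob P (fst (Cod gcat z)))"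
      using yM M_Arr by simp_all
    have "y = Ar P (fpart z)"
      by (rule E.colimit_eqI[OF cE y(2) Pz bt yb])
    then have PM: "Ar P (fpart z) \<in> M" using y by simp
    have kN: "None \<in> Field (one_plus ?r)" by simp
    have iA: "\<iota> None \<in> Arr gcat" using iN[OF kN] by (simp add: GN_def)
    note I = Arr_gcatD[OF iA] io[OF kN]
    have zA: "z \<cdot>\<^bsub>gcat\<^esub> \<iota> None \<in> GM M" using zi kN by blast
    \<comment> \<open>The base component of \<open>z\<close> is read off from the leg at
      \<open>None\<close>.\<close>
    have "epart z \<cdot>\<^bsub>E\<^esub> epart (\<iota> None) = Idt E (Cod E (snd (Ob b None)))"
      using GMD(4)[OF zA] I by simp
    moreover have "Cod E (snd x) = Cod E (snd (Ob b None))"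
      using I(6) ie[OF kN] I(11,12) Obj_gcatD(2)[OF I(9)] by simp
    ultimately have "epart z = Idt E (Cod E (snd x))"
      using ie[OF kN] Z(4,5) z by simp
    then show "z \<in> GM M" using zN PM z by (simp add: GM_def GN_def)
  qed
  ultimately show ?thesis using x(1) det by blast
qed

text \<open>At full length the backdrop speaks of \<open>\<kappa>\<close>-chains in
  \<open>E\<close>, so the first element is dropped and then restored. The claim that the image in
  \<open>E\<close> is a colimit is recorded because smallness of the domains of \<open>u\<close> is
  about this image.\<close>

lemma top_exists:
  assumes b: "is_functor (poset_cat (one_plus \<kappa>)) (wide gcat (GM M)) b"
  shows "\<exists>x \<iota>. is_colimit (poset_cat (one_plus \<kappa>)) gcat b x \<iota> \<and>
        (\<forall>k \<in> Field (one_plus \<kappa>). \<iota> k \<in> GN) \<and>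
        G.detects GN \<iota> (Field (one_plus \<kappa>)) x \<and>
        is_colimit (poset_cat (one_plus \<kappa>)) E (PE \<circ>\<^sub>F b) (Ob PE x) (\<lambda>k. Ar PE (\<iota> k)) \<and>
        (\<forall>k \<in> Field (one_plus \<kappa>). epart (\<iota> k) = Idt E (Cod E (snd (Ob b k))))"
proof -
  let ?K = "poset_cat (one_plus \<kappa>)"
  note b' = PE_functor[OF b]
  obtain k0 where k0: "k0 \<in> Field \<kappa>" using nonempty by blast
  obtain c0 \<beta>' where "is_colimit (poset_cat \<kappa>) E (some_functor (PE \<circ>\<^sub>F b)) c0 \<beta>'"
    using backdrop some_functor_functor[OF b'] unfolding backdrop_def by blast
  then obtain \<beta> where cE: "is_colimit ?K E (PE \<circ>\<^sub>F b) c0 \<beta>"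
    using E.option_colimit[OF wo k0 wide_functor[OF M_wide b']] by blast
  have vk: "van_kampen ?K E F P (PE \<circ>\<^sub>F b) c0 \<beta>"
    using vk_chains b' cE ordLeq_reflexive[OF wo] unfolding van_kampen_chains_def by blast
  obtain x \<iota> where x: "is_colimit ?K gcat b x \<iota>" "Ob PE x = c0"
    and iN: "\<And>k. k \<in> Field (one_plus \<kappa>) \<Longrightarrow> \<iota> k \<in> GN"
    and ie: "\<And>k. k \<in> Field (one_plus \<kappa>) \<Longrightarrow> epart (\<iota> k) = Idt E (Cod E (snd (Ob b k)))"
    and iP: "\<And>k. k \<in> Field (one_plus \<kappa>) \<Longrightarrow> Ar PE (\<iota> k) = \<beta> k"
    and det: "G.detects GN \<iota> (Field (one_plus \<kappa>)) x"
    using vk_chain_colimit[OF b cE vk] by blast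
  have co: "is_cocone ?K E (PE \<circ>\<^sub>F b) d (\<lambda>k. Ar PE (\<iota> k)) = is_cocone ?K E (PE \<circ>\<^sub>F b) d \<beta>" for d
  proof -
    have "fst t \<in> Field (one_plus \<kappa>)" "snd t \<in> Field (one_plus \<kappa>)" if "t \<in> one_plus \<kappa>" for t
      using that by (metis FieldI1 FieldI2 prod.collapse)+
    then show ?thesis using iP unfolding is_cocone_def poset_cat_simps by simp
  qed
  have "is_colimit ?K E (PE \<circ>\<^sub>F b) c0 (\<lambda>k. Ar PE (\<iota> k))"
    using cE co iP unfolding is_colimit_def poset_cat_simps(1) by simp
  then show ?thesis using x iN ie det by blast
qed

lemma cobase_exists:
  assumes m: "m \<in> GM M" and f: "f \<in> GN" and mf: "Dom gcat f = Dom gcat m"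
  obtains p q where "G.pushout m f p q" "p \<in> GN" "q \<in> GM M"
    "\<And>z. z \<in> Arr gcat \<Longrightarrow> Dom gcat z = Cod gcat p \<Longrightarrow> z \<cdot>\<^bsub>gcat\<^esub> p \<in> GN \<Longrightarrow> z \<cdot>\<^bsub>gcat\<^esub> q \<in> GN \<Longrightarrow> z \<in> GN"
    "is_pushout E (Ar P (fpart m)) (Ar P (fpart f)) (Ar P (fpart p)) (Ar P (fpart q))"
proof -
  have fA: "f \<in> Arr gcat" using f by (simp add: GN_def)
  note M = GMD[OF m] and F' = Arr_gcatD[OF fA]
  note M' = Arr_gcatD[OF M(1)]
  have "closed_under_cobase_change E M" using backdrop by (simp add: backdrop_def)
  moreover have "Ar P (fpart f) \<in> Arr E" "Dom E (Ar P (fpart f)) = Dom E (Ar P (fpart m))"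
    using F'(1,2) M'(1,2) mf by simp_all
  ultimately obtain p q where pq: "is_pushout E (Ar P (fpart m)) (Ar P (fpart f)) p q" "q \<in> M"
    using M(3) unfolding closed_under_cobase_change_def by blast
  have vk: "van_kampen span_cat E F P (span_diagram E (Ar P (fpart m)) (Ar P (fpart f))) (Cod E p)
      (pushout_cocone E (Ar P (fpart m)) p q)"
    using vk_cobase M(3) pq(1) unfolding van_kampen_cobase_changes_def by blast
  obtain p' q' where *: "G.pushout m f p' q'" "p' \<in> GN" "q' \<in> GN"
    "epart q' = Idt E (Cod E (snd (Cod gcat f)))"
    "Ar P (fpart p') = p" "Ar P (fpart q') = q"
    "\<And>z. z \<in> Arr gcat \<Longrightarrow> Dom gcat z = Cod gcat p' \<Longrightarrow> z \<cdot>\<^bsub>gcat\<^esub> p' \<in> GN \<Longrightarrow> z \<cdot>\<^bsub>gcat\<^esub> q' \<in> GN \<Longrightarrow> z \<in> GN"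
    using vk_pushout[OF m f mf pq(1) vk] by blast
  have "Dom gcat q' = Cod gcat f" using G.pushoutD[OF *(1)] by blast
  then have "q' \<in> GM M" using *(3,4,6) pq(2) by (simp add: GM_def GN_def)
  with * pq that show ?thesis by blast
qed

text \<open>Condition (b) of compatibility, transported to the comma category. The given pushout is
  isomorphic to the one from \<open>cobase_exists\<close>, whose image in \<open>E\<close> is a
  pushout; so its own image is a pushout, and the image of \<open>w\<close> is the gap map of the
  square \<open>sq y\<close>.\<close>

lemma gap_GM:
  assumes y: "y \<in> GM M" and po: "G.pushout (a_trans (Dom gcat y)) (Ar A_functor y) p q" and q: "q \<in> GM M"
    and w: "w \<in> GN" "Dom gcat w = Cod gcat p"
    and wp: "w \<cdot>\<^bsub>gcat\<^esub> p = Ar C_functor y" and wq: "w \<cdot>\<^bsub>gcat\<^esub> q = a_trans (Cod gcat y)"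
  shows "w \<in> GM M"
proof -
  note Y = GMD[OF y]
  note Y' = Arr_gcatD[OF Y(1)]
  note PO = G.pushoutD[OF po]
  have wA: "w \<in> Arr gcat" using w by (simp add: GN_def)
  have am: "a_trans (Dom gcat y) \<in> GM M" by (rule a_trans_GM[OF Y'(9)])
  have Ay: "Ar A_functor y \<in> GN"
    using A_C_Arr(1)[OF Y(1)] A_part_simps(6)[OF Y(1) Y(2)] by (simp add: GN_def)
  obtain p0 q0 where po0: "G.pushout (a_trans (Dom gcat y)) (Ar A_functor y) p0 q0"
    and E0: "is_pushout E (Ar P (fpart (a_trans (Dom gcat y)))) (Ar P (fpart (Ar A_functor y)))
      (Ar P (fpart p0)) (Ar P (fpart q0))"
    by (rule cobase_exists[OF am Ay]) auto
  note PO0 = G.pushoutD[OF po0]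
  obtain h k where hk: "h \<in> hom gcat (Cod gcat p0) (Cod gcat p)" "k \<in> hom gcat (Cod gcat p) (Cod gcat p0)"
    "h \<cdot>\<^bsub>gcat\<^esub> p0 = p" "h \<cdot>\<^bsub>gcat\<^esub> q0 = q" "h \<cdot>\<^bsub>gcat\<^esub> k = Idt gcat (Cod gcat p)" "k \<cdot>\<^bsub>gcat\<^esub> h = Idt gcat (Cod gcat p0)"
    by (rule G.pushout_unique[OF po0 po]) auto
  have hA: "h \<in> Arr gcat" and kA: "k \<in> Arr gcat" using hk by auto
  note hP = Arr_gcatD(1-3)[OF hA] and kP = Arr_gcatD(1-3)[OF kA]
  note pP = Arr_gcatD(1-3)[OF PO0(3)] and qP = Arr_gcatD(1-3)[OF PO0(4)]
  have cp: "fst (Cod gcat p) \<in> Obj F" "fst (Cod gcat p0) \<in> Obj F"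
    using Obj_gcatD(1) Arr_gcatD(10) PO(3) PO0(3) by blast+
  have "E.pushout (Ar P (fpart (a_trans (Dom gcat y)))) (Ar P (fpart (Ar A_functor y)))
      (Ar P (fpart h) \<cdot>\<^bsub>E\<^esub> Ar P (fpart p0)) (Ar P (fpart h) \<cdot>\<^bsub>E\<^esub> Ar P (fpart q0))"
  proof (rule E.pushout_iso[OF E0[unfolded E.is_pushout_iff], where k = "Ar P (fpart k)"])
    have "fpart h \<cdot>\<^bsub>F\<^esub> fpart k = Idt F (fst (Cod gcat p))" "fpart k \<cdot>\<^bsub>F\<^esub> fpart h = Idt F (fst (Cod gcat p0))"
      using arg_cong[OF hk(5), of fpart] arg_cong[OF hk(6), of fpart] by simp_all
    then have "Ar P (fpart h) \<cdot>\<^bsub>E\<^esub> Ar P (fpart k) = Idt E (Ob P (fst (Cod gcat p)))"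
      "Ar P (fpart k) \<cdot>\<^bsub>E\<^esub> Ar P (fpart h) = Idt E (Ob P (fst (Cod gcat p0)))"
      using P_simps(6)[of "fpart k" "fpart h"] P_simps(6)[of "fpart h" "fpart k"] hP kP hk cp by simp_all
    then show "Ar P (fpart h) \<cdot>\<^bsub>E\<^esub> Ar P (fpart k) = Idt E (Cod E (Ar P (fpart h)))"
      "Ar P (fpart k) \<cdot>\<^bsub>E\<^esub> Ar P (fpart h) = Idt E (Dom E (Ar P (fpart h)))"
      using hP hk by simp_all
  qed (use hP kP hk pP in simp_all)
  moreover have "fpart p = fpart h \<cdot>\<^bsub>F\<^esub> fpart p0" "fpart q = fpart h \<cdot>\<^bsub>F\<^esub> fpart q0"
    using parts_cmp(1)[of h p0] parts_cmp(1)[of h q0] unfolding hk(3,4) .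
  then have "Ar P (fpart p) = Ar P (fpart h) \<cdot>\<^bsub>E\<^esub> Ar P (fpart p0)" "Ar P (fpart q) = Ar P (fpart h) \<cdot>\<^bsub>E\<^esub> Ar P (fpart q0)"
    using hP pP qP hk(1) PO0(8) by simp_all
  ultimately have E1: "is_pushout E (Ob D (sdom (sq y))) (upper (Ar D (sq y))) (Ar P (fpart p)) (Ar P (fpart q))"
    using a_lift_simps(3)[OF Y'(9)] A_part_simps(4)[OF Y(1)] sq_arrow[OF Y(1)] by (simp add: E.is_pushout_iff)
  note W = Arr_gcatD(1-3)[OF wA] and pP' = Arr_gcatD(1-3)[OF PO(3)] and qP' = Arr_gcatD(1-3)[OF PO(4)]
  have wpq: "fpart w \<cdot>\<^bsub>F\<^esub> fpart p = C_part y" "fpart w \<cdot>\<^bsub>F\<^esub> fpart q = a_lift (Cod gcat y)"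
    using arg_cong[OF wp, of fpart] arg_cong[OF wq, of fpart] by simp_all
  have wc: "Cod gcat w = C_obj (Cod gcat y)" using arg_cong[OF wq, of "Cod gcat"] by simp
  have "lower (sq y) \<in> M"
    using M_wide Y(4) sq_arrow(5)[OF Y(1)] Obj_gcatD(2)[OF Y'(9)] by (simp add: wide_subcategory_def)
  then have "Ar P (fpart w) \<in> M"
    using compatible sq_arrow(1)[OF Y(1)] Y(3) sq_arrow(4)[OF Y(1)] E1
  proof -
    have "Ar P (fpart w) \<in> hom E (Cod E (Ar P (fpart p))) (Cod E (Ob D (scod (sq y))))"
      using W pP' w wc a_lift_simps(5)[OF Y'(10)] sq_arrow(3)[OF Y(1)] by (simp add: C_obj_def)
    moreover have "Ar P (fpart w) \<cdot>\<^bsub>E\<^esub> Ar P (fpart p) = lower (Ar D (sq y))"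
      using P_simps(6)[of "fpart p" "fpart w"] W pP' w wpq(1) C_part_simps(4)[OF Y(1)] by simp
    moreover have "Ar P (fpart w) \<cdot>\<^bsub>E\<^esub> Ar P (fpart q) = Ob D (scod (sq y))"
      using P_simps(6)[of "fpart q" "fpart w"] W qP' w wpq(2) a_lift_simps(3)[OF Y'(10)] sq_arrow(3)[OF Y(1)] PO
      by simp
    moreover have "upper (sq y) \<in> M" using Y(3) sq_arrow(4)[OF Y(1)] by simp
    ultimately show ?thesis
      using compatible sq_arrow(1)[OF Y(1)] E1 \<open>lower (sq y) \<in> M\<close> unfolding compatible_def by blast
  qed
  \<comment> \<open>Both \<open>q\<close> and the cell \<open>w q\<close> are over identities of the
    base, which forces the base component of \<open>w\<close>.\<close>
  moreover have "epart w = Idt E (Cod E (snd (Dom gcat w)))"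
  proof -
    note Q = GMD[OF q]
    have eq: "epart w \<cdot>\<^bsub>E\<^esub> epart q = Idt E (Cod E (snd (Cod gcat y)))"
      using arg_cong[OF wq, of epart] by simp
    have dq: "Dom gcat q = A_obj (Cod gcat y)" using PO(7) by simp
    have cq: "Cod E (snd (Cod gcat q)) = Cod E (snd (Cod gcat y))"
      using Q(5) dq obj_gcat(3)[OF Y'(10)] by simp
    have "epart q = Idt E (Cod E (snd (Dom gcat w)))"
      using Q(4,5) w(2) PO(8) by simp
    then have "epart w \<cdot>\<^bsub>E\<^esub> epart q = epart w" using Arr_gcatD(4,5)[OF wA] by simp
    then show ?thesis using eq cq w(2) PO(8) by simp
  qed
  ultimately show ?thesis using w(1) by (simp add: GM_def GN_def)
qed

definition top_good ::
  "('k option, 'k option \<times> 'k option, 'p \<times> 'a, ('p \<times> 'a) \<times> ('b \<times> 'a) \<times> ('p \<times> 'a)) funct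
    \<Rightarrow> 'p \<times> 'a \<Rightarrow> ('k option \<Rightarrow> ('p \<times> 'a) \<times> ('b \<times> 'a) \<times> ('p \<times> 'a)) \<Rightarrow> bool" where
  "top_good b x \<iota> \<longleftrightarrow> is_colimit (poset_cat (one_plus \<kappa>)) E (PE \<circ>\<^sub>F b) (Ob PE x) (\<lambda>k. Ar PE (\<iota> k)) \<and>
     (\<forall>k \<in> Field (one_plus \<kappa>). epart (\<iota> k) = Idt E (Cod E (snd (Ob b k))))"

sublocale cells: cell_system_top gcat \<kappa> GN "GM M" A_functor C_functor a_trans e_trans top_good
proof unfold_locales
  show "Well_order \<kappa>" by (rule wo)
  show "wide_subcategory gcat GN" "wide_subcategory gcat (GM M)" "GM M \<subseteq> GN"
    by (rule wide_GN wide_GM[OF M_wide] GM_GN)+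
  show "is_functor gcat gcat A_functor" "is_functor gcat gcat C_functor" by (rule A_C_functor)+
  show "Ar A_functor f \<in> GN" "Ar C_functor f \<in> GN" if "f \<in> GN" for f
    using that A_C_Arr[of f] A_part_simps(6)[of f] C_part_simps(6)[of f] by (auto simp: GN_def)
  show "a_trans x \<in> GM M" "e_trans x \<in> GN" if "x \<in> Obj gcat" for x
    using a_trans_GM[OF that] e_trans_GN[OF that] .
  show "nat_trans gcat gcat A_functor C_functor a_trans" "nat_trans gcat gcat A_functor id_functor e_trans"
    by (rule a_e_natural)+
  show "\<exists>p q. G.pushout m f p q \<and> p \<in> GN \<and> q \<in> GM M \<and>
        (\<forall>z \<in> Arr gcat. Dom gcat z = Cod gcat p \<and> z \<cdot>\<^bsub>gcat\<^esub> p \<in> GN \<and> z \<cdot>\<^bsub>gcat\<^esub> q \<in> GN \<longrightarrow> z \<in> GN)"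
    if "m \<in> GM M" "f \<in> GN" "Dom gcat f = Dom gcat m" for m f
    by (rule cobase_exists[OF that]) blast
  show "w \<in> GM M"
    if "y \<in> GM M" "G.pushout (a_trans (Dom gcat y)) (Ar A_functor y) p q" "q \<in> GM M" "w \<in> GN"
      "Dom gcat w = Cod gcat p" "w \<cdot>\<^bsub>gcat\<^esub> p = Ar C_functor y" "w \<cdot>\<^bsub>gcat\<^esub> q = a_trans (Cod gcat y)" for y p q w
    using gap_GM[OF that] .
  show "\<exists>x \<iota>. is_colimit (poset_cat (one_plus (seg \<kappa> c))) gcat b x \<iota> \<and>
        (\<forall>k \<in> Field (one_plus (seg \<kappa> c)). \<iota> k \<in> GM M) \<and>
        G.detects GN \<iota> (Field (one_plus (seg \<kappa> c))) x \<and>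
        G.detects (GM M) \<iota> (Field (one_plus (seg \<kappa> c))) x"
    if "c \<in> Field \<kappa>" "is_functor (poset_cat (one_plus (seg \<kappa> c))) (wide gcat (GM M)) b" for c b
    using chain_exists[OF that] .
  show "\<exists>x \<iota>. is_colimit (poset_cat (one_plus \<kappa>)) gcat b x \<iota> \<and>
        (\<forall>k \<in> Field (one_plus \<kappa>). \<iota> k \<in> GN) \<and>
        G.detects GN \<iota> (Field (one_plus \<kappa>)) x \<and> top_good b x \<iota>"
    if "is_functor (poset_cat (one_plus \<kappa>)) (wide gcat (GM M)) b" for b
    using top_exists[OF that] unfolding top_good_def by blast
qed

section \<open>The stages of the chosen chain and smallness\<close>

abbreviation pf where "pf t \<equiv> Ar P (fpart t)"

lemma pf_simps [simp]:
  assumes "t \<in> Arr gcat"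
  shows "pf t \<in> Arr E" "Dom E (pf t) = Ob P (fst (Dom gcat t))" "Cod E (pf t) = Ob P (fst (Cod gcat t))"
  using Arr_gcatD(1-3)[OF assms] by simp_all

lemma pf_cmp:
  assumes "t \<in> Arr gcat" "s \<in> Arr gcat" "Cod gcat t = Dom gcat s"
  shows "pf (s \<cdot>\<^bsub>gcat\<^esub> t) = pf s \<cdot>\<^bsub>E\<^esub> pf t"
  using Arr_gcatD(1-3)[OF assms(1)] Arr_gcatD(1-3)[OF assms(2)] assms(3) by simp

lemma snd_pf: "t \<in> Arr gcat \<Longrightarrow> epart t = Idt E (Cod E (snd (Dom gcat t))) \<Longrightarrow>
    snd (Cod gcat t) \<cdot>\<^bsub>E\<^esub> pf t = snd (Dom gcat t) \<and> Cod E (snd (Cod gcat t)) = Cod E (snd (Dom gcat t))"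
  using Arr_gcatD(4-7,9)[of t] Obj_gcatD(2)[of "Dom gcat t"] by (metis E.idt_cmp E.idt_simps(3) E.obj_simps(2))

lemma above_ex:
  assumes "c \<in> Field \<kappa>" "d \<in> Field \<kappa>"
  obtains m where "m \<in> Field \<kappa>" "c \<in> underS \<kappa> m" "d \<in> underS \<kappa> m"
proof -
  have "\<exists>m \<in> Field \<kappa>. \<forall>b \<in> {c, d}. (b, m) \<in> \<kappa> \<and> b \<noteq> m"
    using limit assms unfolding limit_ordinal_def by (metis empty_not_insert empty_subsetI finite.simps insert_subset)
  then show ?thesis using that by (auto simp: underS_def)
qed

text \<open>The object reached before cells are attached at \<open>c\<close>; its structure map is
  the one whose lifting problems are solved at this stage.\<close>

definition stage where "stage X c = Dom gcat (cells.nexts X c)"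

definition stage_top where
  "stage_top X c = cells.tops X (Some c) \<cdot>\<^bsub>gcat\<^esub> cells.nexts X c"

definition stage_map where
  "stage_map X c d = cells.legs X d (Some c) \<cdot>\<^bsub>gcat\<^esub> cells.nexts X c"

abbreviation top_map_to where "top_map_to X \<equiv> snd (cells.top_obj X)"

context
  fixes X assumes X: "X \<in> Obj gcat"
begin

private lemmas cel = cells.cellular_cells(1)[OF X]
private lemmas st = cells.cellularD(1)[OF cel]
private lemmas ch = cells.chain_onD[OF cells.cellularD(3)[OF cel]]
private lemmas tp = cells.chain_colimitD[OF cells.cellularD(2)[OF cel]]

lemma epart_tops:
  assumes "k \<in> insert None (Some ` Field \<kappa>)"
  shows "epart (cells.tops X k) = Idt E (Cod E (snd (Dom gcat (cells.tops X k))))"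
proof -
  have "epart (cells.tops X k) = Idt E (Cod E (snd (Ob (chain_diagram gcat X (cells.legs X) (cells.nexts X)) k)))"
    using cells.cellular_cells(2)[OF X] assms unfolding top_good_def Field_one_plus by blast
  then show ?thesis using assms tp(2,5) by auto
qed

lemma stage_simps:
  assumes c: "c \<in> Field \<kappa>"
  shows "cells.nexts X c \<in> GM M" "cells.nexts X c \<in> Arr gcat" "Dom gcat (cells.nexts X c) = stage X c"
    "stage X c \<in> Obj gcat"
    "cells.tops X (Some c) \<in> Arr gcat" "Dom gcat (cells.tops X (Some c)) = Cod gcat (cells.nexts X c)"
    "Cod gcat (cells.tops X (Some c)) = cells.top_obj X"
    "cells.attach X c \<in> Arr gcat" "Dom gcat (cells.attach X c) = C_obj (stage X c)"
    "Cod gcat (cells.attach X c) = Cod gcat (cells.nexts X c)"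
    "stage_top X c \<in> Arr gcat" "Dom gcat (stage_top X c) = stage X c" "Cod gcat (stage_top X c) = cells.top_obj X"
proof -
  show 1: "cells.nexts X c \<in> GM M" "cells.nexts X c \<in> Arr gcat" "Dom gcat (cells.nexts X c) = stage X c"
    using cells.stepD(4,5)[OF st[OF c]] by (simp_all add: stage_def)
  then show "stage X c \<in> Obj gcat" using G.obj_simps(1)[of "cells.nexts X c"] by simp
  show 2: "cells.tops X (Some c) \<in> Arr gcat" "Dom gcat (cells.tops X (Some c)) = Cod gcat (cells.nexts X c)"
    "Cod gcat (cells.tops X (Some c)) = cells.top_obj X"
    using tp(4-6)[OF c] by simp_all
  show "cells.attach X c \<in> Arr gcat" "Dom gcat (cells.attach X c) = C_obj (stage X c)"
    "Cod gcat (cells.attach X c) = Cod gcat (cells.nexts X c)"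
    using cells.stepD(7-9)[OF st[OF c]] by (simp_all add: stage_def)
  show "stage_top X c \<in> Arr gcat" "Dom gcat (stage_top X c) = stage X c" "Cod gcat (stage_top X c) = cells.top_obj X"
    using 1 2 by (simp_all add: stage_top_def)
qed

lemma attach_e:
  assumes c: "c \<in> Field \<kappa>"
  shows "cells.attach X c \<cdot>\<^bsub>gcat\<^esub> a_trans (stage X c) = cells.nexts X c \<cdot>\<^bsub>gcat\<^esub> e_trans (stage X c)"
  using cells.stepD(10)[OF st[OF c]] by (simp add: stage_def)

text \<open>Forced by the attaching equation, whose other three sides are over identities of the
  base.\<close>

lemma epart_attach:
  assumes c: "c \<in> Field \<kappa>"
  shows "epart (cells.attach X c) = Idt E (Cod E (snd (stage X c)))"
proof -
  note S = stage_simps[OF c]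
  have o: "Cod E (snd (stage X c)) \<in> Obj E" using Obj_gcatD(2)[OF S(4)] by simp
  have "epart (cells.attach X c) \<cdot>\<^bsub>E\<^esub> Idt E (Cod E (snd (stage X c))) =
      epart (cells.nexts X c) \<cdot>\<^bsub>E\<^esub> Idt E (Cod E (snd (stage X c)))"
    using arg_cong[OF attach_e[OF c], of epart] by simp
  then show ?thesis
    using Arr_gcatD(4,5)[OF S(8)] S(9) obj_gcat(4)[OF S(4)] GMD(4)[OF S(1)] S(3) o by simp
qed

text \<open>The last equation is what makes the fillers correct on the codomain side: over the base,
  an attached cell is the lower part of the counit.\<close>

lemma stage_over:
  assumes c: "c \<in> Field \<kappa>"
  shows "epart (stage_top X c) = Idt E (Cod E (snd (stage X c)))"
    "top_map_to X \<cdot>\<^bsub>E\<^esub> pf (stage_top X c) = snd (stage X c)"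
    "Cod E (top_map_to X) = Cod E (snd (stage X c))"
    "top_map_to X \<cdot>\<^bsub>E\<^esub> pf (cells.tops X (Some c)) \<cdot>\<^bsub>E\<^esub> pf (cells.attach X c) = lower (eps (snd (stage X c)))"
proof -
  note S = stage_simps[OF c]
  have o: "Cod E (snd (stage X c)) \<in> Obj E" using Obj_gcatD(2)[OF S(4)] by simp
  have k: "Some c \<in> insert None (Some ` Field \<kappa>)" using c by simp
  note N = GMD[OF S(1)]
  have et: "epart (cells.tops X (Some c)) = Idt E (Cod E (snd (stage X c)))"
    using epart_tops[OF k] N(5) S by simp
  show e: "epart (stage_top X c) = Idt E (Cod E (snd (stage X c)))"
    using et N(4) S o by (simp add: stage_top_def)
  then show 1: "top_map_to X \<cdot>\<^bsub>E\<^esub> pf (stage_top X c) = snd (stage X c)"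
    "Cod E (top_map_to X) = Cod E (snd (stage X c))"
    using snd_pf[OF S(11)] S by auto
  have tt: "top_map_to X \<cdot>\<^bsub>E\<^esub> pf (cells.tops X (Some c)) = snd (Cod gcat (cells.nexts X c))"
    using snd_pf[OF S(5)] et N(5) S by simp
  have "snd (Cod gcat (cells.nexts X c)) \<cdot>\<^bsub>E\<^esub> pf (cells.attach X c) = snd (C_obj (stage X c))"
    using snd_pf[OF S(8)] epart_attach[OF c] obj_gcat(4)[OF S(4)] S by simp
  moreover have "top_map_to X \<cdot>\<^bsub>E\<^esub> pf (cells.tops X (Some c)) \<cdot>\<^bsub>E\<^esub> pf (cells.attach X c) =
      snd (Cod gcat (cells.nexts X c)) \<cdot>\<^bsub>E\<^esub> pf (cells.attach X c)"
    by (rule E.cmp_eq_cmp[OF tt]) (use S Obj_gcatD[of "cells.top_obj X"] G.obj_simps(2)[OF S(5)] in simp_all)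
  ultimately show "top_map_to X \<cdot>\<^bsub>E\<^esub> pf (cells.tops X (Some c)) \<cdot>\<^bsub>E\<^esub> pf (cells.attach X c) = lower (eps (snd (stage X c)))"
    by (simp add: C_obj_def)
qed

text \<open>The equation with \<open>Ar C_functor\<close> says that the cell at \<open>d\<close>
  restricts to the one attached at \<open>c\<close>. The last equation computes a leg of the final
  colimit through a later stage.\<close>

lemma stage_map_simps:
  assumes d: "d \<in> Field \<kappa>" and cd: "c \<in> underS \<kappa> d"
  shows "stage_map X c d \<in> Arr gcat" "Dom gcat (stage_map X c d) = stage X c" "Cod gcat (stage_map X c d) = stage X d"
    "epart (stage_map X c d) = Idt E (Cod E (snd (stage X c)))"
    "stage_top X d \<cdot>\<^bsub>gcat\<^esub> stage_map X c d = stage_top X c"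
    "cells.attach X d \<cdot>\<^bsub>gcat\<^esub> Ar C_functor (stage_map X c d) =
      cells.nexts X d \<cdot>\<^bsub>gcat\<^esub> cells.legs X d (Some c) \<cdot>\<^bsub>gcat\<^esub> cells.attach X c"
    "cells.legs X d (Some c) \<in> Arr gcat" "Dom gcat (cells.legs X d (Some c)) = Cod gcat (cells.nexts X c)"
    "Cod gcat (cells.legs X d (Some c)) = stage X d"
    "cells.tops X (Some d) \<cdot>\<^bsub>gcat\<^esub> cells.nexts X d \<cdot>\<^bsub>gcat\<^esub> cells.legs X d (Some c) = cells.tops X (Some c)"
proof -
  have c: "c \<in> Field \<kappa>" using cd cells.lt_Field by blast
  note S = stage_simps[OF c] and S' = stage_simps[OF d]
  show l: "cells.legs X d (Some c) \<in> Arr gcat" "Dom gcat (cells.legs X d (Some c)) = Cod gcat (cells.nexts X c)"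
    "Cod gcat (cells.legs X d (Some c)) = stage X d"
    using ch(5-7)[OF d cd] by (simp_all add: stage_def)
  then show m: "stage_map X c d \<in> Arr gcat" "Dom gcat (stage_map X c d) = stage X c" "Cod gcat (stage_map X c d) = stage X d"
    using S by (simp_all add: stage_map_def)
  have "cells.legs X d (Some c) \<in> GM M" using cells.stepD(2)[OF st[OF d], of "Some c"] cd by simp
  then have "stage_map X c d \<in> GM M" unfolding stage_map_def
    by (intro cells.M_cmp[OF S(1)]) (use l in simp_all)
  from GMD(4)[OF this] show "epart (stage_map X c d) = Idt E (Cod E (snd (stage X c)))"
    unfolding m(2) .
  show t: "cells.tops X (Some d) \<cdot>\<^bsub>gcat\<^esub> cells.nexts X d \<cdot>\<^bsub>gcat\<^esub> cells.legs X d (Some c) = cells.tops X (Some c)"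
    using tp(8)[OF d cd] .
  have "stage_top X d \<cdot>\<^bsub>gcat\<^esub> stage_map X c d =
      (cells.tops X (Some d) \<cdot>\<^bsub>gcat\<^esub> cells.nexts X d \<cdot>\<^bsub>gcat\<^esub> cells.legs X d (Some c)) \<cdot>\<^bsub>gcat\<^esub> cells.nexts X c"
    unfolding stage_top_def stage_map_def using S S' l by simp
  then show "stage_top X d \<cdot>\<^bsub>gcat\<^esub> stage_map X c d = stage_top X c"
    unfolding t stage_top_def .
  show "cells.attach X d \<cdot>\<^bsub>gcat\<^esub> Ar C_functor (stage_map X c d) =
      cells.nexts X d \<cdot>\<^bsub>gcat\<^esub> cells.legs X d (Some c) \<cdot>\<^bsub>gcat\<^esub> cells.attach X c"
    using cells.stepD(11)[OF st[OF d] cd] by (simp only: stage_map_def)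
qed

text \<open>Smallness applied to the image of the chain in \<open>E\<close> with the first element
  dropped. The second part asks for a strictly later stage, because \<open>legs X m\<close> has a
  component at \<open>Some c\<close> only for \<open>c < m\<close>.\<close>

lemma chain_small:
  assumes i: "i \<in> Obj J"
  shows "g \<in> hom E (Dom E (Ob u i)) (Ob P (fst (cells.top_obj X))) \<Longrightarrow>
      \<exists>c \<in> Field \<kappa>. \<exists>w \<in> hom E (Dom E (Ob u i)) (Ob P (fst (Cod gcat (cells.nexts X c)))).
        pf (cells.tops X (Some c)) \<cdot>\<^bsub>E\<^esub> w = g"
    "c \<in> Field \<kappa> \<Longrightarrow> w \<in> hom E (Dom E (Ob u i)) (Ob P (fst (Cod gcat (cells.nexts X c)))) \<Longrightarrow>
      w' \<in> hom E (Dom E (Ob u i)) (Ob P (fst (Cod gcat (cells.nexts X c)))) \<Longrightarrow>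
      pf (cells.tops X (Some c)) \<cdot>\<^bsub>E\<^esub> w = pf (cells.tops X (Some c)) \<cdot>\<^bsub>E\<^esub> w' \<Longrightarrow>
      \<exists>m \<in> Field \<kappa>. c \<in> underS \<kappa> m \<and>
        pf (cells.legs X m (Some c)) \<cdot>\<^bsub>E\<^esub> w = pf (cells.legs X m (Some c)) \<cdot>\<^bsub>E\<^esub> w'"
proof -
  let ?b = "chain_diagram gcat X (cells.legs X) (cells.nexts X)"
  let ?B = "some_functor (PE \<circ>\<^sub>F ?b)"
  obtain k0 where k0: "k0 \<in> Field \<kappa>" using nonempty by blast
  have r: "Restr \<kappa> (Field \<kappa>) = \<kappa>" by (auto simp: Field_def)
  have b: "is_functor (poset_cat (one_plus \<kappa>)) (wide gcat (GM M)) ?b"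
    using cells.chain_diagram_functor[OF cells.cellularD(3)[OF cel] wide_GM[OF M_wide] cells.stepD(4)[OF st] cells.stepD(2)[OF st]]
    unfolding r .
  note b' = PE_functor[OF b]
  note B = some_functor_functor[OF b']
  have "is_colimit (poset_cat (one_plus \<kappa>)) E (PE \<circ>\<^sub>F ?b) (Ob PE (cells.top_obj X)) (\<lambda>k. Ar PE (cells.tops X k))"
    using cells.cellular_cells(2)[OF X] unfolding top_good_def by blast
  from E.some_colimit[OF wo k0 wide_functor[OF M_wide b'] this]
  have col: "is_colimit (poset_cat \<kappa>) E ?B (Ob PE (cells.top_obj X)) (\<lambda>k. Ar PE (cells.tops X (Some k)))" .
  then have co: "is_cocone (poset_cat \<kappa>) E ?B (Ob PE (cells.top_obj X)) (\<lambda>k. Ar PE (cells.tops X (Some k)))"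
    by (simp add: is_colimit_def)
  have s: "is_colimit (poset_cat \<kappa>) set_cat (hom_functor E (Dom E (Ob u i)) \<circ>\<^sub>F ?B)
      (Ob (hom_functor E (Dom E (Ob u i))) (Ob PE (cells.top_obj X)))
      (\<lambda>k. Ar (hom_functor E (Dom E (Ob u i))) (Ar PE (cells.tops X (Some k))))"
    using small[OF i] B col unfolding small_object_def by blast
  note sf = E.small_factor[OF wo wide_functor[OF M_wide B] co s] and se = E.small_eq[OF wo wide_functor[OF M_wide B] co s]
  show "\<exists>c \<in> Field \<kappa>. \<exists>w \<in> hom E (Dom E (Ob u i)) (Ob P (fst (Cod gcat (cells.nexts X c)))).
        pf (cells.tops X (Some c)) \<cdot>\<^bsub>E\<^esub> w = g"
    if "g \<in> hom E (Dom E (Ob u i)) (Ob P (fst (cells.top_obj X)))"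
    using sf[of g] that by simp
  assume c: "c \<in> Field \<kappa>" and w: "w \<in> hom E (Dom E (Ob u i)) (Ob P (fst (Cod gcat (cells.nexts X c))))"
      "w' \<in> hom E (Dom E (Ob u i)) (Ob P (fst (Cod gcat (cells.nexts X c))))"
    and eq: "pf (cells.tops X (Some c)) \<cdot>\<^bsub>E\<^esub> w = pf (cells.tops X (Some c)) \<cdot>\<^bsub>E\<^esub> w'"
  obtain m where m: "(c, m) \<in> \<kappa>" "Ar ?B (c, m) \<cdot>\<^bsub>E\<^esub> w = Ar ?B (c, m) \<cdot>\<^bsub>E\<^esub> w'"
    using se[OF c, of w w'] w eq by auto
  have mF: "m \<in> Field \<kappa>" using m(1) by (rule FieldI2)
  \<comment> \<open>The stage \<open>m\<close> may be \<open>c\<close> itself;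
    \<open>\<kappa>\<close> is a limit ordinal, so a strictly later one exists.\<close>
  obtain n where n: "n \<in> Field \<kappa>" "m \<in> underS \<kappa> n" using above_ex[OF mF mF] by blast
  have cn: "c \<in> underS \<kappa> n"
    using m(1) n(2) cells.lt_trans[of c m n] by (cases "c = m") (auto simp: underS_def)
  note S = stage_simps[OF c] and Sm = stage_simps[OF mF] and L = stage_map_simps[OF n(1) n(2)] and Lc = stage_map_simps[OF n(1) cn]
  have "pf (cells.legs X n (Some c)) = pf (cells.legs X n (Some m)) \<cdot>\<^bsub>E\<^esub> Ar ?B (c, m)"
  proof (cases "c = m")
    case True
    have "Cod gcat (cells.nexts X m) \<in> Obj gcat" using Sm(2) by (rule G.obj_simps)
    from Obj_gcatD(1)[OF this] show ?thesis using True L(7-9) pf_simps[OF L(7)] by simp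
  next
    case False
    then have cm: "c \<in> underS \<kappa> m" using m(1) by (simp add: underS_def)
    note Lm = stage_map_simps[OF mF cm]
    have "cells.legs X n (Some c) = cells.legs X n (Some m) \<cdot>\<^bsub>gcat\<^esub> (cells.nexts X m \<cdot>\<^bsub>gcat\<^esub> cells.legs X m (Some c))"
      using ch(9)[OF n(1) n(2) cm] by simp
    moreover have "Ar ?B (c, m) = pf (cells.nexts X m \<cdot>\<^bsub>gcat\<^esub> cells.legs X m (Some c))"
      using False by simp
    ultimately show ?thesis
      using pf_cmp[of "cells.nexts X m \<cdot>\<^bsub>gcat\<^esub> cells.legs X m (Some c)" "cells.legs X n (Some m)"] L(7-9) Sm Lm(7-9) by simp
  qed
  moreover have "Ar ?B (c, m) \<in> hom E (Ob ?B c) (Ob ?B m)"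
    using functorD(2-4)[OF wide_functor[OF M_wide B], of "(c, m)"] m(1) by simp
  ultimately have "pf (cells.legs X n (Some c)) \<cdot>\<^bsub>E\<^esub> w = pf (cells.legs X n (Some c)) \<cdot>\<^bsub>E\<^esub> w'"
    using m(2) w L(7-9) by simp
  then show "\<exists>m \<in> Field \<kappa>. c \<in> underS \<kappa> m \<and> pf (cells.legs X m (Some c)) \<cdot>\<^bsub>E\<^esub> w = pf (cells.legs X m (Some c)) \<cdot>\<^bsub>E\<^esub> w'"
    using n(1) cn by blast
qed

end

end

section \<open>The lifting structure on the colimit\<close>

context ext_setting
begin

text \<open>By smallness every lifting problem against the last map factors through some stage; the cell attached
  at that stage contains a filler.\<close>

definition rep where
  "rep X i s c g \<longleftrightarrow> c \<in> Field \<kappa> \<and> g \<in> hom E (Dom E (Ob u i)) (Ob P (fst (stage X c))) \<and>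
     pf (stage_top X c) \<cdot>\<^bsub>E\<^esub> g = upper s"

definition rep_square where "rep_square X i s c g = Square (Ob u i) g (lower s) (snd (stage X c))"

text \<open>The coprojection at \<open>rep_square\<close> solves the problem inside the codomain of
  the cell; the attaching map and a leg of the colimit carry the solution to the last
  object.\<close>

definition rep_lift where
  "rep_lift X i s c g =
     pf (cells.tops X (Some c)) \<cdot>\<^bsub>E\<^esub> pf (cells.attach X c) \<cdot>\<^bsub>E\<^esub> lower (coproj i (rep_square X i s c g))"

context
  fixes X i s
  assumes X: "X \<in> Obj gcat" and i: "i \<in> Obj J" and s: "s \<in> Arr (arrow_cat E)"
    and sd: "sdom s = Ob u i" and sc: "scod s = top_map_to X"
begin

lemma problem_simps:
  shows "upper s \<in> hom E (Dom E (Ob u i)) (Ob P (fst (cells.top_obj X)))"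
    "lower s \<in> hom E (Cod E (Ob u i)) (Cod E (top_map_to X))"
    "lower s \<cdot>\<^bsub>E\<^esub> Ob u i = top_map_to X \<cdot>\<^bsub>E\<^esub> upper s"
    "cells.top_obj X \<in> Obj gcat"
proof -
  show o: "cells.top_obj X \<in> Obj gcat" using cells.unit_simps(3)[OF X] .
  show "upper s \<in> hom E (Dom E (Ob u i)) (Ob P (fst (cells.top_obj X)))"
    "lower s \<in> hom E (Cod E (Ob u i)) (Cod E (top_map_to X))"
    "lower s \<cdot>\<^bsub>E\<^esub> Ob u i = top_map_to X \<cdot>\<^bsub>E\<^esub> upper s"
    using arrow_simps[OF s] Obj_gcatD[OF o] by (simp_all add: sd sc)
qed

lemma rep_ex: "\<exists>c g. rep X i s c g"
proof -
  obtain c w where c: "c \<in> Field \<kappa>" and w: "w \<in> hom E (Dom E (Ob u i)) (Ob P (fst (Cod gcat (cells.nexts X c))))"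
    and e: "pf (cells.tops X (Some c)) \<cdot>\<^bsub>E\<^esub> w = upper s"
    using chain_small(1)[OF X i problem_simps(1)] by blast
  \<comment> \<open>Smallness factors the problem through the object after attaching at
    \<open>c\<close>, while a representative has to lie in an object before attaching; hence a later
    stage.\<close>
  obtain d where d: "d \<in> Field \<kappa>" "c \<in> underS \<kappa> d" using above_ex[OF c c] by blast
  note S = stage_simps[OF X c] and S' = stage_simps[OF X d(1)] and L = stage_map_simps[OF X d]
  have "pf (cells.tops X (Some c)) = pf (stage_top X d) \<cdot>\<^bsub>E\<^esub> pf (cells.legs X d (Some c))"
  proof -
    have "stage_top X d \<cdot>\<^bsub>gcat\<^esub> cells.legs X d (Some c) = cells.tops X (Some c)"
      unfolding L(10)[symmetric] stage_top_def using S' L(7-9) by simp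
    then show ?thesis using pf_cmp[of "cells.legs X d (Some c)" "stage_top X d"] S' L(7-9) by simp
  qed
  then have "pf (stage_top X d) \<cdot>\<^bsub>E\<^esub> (pf (cells.legs X d (Some c)) \<cdot>\<^bsub>E\<^esub> w) = upper s"
    using e w S' L(7-9) by simp
  then have "rep X i s d (pf (cells.legs X d (Some c)) \<cdot>\<^bsub>E\<^esub> w)"
    using d w L(7-9) by (simp add: rep_def)
  then show ?thesis by blast
qed

lemma rep_square_simps:
  assumes r: "rep X i s c g"
  shows "rep_square X i s c g \<in> Arr (arrow_cat E)" "sdom (rep_square X i s c g) = Ob u i"
    "scod (rep_square X i s c g) = snd (stage X c)"
    "upper (rep_square X i s c g) = g" "lower (rep_square X i s c g) = lower s"
proof -
  have c: "c \<in> Field \<kappa>" and g: "g \<in> hom E (Dom E (Ob u i)) (Ob P (fst (stage X c)))"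
    and e: "pf (stage_top X c) \<cdot>\<^bsub>E\<^esub> g = upper s"
    using r by (auto simp: rep_def)
  note S = stage_simps[OF X c] and V = stage_over[OF X c] and p = problem_simps
  note o = Obj_gcatD[OF S(4)] and t = Obj_gcatD[OF p(4)]
  have "lower s \<cdot>\<^bsub>E\<^esub> Ob u i = top_map_to X \<cdot>\<^bsub>E\<^esub> (pf (stage_top X c) \<cdot>\<^bsub>E\<^esub> g)" using p(3) e by simp
  also have "\<dots> = snd (stage X c) \<cdot>\<^bsub>E\<^esub> g"
    by (rule E.cmp_eq_cmp[OF V(2)]) (use S t g in simp_all)
  finally show "rep_square X i s c g \<in> Arr (arrow_cat E)"
    using p(1,2) g o V(3) i by (simp add: rep_square_def Arr_arrow_cat)
qed (simp_all add: rep_square_def)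

lemma coproj_rep_simps:
  assumes r: "rep X i s c g"
  defines "a \<equiv> coproj i (rep_square X i s c g)"
  shows "upper a \<in> hom E (Dom E (Ob u i)) (Dom E (Ob D (snd (stage X c))))"
    "lower a \<in> hom E (Cod E (Ob u i)) (Cod E (Ob D (snd (stage X c))))"
    "lower a \<cdot>\<^bsub>E\<^esub> Ob u i = Ob D (snd (stage X c)) \<cdot>\<^bsub>E\<^esub> upper a"
    "upper (eps (snd (stage X c))) \<cdot>\<^bsub>E\<^esub> upper a = g"
    "lower (eps (snd (stage X c))) \<cdot>\<^bsub>E\<^esub> lower a = lower s"
proof -
  note R = rep_square_simps[OF r]
  have c: "c \<in> Field \<kappa>" using r by (simp add: rep_def)
  note I = coproj_hom[OF i R(1,2), folded a_def]
  show "upper a \<in> hom E (Dom E (Ob u i)) (Dom E (Ob D (snd (stage X c))))"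
    "lower a \<in> hom E (Cod E (Ob u i)) (Cod E (Ob D (snd (stage X c))))"
    "lower a \<cdot>\<^bsub>E\<^esub> Ob u i = Ob D (snd (stage X c)) \<cdot>\<^bsub>E\<^esub> upper a"
    using arrow_simps[OF I(1)] I(2,3) R(3) by simp_all
  have "eps (snd (stage X c)) \<cdot>\<^bsub>arrow_cat E\<^esub> a = rep_square X i s c g"
    unfolding a_def by (rule eps_coproj[OF _ i R(1-3)]) (use Obj_gcatD(2)[OF stage_simps(4)[OF X c]] in simp)
  from arg_cong[OF this, of upper] arg_cong[OF this, of lower]
  show "upper (eps (snd (stage X c))) \<cdot>\<^bsub>E\<^esub> upper a = g" "lower (eps (snd (stage X c))) \<cdot>\<^bsub>E\<^esub> lower a = lower s"
    using R by simp_all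
qed

text \<open>The upper triangle is the attaching equation \<open>attach_e\<close>, the lower one the
  last equation of \<open>stage_over\<close>; in both, the counit undoes the coprojection.\<close>

lemma rep_lift_simps:
  assumes r: "rep X i s c g"
  shows "rep_lift X i s c g \<in> hom E (Cod E (Ob u i)) (Ob P (fst (cells.top_obj X)))"
    "rep_lift X i s c g \<cdot>\<^bsub>E\<^esub> Ob u i = upper s"
    "top_map_to X \<cdot>\<^bsub>E\<^esub> rep_lift X i s c g = lower s"
proof -
  have c: "c \<in> Field \<kappa>" and g: "g \<in> hom E (Dom E (Ob u i)) (Ob P (fst (stage X c)))"
    and e: "pf (stage_top X c) \<cdot>\<^bsub>E\<^esub> g = upper s"
    using r by (auto simp: rep_def)
  note S = stage_simps[OF X c] and V = stage_over[OF X c] and p = problem_simps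
  note o = Obj_gcatD[OF S(4)] and t = Obj_gcatD[OF p(4)]
  note I = coproj_rep_simps[OF r]
  let ?a = "coproj i (rep_square X i s c g)" and ?t = "pf (cells.tops X (Some c))" and ?\<alpha> = "pf (cells.attach X c)"
    and ?n = "pf (cells.nexts X c)" and ?p = "snd (stage X c)"
  have cC: "Ob P (fst (C_obj (stage X c))) = Cod E (Ob D ?p)"
    using a_lift_simps(5)[OF S(4)] by (simp add: C_obj_def)
  have tA: "?t \<in> Arr E" "Dom E ?t = Ob P (fst (Cod gcat (cells.nexts X c)))" "Cod E ?t = Ob P (fst (cells.top_obj X))"
    and \<alpha>A: "?\<alpha> \<in> Arr E" "Dom E ?\<alpha> = Cod E (Ob D ?p)" "Cod E ?\<alpha> = Ob P (fst (Cod gcat (cells.nexts X c)))"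
    and nA: "?n \<in> Arr E" "Dom E ?n = Ob P (fst (stage X c))" "Cod E ?n = Ob P (fst (Cod gcat (cells.nexts X c)))"
    using S cC by simp_all
  have DA: "Ob D ?p \<in> Arr E" using o by simp
  show "rep_lift X i s c g \<in> hom E (Cod E (Ob u i)) (Ob P (fst (cells.top_obj X)))"
    using tA \<alpha>A I(2) by (simp add: rep_lift_def)
  have aD: "?\<alpha> \<cdot>\<^bsub>E\<^esub> Ob D ?p = ?n \<cdot>\<^bsub>E\<^esub> upper (eps ?p)"
  proof -
    have aA: "a_trans (stage X c) \<in> Arr gcat" "e_trans (stage X c) \<in> Arr gcat"
      using cells.a_simps(1)[OF S(4)] cells.e_simps(1)[OF S(4)] .
    have "pf (cells.attach X c \<cdot>\<^bsub>gcat\<^esub> a_trans (stage X c)) = pf (cells.nexts X c \<cdot>\<^bsub>gcat\<^esub> e_trans (stage X c))"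
      using attach_e[OF X c] by simp
    moreover have "pf (cells.attach X c \<cdot>\<^bsub>gcat\<^esub> a_trans (stage X c)) = ?\<alpha> \<cdot>\<^bsub>E\<^esub> pf (a_trans (stage X c))"
      by (rule pf_cmp) (use aA S in simp_all)
    moreover have "pf (cells.nexts X c \<cdot>\<^bsub>gcat\<^esub> e_trans (stage X c)) = ?n \<cdot>\<^bsub>E\<^esub> pf (e_trans (stage X c))"
      by (rule pf_cmp) (use aA S in simp_all)
    ultimately show ?thesis
      using a_lift_simps(3)[OF S(4)] e_lift_simps(4)[OF S(4)] by simp
  qed
  have "rep_lift X i s c g \<cdot>\<^bsub>E\<^esub> Ob u i = ?t \<cdot>\<^bsub>E\<^esub> ?\<alpha> \<cdot>\<^bsub>E\<^esub> (lower ?a \<cdot>\<^bsub>E\<^esub> Ob u i)"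
    using tA \<alpha>A I(1,2) i by (simp add: rep_lift_def)
  also have "\<dots> = ?t \<cdot>\<^bsub>E\<^esub> (?\<alpha> \<cdot>\<^bsub>E\<^esub> Ob D ?p) \<cdot>\<^bsub>E\<^esub> upper ?a"
    unfolding I(3) using tA \<alpha>A I(1,2) DA by simp
  also have "\<dots> = ?t \<cdot>\<^bsub>E\<^esub> ?n \<cdot>\<^bsub>E\<^esub> (upper (eps ?p) \<cdot>\<^bsub>E\<^esub> upper ?a)"
    unfolding aD using tA nA I(1,2) eps_arrow(1-3)[OF S(4)] o by simp
  also have "\<dots> = (?t \<cdot>\<^bsub>E\<^esub> ?n) \<cdot>\<^bsub>E\<^esub> g"
    unfolding I(4) using tA nA g by simp
  also have "?t \<cdot>\<^bsub>E\<^esub> ?n = pf (stage_top X c)"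
    unfolding stage_top_def by (rule pf_cmp[symmetric]) (use S in simp_all)
  finally show "rep_lift X i s c g \<cdot>\<^bsub>E\<^esub> Ob u i = upper s" using e by simp
  have "top_map_to X \<cdot>\<^bsub>E\<^esub> rep_lift X i s c g = (top_map_to X \<cdot>\<^bsub>E\<^esub> ?t \<cdot>\<^bsub>E\<^esub> ?\<alpha>) \<cdot>\<^bsub>E\<^esub> lower ?a"
    using tA \<alpha>A I(1,2) t by (simp add: rep_lift_def)
  then show "top_map_to X \<cdot>\<^bsub>E\<^esub> rep_lift X i s c g = lower s"
    unfolding V(4) I(5) .
qed

text \<open>The point of attaching along gap maps: the cell at \<open>d\<close> restricts to the
  cell already attached at \<open>c\<close>, so the filler does not change at a later stage.
  Independent cells would give two unrelated fillers.\<close>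

lemma rep_up:
  assumes r: "rep X i s c g" and d: "d \<in> Field \<kappa>" "c \<in> underS \<kappa> d"
  shows "rep X i s d (pf (stage_map X c d) \<cdot>\<^bsub>E\<^esub> g)"
    "rep_lift X i s d (pf (stage_map X c d) \<cdot>\<^bsub>E\<^esub> g) = rep_lift X i s c g"
proof -
  have c: "c \<in> Field \<kappa>" and g: "g \<in> hom E (Dom E (Ob u i)) (Ob P (fst (stage X c)))"
    and e: "pf (stage_top X c) \<cdot>\<^bsub>E\<^esub> g = upper s"
    using r by (auto simp: rep_def)
  note S = stage_simps[OF X c] and S' = stage_simps[OF X d(1)] and L = stage_map_simps[OF X d]
  note R = rep_square_simps[OF r] and I = coproj_rep_simps[OF r] and p = problem_simps
  let ?y = "stage_map X c d"
  have y: "pf (stage_top X c) = pf (stage_top X d) \<cdot>\<^bsub>E\<^esub> pf ?y"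
    using pf_cmp[of ?y "stage_top X d"] L S' by simp
  show r': "rep X i s d (pf ?y \<cdot>\<^bsub>E\<^esub> g)"
    using e g L S' d unfolding y by (simp add: rep_def)
  note Sq = sq_arrow[OF L(1)]
  have "rep_square X i s d (pf ?y \<cdot>\<^bsub>E\<^esub> g) = sq ?y \<cdot>\<^bsub>arrow_cat E\<^esub> rep_square X i s c g"
    using R L Sq stage_over(3)[OF X c] p(2) by (simp add: rep_square_def)
  then have "coproj i (rep_square X i s d (pf ?y \<cdot>\<^bsub>E\<^esub> g)) = Ar D (sq ?y) \<cdot>\<^bsub>arrow_cat E\<^esub> coproj i (rep_square X i s c g)"
    using coproj_D[OF i R(1,2) Sq(1)] Sq(2) R(3) L(2) by simp
  then have lo: "lower (coproj i (rep_square X i s d (pf ?y \<cdot>\<^bsub>E\<^esub> g))) =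
      lower (Ar D (sq ?y)) \<cdot>\<^bsub>E\<^esub> lower (coproj i (rep_square X i s c g))"
    by simp
  let ?a = "lower (coproj i (rep_square X i s c g))"
  have FC: "Ar C_functor ?y \<in> Arr gcat" by (rule A_C_Arr[OF L(1)])
  have pC: "pf (Ar C_functor ?y) = lower (Ar D (sq ?y))" using C_part_simps(4)[OF L(1)] by simp
  have cC: "Ob P (fst (C_obj (stage X c))) = Cod E (Ob D (snd (stage X c)))"
    "Ob P (fst (C_obj (stage X d))) = Cod E (Ob D (snd (stage X d)))"
    using a_lift_simps(5)[OF S(4)] a_lift_simps(5)[OF S'(4)] by (simp_all add: C_obj_def)
  have 1: "pf (cells.attach X d) \<cdot>\<^bsub>E\<^esub> lower (Ar D (sq ?y)) =
      pf (cells.nexts X d) \<cdot>\<^bsub>E\<^esub> pf (cells.legs X d (Some c)) \<cdot>\<^bsub>E\<^esub> pf (cells.attach X c)"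
  proof -
    have "pf (cells.attach X d) \<cdot>\<^bsub>E\<^esub> pf (Ar C_functor ?y) = pf (cells.attach X d \<cdot>\<^bsub>gcat\<^esub> Ar C_functor ?y)"
      by (rule pf_cmp[symmetric]) (use FC S' L in simp_all)
    also have "\<dots> = pf (cells.nexts X d) \<cdot>\<^bsub>E\<^esub> pf (cells.legs X d (Some c)) \<cdot>\<^bsub>E\<^esub> pf (cells.attach X c)"
      unfolding L(6) using pf_cmp[of "cells.attach X c" "cells.legs X d (Some c)"]
        pf_cmp[of "cells.legs X d (Some c) \<cdot>\<^bsub>gcat\<^esub> cells.attach X c" "cells.nexts X d"] S S' L(7-9) by simp
    finally show ?thesis unfolding pC .
  qed
  have 2: "pf (cells.tops X (Some d)) \<cdot>\<^bsub>E\<^esub> pf (cells.nexts X d) \<cdot>\<^bsub>E\<^esub> pf (cells.legs X d (Some c)) = pf (cells.tops X (Some c))"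
    using pf_cmp[of "cells.legs X d (Some c)" "cells.nexts X d"]
      pf_cmp[of "cells.nexts X d \<cdot>\<^bsub>gcat\<^esub> cells.legs X d (Some c)" "cells.tops X (Some d)"] S' L(7-10) by simp
  have tA: "pf (cells.tops X (Some d)) \<in> Arr E" "Dom E (pf (cells.tops X (Some d))) = Ob P (fst (Cod gcat (cells.nexts X d)))"
    "pf (cells.attach X d) \<in> Arr E" "Dom E (pf (cells.attach X d)) = Cod E (Ob D (snd (stage X d)))"
    "Cod E (pf (cells.attach X d)) = Ob P (fst (Cod gcat (cells.nexts X d)))"
    "pf (cells.attach X c) \<in> Arr E" "Dom E (pf (cells.attach X c)) = Cod E (Ob D (snd (stage X c)))"
    "Cod E (pf (cells.attach X c)) = Ob P (fst (Cod gcat (cells.nexts X c)))"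
    "pf (cells.nexts X d) \<in> Arr E" "Dom E (pf (cells.nexts X d)) = Ob P (fst (stage X d))"
    "Cod E (pf (cells.nexts X d)) = Ob P (fst (Cod gcat (cells.nexts X d)))"
    "pf (cells.legs X d (Some c)) \<in> Arr E" "Dom E (pf (cells.legs X d (Some c))) = Ob P (fst (Cod gcat (cells.nexts X c)))"
    "Cod E (pf (cells.legs X d (Some c))) = Ob P (fst (stage X d))"
    using S S' L(7-9) cC by simp_all
  note Dl = D_sq(4-6)[OF L(1), unfolded L(2,3)]
  have "rep_lift X i s d (pf ?y \<cdot>\<^bsub>E\<^esub> g) = pf (cells.tops X (Some d)) \<cdot>\<^bsub>E\<^esub> (pf (cells.attach X d) \<cdot>\<^bsub>E\<^esub> lower (Ar D (sq ?y))) \<cdot>\<^bsub>E\<^esub> ?a"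
    unfolding rep_lift_def lo using tA Dl I(2) by simp
  also have "\<dots> = (pf (cells.tops X (Some d)) \<cdot>\<^bsub>E\<^esub> pf (cells.nexts X d) \<cdot>\<^bsub>E\<^esub> pf (cells.legs X d (Some c))) \<cdot>\<^bsub>E\<^esub> pf (cells.attach X c) \<cdot>\<^bsub>E\<^esub> ?a"
    unfolding 1 using tA Dl I(2) by simp
  finally show "rep_lift X i s d (pf ?y \<cdot>\<^bsub>E\<^esub> g) = rep_lift X i s c g"
    unfolding 2 rep_lift_def .
qed

text \<open>The two representatives have the same image in the last object, so by smallness they
  become equal at a later stage, where \<open>rep_up\<close> compares the fillers.\<close>

lemma rep_lift_same_stage:
  assumes r: "rep X i s c g" and r': "rep X i s c g'"
  shows "rep_lift X i s c g = rep_lift X i s c g'"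
proof -
  have c: "c \<in> Field \<kappa>" and g: "g \<in> hom E (Dom E (Ob u i)) (Ob P (fst (stage X c)))"
    "g' \<in> hom E (Dom E (Ob u i)) (Ob P (fst (stage X c)))"
    and e: "pf (stage_top X c) \<cdot>\<^bsub>E\<^esub> g = upper s" "pf (stage_top X c) \<cdot>\<^bsub>E\<^esub> g' = upper s"
    using r r' by (auto simp: rep_def)
  note S = stage_simps[OF X c]
  let ?n = "pf (cells.nexts X c)"
  have t: "pf (stage_top X c) = pf (cells.tops X (Some c)) \<cdot>\<^bsub>E\<^esub> ?n"
    unfolding stage_top_def by (rule pf_cmp) (use S in simp_all)
  have "pf (cells.tops X (Some c)) \<cdot>\<^bsub>E\<^esub> ?n \<cdot>\<^bsub>E\<^esub> g = pf (cells.tops X (Some c)) \<cdot>\<^bsub>E\<^esub> ?n \<cdot>\<^bsub>E\<^esub> g'"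
    using e g S unfolding t by simp
  then obtain m where m: "m \<in> Field \<kappa>" "c \<in> underS \<kappa> m"
    and eq: "pf (cells.legs X m (Some c)) \<cdot>\<^bsub>E\<^esub> ?n \<cdot>\<^bsub>E\<^esub> g = pf (cells.legs X m (Some c)) \<cdot>\<^bsub>E\<^esub> ?n \<cdot>\<^bsub>E\<^esub> g'"
    using chain_small(2)[OF X i c, of "?n \<cdot>\<^bsub>E\<^esub> g" "?n \<cdot>\<^bsub>E\<^esub> g'"] g S by auto
  note L = stage_map_simps[OF X m]
  have "pf (stage_map X c m) = pf (cells.legs X m (Some c)) \<cdot>\<^bsub>E\<^esub> ?n"
    unfolding stage_map_def by (rule pf_cmp) (use S L in simp_all)
  then have "pf (stage_map X c m) \<cdot>\<^bsub>E\<^esub> g = pf (stage_map X c m) \<cdot>\<^bsub>E\<^esub> g'"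
    using eq g S L(7-9) by simp
  then show ?thesis using rep_up(2)[OF r m] rep_up(2)[OF r' m] by simp
qed

lemma rep_lift_unique:
  assumes r: "rep X i s c g" and r': "rep X i s c' g'"
  shows "rep_lift X i s c g = rep_lift X i s c' g'"
proof -
  have "c \<in> Field \<kappa>" "c' \<in> Field \<kappa>" using r r' by (auto simp: rep_def)
  then obtain m where m: "m \<in> Field \<kappa>" "c \<in> underS \<kappa> m" "c' \<in> underS \<kappa> m" by (rule above_ex)
  show ?thesis
    using rep_up(2)[OF r m(1,2)] rep_up(2)[OF r' m(1,3)]
      rep_lift_same_stage[OF rep_up(1)[OF r m(1,2)] rep_up(1)[OF r' m(1,3)]] by simp
qed

end

text \<open>Neither the stage nor the factorization is canonical; by \<open>rep_lift_unique\<close>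
  the chosen value is the same for all representatives.\<close>

definition lift_of where
  "lift_of X i s = (SOME h. \<exists>c g. rep X i s c g \<and> h = rep_lift X i s c g)"

lemma lift_of_eq:
  assumes "X \<in> Obj gcat" "i \<in> Obj J" "s \<in> Arr (arrow_cat E)" "sdom s = Ob u i" "scod s = top_map_to X"
    and r: "rep X i s c g"
  shows "lift_of X i s = rep_lift X i s c g"
proof -
  have "\<exists>h. \<exists>c g. rep X i s c g \<and> h = rep_lift X i s c g" using r by blast
  from someI_ex[OF this] obtain c' g' where r': "rep X i s c' g'"
    and l: "lift_of X i s = rep_lift X i s c' g'"
    unfolding lift_of_def[symmetric] by blast
  show ?thesis unfolding l by (rule rep_lift_unique[OF assms(1-5) r' r])
qed

definition lift_struct where
  "lift_struct X = (top_map_to X, \<lambda>(i, s) \<in> lifting_problems E J u (top_map_to X). lift_of X i s)"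

lemma lifting_problems_iff: "(i, s) \<in> lifting_problems E J u f \<longleftrightarrow>
    i \<in> Obj J \<and> s \<in> Arr (arrow_cat E) \<and> sdom s = Ob u i \<and> scod s = f"
  by (simp add: lifting_problems_def)

lemma lift_struct_in:
  assumes X: "X \<in> Obj gcat"
  shows "lift_struct X \<in> lift_structs E J u"
proof -
  have top: "top_map_to X \<in> Arr E" "Dom E (top_map_to X) = Ob P (fst (cells.top_obj X))"
    using Obj_gcatD[OF cells.unit_simps(3)[OF X]] by auto
  let ?\<psi> = "snd (lift_struct X)"
  have val: "?\<psi> (i, s) = lift_of X i s" if "(i, s) \<in> lifting_problems E J u (top_map_to X)" for i s
    using that by (simp add: lift_struct_def)
  have 1: "?\<psi> (i, s) \<in> hom E (Cod E (Ob u i)) (Dom E (top_map_to X)) \<and> ?\<psi> (i, s) \<cdot>\<^bsub>E\<^esub> Ob u i = upper s \<and>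
      top_map_to X \<cdot>\<^bsub>E\<^esub> ?\<psi> (i, s) = lower s" if pr: "(i, s) \<in> lifting_problems E J u (top_map_to X)" for i s
  proof -
    have s: "i \<in> Obj J" "s \<in> Arr (arrow_cat E)" "sdom s = Ob u i" "scod s = top_map_to X"
      using pr by (auto simp: lifting_problems_iff)
    obtain c g where r: "rep X i s c g" using rep_ex[OF X s] by blast
    show ?thesis
      using rep_lift_simps[OF X s r] top unfolding val[OF pr] lift_of_eq[OF X s r] by simp
  qed
  have 2: "?\<psi> (Dom J t, \<alpha> \<cdot>\<^bsub>arrow_cat E\<^esub> Ar u t) = ?\<psi> (Cod J t, \<alpha>) \<cdot>\<^bsub>E\<^esub> lower (Ar u t)"
    if t: "t \<in> Arr J" and a: "\<alpha> \<in> hom (arrow_cat E) (Ob u (Cod J t)) (top_map_to X)" for t \<alpha>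
  proof -
    let ?s = "\<alpha> \<cdot>\<^bsub>arrow_cat E\<^esub> Ar u t"
    have A: "Cod J t \<in> Obj J" "\<alpha> \<in> Arr (arrow_cat E)" "sdom \<alpha> = Ob u (Cod J t)" "scod \<alpha> = top_map_to X"
      using a t by auto
    have S: "Dom J t \<in> Obj J" "?s \<in> Arr (arrow_cat E)" "sdom ?s = Ob u (Dom J t)" "scod ?s = top_map_to X"
      using AE.cmp_simps[of "Ar u t" \<alpha>] A t by (simp_all del: arrow_cat_simps(5))
    note U = arrow_simps[OF u_simps(2)[OF t]]
    obtain c g where r: "rep X (Cod J t) \<alpha> c g" using rep_ex[OF X A] by blast
    have c: "c \<in> Field \<kappa>" and g: "g \<in> hom E (Dom E (Ob u (Cod J t))) (Ob P (fst (stage X c)))"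
      and e: "pf (stage_top X c) \<cdot>\<^bsub>E\<^esub> g = upper \<alpha>"
      using r by (auto simp: rep_def)
    note St = stage_simps[OF X c]
    \<comment> \<open>A representative for \<open>Cod J t\<close> restricts along
      \<open>Ar u t\<close> to one for \<open>Dom J t\<close> at the same stage, and coprojections
      are compatible with this restriction.\<close>
    let ?g = "g \<cdot>\<^bsub>E\<^esub> upper (Ar u t)"
    have "pf (stage_top X c) \<cdot>\<^bsub>E\<^esub> ?g = upper \<alpha> \<cdot>\<^bsub>E\<^esub> upper (Ar u t)"
      by (rule E.cmp_eq_cmp[OF e]) (use g U t St in simp_all)
    then have r': "rep X (Dom J t) ?s c ?g"
      using c g U t by (simp add: rep_def)
    have "rep_square X (Dom J t) ?s c ?g = rep_square X (Cod J t) \<alpha> c g \<cdot>\<^bsub>arrow_cat E\<^esub> Ar u t"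
      using t by (simp add: rep_square_def)
    then have "coproj (Dom J t) (rep_square X (Dom J t) ?s c ?g) =
        coproj (Cod J t) (rep_square X (Cod J t) \<alpha> c g) \<cdot>\<^bsub>arrow_cat E\<^esub> Ar u t"
      using coproj_u[OF t rep_square_simps(1,2)[OF X A r]] by simp
    then have lo: "lower (coproj (Dom J t) (rep_square X (Dom J t) ?s c ?g)) =
        lower (coproj (Cod J t) (rep_square X (Cod J t) \<alpha> c g)) \<cdot>\<^bsub>E\<^esub> lower (Ar u t)"
      by simp
    have cC: "Ob P (fst (C_obj (stage X c))) = Cod E (Ob D (snd (stage X c)))"
      using a_lift_simps(5)[OF St(4)] by (simp add: C_obj_def)
    have "rep_lift X (Dom J t) ?s c ?g = rep_lift X (Cod J t) \<alpha> c g \<cdot>\<^bsub>E\<^esub> lower (Ar u t)"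
      unfolding rep_lift_def lo using St cC coproj_rep_simps(2)[OF X A r] U t by simp
    moreover have "(Dom J t, ?s) \<in> lifting_problems E J u (top_map_to X)" "(Cod J t, \<alpha>) \<in> lifting_problems E J u (top_map_to X)"
      using S A unfolding lifting_problems_iff by auto
    ultimately show ?thesis
      using val lift_of_eq[OF X S r'] lift_of_eq[OF X A r] by simp
  qed
  have "snd (lift_struct X) \<in> extensional (lifting_problems E J u (top_map_to X))"
    by (simp add: lift_struct_def)
  then show ?thesis
    unfolding lift_structs_def
    using top(1) 1 2 by (auto simp: lift_struct_def simp del: arrow_cat_simps(5))
qed

text \<open>The map of chains behind \<open>top_map\<close> takes a representative at stage
  \<open>c\<close> to one at the same stage by \<open>v c\<close>, and its compatibility with the
  attaching maps takes filler to filler. As fillers do not depend on representatives, one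
  representative suffices.\<close>

lemma top_map_respects:
  assumes x: "x \<in> Arr gcat"
  shows "epart (cells.top_map x) = epart x"
    "\<And>i s. (i, s) \<in> lifting_problems E J u (top_map_to (Dom gcat x)) \<Longrightarrow>
      snd (lift_struct (Cod gcat x)) (i, sq (cells.top_map x) \<cdot>\<^bsub>arrow_cat E\<^esub> s) =
      pf (cells.top_map x) \<cdot>\<^bsub>E\<^esub> snd (lift_struct (Dom gcat x)) (i, s)"
proof -
  let ?X = "Dom gcat x" and ?X' = "Cod gcat x" and ?w = "cells.top_map x"
  have X: "?X \<in> Obj gcat" and X': "?X' \<in> Obj gcat" using x by auto
  note W = cells.top_map_simps[OF x]
  obtain v z where m: "cells.cells_map ?X ?X' x v z ?w" using cells.top_map[OF x] by blast
  note mm = cells.cell_mapD[OF cells.cellular_cells(1)[OF X] cells.cellular_cells(1)[OF X'] m]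
  note cel = cells.cellular_cells(1)[OF X] and cel' = cells.cellular_cells(1)[OF X']
  note G = Arr_gcatD[OF x]
  have eN: "epart (cells.tops ?X None) = Idt E (Cod E (snd ?X))" "epart (cells.tops ?X' None) = Idt E (Cod E (snd ?X'))"
    using epart_tops[OF X, of None] epart_tops[OF X', of None] cells.unit_simps(2)[OF X] cells.unit_simps(2)[OF X'] by simp_all
  have tN: "cells.tops ?X None \<in> Arr gcat" using cells.unit_simps(1)[OF X] .
  have dW: "Dom E (epart ?w) = Cod E (snd ?X)"
    using snd_pf[OF tN] eN(1) cells.unit_simps(2)[OF X] Arr_gcatD(5)[OF W(1)] W(2) by simp
  have "epart ?w \<cdot>\<^bsub>E\<^esub> Idt E (Cod E (snd ?X)) = Idt E (Cod E (snd ?X')) \<cdot>\<^bsub>E\<^esub> epart x"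
    using arg_cong[OF W(4), of epart] eN by simp
  then show ex: "epart ?w = epart x"
    using Arr_gcatD(4)[OF W(1)] dW G(4-6) by simp
  fix i s assume pr: "(i, s) \<in> lifting_problems E J u (top_map_to ?X)"
  have s: "i \<in> Obj J" "s \<in> Arr (arrow_cat E)" "sdom s = Ob u i" "scod s = top_map_to ?X"
    using pr by (auto simp: lifting_problems_iff)
  let ?s = "sq ?w \<cdot>\<^bsub>arrow_cat E\<^esub> s"
  note Sq = sq_arrow[OF W(1)]
  have s': "i \<in> Obj J" "?s \<in> Arr (arrow_cat E)" "sdom ?s = Ob u i" "scod ?s = top_map_to ?X'"
    using AE.cmp_simps[of s "sq ?w"] s Sq W by (simp_all del: arrow_cat_simps(5))
  obtain c g where r: "rep ?X i s c g" using rep_ex[OF X s] by blast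
  have c: "c \<in> Field \<kappa>" and g: "g \<in> hom E (Dom E (Ob u i)) (Ob P (fst (stage ?X c)))"
    and e: "pf (stage_top ?X c) \<cdot>\<^bsub>E\<^esub> g = upper s"
    using r by (auto simp: rep_def)
  note S = stage_simps[OF X c] and S' = stage_simps[OF X' c]
  have V: "v c \<in> Arr gcat" "Dom gcat (v c) = stage ?X c" "Cod gcat (v c) = stage ?X' c"
    and Z: "z c \<in> Arr gcat" "Dom gcat (z c) = Cod gcat (cells.nexts ?X c)" "Cod gcat (z c) = Cod gcat (cells.nexts ?X' c)"
    using mm(1-6)[OF c] by (simp_all add: stage_def)
  have zn: "z c \<cdot>\<^bsub>gcat\<^esub> cells.nexts ?X c = cells.nexts ?X' c \<cdot>\<^bsub>gcat\<^esub> v c"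
    and za: "z c \<cdot>\<^bsub>gcat\<^esub> cells.attach ?X c = cells.attach ?X' c \<cdot>\<^bsub>gcat\<^esub> Ar C_functor (v c)"
    and wt: "?w \<cdot>\<^bsub>gcat\<^esub> cells.tops ?X (Some c) = cells.tops ?X' (Some c) \<cdot>\<^bsub>gcat\<^esub> z c"
    using mm(9,10,15)[OF c] .
  have top: "stage_top ?X' c \<cdot>\<^bsub>gcat\<^esub> v c = ?w \<cdot>\<^bsub>gcat\<^esub> stage_top ?X c"
  proof -
    have "stage_top ?X' c \<cdot>\<^bsub>gcat\<^esub> v c = cells.tops ?X' (Some c) \<cdot>\<^bsub>gcat\<^esub> (cells.nexts ?X' c \<cdot>\<^bsub>gcat\<^esub> v c)"
      unfolding stage_top_def using S' V by simp
    also have "\<dots> = (cells.tops ?X' (Some c) \<cdot>\<^bsub>gcat\<^esub> z c) \<cdot>\<^bsub>gcat\<^esub> cells.nexts ?X c"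
      unfolding zn[symmetric] using S S' Z by simp
    also have "\<dots> = ?w \<cdot>\<^bsub>gcat\<^esub> stage_top ?X c"
      unfolding wt[symmetric] stage_top_def using S W by simp
    finally show ?thesis .
  qed
  let ?g = "pf (v c) \<cdot>\<^bsub>E\<^esub> g"
  have "pf (stage_top ?X' c) \<cdot>\<^bsub>E\<^esub> ?g = (pf (stage_top ?X' c) \<cdot>\<^bsub>E\<^esub> pf (v c)) \<cdot>\<^bsub>E\<^esub> g"
    using S' V g by simp
  also have "pf (stage_top ?X' c) \<cdot>\<^bsub>E\<^esub> pf (v c) = pf ?w \<cdot>\<^bsub>E\<^esub> pf (stage_top ?X c)"
    using pf_cmp[of "v c" "stage_top ?X' c"] pf_cmp[of "stage_top ?X c" ?w] top S S' V W by simp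
  also have "(pf ?w \<cdot>\<^bsub>E\<^esub> pf (stage_top ?X c)) \<cdot>\<^bsub>E\<^esub> g = pf ?w \<cdot>\<^bsub>E\<^esub> upper s"
    using e S W g by simp
  finally have r': "rep ?X' i ?s c ?g"
    using c g V Sq by (simp add: rep_def)
  have k0: "Cod E (snd (stage ?X c)) = Cod E (snd ?X)"
    using stage_over(3)[OF X c] snd_pf[OF tN] eN(1) cells.unit_simps(2)[OF X] by simp
  \<comment> \<open>All legs are over identities of the base, so the map of chains has base
    component \<open>epart x\<close> at every stage.\<close>
  have ev: "epart (v c) = epart x"
  proof -
    have l: "cells.legs ?X c None \<in> GM M" "cells.legs ?X' c None \<in> GM M"
      using cells.stepD(2)[OF cells.cellularD(1)[OF cel c], of None] cells.stepD(2)[OF cells.cellularD(1)[OF cel' c], of None] by auto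
    note ld = cells.chain_onD(2-4)[OF cells.cellularD(3)[OF cel] c] cells.chain_onD(2-4)[OF cells.cellularD(3)[OF cel'] c]
    have "epart (v c) \<cdot>\<^bsub>E\<^esub> epart (cells.legs ?X c None) = epart (cells.legs ?X' c None) \<cdot>\<^bsub>E\<^esub> epart x"
      using arg_cong[OF mm(7)[OF c], of epart] by simp
    then show ?thesis
      using GMD(4)[OF l(1)] GMD(4)[OF l(2)] ld G(4-6) Arr_gcatD(4,5)[OF V(1)] V(2) k0 by simp
  qed
  note R = rep_square_simps[OF X s r]
  note Sv = sq_arrow[OF V(1)]
  have "rep_square ?X' i ?s c ?g = sq (v c) \<cdot>\<^bsub>arrow_cat E\<^esub> rep_square ?X i s c g"
    using R V Sv Sq ev ex by (simp add: rep_square_def)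
  then have "coproj i (rep_square ?X' i ?s c ?g) = Ar D (sq (v c)) \<cdot>\<^bsub>arrow_cat E\<^esub> coproj i (rep_square ?X i s c g)"
    using coproj_D[OF s(1) R(1,2) Sv(1)] Sv(2) R(3) V(2) by simp
  then have lo: "lower (coproj i (rep_square ?X' i ?s c ?g)) = lower (Ar D (sq (v c))) \<cdot>\<^bsub>E\<^esub> lower (coproj i (rep_square ?X i s c g))"
    by simp
  let ?a = "lower (coproj i (rep_square ?X i s c g))"
  note I = coproj_rep_simps(2)[OF X s r]
  have FC: "Ar C_functor (v c) \<in> Arr gcat" by (rule A_C_Arr[OF V(1)])
  have pC: "pf (Ar C_functor (v c)) = lower (Ar D (sq (v c)))" using C_part_simps(4)[OF V(1)] by simp
  have cC: "Ob P (fst (C_obj (stage ?X c))) = Cod E (Ob D (snd (stage ?X c)))"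
    "Ob P (fst (C_obj (stage ?X' c))) = Cod E (Ob D (snd (stage ?X' c)))"
    using a_lift_simps(5)[OF S(4)] a_lift_simps(5)[OF S'(4)] by (simp_all add: C_obj_def)
  have 1: "pf (cells.attach ?X' c) \<cdot>\<^bsub>E\<^esub> lower (Ar D (sq (v c))) = pf (z c) \<cdot>\<^bsub>E\<^esub> pf (cells.attach ?X c)"
  proof -
    have "pf (cells.attach ?X' c \<cdot>\<^bsub>gcat\<^esub> Ar C_functor (v c)) = pf (cells.attach ?X' c) \<cdot>\<^bsub>E\<^esub> pf (Ar C_functor (v c))"
      by (rule pf_cmp) (use FC S' V in simp_all)
    moreover have "pf (z c \<cdot>\<^bsub>gcat\<^esub> cells.attach ?X c) = pf (z c) \<cdot>\<^bsub>E\<^esub> pf (cells.attach ?X c)"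
      by (rule pf_cmp) (use S Z in simp_all)
    ultimately show ?thesis unfolding za pC by simp
  qed
  have 2: "pf (cells.tops ?X' (Some c)) \<cdot>\<^bsub>E\<^esub> pf (z c) = pf ?w \<cdot>\<^bsub>E\<^esub> pf (cells.tops ?X (Some c))"
  proof -
    have "pf (?w \<cdot>\<^bsub>gcat\<^esub> cells.tops ?X (Some c)) = pf ?w \<cdot>\<^bsub>E\<^esub> pf (cells.tops ?X (Some c))"
      by (rule pf_cmp) (use S W in simp_all)
    moreover have "pf (cells.tops ?X' (Some c) \<cdot>\<^bsub>gcat\<^esub> z c) = pf (cells.tops ?X' (Some c)) \<cdot>\<^bsub>E\<^esub> pf (z c)"
      by (rule pf_cmp) (use S' Z in simp_all)
    ultimately show ?thesis unfolding wt by simp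
  qed
  have A: "pf (cells.tops ?X' (Some c)) \<in> Arr E" "Dom E (pf (cells.tops ?X' (Some c))) = Ob P (fst (Cod gcat (cells.nexts ?X' c)))"
    "pf (cells.tops ?X (Some c)) \<in> Arr E" "Dom E (pf (cells.tops ?X (Some c))) = Ob P (fst (Cod gcat (cells.nexts ?X c)))"
    "Cod E (pf (cells.tops ?X (Some c))) = Ob P (fst (cells.top_obj ?X))"
    "pf (cells.attach ?X' c) \<in> Arr E" "Dom E (pf (cells.attach ?X' c)) = Cod E (Ob D (snd (stage ?X' c)))"
    "Cod E (pf (cells.attach ?X' c)) = Ob P (fst (Cod gcat (cells.nexts ?X' c)))"
    "pf (cells.attach ?X c) \<in> Arr E" "Dom E (pf (cells.attach ?X c)) = Cod E (Ob D (snd (stage ?X c)))"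
    "Cod E (pf (cells.attach ?X c)) = Ob P (fst (Cod gcat (cells.nexts ?X c)))"
    "pf (z c) \<in> Arr E" "Dom E (pf (z c)) = Ob P (fst (Cod gcat (cells.nexts ?X c)))"
    "Cod E (pf (z c)) = Ob P (fst (Cod gcat (cells.nexts ?X' c)))"
    "pf ?w \<in> Arr E" "Dom E (pf ?w) = Ob P (fst (cells.top_obj ?X))"
    using S S' Z W cC by simp_all
  note Dl = D_sq(4-6)[OF V(1), unfolded V(2,3)]
  have "rep_lift ?X' i ?s c ?g = pf (cells.tops ?X' (Some c)) \<cdot>\<^bsub>E\<^esub> (pf (cells.attach ?X' c) \<cdot>\<^bsub>E\<^esub> lower (Ar D (sq (v c)))) \<cdot>\<^bsub>E\<^esub> ?a"
    unfolding rep_lift_def lo using A Dl I by simp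
  also have "\<dots> = (pf (cells.tops ?X' (Some c)) \<cdot>\<^bsub>E\<^esub> pf (z c)) \<cdot>\<^bsub>E\<^esub> pf (cells.attach ?X c) \<cdot>\<^bsub>E\<^esub> ?a"
    unfolding 1 using A I by simp
  also have "\<dots> = pf ?w \<cdot>\<^bsub>E\<^esub> rep_lift ?X i s c g"
    unfolding 2 rep_lift_def using A I by simp
  finally have "lift_of ?X' i ?s = pf ?w \<cdot>\<^bsub>E\<^esub> lift_of ?X i s"
    unfolding lift_of_eq[OF X s r] lift_of_eq[OF X' s' r'] .
  moreover have "(i, ?s) \<in> lifting_problems E J u (top_map_to ?X')" unfolding lifting_problems_iff using s' by blast
  ultimately show "snd (lift_struct ?X') (i, ?s) = pf ?w \<cdot>\<^bsub>E\<^esub> snd (lift_struct ?X) (i, s)"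
    using pr by (simp add: lift_struct_def del: arrow_cat_simps(5))
qed

end

section \<open>The extension functor\<close>

lemma struct_cat_simps [simp]:
  "Obj (struct_cat B X \<pi> resp) = X"
  "(x, a, y) \<in> Arr (struct_cat B X \<pi> resp) \<longleftrightarrow> x \<in> X \<and> y \<in> X \<and> a \<in> hom B (\<pi> x) (\<pi> y) \<and> resp x a y"
  "Dom (struct_cat B X \<pi> resp) t = fst t" "Cod (struct_cat B X \<pi> resp) t = snd (snd t)"
  "Idt (struct_cat B X \<pi> resp) x = (x, Idt B (\<pi> x), x)"
  "t' \<cdot>\<^bsub>struct_cat B X \<pi> resp\<^esub> t = (fst t, fst (snd t') \<cdot>\<^bsub>B\<^esub> fst (snd t), snd (snd t'))"
  by (auto simp: struct_cat_def split: prod.splits)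

lemma struct_forget_simps [simp]:
  "Ob (struct_forget \<pi>) x = \<pi> x" "Ar (struct_forget \<pi>) t = fst (snd t)"
  by (auto simp: struct_forget_def split: prod.splits)

lemma (in category) category_struct_cat:
  assumes \<pi>: "\<And>x. x \<in> X \<Longrightarrow> \<pi> x \<in> Obj C" and idt: "\<And>x. x \<in> X \<Longrightarrow> resp x (Idt C (\<pi> x)) x"
    and cmp: "\<And>x a y b z. (x, a, y) \<in> Arr (struct_cat C X \<pi> resp) \<Longrightarrow> (y, b, z) \<in> Arr (struct_cat C X \<pi> resp) \<Longrightarrow>
      resp x (b \<cdot> a) z"
  shows "category (struct_cat C X \<pi> resp)" "is_functor (struct_cat C X \<pi> resp) C (struct_forget \<pi>)"
proof -
  let ?S = "struct_cat C X \<pi> resp"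
  have arr: "fst t \<in> X" "snd (snd t) \<in> X" "fst (snd t) \<in> Arr C" "Dom C (fst (snd t)) = \<pi> (fst t)"
    "Cod C (fst (snd t)) = \<pi> (snd (snd t))" if "t \<in> Arr ?S" for t
    using that by (cases t; simp)+
  show "category ?S"
  proof
    fix w x y z a b c
    show "Dom ?S a \<in> Obj ?S" "Cod ?S a \<in> Obj ?S" if "a \<in> Arr ?S" using arr[OF that] by simp_all
    show "Idt ?S x \<in> hom ?S x x" if "x \<in> Obj ?S" using that \<pi> idt by simp
    show "b \<cdot>\<^bsub>?S\<^esub> a \<in> hom ?S x z" if "a \<in> hom ?S x y" "b \<in> hom ?S y z"
      using that cmp by (cases a; cases b) auto
    show "Idt ?S y \<cdot>\<^bsub>?S\<^esub> a = a" "a \<cdot>\<^bsub>?S\<^esub> Idt ?S x = a" if "a \<in> hom ?S x y"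
      using that by (cases a; auto)+
    show "(c \<cdot>\<^bsub>?S\<^esub> b) \<cdot>\<^bsub>?S\<^esub> a = c \<cdot>\<^bsub>?S\<^esub> b \<cdot>\<^bsub>?S\<^esub> a" if "a \<in> hom ?S w x" "b \<in> hom ?S x y" "c \<in> hom ?S y z"
      using that arr[of a] arr[of b] arr[of c] by simp
  qed
  show "is_functor ?S C (struct_forget \<pi>)"
    using \<pi> arr by (simp add: is_functor_def)
qed

context ext_setting
begin

context
  fixes W :: "'a awfs"
  assumes awfs: "is_awfs E W" and generated: "cofibrantly_generated E W J u"
begin

section \<open>Algebras of the given AWFS on the last maps\<close>

abbreviation mid_map where "mid_map \<sigma> \<equiv> upper (Ar \<R>\<^bsub>W\<^esub> \<sigma>)"

lemma awfs_simps:
  assumes f: "f \<in> Arr E"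
  shows "Ob \<L>\<^bsub>W\<^esub> f \<in> Arr E" "Ob \<R>\<^bsub>W\<^esub> f \<in> Arr E" "Dom E (Ob \<L>\<^bsub>W\<^esub> f) = Dom E f"
    "Cod E (Ob \<L>\<^bsub>W\<^esub> f) = Dom E (Ob \<R>\<^bsub>W\<^esub> f)" "Cod E (Ob \<R>\<^bsub>W\<^esub> f) = Cod E f"
    "mid_map (Idt (arrow_cat E) f) = Idt E (Dom E (Ob \<R>\<^bsub>W\<^esub> f))"
proof -
  have L: "is_functor (arrow_cat E) (arrow_cat E) \<L>\<^bsub>W\<^esub>" and R: "is_functor (arrow_cat E) (arrow_cat E) \<R>\<^bsub>W\<^esub>"
    using awfs by (simp_all add: is_awfs_def)
  show "Ob \<L>\<^bsub>W\<^esub> f \<in> Arr E" "Ob \<R>\<^bsub>W\<^esub> f \<in> Arr E" using functorD(1)[OF L, of f] functorD(1)[OF R, of f] f by simp_all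
  show "Dom E (Ob \<L>\<^bsub>W\<^esub> f) = Dom E f" "Cod E (Ob \<L>\<^bsub>W\<^esub> f) = Dom E (Ob \<R>\<^bsub>W\<^esub> f)" "Cod E (Ob \<R>\<^bsub>W\<^esub> f) = Cod E f"
    using awfs f by (simp_all add: is_awfs_def functor_eq_def dom_functor_def cod_functor_def)
  show "mid_map (Idt (arrow_cat E) f) = Idt E (Dom E (Ob \<R>\<^bsub>W\<^esub> f))"
    using functorD(5)[OF R, of f] f by simp
qed

lemma mid_map_simps:
  assumes s: "\<sigma> \<in> Arr (arrow_cat E)"
  shows "mid_map \<sigma> \<in> Arr E" "Dom E (mid_map \<sigma>) = Dom E (Ob \<R>\<^bsub>W\<^esub> (sdom \<sigma>))"
    "Cod E (mid_map \<sigma>) = Dom E (Ob \<R>\<^bsub>W\<^esub> (scod \<sigma>))"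
    "mid_map \<sigma> \<cdot>\<^bsub>E\<^esub> Ob \<L>\<^bsub>W\<^esub> (sdom \<sigma>) = Ob \<L>\<^bsub>W\<^esub> (scod \<sigma>) \<cdot>\<^bsub>E\<^esub> upper \<sigma>"
proof -
  have L: "is_functor (arrow_cat E) (arrow_cat E) \<L>\<^bsub>W\<^esub>" and R: "is_functor (arrow_cat E) (arrow_cat E) \<R>\<^bsub>W\<^esub>"
    using awfs by (simp_all add: is_awfs_def)
  have RA: "Ar \<R>\<^bsub>W\<^esub> \<sigma> \<in> Arr (arrow_cat E)" "sdom (Ar \<R>\<^bsub>W\<^esub> \<sigma>) = Ob \<R>\<^bsub>W\<^esub> (sdom \<sigma>)" "scod (Ar \<R>\<^bsub>W\<^esub> \<sigma>) = Ob \<R>\<^bsub>W\<^esub> (scod \<sigma>)"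
    using functorD(2-4)[OF R s] by simp_all
  show "mid_map \<sigma> \<in> Arr E" "Dom E (mid_map \<sigma>) = Dom E (Ob \<R>\<^bsub>W\<^esub> (sdom \<sigma>))"
    "Cod E (mid_map \<sigma>) = Dom E (Ob \<R>\<^bsub>W\<^esub> (scod \<sigma>))"
    using arrow_simps(3-5)[OF RA(1)] unfolding RA(2,3) .
  have LA: "Ar \<L>\<^bsub>W\<^esub> \<sigma> \<in> Arr (arrow_cat E)" "sdom (Ar \<L>\<^bsub>W\<^esub> \<sigma>) = Ob \<L>\<^bsub>W\<^esub> (sdom \<sigma>)" "scod (Ar \<L>\<^bsub>W\<^esub> \<sigma>) = Ob \<L>\<^bsub>W\<^esub> (scod \<sigma>)"
    using functorD(2-4)[OF L s] by simp_all
  have "upper (Ar \<L>\<^bsub>W\<^esub> \<sigma>) = upper \<sigma>" "lower (Ar \<L>\<^bsub>W\<^esub> \<sigma>) = mid_map \<sigma>"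
    using awfs s by (simp_all add: is_awfs_def functor_eq_def dom_functor_def cod_functor_def)
  with arrow_simps(9)[OF LA(1)] LA(2,3)
  show "mid_map \<sigma> \<cdot>\<^bsub>E\<^esub> Ob \<L>\<^bsub>W\<^esub> (sdom \<sigma>) = Ob \<L>\<^bsub>W\<^esub> (scod \<sigma>) \<cdot>\<^bsub>E\<^esub> upper \<sigma>" by simp
qed

lemma mid_map_cmp:
  assumes "\<sigma> \<in> Arr (arrow_cat E)" "\<tau> \<in> Arr (arrow_cat E)" "scod \<sigma> = sdom \<tau>"
  shows "mid_map (\<tau> \<cdot>\<^bsub>arrow_cat E\<^esub> \<sigma>) = mid_map \<tau> \<cdot>\<^bsub>E\<^esub> mid_map \<sigma>"
proof -
  have R: "is_functor (arrow_cat E) (arrow_cat E) \<R>\<^bsub>W\<^esub>" using awfs by (simp add: is_awfs_def)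
  have "Ar \<R>\<^bsub>W\<^esub> (\<tau> \<cdot>\<^bsub>arrow_cat E\<^esub> \<sigma>) = Ar \<R>\<^bsub>W\<^esub> \<tau> \<cdot>\<^bsub>arrow_cat E\<^esub> Ar \<R>\<^bsub>W\<^esub> \<sigma>"
    by (rule functorD(6)[OF R]) (use assms in simp_all)
  then show ?thesis by simp
qed

text \<open>The functor from lifting structures to algebras takes \<open>lift_struct X\<close> to an
  algebra structure on the same map and, by \<open>top_map_respects\<close>, the square of
  \<open>top_map\<close> to a morphism of algebras. The unit law of the former and the upper side of
  the latter are the two conclusions.\<close>

lemma algebra_ex:
  "\<exists>q. (\<forall>X \<in> Obj gcat. q X \<in> hom E (Dom E (Ob \<R>\<^bsub>W\<^esub> (top_map_to X))) (Ob P (fst (cells.top_obj X))) \<and>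
        q X \<cdot>\<^bsub>E\<^esub> Ob \<L>\<^bsub>W\<^esub> (top_map_to X) = Idt E (Ob P (fst (cells.top_obj X)))) \<and>
      (\<forall>x \<in> Arr gcat. pf (cells.top_map x) \<cdot>\<^bsub>E\<^esub> q (Dom gcat x) =
        q (Cod gcat x) \<cdot>\<^bsub>E\<^esub> mid_map (sq (cells.top_map x)))"
proof -
  define Al where "Al = Ver (Alg_dbl E W)"
  define Li where "Li = Ver (Lift_dbl E J u)"
  obtain V V' where V: "is_functor Li Al V'" "functor_eq Li (V \<circ>\<^sub>F V') id_functor"
      "functor_eq Al (struct_forget fst \<circ>\<^sub>F V) (struct_forget fst)"
    using generated unfolding cofibrantly_generated_def dbl_iso_over_def dbl_functor_def Al_def Li_def by blast
  note V' = functorD(1-4)[OF V(1)]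
  have Al: "Al = struct_cat (arrow_cat E) (right_maps E W) fst (\<lambda>(f, p) \<sigma> (g, q).
      \<sigma> \<cdot>\<^bsub>arrow_cat E\<^esub> alg_square E W f p = alg_square E W g q \<cdot>\<^bsub>arrow_cat E\<^esub> Ar \<R>\<^bsub>W\<^esub> \<sigma>)"
    by (simp add: Al_def Alg_dbl_def struct_dbl_def)
  have Li: "Li = struct_cat (arrow_cat E) (lift_structs E J u) fst (\<lambda>(f, \<psi>) \<beta> (f', \<psi>').
      \<forall>(i, \<alpha>) \<in> lifting_problems E J u f. \<psi>' (i, \<beta> \<cdot>\<^bsub>arrow_cat E\<^esub> \<alpha>) = upper \<beta> \<cdot>\<^bsub>E\<^esub> \<psi> (i, \<alpha>))"
    by (simp add: Li_def Lift_dbl_def struct_dbl_def)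
  \<comment> \<open>The isomorphism is stated to lie over \<open>Sq\<close> for \<open>V\<close>;
    for its inverse \<open>V'\<close> this follows from \<open>V V' = id\<close>.\<close>
  have over: "fst (Ob V' v) = fst v" if v: "v \<in> Obj Li" for v
  proof -
    have "Ob V (Ob V' v) = v" using V(2) v by (simp add: functor_eq_def id_functor_def)
    moreover have "fst (Ob V (Ob V' v)) = fst (Ob V' v)" using V(3) V'(1)[OF v] by (simp add: functor_eq_def)
    ultimately show ?thesis by simp
  qed
  have over_Ar: "fst (snd (Ar V' t)) = fst (snd t)" if t: "t \<in> Arr Li" for t
  proof -
    have "Ar V (Ar V' t) = t" using V(2) t by (simp add: functor_eq_def id_functor_def)
    moreover have "fst (snd (Ar V (Ar V' t))) = fst (snd (Ar V' t))" using V(3) V'(2)[OF t] by (simp add: functor_eq_def)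
    ultimately show ?thesis by simp
  qed
  define q where "q X = snd (Ob V' (lift_struct X))" for X
  have LX: "lift_struct X \<in> Obj Li" if "X \<in> Obj gcat" for X using lift_struct_in[OF that] by (simp add: Li)
  have ObV: "Ob V' (lift_struct X) = (top_map_to X, q X)" if "X \<in> Obj gcat" for X
    using over[OF LX[OF that]] by (simp add: q_def lift_struct_def prod_eq_iff)
  have 1: "q X \<in> hom E (Dom E (Ob \<R>\<^bsub>W\<^esub> (top_map_to X))) (Ob P (fst (cells.top_obj X))) \<and>
      q X \<cdot>\<^bsub>E\<^esub> Ob \<L>\<^bsub>W\<^esub> (top_map_to X) = Idt E (Ob P (fst (cells.top_obj X)))" if X: "X \<in> Obj gcat" for X
  proof -
    note t = Obj_gcatD[OF cells.unit_simps(3)[OF X]]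
    have "(top_map_to X, q X) \<in> right_maps E W" using V'(1)[OF LX[OF X]] ObV[OF X] by (simp add: Al)
    then have m: "alg_square E W (top_map_to X) (q X) \<in> hom (arrow_cat E) (Ob \<R>\<^bsub>W\<^esub> (top_map_to X)) (top_map_to X)"
      "alg_square E W (top_map_to X) (q X) \<cdot>\<^bsub>arrow_cat E\<^esub> unit_square E W (top_map_to X) = Idt (arrow_cat E) (top_map_to X)"
      by (simp_all add: right_maps_def monad_algebra_def del: arrow_cat_simps(5))
    have "q X \<in> hom E (Dom E (Ob \<R>\<^bsub>W\<^esub> (top_map_to X))) (Ob P (fst (cells.top_obj X)))"
      using m(1) t by (simp add: alg_square_def Arr_arrow_cat)
    moreover have "q X \<cdot>\<^bsub>E\<^esub> Ob \<L>\<^bsub>W\<^esub> (top_map_to X) = Idt E (Ob P (fst (cells.top_obj X)))"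
      using arg_cong[OF m(2), of upper] t by (simp add: alg_square_def unit_square_def)
    ultimately show ?thesis by blast
  qed
  have 2: "pf (cells.top_map x) \<cdot>\<^bsub>E\<^esub> q (Dom gcat x) = q (Cod gcat x) \<cdot>\<^bsub>E\<^esub> mid_map (sq (cells.top_map x))"
    if x: "x \<in> Arr gcat" for x
  proof -
    have X: "Dom gcat x \<in> Obj gcat" "Cod gcat x \<in> Obj gcat" using x by auto
    note W = cells.top_map_simps[OF x]
    note S = sq_arrow[OF W(1), unfolded W(2,3)]
    let ?t = "(lift_struct (Dom gcat x), sq (cells.top_map x), lift_struct (Cod gcat x))"
    have t: "?t \<in> Arr Li"
      unfolding Li struct_cat_simps case_prod_beta
    proof (intro conjI ballI)
      show "lift_struct (Dom gcat x) \<in> lift_structs E J u" "lift_struct (Cod gcat x) \<in> lift_structs E J u"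
        using lift_struct_in X by blast+
      show "sq (cells.top_map x) \<in> hom (arrow_cat E) (fst (lift_struct (Dom gcat x))) (fst (lift_struct (Cod gcat x)))"
        using S by (simp add: lift_struct_def)
      show "snd (lift_struct (Cod gcat x)) (fst p, sq (cells.top_map x) \<cdot>\<^bsub>arrow_cat E\<^esub> snd p) =
          upper (sq (cells.top_map x)) \<cdot>\<^bsub>E\<^esub> snd (lift_struct (Dom gcat x)) (fst p, snd p)"
        if "p \<in> lifting_problems E J u (fst (lift_struct (Dom gcat x)))" for p
        using top_map_respects(2)[OF x, of "fst p" "snd p"] that S(4) by (simp add: lift_struct_def del: arrow_cat_simps(5))
    qed
    have "Ar V' ?t = ((top_map_to (Dom gcat x), q (Dom gcat x)), sq (cells.top_map x), (top_map_to (Cod gcat x), q (Cod gcat x)))"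
      using V'(3,4)[OF t] over_Ar[OF t] ObV[OF X(1)] ObV[OF X(2)] by (simp add: Al Li prod_eq_iff)
    with V'(2)[OF t] have "sq (cells.top_map x) \<cdot>\<^bsub>arrow_cat E\<^esub> alg_square E W (top_map_to (Dom gcat x)) (q (Dom gcat x)) =
        alg_square E W (top_map_to (Cod gcat x)) (q (Cod gcat x)) \<cdot>\<^bsub>arrow_cat E\<^esub> Ar \<R>\<^bsub>W\<^esub> (sq (cells.top_map x))"
      by (simp add: Al del: arrow_cat_simps(5))
    from arg_cong[OF this, of upper] show ?thesis using S by (simp add: alg_square_def)
  qed
  show ?thesis using 1 2 by blast
qed

lemma phi_ex:
  "\<exists>\<phi>. (\<forall>X \<in> Obj gcat. \<phi> X \<in> hom E (Dom E (Ob \<R>\<^bsub>W\<^esub> (snd X))) (Ob P (fst (cells.top_obj X))) \<and>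
        \<phi> X \<cdot>\<^bsub>E\<^esub> Ob \<L>\<^bsub>W\<^esub> (snd X) = pf (cells.tops X None)) \<and>
      (\<forall>x \<in> Arr gcat. pf (cells.top_map x) \<cdot>\<^bsub>E\<^esub> \<phi> (Dom gcat x) = \<phi> (Cod gcat x) \<cdot>\<^bsub>E\<^esub> mid_map (sq x))"
proof -
  obtain q where q: "\<And>X. X \<in> Obj gcat \<Longrightarrow> q X \<in> hom E (Dom E (Ob \<R>\<^bsub>W\<^esub> (top_map_to X))) (Ob P (fst (cells.top_obj X)))"
      "\<And>X. X \<in> Obj gcat \<Longrightarrow> q X \<cdot>\<^bsub>E\<^esub> Ob \<L>\<^bsub>W\<^esub> (top_map_to X) = Idt E (Ob P (fst (cells.top_obj X)))"
    and qn: "\<And>x. x \<in> Arr gcat \<Longrightarrow> pf (cells.top_map x) \<cdot>\<^bsub>E\<^esub> q (Dom gcat x) =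
        q (Cod gcat x) \<cdot>\<^bsub>E\<^esub> mid_map (sq (cells.top_map x))"
    using algebra_ex by blast
  define \<phi> where "\<phi> X = q X \<cdot>\<^bsub>E\<^esub> mid_map (sq (cells.tops X None))" for X
  have mt: "mid_map (sq (cells.tops X None)) \<in> Arr E"
      "Dom E (mid_map (sq (cells.tops X None))) = Dom E (Ob \<R>\<^bsub>W\<^esub> (snd X))"
      "Cod E (mid_map (sq (cells.tops X None))) = Dom E (Ob \<R>\<^bsub>W\<^esub> (top_map_to X))"
      "mid_map (sq (cells.tops X None)) \<cdot>\<^bsub>E\<^esub> Ob \<L>\<^bsub>W\<^esub> (snd X) = Ob \<L>\<^bsub>W\<^esub> (top_map_to X) \<cdot>\<^bsub>E\<^esub> pf (cells.tops X None)"
    if X: "X \<in> Obj gcat" for X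
    using mid_map_simps[OF sq_arrow(1)[OF cells.unit_simps(1)[OF X]]] sq_arrow(2-4)[OF cells.unit_simps(1)[OF X]]
    by (simp_all add: cells.unit_simps(2)[OF X])
  have 1: "\<phi> X \<in> hom E (Dom E (Ob \<R>\<^bsub>W\<^esub> (snd X))) (Ob P (fst (cells.top_obj X))) \<and>
      \<phi> X \<cdot>\<^bsub>E\<^esub> Ob \<L>\<^bsub>W\<^esub> (snd X) = pf (cells.tops X None)" if X: "X \<in> Obj gcat" for X
  proof -
    have f: "snd X \<in> Arr E" and t: "top_map_to X \<in> Arr E" "Dom E (top_map_to X) = Ob P (fst (cells.top_obj X))"
      using Obj_gcatD[OF X] Obj_gcatD[OF cells.unit_simps(3)[OF X]] by auto
    note L = awfs_simps(1,3,4)[OF f] awfs_simps(1,3,4)[OF t(1)] and m = mt(1-3)[OF X]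
    have qA: "q X \<in> Arr E" "Dom E (q X) = Dom E (Ob \<R>\<^bsub>W\<^esub> (top_map_to X))" "Cod E (q X) = Ob P (fst (cells.top_obj X))"
      using q(1)[OF X] by auto
    have p: "pf (cells.tops X None) \<in> Arr E" "Cod E (pf (cells.tops X None)) = Ob P (fst (cells.top_obj X))"
      using pf_simps[OF cells.unit_simps(1)[OF X]] by auto
    have "\<phi> X \<cdot>\<^bsub>E\<^esub> Ob \<L>\<^bsub>W\<^esub> (snd X) = q X \<cdot>\<^bsub>E\<^esub> (mid_map (sq (cells.tops X None)) \<cdot>\<^bsub>E\<^esub> Ob \<L>\<^bsub>W\<^esub> (snd X))"
      unfolding \<phi>_def using L m qA by simp
    also have "\<dots> = (q X \<cdot>\<^bsub>E\<^esub> Ob \<L>\<^bsub>W\<^esub> (top_map_to X)) \<cdot>\<^bsub>E\<^esub> pf (cells.tops X None)"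
      unfolding mt(4)[OF X] using L qA p t(2) by simp
    also have "\<dots> = pf (cells.tops X None)" unfolding q(2)[OF X] using p by simp
    finally show ?thesis using m qA by (simp add: \<phi>_def)
  qed
  have 2: "pf (cells.top_map x) \<cdot>\<^bsub>E\<^esub> \<phi> (Dom gcat x) = \<phi> (Cod gcat x) \<cdot>\<^bsub>E\<^esub> mid_map (sq x)" if x: "x \<in> Arr gcat" for x
  proof -
    have X: "Dom gcat x \<in> Obj gcat" "Cod gcat x \<in> Obj gcat" using x by auto
    note W = cells.top_map_simps[OF x]
    note S = sq_arrow(1-3)[OF W(1), unfolded W(2,3)] and Sx = sq_arrow(1-3)[OF x]
    note U = cells.unit_simps(1,2)[OF X(1)] cells.unit_simps(1,2)[OF X(2)]
    note SU = sq_arrow(1-3)[OF U(1), unfolded U(2)] and SU' = sq_arrow(1-3)[OF U(3), unfolded U(4)]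
    note mw = mid_map_simps(1-3)[OF S(1), unfolded S(2,3)] and mx = mid_map_simps(1-3)[OF Sx(1), unfolded Sx(2,3)]
    note m = mt(1-3)[OF X(1)] mt(1-3)[OF X(2)]
    have qA: "q X \<in> Arr E" "Dom E (q X) = Dom E (Ob \<R>\<^bsub>W\<^esub> (top_map_to X))" "Cod E (q X) = Ob P (fst (cells.top_obj X))"
      if "X \<in> Obj gcat" for X
      using q(1)[OF that] by auto
    note qq = qA[OF X(1)] qA[OF X(2)]
    \<comment> \<open>The maps from an object into the last object of its chain are natural; the
      middle functor turns this square into the one that is needed next to the naturality of
      \<open>q\<close>.\<close>
    have "sq (cells.top_map x) \<cdot>\<^bsub>arrow_cat E\<^esub> sq (cells.tops (Dom gcat x) None) = sq (cells.tops (Cod gcat x) None) \<cdot>\<^bsub>arrow_cat E\<^esub> sq x"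
      using sq_cmp[OF U(1) W(1)] sq_cmp[OF x U(3)] W(2,4) U(4) by (simp del: arrow_cat_simps(5))
    then have e: "mid_map (sq (cells.top_map x)) \<cdot>\<^bsub>E\<^esub> mid_map (sq (cells.tops (Dom gcat x) None)) =
        mid_map (sq (cells.tops (Cod gcat x) None)) \<cdot>\<^bsub>E\<^esub> mid_map (sq x)"
      using mid_map_cmp[OF SU(1) S(1)] mid_map_cmp[OF Sx(1) SU'(1)] S(2) SU(3) SU'(2) Sx(3) by (simp del: arrow_cat_simps(5))
    have "pf (cells.top_map x) \<cdot>\<^bsub>E\<^esub> \<phi> (Dom gcat x) =
        (pf (cells.top_map x) \<cdot>\<^bsub>E\<^esub> q (Dom gcat x)) \<cdot>\<^bsub>E\<^esub> mid_map (sq (cells.tops (Dom gcat x) None))"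
      unfolding \<phi>_def using pf_simps[OF W(1)] W(2) qq m by simp
    also have "\<dots> = q (Cod gcat x) \<cdot>\<^bsub>E\<^esub> (mid_map (sq (cells.top_map x)) \<cdot>\<^bsub>E\<^esub> mid_map (sq (cells.tops (Dom gcat x) None)))"
      unfolding qn[OF x] using qq m mw by simp
    also have "\<dots> = \<phi> (Cod gcat x) \<cdot>\<^bsub>E\<^esub> mid_map (sq x)"
      unfolding e \<phi>_def using qq m mx by simp
    finally show ?thesis .
  qed
  show ?thesis using 1 2 by blast
qed

section \<open>Left maps and the extension functor\<close>

lemma coalg_cat_simps:
  shows "(f, s) \<in> Obj (coalg_cat E W) \<longleftrightarrow> (f, s) \<in> left_maps E W"
    "(c, \<sigma>, d) \<in> Arr (coalg_cat E W) \<longleftrightarrow> c \<in> left_maps E W \<and> d \<in> left_maps E W \<and>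
      \<sigma> \<in> Arr (arrow_cat E) \<and> sdom \<sigma> = fst c \<and> scod \<sigma> = fst d \<and> snd d \<cdot>\<^bsub>E\<^esub> lower \<sigma> = mid_map \<sigma> \<cdot>\<^bsub>E\<^esub> snd c"
  by (auto simp: coalg_cat_def mid_def dom_functor_def split: prod.splits)

lemma left_mapsD:
  assumes "c \<in> left_maps E W"
  shows "fst c \<in> Arr E" "snd c \<in> Arr E" "Dom E (snd c) = Cod E (fst c)"
    "Cod E (snd c) = Dom E (Ob \<R>\<^bsub>W\<^esub> (fst c))" "snd c \<cdot>\<^bsub>E\<^esub> fst c = Ob \<L>\<^bsub>W\<^esub> (fst c)"
  using assms by (auto simp: left_maps_def mid_def dom_functor_def)

lemma coalg_category:
  shows "category (coalg_cat E W)" "is_functor (coalg_cat E W) (arrow_cat E) coalg_forget"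
proof -
  let ?r = "\<lambda>(f, s) \<sigma> (g, t). t \<cdot>\<^bsub>E\<^esub> lower \<sigma> = Ar (mid E W) \<sigma> \<cdot>\<^bsub>E\<^esub> s"
  have r: "?r c \<sigma> d \<longleftrightarrow> snd d \<cdot>\<^bsub>E\<^esub> lower \<sigma> = mid_map \<sigma> \<cdot>\<^bsub>E\<^esub> snd c" for c \<sigma> d
    by (simp add: mid_def dom_functor_def split: prod.splits)
  have o: "fst c \<in> Obj (arrow_cat E)" if "c \<in> left_maps E W" for c
    using left_mapsD[OF that] by simp
  have i: "?r c (Idt (arrow_cat E) (fst c)) c" if "c \<in> left_maps E W" for c
    unfolding r using left_mapsD[OF that] awfs_simps(6)[of "fst c"] by simp
  have m: "?r c (\<tau> \<cdot>\<^bsub>arrow_cat E\<^esub> \<sigma>) d'"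
    if s: "(c, \<sigma>, d) \<in> Arr (struct_cat (arrow_cat E) (left_maps E W) fst ?r)"
      and t: "(d, \<tau>, d') \<in> Arr (struct_cat (arrow_cat E) (left_maps E W) fst ?r)" for c \<sigma> d \<tau> d'
  proof -
    have s': "c \<in> left_maps E W" "d \<in> left_maps E W" "\<sigma> \<in> Arr (arrow_cat E)" "sdom \<sigma> = fst c" "scod \<sigma> = fst d"
      and se: "snd d \<cdot>\<^bsub>E\<^esub> lower \<sigma> = mid_map \<sigma> \<cdot>\<^bsub>E\<^esub> snd c"
      using s unfolding struct_cat_simps r by auto
    have t': "d' \<in> left_maps E W" "\<tau> \<in> Arr (arrow_cat E)" "sdom \<tau> = fst d" "scod \<tau> = fst d'"
      and te: "snd d' \<cdot>\<^bsub>E\<^esub> lower \<tau> = mid_map \<tau> \<cdot>\<^bsub>E\<^esub> snd d"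
      using t unfolding struct_cat_simps r by auto
    note S = arrow_simps(6-8)[OF s'(3)] mid_map_simps(1-3)[OF s'(3)] and T = arrow_simps(6-8)[OF t'(2)] mid_map_simps(1-3)[OF t'(2)]
    note lm = left_mapsD(1-4)[OF s'(1)] left_mapsD(1-4)[OF s'(2)] left_mapsD(1-4)[OF t'(1)]
    have "snd d' \<cdot>\<^bsub>E\<^esub> lower \<tau> \<cdot>\<^bsub>E\<^esub> lower \<sigma> = (mid_map \<tau> \<cdot>\<^bsub>E\<^esub> snd d) \<cdot>\<^bsub>E\<^esub> lower \<sigma>"
      by (rule E.cmp_eq_cmp[OF te]) (use S T lm s' t' in simp_all)
    also have "\<dots> = mid_map \<tau> \<cdot>\<^bsub>E\<^esub> (snd d \<cdot>\<^bsub>E\<^esub> lower \<sigma>)"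
      using S T lm s' t' by simp
    also have "\<dots> = (mid_map \<tau> \<cdot>\<^bsub>E\<^esub> mid_map \<sigma>) \<cdot>\<^bsub>E\<^esub> snd c"
      unfolding se using S T lm s' t' by simp
    finally show ?thesis
      unfolding r using mid_map_cmp[OF s'(3) t'(2)] s'(5) t'(3) by simp
  qed
  show "category (coalg_cat E W)" "is_functor (coalg_cat E W) (arrow_cat E) coalg_forget"
    unfolding coalg_cat_def coalg_forget_def
    by (rule AE.category_struct_cat, erule o, erule i, erule (1) m)+
qed

text \<open>A morphism of left maps and a map \<open>x\<close> of \<open>F\<close> over its upper
  side form a morphism \<open>arr t x\<close> of the comma category. Then \<open>top_map\<close>
  acts on the last objects, and \<open>pl t x\<close> is its unique restriction to the reindexed
  ones. The laws required by \<open>ext_functorI\<close> follow from functoriality of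
  \<open>top_map\<close> and uniqueness of factorizations through cartesian maps.\<close>

theorem extension_functor:
  "\<exists>G. is_functor (coalg_cat E W) (Ext E F P cl) G \<and> functor_eq (coalg_cat E W) (ext_forget \<circ>\<^sub>F G) coalg_forget"
proof -
  obtain \<phi> where \<phi>: "\<And>X. X \<in> Obj gcat \<Longrightarrow> \<phi> X \<in> hom E (Dom E (Ob \<R>\<^bsub>W\<^esub> (snd X))) (Ob P (fst (cells.top_obj X)))"
      "\<And>X. X \<in> Obj gcat \<Longrightarrow> \<phi> X \<cdot>\<^bsub>E\<^esub> Ob \<L>\<^bsub>W\<^esub> (snd X) = pf (cells.tops X None)"
    and \<phi>n: "\<And>x. x \<in> Arr gcat \<Longrightarrow> pf (cells.top_map x) \<cdot>\<^bsub>E\<^esub> \<phi> (Dom gcat x) = \<phi> (Cod gcat x) \<cdot>\<^bsub>E\<^esub> mid_map (sq x)"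
    using phi_ex by blast
  define lift where "lift c Z = cl (\<phi> (Z, fst c) \<cdot>\<^bsub>E\<^esub> snd c) (fst (cells.top_obj (Z, fst c)))" for c Z
  define S where "S c Z = fill (lift c Z) (fpart (cells.tops (Z, fst c) None)) (fst c)" for c Z
  define arr where "arr t x = ((Dom F x, fst (fst t)), (x, lower (fst (snd t))), (Cod F x, fst (snd (snd t))))"
    for t :: "('a \<times> 'a) \<times> 'a square \<times> ('a \<times> 'a)" and x
  define pl where "pl t x = fill (lift (snd (snd t)) (Cod F x))
    (fpart (cells.top_map (arr t x)) \<cdot>\<^bsub>F\<^esub> lift (fst t) (Dom F x)) (lower (fst (snd t)))" for t x
  have X: "(Z, fst c) \<in> Obj gcat" if "c \<in> left_maps E W" "Z \<in> Obj F" "Ob P Z = Dom E (fst c)" for c Z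
    using that left_mapsD[OF that(1)] by simp
  have lift: "lift c Z \<in> cart" "lift c Z \<in> Arr F" "Cod F (lift c Z) = fst (cells.top_obj (Z, fst c))"
      "Ar P (lift c Z) = \<phi> (Z, fst c) \<cdot>\<^bsub>E\<^esub> snd c" "Ob P (Dom F (lift c Z)) = Cod E (fst c)"
    if "c \<in> left_maps E W" "Z \<in> Obj F" "Ob P Z = Dom E (fst c)" for c Z
  proof -
    note l = left_mapsD(2-4)[OF that(1)]
    have p: "\<phi> (Z, fst c) \<in> Arr E" "Dom E (\<phi> (Z, fst c)) = Dom E (Ob \<R>\<^bsub>W\<^esub> (fst c))"
      "Cod E (\<phi> (Z, fst c)) = Ob P (fst (cells.top_obj (Z, fst c)))"
      using \<phi>(1)[OF X[OF that]] by auto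
    have m: "\<phi> (Z, fst c) \<cdot>\<^bsub>E\<^esub> snd c \<in> Arr E" "Dom E (\<phi> (Z, fst c) \<cdot>\<^bsub>E\<^esub> snd c) = Cod E (fst c)"
      "Cod E (\<phi> (Z, fst c) \<cdot>\<^bsub>E\<^esub> snd c) = Ob P (fst (cells.top_obj (Z, fst c)))"
      using p l by simp_all
    note t = Obj_gcatD(1)[OF cells.unit_simps(3)[OF X[OF that]]]
    show "lift c Z \<in> cart" "lift c Z \<in> Arr F" "Cod F (lift c Z) = fst (cells.top_obj (Z, fst c))"
      "Ar P (lift c Z) = \<phi> (Z, fst c) \<cdot>\<^bsub>E\<^esub> snd c" "Ob P (Dom F (lift c Z)) = Cod E (fst c)"
      unfolding lift_def using cl_simps[OF t m(1,3)] m(2) by simp_all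
  qed
  have S: "S c Z \<in> Arr F" "Dom F (S c Z) = Z" "Cod F (S c Z) = Dom F (lift c Z)" "Ar P (S c Z) = fst c"
      "lift c Z \<cdot>\<^bsub>F\<^esub> S c Z = fpart (cells.tops (Z, fst c) None)" "S c Z \<in> cart"
    if c: "c \<in> left_maps E W" "Z \<in> Obj F" "Ob P Z = Dom E (fst c)" for c Z
  proof -
    note l = left_mapsD[OF c(1)] and L = lift[OF c]
    note U = cells.unit_simps[OF X[OF c]]
    have tc: "fpart (cells.tops (Z, fst c) None) \<in> cart" using U(4) by (simp add: GN_def)
    have t: "fpart (cells.tops (Z, fst c) None) \<in> Arr F" "Dom F (fpart (cells.tops (Z, fst c) None)) = Z"
      "Cod F (fpart (cells.tops (Z, fst c) None)) = Cod F (lift c Z)"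
      using Arr_gcatD(1-3)[OF U(1)] U(2) L(3) by simp_all
    have w: "fst c \<in> hom E (Ob P (Dom F (fpart (cells.tops (Z, fst c) None)))) (Ob P (Dom F (lift c Z)))"
      using t(2) L(5) l(1) c(3) by simp
    have p: "\<phi> (Z, fst c) \<in> Arr E" "Dom E (\<phi> (Z, fst c)) = Dom E (Ob \<R>\<^bsub>W\<^esub> (fst c))"
      using \<phi>(1)[OF X[OF c]] by auto
    \<comment> \<open>By the law \<open>s f = L f\<close> of a left map, \<open>\<phi> s f\<close>
      equals \<open>\<phi> (L f)\<close>, which is the image of the map from \<open>Z\<close> into
      the last object.\<close>
    have e: "Ar P (lift c Z) \<cdot>\<^bsub>E\<^esub> fst c = Ar P (fpart (cells.tops (Z, fst c) None))"
      using \<phi>(2)[OF X[OF c]] l p unfolding L(4) by simp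
    note f = fill_simps[OF L(1) t(1,3) w e]
    show "S c Z \<in> Arr F" "Dom F (S c Z) = Z" "Cod F (S c Z) = Dom F (lift c Z)" "Ar P (S c Z) = fst c"
      "lift c Z \<cdot>\<^bsub>F\<^esub> S c Z = fpart (cells.tops (Z, fst c) None)" "S c Z \<in> cart"
      unfolding S_def using f(1-5) f(6)[OF tc] t(2) by simp_all
  qed
  have tD: "fst t \<in> left_maps E W" "snd (snd t) \<in> left_maps E W" "fst (snd t) \<in> Arr (arrow_cat E)"
      "sdom (fst (snd t)) = fst (fst t)" "scod (fst (snd t)) = fst (snd (snd t))"
      "snd (snd (snd t)) \<cdot>\<^bsub>E\<^esub> lower (fst (snd t)) = mid_map (fst (snd t)) \<cdot>\<^bsub>E\<^esub> snd (fst t)"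
    if "t \<in> Arr (coalg_cat E W)" for t
    using that coalg_cat_simps(2)[of "fst t" "fst (snd t)" "snd (snd t)"] by auto
  have arr: "arr t x \<in> Arr gcat" "Dom gcat (arr t x) = (Dom F x, fst (fst t))"
      "Cod gcat (arr t x) = (Cod F x, fst (snd (snd t)))" "fpart (arr t x) = x" "sq (arr t x) = fst (snd t)"
      "Ob P (Dom F x) = Dom E (fst (fst t))" "Ob P (Cod F x) = Dom E (fst (snd (snd t)))"
    if t: "t \<in> Arr (coalg_cat E W)" and x: "x \<in> Arr F" "Ar P x = upper (fst (snd t))" for t x
  proof -
    note a = arrow_simps[OF tD(3)[OF t], unfolded tD(4,5)[OF t]]
    show o: "Ob P (Dom F x) = Dom E (fst (fst t))" "Ob P (Cod F x) = Dom E (fst (snd (snd t)))"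
      using P_simps(3,4)[OF x(1)] x(2) a(4,5) by simp_all
    show "arr t x \<in> Arr gcat" "Dom gcat (arr t x) = (Dom F x, fst (fst t))"
      "Cod gcat (arr t x) = (Cod F x, fst (snd (snd t)))" "fpart (arr t x) = x"
      using a o x by (simp_all add: arr_def Arr_gcat)
    show "sq (arr t x) = fst (snd t)"
      using x(2) tD(4,5)[OF t] by (simp add: sq_def arr_def square.expand)
  qed
  have pl: "pl t x \<in> Arr F" "Dom F (pl t x) = Dom F (lift (fst t) (Dom F x))" "Cod F (pl t x) = Dom F (lift (snd (snd t)) (Cod F x))"
      "Ar P (pl t x) = lower (fst (snd t))"
      "lift (snd (snd t)) (Cod F x) \<cdot>\<^bsub>F\<^esub> pl t x = fpart (cells.top_map (arr t x)) \<cdot>\<^bsub>F\<^esub> lift (fst t) (Dom F x)"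
      "x \<in> cart \<Longrightarrow> pl t x \<in> cart"
      "fpart (cells.top_map (arr t x)) \<in> Arr F" "Dom F (fpart (cells.top_map (arr t x))) = Cod F (lift (fst t) (Dom F x))"
      "Cod F (fpart (cells.top_map (arr t x))) = Cod F (lift (snd (snd t)) (Cod F x))"
    if t: "t \<in> Arr (coalg_cat E W)" and x: "x \<in> Arr F" "Ar P x = upper (fst (snd t))" for t x
  proof -
    note A = arr[OF t x] and a = arrow_simps[OF tD(3)[OF t], unfolded tD(4,5)[OF t]]
    note W = cells.top_map_simps[OF A(1), unfolded A(2,3)]
    have o: "Dom F x \<in> Obj F" "Cod F x \<in> Obj F" using x by auto
    note L = lift[OF tD(1)[OF t] o(1) A(6)] and L' = lift[OF tD(2)[OF t] o(2) A(7)]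
    note l = left_mapsD[OF tD(1)[OF t]] and l' = left_mapsD[OF tD(2)[OF t]]
    let ?w = "fpart (cells.top_map (arr t x))"
    show w: "?w \<in> Arr F" "Dom F ?w = Cod F (lift (fst t) (Dom F x))" "Cod F ?w = Cod F (lift (snd (snd t)) (Cod F x))"
      using Arr_gcatD(1-3)[OF W(1)] W(2,3) L(3) L'(3) by simp_all
    have wL: "?w \<cdot>\<^bsub>F\<^esub> lift (fst t) (Dom F x) \<in> Arr F"
      "Dom F (?w \<cdot>\<^bsub>F\<^esub> lift (fst t) (Dom F x)) = Dom F (lift (fst t) (Dom F x))"
      "Cod F (?w \<cdot>\<^bsub>F\<^esub> lift (fst t) (Dom F x)) = Cod F (lift (snd (snd t)) (Cod F x))"
      using w L(2) by simp_all
    let ?\<sigma> = "fst (snd t)" and ?X = "(Dom F x, fst (fst t))" and ?X' = "(Cod F x, fst (snd (snd t)))"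
    have lo: "lower ?\<sigma> \<in> hom E (Ob P (Dom F (?w \<cdot>\<^bsub>F\<^esub> lift (fst t) (Dom F x)))) (Ob P (Dom F (lift (snd (snd t)) (Cod F x))))"
      using wL(2) L(5) L'(5) a by simp
    have p: "\<phi> ?X \<in> Arr E" "Dom E (\<phi> ?X) = Dom E (Ob \<R>\<^bsub>W\<^esub> (fst (fst t)))" "Cod E (\<phi> ?X) = Ob P (fst (cells.top_obj ?X))"
      using \<phi>(1)[OF X[OF tD(1)[OF t] o(1) A(6)]] by auto
    have p': "\<phi> ?X' \<in> Arr E" "Dom E (\<phi> ?X') = Dom E (Ob \<R>\<^bsub>W\<^esub> (fst (snd (snd t))))"
      using \<phi>(1)[OF X[OF tD(2)[OF t] o(2) A(7)]] by auto
    note mm = mid_map_simps(1-3)[OF tD(3)[OF t], unfolded tD(4,5)[OF t]]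
    \<comment> \<open>Here the morphism condition on left maps enters: \<open>tD(6)\<close> moves
      the coalgebra structures past the square, and naturality of \<open>\<phi>\<close> does the
      rest.\<close>
    have e: "Ar P (lift (snd (snd t)) (Cod F x)) \<cdot>\<^bsub>E\<^esub> lower ?\<sigma> = Ar P (?w \<cdot>\<^bsub>F\<^esub> lift (fst t) (Dom F x))"
    proof -
      have "Ar P (lift (snd (snd t)) (Cod F x)) \<cdot>\<^bsub>E\<^esub> lower ?\<sigma> = \<phi> ?X' \<cdot>\<^bsub>E\<^esub> (snd (snd (snd t)) \<cdot>\<^bsub>E\<^esub> lower ?\<sigma>)"
        unfolding L'(4) using p' l' a by simp
      also have "\<dots> = (\<phi> ?X' \<cdot>\<^bsub>E\<^esub> mid_map (sq (arr t x))) \<cdot>\<^bsub>E\<^esub> snd (fst t)"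
        unfolding tD(6)[OF t] A(5) using p' l mm by simp
      also have "\<dots> = (pf (cells.top_map (arr t x)) \<cdot>\<^bsub>E\<^esub> \<phi> ?X) \<cdot>\<^bsub>E\<^esub> snd (fst t)"
        using \<phi>n[OF A(1)] A(2,3) by simp
      also have "\<dots> = pf (cells.top_map (arr t x)) \<cdot>\<^bsub>E\<^esub> Ar P (lift (fst t) (Dom F x))"
        unfolding L(4) using p l pf_simps[OF W(1)] W(2) by simp
      finally show ?thesis using w L(2) by simp
    qed
    note f = fill_simps[OF L'(1) wL(1,3) lo e]
    show "pl t x \<in> Arr F" "Dom F (pl t x) = Dom F (lift (fst t) (Dom F x))" "Cod F (pl t x) = Dom F (lift (snd (snd t)) (Cod F x))"
      "Ar P (pl t x) = lower (fst (snd t))"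
      "lift (snd (snd t)) (Cod F x) \<cdot>\<^bsub>F\<^esub> pl t x = fpart (cells.top_map (arr t x)) \<cdot>\<^bsub>F\<^esub> lift (fst t) (Dom F x)"
      unfolding pl_def using f(1-5) wL(2) by simp_all
    assume "x \<in> cart"
    then have "arr t x \<in> GN" using A(1,4) by (simp add: GN_def)
    then have "?w \<in> cart" using cells.top_map_N by (simp add: GN_def)
    then have "?w \<cdot>\<^bsub>F\<^esub> lift (fst t) (Dom F x) \<in> cart" using cart_cmp[OF L(1)] w(2) by simp
    from f(6)[OF this] show "pl t x \<in> cart" unfolding pl_def .
  qed
  have arr_idt: "arr (Idt (coalg_cat E W) c) (Idt F Z) = Idt gcat (Z, fst c)"
    if "c \<in> left_maps E W" "Z \<in> Obj F" for c Z
    using that by (simp add: arr_def coalg_cat_def)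
  have arr_cmp: "arr (t' \<cdot>\<^bsub>coalg_cat E W\<^esub> t) (x' \<cdot>\<^bsub>F\<^esub> x) = arr t' x' \<cdot>\<^bsub>gcat\<^esub> arr t x"
    if "x \<in> Arr F" "x' \<in> Arr F" "Cod F x = Dom F x'" for t t' x x'
    using that by (simp add: arr_def coalg_cat_def)
  show ?thesis
  proof (rule ext_functorI[OF coalg_category, where S = S and pl = pl])
    fix c Z assume c: "c \<in> Obj (coalg_cat E W)" "Z \<in> Obj F" "Ob P Z = Dom E (Ob coalg_forget c)"
    have c': "c \<in> left_maps E W" "Ob P Z = Dom E (fst c)" using c by (simp_all add: coalg_cat_def coalg_forget_def)
    show "S c Z \<in> cart \<and> Ar P (S c Z) = Ob coalg_forget c \<and> Dom F (S c Z) = Z"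
      using S[OF c'(1) c(2) c'(2)] by (simp add: coalg_forget_def)
    note L = lift[OF c'(1) c(2) c'(2)]
    have "fpart (cells.top_map (arr (Idt (coalg_cat E W) c) (Idt F Z))) = Idt F (Cod F (lift c Z))"
      unfolding arr_idt[OF c'(1) c(2)] cells.top_map_idt[OF X[OF c'(1) c(2) c'(2)]] using L(3) by simp
    moreover have "fill (lift c Z) (Idt F (Cod F (lift c Z)) \<cdot>\<^bsub>F\<^esub> lift c Z) (Idt E (Cod E (fst c))) = Idt F (Dom F (lift c Z))"
      by (rule fill_eqI[OF L(1)]) (use L in simp_all)
    ultimately show "pl (Idt (coalg_cat E W) c) (Idt F Z) = Idt F (Cod F (S c Z))"
      unfolding pl_def using S(3)[OF c'(1) c(2) c'(2)] c(2) by (simp add: coalg_cat_def)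
  next
    fix t x assume t: "t \<in> Arr (coalg_cat E W)" and x: "x \<in> Arr F" "Ar P x = upper (Ar coalg_forget t)"
    have x': "Ar P x = upper (fst (snd t))" using x(2) by (simp add: coalg_forget_def)
    have o: "Dom F x \<in> Obj F" "Cod F x \<in> Obj F" using x by auto
    note A = arr[OF t x(1) x'] and p = pl[OF t x(1) x'] and a = arrow_simps[OF tD(3)[OF t], unfolded tD(4,5)[OF t]]
    note L = lift[OF tD(1)[OF t] o(1) A(6)] and L' = lift[OF tD(2)[OF t] o(2) A(7)]
    note s = S[OF tD(1)[OF t] o(1) A(6)] and s' = S[OF tD(2)[OF t] o(2) A(7)]
    have "pl t x \<cdot>\<^bsub>F\<^esub> S (fst t) (Dom F x) = S (snd (snd t)) (Cod F x) \<cdot>\<^bsub>F\<^esub> x"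
    proof (rule cart_eqI[OF L'(1)])
      show "pl t x \<cdot>\<^bsub>F\<^esub> S (fst t) (Dom F x) \<in> hom F (Dom F x) (Dom F (lift (snd (snd t)) (Cod F x)))"
        using p(1-3) s(1-3) by simp
      show "S (snd (snd t)) (Cod F x) \<cdot>\<^bsub>F\<^esub> x \<in> hom F (Dom F x) (Dom F (lift (snd (snd t)) (Cod F x)))"
        using s'(1-3) x by simp
      show "Ar P (pl t x \<cdot>\<^bsub>F\<^esub> S (fst t) (Dom F x)) = Ar P (S (snd (snd t)) (Cod F x) \<cdot>\<^bsub>F\<^esub> x)"
        using p(1-4) s(1-4) s'(1-4) x x' a(9) by simp
      let ?w = "cells.top_map (arr t x)"
      note W = cells.top_map_simps[OF A(1), unfolded A(2,3)]
      have "lift (snd (snd t)) (Cod F x) \<cdot>\<^bsub>F\<^esub> pl t x \<cdot>\<^bsub>F\<^esub> S (fst t) (Dom F x) =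
          (fpart ?w \<cdot>\<^bsub>F\<^esub> lift (fst t) (Dom F x)) \<cdot>\<^bsub>F\<^esub> S (fst t) (Dom F x)"
        by (rule F.cmp_eq_cmp[OF p(5)]) (use p(1-3) L'(2) s(1-3) in simp_all)
      also have "\<dots> = fpart ?w \<cdot>\<^bsub>F\<^esub> (lift (fst t) (Dom F x) \<cdot>\<^bsub>F\<^esub> S (fst t) (Dom F x))"
        using p(7,8) L(2) s(1-3) by simp
      also have "\<dots> = fpart (cells.tops (Cod F x, fst (snd (snd t))) None) \<cdot>\<^bsub>F\<^esub> x"
        unfolding s(5) using arg_cong[OF W(4), of fpart] A(4) by simp
      also have "\<dots> = lift (snd (snd t)) (Cod F x) \<cdot>\<^bsub>F\<^esub> S (snd (snd t)) (Cod F x) \<cdot>\<^bsub>F\<^esub> x"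
        by (rule F.cmp_eq_cmp[OF s'(5), symmetric]) (use L'(2) s'(1-3) x in simp_all)
      finally show "lift (snd (snd t)) (Cod F x) \<cdot>\<^bsub>F\<^esub> pl t x \<cdot>\<^bsub>F\<^esub> S (fst t) (Dom F x) =
          lift (snd (snd t)) (Cod F x) \<cdot>\<^bsub>F\<^esub> S (snd (snd t)) (Cod F x) \<cdot>\<^bsub>F\<^esub> x" .
    qed
    then show "pl t x \<in> hom F (Cod F (S (Dom (coalg_cat E W) t) (Dom F x))) (Cod F (S (Cod (coalg_cat E W) t) (Cod F x))) \<and>
        Ar P (pl t x) = lower (Ar coalg_forget t) \<and>
        pl t x \<cdot>\<^bsub>F\<^esub> S (Dom (coalg_cat E W) t) (Dom F x) = S (Cod (coalg_cat E W) t) (Cod F x) \<cdot>\<^bsub>F\<^esub> x"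
      using p(1-4) s(3) s'(3) by (simp add: coalg_cat_def coalg_forget_def)
  next
    fix t x assume t: "t \<in> Arr (coalg_cat E W)" and x: "x \<in> cart" "Ar P x = upper (Ar coalg_forget t)"
    show "pl t x \<in> cart"
      using pl(6)[OF t cart_Arr[OF x(1)] _ x(1)] x(2) by (simp add: coalg_forget_def)
  next
    fix t t' x x'
    assume t: "t \<in> Arr (coalg_cat E W)" "t' \<in> Arr (coalg_cat E W)" "Cod (coalg_cat E W) t = Dom (coalg_cat E W) t'"
      and x: "x \<in> Arr F" "x' \<in> Arr F" "Cod F x = Dom F x'"
        "Ar P x = upper (Ar coalg_forget t)" "Ar P x' = upper (Ar coalg_forget t')"
    have u: "Ar P x = upper (fst (snd t))" "Ar P x' = upper (fst (snd t'))" and tt: "snd (snd t) = fst t'"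
      using x(4,5) t(3) by (simp_all add: coalg_forget_def coalg_cat_def)
    note p = pl[OF t(1) x(1) u(1)] and p' = pl[OF t(2) x(2) u(2)]
    note A = arr[OF t(1) x(1) u(1)] and A' = arr[OF t(2) x(2) u(2)]
    have o: "Dom F x \<in> Obj F" "Cod F x \<in> Obj F" "Cod F x' \<in> Obj F" using x by auto
    note L = lift[OF tD(1)[OF t(1)] o(1) A(6)] and L' = lift[OF tD(2)[OF t(1)] o(2) A(7)] and L'' = lift[OF tD(2)[OF t(2)] o(3) A'(7)]
    let ?w = "fpart (cells.top_map (arr t x))" and ?w' = "fpart (cells.top_map (arr t' x'))"
    let ?l = "lift (fst t) (Dom F x)" and ?l' = "lift (fst t') (Dom F x')" and ?l'' = "lift (snd (snd t')) (Cod F x')"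
    have w: "fpart (cells.top_map (arr (t' \<cdot>\<^bsub>coalg_cat E W\<^esub> t) (x' \<cdot>\<^bsub>F\<^esub> x))) = ?w' \<cdot>\<^bsub>F\<^esub> ?w"
      unfolding arr_cmp[OF x(1-3)] using cells.top_map_cmp[OF A(1) A'(1)] A(3) A'(2) x(3) tt by simp
    have pp: "pl t x \<in> Arr F" "Dom F (pl t x) = Dom F ?l" "Cod F (pl t x) = Dom F ?l'" "?l' \<cdot>\<^bsub>F\<^esub> pl t x = ?w \<cdot>\<^bsub>F\<^esub> ?l"
      "?w \<in> Arr F" "Dom F ?w = Cod F ?l" "Cod F ?w = Cod F ?l'"
      using p x(3) tt by simp_all
    have l': "?l' \<in> Arr F" using L'(2) x(3) tt by simp
    have e: "?l'' \<cdot>\<^bsub>F\<^esub> pl t' x' \<cdot>\<^bsub>F\<^esub> pl t x = (?w' \<cdot>\<^bsub>F\<^esub> ?w) \<cdot>\<^bsub>F\<^esub> ?l"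
    proof -
      have "?l'' \<cdot>\<^bsub>F\<^esub> pl t' x' \<cdot>\<^bsub>F\<^esub> pl t x = (?w' \<cdot>\<^bsub>F\<^esub> ?l') \<cdot>\<^bsub>F\<^esub> pl t x"
        by (rule F.cmp_eq_cmp[OF p'(5)]) (use p'(1-3) pp(1-3) L''(2) in simp_all)
      also have "\<dots> = ?w' \<cdot>\<^bsub>F\<^esub> (?l' \<cdot>\<^bsub>F\<^esub> pl t x)"
        using p'(7,8) pp(1-3) l' by simp
      also have "\<dots> = (?w' \<cdot>\<^bsub>F\<^esub> ?w) \<cdot>\<^bsub>F\<^esub> ?l"
        unfolding pp(4) using p'(7,8) pp(5-7) L(2) by simp
      finally show ?thesis .
    qed
    have "fill ?l'' ((?w' \<cdot>\<^bsub>F\<^esub> ?w) \<cdot>\<^bsub>F\<^esub> ?l) (lower (fst (snd t')) \<cdot>\<^bsub>E\<^esub> lower (fst (snd t))) = pl t' x' \<cdot>\<^bsub>F\<^esub> pl t x"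
      by (rule fill_eqI[OF L''(1) _ _ e]) (use p'(1-4) pp(1-3) p(4) in simp_all)
    then show "pl (t' \<cdot>\<^bsub>coalg_cat E W\<^esub> t) (x' \<cdot>\<^bsub>F\<^esub> x) = pl t' x' \<cdot>\<^bsub>F\<^esub> pl t x"
      unfolding pl_def[of "t' \<cdot>\<^bsub>coalg_cat E W\<^esub> t"] w using x(1-3) by (simp add: coalg_cat_def)
  qed
qed

end

end

theorem theorem4p3p19:
  fixes \<kappa> :: "'k rel"
    and E :: "('o, 'a) cat"
    and M :: "'a set"
    and J :: "('i, 't) cat"
    and u :: "('i, 't, 'a, 'a square) funct"
    and D :: "('a, 'a square, 'a, 'a square) funct"
    and \<eta> :: "'i \<Rightarrow> 'a square"
    and W :: "'a awfs"
    and F :: "('p, 'b) cat"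
    and P :: "('p, 'b, 'o, 'a) funct"
    and cl :: "'a \<Rightarrow> 'p \<Rightarrow> 'b"
    and T :: "('a, 'a square, ('a, 'p, 'b) ext_obj, ('a, 'p, 'b) ext_arr) funct"
  assumes "limit_ordinal \<kappa>" and "Field \<kappa> \<noteq> {}"
    and "category E" and "backdrop E \<kappa> M"
    and "category J" and "is_functor J (arrow_cat E) u"
    and "compatible E M J u D \<eta>"
    and "\<And>i. i \<in> Obj J \<Longrightarrow> small_object E \<kappa> M (Dom E (Ob u i))"
    and "is_awfs E W" and "cofibrantly_generated E W J u"
    and "category F" and "fibration E F P cl"
    and "van_kampen_chains E \<kappa> M F P"
    and "van_kampen_cobase_changes E M F P"
    and "is_functor (arrow_cat E) (Ext E F P cl) T"
    and "functor_eq (arrow_cat E) (ext_forget \<circ>\<^sub>F T) D"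
  shows "\<exists>G. is_functor (coalg_cat E W) (Ext E F P cl) G \<and>
             functor_eq (coalg_cat E W) (ext_forget \<circ>\<^sub>F G) coalg_forget"
proof -
  interpret ext_setting E F P cl J \<kappa> M u D \<eta> T
    by (intro ext_setting.intro fibred.intro fibred_axioms.intro ext_setting_axioms.intro assms)
  show ?thesis by (rule extension_functor[OF assms(9,10)])
qed

end
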